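(* Let $\Sigma\subset\mathrm{GL}_d(\mathbb{R})$ be compact, let $\mu_0\in\mathrm{Prob}(\Sigma)$ have full support ($\mathrm{supp}\,\mu_0=\Sigma$) and assume $L_1(\mu_0)>L_2(\mu_0)$. For $p\in[1,+\infty]$ define $$L^p_1(\mu_0):=\Big\{f:\Sigma\to\mathbb{R}\ :\ f\in L^p(\mu_0)\ \text{and}\ \int f\,d\mu_0=1\Big\}.$$ Then the Lyapunov exponent, as a function of the density $f\in L^p_1(\mu_0)$, is real analytic with respect to the $L^p$ norm in a neighbourhood of the constant function $1$. That is, there exist an open neighbourhood $U$ of $1$ in $L^p_1(\mu_0)$ (for the $L^p$ norm) and a real analytic function $F:U\to\mathbb{R}$ such that $F(f)=L_1(f\mu_0)$ for every $f\in U$ with $f\ge0$ $\mu_0$-a.e., where $f\mu_0$ is the probability measure $E\mapsto\int_E f\,d\mu_0$.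
   Context: For $\mu\in\mathrm{Prob}(\Sigma)$ let $g_0,g_1,\dots$ be i.i.d. with law $\mu$. The Lyapunov exponents are the almost sure limits $L_i(\mu)=\lim_n\frac1n\log s_i(g_{n-1}\cdots g_0)$ with $s_1\ge\dots\ge s_d$ the singular values. A function $f$ from an open subset $U$ of a real Banach space $M$ to $\mathbb{R}$ is real analytic if for each $a\in U$ there are $r>0$ and continuous symmetric $n$-linear maps $T_n:M^n\to\mathbb{R}$ ($T_0$ a constant) with $f(x)=\sum_{n\ge0}T_n(x-a,\dots,x-a)$ for all $x\in B(a,r)\subset U$. The set $L^p_1(\mu_0)$ is the translate by the constant function $1$ of the closed subspace $\{h\in L^p(\mu_0;\mathbb{R}):\int h\,d\mu_0=0\}$, and real analyticity on it is defined via this translation. *)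

theory Defs
  imports "HOL-Probability.Probability"
begin

section \<open>Singular values\<close>

text \<open>
  The singular values of \<^term>\<open>A\<close> are the square roots of the eigenvalues of
  \<^term>\<open>transpose A ** A\<close>, listed in decreasing order and repeated according to multiplicity
  (the squares are the roots of the characteristic polynomial).
  The index of \<open>singular_value\<close> starts at 1, as in \<open>s\<^sub>1 \<ge> \<dots> \<ge> s\<^sub>d\<close>.
\<close>

definition singular_values :: "real ^ 'd ^ 'd \<Rightarrow> real list" where
  "singular_values A = (THE ss. length ss = CARD('d) \<and> sorted_wrt (\<ge>) ss \<and> (\<forall>s\<in>set ss. 0 \<le> s) \<and>
     (\<forall>x. det (mat x - transpose A ** A) = (\<Prod>s\<leftarrow>ss. x - s\<^sup>2)))"

definition singular_value :: "nat \<Rightarrow> real ^ 'd ^ 'd \<Rightarrow> real" where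
  "singular_value i A = singular_values A ! (i - 1)"


section \<open>Probability measures on a set, and Lyapunov exponents\<close>

definition Prob :: "'a::topological_space set \<Rightarrow> 'a measure set" where
  "Prob S = {M. prob_space M \<and> sets M = sets (restrict_space borel S)}"

definition supp_measure :: "'a::topological_space measure \<Rightarrow> 'a set" where
  "supp_measure M = {x \<in> space M. \<forall>W. open W \<longrightarrow> x \<in> W \<longrightarrow> 0 < emeasure M (W \<inter> space M)}"

fun matrix_product :: "(nat \<Rightarrow> real ^ 'd ^ 'd) \<Rightarrow> nat \<Rightarrow> real ^ 'd ^ 'd" where
  "matrix_product g 0 = mat 1"
| "matrix_product g (Suc n) = g n ** matrix_product g n"

text \<open>
  The i.i.d. sequence with law \<open>M\<close> is realised as the coordinate process on the infinite product
  space. The almost sure limit is a constant, unique because the product measure is nonzero.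
\<close>

definition lyapunov_exponent :: "nat \<Rightarrow> (real ^ 'd ^ 'd) measure \<Rightarrow> real" where
  "lyapunov_exponent i M = (THE L. AE g in (\<Pi>\<^sub>M n\<in>(UNIV :: nat set). M).
     (\<lambda>n. ln (singular_value i (matrix_product g n)) / real n) \<longlonglongrightarrow> L)"


section \<open>The spaces \<open>L\<^sup>p\<close>\<close>

text \<open>
  Elements of \<open>L\<^sup>p\<close> are represented by measurable functions, and \<open>Lp_norm\<close> is a seminorm on them
  whose null space consists of the functions that vanish almost everywhere. Quotienting by this null
  space gives the usual Banach space. A set that is open for the seminorm is a union of equivalence
  classes, and continuous multilinear maps as well as the analytic functions below take
  equal values on almost everywhere equal arguments, so that all notions descend to the quotient.
\<close>

definition Lp_space :: "'a measure \<Rightarrow> ennreal \<Rightarrow> ('a \<Rightarrow> real) set" where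
  "Lp_space M p = {f \<in> borel_measurable M.
     if p = \<infinity> then esssup M (\<lambda>x. ennreal \<bar>f x\<bar>) < \<infinity>
     else integrable M (\<lambda>x. \<bar>f x\<bar> powr enn2real p)}"

definition Lp_norm :: "'a measure \<Rightarrow> ennreal \<Rightarrow> ('a \<Rightarrow> real) \<Rightarrow> real" where
  "Lp_norm M p f =
     (if p = \<infinity> then enn2real (esssup M (\<lambda>x. ennreal \<bar>f x\<bar>))
      else (\<integral>x. \<bar>f x\<bar> powr enn2real p \<partial>M) powr (1 / enn2real p))"

definition Lp_mean0 :: "'a measure \<Rightarrow> ennreal \<Rightarrow> ('a \<Rightarrow> real) set" where
  "Lp_mean0 M p = {h \<in> Lp_space M p. (\<integral>x. h x \<partial>M) = 0}"

definition Lp_mean1 :: "'a measure \<Rightarrow> ennreal \<Rightarrow> ('a \<Rightarrow> real) set" where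
  "Lp_mean1 M p = {f \<in> Lp_space M p. (\<integral>x. f x \<partial>M) = 1}"


section \<open>Real analytic functions on seminormed spaces of functions\<close>

text \<open>
  Here \<open>V\<close> is a set of real-valued functions and \<open>N\<close> a seminorm, both for the pointwise
  operations. In \<open>sn_ball\<close> and \<open>sn_open\<close> the set \<open>V\<close> may also be a translate of a linear subspace.
\<close>

definition sn_ball :: "('a \<Rightarrow> real) set \<Rightarrow> (('a \<Rightarrow> real) \<Rightarrow> real) \<Rightarrow> ('a \<Rightarrow> real) \<Rightarrow> real \<Rightarrow> ('a \<Rightarrow> real) set"
  where "sn_ball V N a r = {x \<in> V. N (\<lambda>t. x t - a t) < r}"

definition sn_open :: "('a \<Rightarrow> real) set \<Rightarrow> (('a \<Rightarrow> real) \<Rightarrow> real) \<Rightarrow> ('a \<Rightarrow> real) set \<Rightarrow> bool" where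
  "sn_open V N U \<longleftrightarrow> U \<subseteq> V \<and> (\<forall>a\<in>U. \<exists>r>0. sn_ball V N a r \<subseteq> U)"

text \<open>
  An element of \<open>V\<^sup>n\<close> is a list of length \<open>n\<close> with entries in \<open>V\<close>. Continuity is
  (joint) continuity at every point of \<open>V\<^sup>n\<close>. For \<open>n = 0\<close> the conditions hold trivially and
  \<open>T []\<close> is the constant.
\<close>

definition cont_sym_multilinear ::
  "('a \<Rightarrow> real) set \<Rightarrow> (('a \<Rightarrow> real) \<Rightarrow> real) \<Rightarrow> nat \<Rightarrow> (('a \<Rightarrow> real) list \<Rightarrow> real) \<Rightarrow> bool" where
  "cont_sym_multilinear V N n T \<longleftrightarrow>
     (\<forall>xs\<in>{xs. length xs = n \<and> set xs \<subseteq> V}.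
        (\<forall>i<n. \<forall>x\<in>V. \<forall>y\<in>V. \<forall>a b.
           T (xs[i := (\<lambda>t. a * x t + b * y t)]) = a * T (xs[i := x]) + b * T (xs[i := y])) \<and>
        (\<forall>ys. mset ys = mset xs \<longrightarrow> T ys = T xs) \<and>
        (\<forall>e>0. \<exists>d>0. \<forall>ys\<in>{ys. length ys = n \<and> set ys \<subseteq> V}.
           (\<forall>i<n. N (\<lambda>t. (ys ! i) t - (xs ! i) t) < d) \<longrightarrow> \<bar>T ys - T xs\<bar> < e))"

definition real_analytic_on ::
  "('a \<Rightarrow> real) set \<Rightarrow> (('a \<Rightarrow> real) \<Rightarrow> real) \<Rightarrow> ('a \<Rightarrow> real) set \<Rightarrow> (('a \<Rightarrow> real) \<Rightarrow> real) \<Rightarrow> bool" where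
  "real_analytic_on V N U F \<longleftrightarrow> sn_open V N U \<and>
     (\<forall>a\<in>U. \<exists>r>0. \<exists>T :: nat \<Rightarrow> ('a \<Rightarrow> real) list \<Rightarrow> real.
        sn_ball V N a r \<subseteq> U \<and> (\<forall>n. cont_sym_multilinear V N n (T n)) \<and>
        (\<forall>x\<in>sn_ball V N a r. (\<lambda>n. T n (replicate n (\<lambda>t. x t - a t))) sums F x))"

end

theory Submission
  imports Defs
begin

text \<open>
  Among the subspaces invariant under \<open>\<Sigma>\<close> on which the random product grows at a rate below
  \<open>L\<^sub>1(\<mu>\<^sub>0)\<close>, take one of maximal dimension, \<open>V\<close>. By maximality, the expectation of
  \<open>ln |g\<^sub>n\<^sub>-\<^sub>1 \<dots> g\<^sub>0 x|\<close> in the quotient by \<open>V\<close> grows at rate \<open>L\<^sub>1(\<mu>\<^sub>0)\<close> uniformly in \<open>x\<close>: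
  otherwise some direction is almost surely slow, and the almost surely slow vectors form a larger
  invariant subspace. Since \<open>L\<^sub>1 + L\<^sub>2 < 2 L\<^sub>1\<close>, the action on the projective space of the quotient
  therefore contracts a power of the angle in the mean. The transfer operator
  \<open>T\<^sub>f \<phi>(x) = \<integral> \<phi>(g x) f(g) d\<mu>\<^sub>0(g)\<close> is linear in the density \<open>f\<close> and stays a contraction of the
  corresponding Lipschitz seminorm, modulo constants, for all signed \<open>f\<close> close to \<open>1\<close> in \<open>L\<^sup>1\<close>.
  Expanding the solution of the Poisson equation in powers of \<open>f - f\<^sub>0\<close> gives the power series of
  the mean growth rate on the quotient. For \<open>f \<ge> 0\<close> close to \<open>1\<close> the growth on \<open>V\<close> remains
  smaller, so this rate is \<open>L\<^sub>1(f \<mu>\<^sub>0)\<close>.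
\<close>

section \<open>Singular values and two-dimensional areas\<close>

text \<open>No irreducibility is assumed, so there may be invariant subspaces of slow growth, on
  which the projective action need not contract. Dividing by one of maximal dimension leaves a
  quotient without slow directions, and full support makes this subspace invariant under every
  element of \<Sigma>, hence usable for every law f \<mu>_0. Two obstacles shape the rest. The
  neighbourhood of 1 contains signed densities, for which no random product exists; so the
  functional is built from the operator alone and compared with the exponent only where f is
  nonnegative. And the operator is linear in f for a single step only, whereas the dynamics give
  contraction after N steps; a weight that sums N steps of the original gauge restores contraction
  in one step for \<mu>_0, and a signed perturbation then costs a multiple of the L^1 norm of f - 1.
  On a probability space the L^p norm dominates the L^1 norm, which settles all p at once.\<close>

lemma linear_coefficient_zero:
  fixes b c :: real
  assumes "\<And>t. 0 \<le> 2 * t * b + t\<^sup>2 * c"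
  shows "b = 0"
proof (rule ccontr)
  assume b: "b \<noteq> 0"
  show False
  proof (cases "c = 0")
    case True
    with assms[of "- b"] b show False
      by (simp add: not_sum_squares_lt_zero power2_eq_square) (use b in \<open>smt (verit) zero_less_mult_iff\<close>)
  next
    case False
    \<comment> \<open>Any \<open>k\<close> above both 0 and \<open>c\<close> serves: at
      \<open>t = - b / k\<close> the linear term outweighs the quadratic one.\<close>
    define k where "k = 1 + \<bar>c\<bar>"
    have k: "0 < k" "c < k" by (auto simp: k_def)
    have "0 \<le> 2 * (- b / k) * b + (- b / k)\<^sup>2 * c"
      by (rule assms)
    also have "\<dots> = (b\<^sup>2 / k) * (c / k - 2)"
      using k by (simp add: power2_eq_square field_simps)
    also have "\<dots> < 0"
      using k b by (intro mult_pos_neg) (auto simp: field_simps)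
    finally show False by simp
  qed
qed

text \<open>Maximise the Rayleigh quotient over the unit sphere of \<open>U\<close>. The first
  variation at the maximiser \<open>v\<close> makes \<open>S *v v - l *\<^sub>R v\<close> orthogonal
  to \<open>U\<close>; by invariance this vector lies in \<open>U\<close>, so it vanishes.\<close>

lemma symmetric_eigenvector_in_subspace:
  fixes S :: "real ^ 'd ^ 'd"
  assumes sym: "transpose S = S" and U: "subspace U" "U \<noteq> {0}"
    and inv: "\<And>x. x \<in> U \<Longrightarrow> S *v x \<in> U"
  obtains v l where "v \<in> U" "norm v = 1" "S *v v = l *\<^sub>R v"
proof -
  have symd: "(S *v x) \<bullet> y = x \<bullet> (S *v y)" for x y
    by (metis dot_lmul_matrix sym vector_transpose_matrix transpose_matrix_vector)
  let ?K = "U \<inter> sphere 0 1"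
  obtain u where u: "u \<in> U" "u \<noteq> 0"
    using U subspace_0 by fastforce
  have "u /\<^sub>R norm u \<in> ?K"
    using u U by (auto simp: subspace_scale)
  moreover have "compact ?K"
    using closed_subspace[OF U(1)] compact_sphere by (metis closed_Int_compact)
  moreover have "continuous_on ?K (\<lambda>x. x \<bullet> (S *v x))"
    by (intro continuous_intros matrix_vector_mult_linear_continuous_on)
  ultimately obtain v where v: "v \<in> ?K" and max: "\<And>x. x \<in> ?K \<Longrightarrow> x \<bullet> (S *v x) \<le> v \<bullet> (S *v v)"
    using continuous_attains_sup[of ?K "\<lambda>x. x \<bullet> (S *v x)"] by blast
  define l where "l = v \<bullet> (S *v v)"
  have q: "x \<bullet> (S *v x) \<le> l * (x \<bullet> x)" if "x \<in> U" for x
  proof (cases "x = 0")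
    case False
    then have "x /\<^sub>R norm x \<in> ?K"
      using that U by (auto simp: subspace_scale)
    from max[OF this] have "(x \<bullet> (S *v x)) / (norm x)\<^sup>2 \<le> l"
      by (simp add: l_def matrix_vector_mult_scaleR power2_eq_square field_simps)
    then show ?thesis
      using False by (simp add: field_simps power2_norm_eq_inner)
  qed simp
  have vv: "v \<bullet> v = 1" "norm v = 1" "v \<in> U"
    using v by (auto simp: dot_square_norm)
  have "l * (v \<bullet> w) - w \<bullet> (S *v v) = 0" if w: "w \<in> U" for w
  proof (rule linear_coefficient_zero[where c = "l * (w \<bullet> w) - w \<bullet> (S *v w)"])
    fix t :: real
    have "v + t *\<^sub>R w \<in> U"
      using vv w U by (simp add: subspace_add subspace_scale)
    from q[OF this] have "v \<bullet> (S *v v) + t * (v \<bullet> (S *v w)) + t * (w \<bullet> (S *v v)) + t\<^sup>2 * (w \<bullet> (S *v w))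
      \<le> l * (v \<bullet> v + 2 * t * (v \<bullet> w) + t\<^sup>2 * (w \<bullet> w))"
      by (simp add: matrix_vector_right_distrib matrix_vector_mult_scaleR inner_add_left
          inner_add_right power2_eq_square algebra_simps inner_commute)
    moreover have "v \<bullet> (S *v w) = w \<bullet> (S *v v)"
      by (metis symd inner_commute)
    ultimately show "0 \<le> 2 * t * (l * (v \<bullet> w) - w \<bullet> (S *v v)) + t\<^sup>2 * (l * (w \<bullet> w) - w \<bullet> (S *v w))"
      using vv by (simp add: l_def algebra_simps)
  qed
  note orth = this
  have "w \<bullet> (S *v v - l *\<^sub>R v) = 0" if "w \<in> U" for w
    using orth[OF that] unfolding inner_diff_right by (simp add: inner_commute)
  then have "(S *v v - l *\<^sub>R v) \<bullet> (S *v v - l *\<^sub>R v) = 0"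
    using inv vv U by (simp add: subspace_diff subspace_scale)
  then have "S *v v = l *\<^sub>R v" by simp
  then show ?thesis using that vv by blast
qed

text \<open>Take a largest orthonormal set of eigenvectors. By symmetry its orthogonal complement is
  invariant, so a nonzero complement would contain one more eigenvector.\<close>

lemma symmetric_orthonormal_eigenbasis:
  fixes S :: "real ^ 'd ^ 'd"
  assumes sym: "transpose S = S"
  obtains B where "finite B" "card B = CARD('d)" "pairwise orthogonal B"
    "\<And>b. b \<in> B \<Longrightarrow> norm b = 1" "\<And>b. b \<in> B \<Longrightarrow> \<exists>l. S *v b = l *\<^sub>R b"
proof -
  define Q where "Q B \<longleftrightarrow> pairwise orthogonal B \<and> (\<forall>b\<in>B. norm b = 1) \<and>
      (\<forall>b\<in>B. \<exists>l. S *v b = l *\<^sub>R b)" for B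
  have ind: "independent B" if "Q B" for B
    using that pairwise_orthogonal_independent[of B] unfolding Q_def by force
  have fin: "finite B" "card B \<le> CARD('d)" if "Q B" for B
    using ind[OF that] independent_bound[of B] by auto
  have "\<exists>B. Q B \<and> (\<forall>B'. Q B' \<longrightarrow> card B' \<le> card B)"
    by (rule Lattices_Big.ex_has_greatest_nat[of Q "{}" card "CARD('d) + 1"])
      (use fin(2) in \<open>auto simp: Q_def le_imp_less_Suc\<close>)
  then obtain B where B: "Q B" and max: "\<And>B'. Q B' \<Longrightarrow> card B' \<le> card B"
    by blast
  let ?U = "{x. \<forall>b\<in>B. orthogonal b x}"
  have U: "subspace ?U"
    by (auto simp: subspace_def orthogonal_def inner_add_right)
  have symd: "(S *v x) \<bullet> y = x \<bullet> (S *v y)" for x y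
    by (metis dot_lmul_matrix sym vector_transpose_matrix transpose_matrix_vector)
  have inv: "S *v x \<in> ?U" if x: "x \<in> ?U" for x
  proof safe
    fix b assume b: "b \<in> B"
    then obtain l where "S *v b = l *\<^sub>R b" using B unfolding Q_def by blast
    then have "b \<bullet> (S *v x) = l * (b \<bullet> x)" by (metis symd inner_scaleR_left)
    then show "orthogonal b (S *v x)"
      using x b by (auto simp: orthogonal_def)
  qed
  have U0: "?U = {0}"
  proof (rule ccontr)
    assume "?U \<noteq> {0}"
    then obtain v l where v: "v \<in> ?U" "norm v = 1" "S *v v = l *\<^sub>R v"
      by (rule symmetric_eigenvector_in_subspace[OF sym U _ inv])
    have nB: "v \<notin> B"
      using v(1,2) by (metis (mono_tags) mem_Collect_eq norm_zero orthogonal_self zero_neq_one)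
    have "Q (insert v B)"
      using B v orthogonal_commute[of v] unfolding Q_def pairwise_insert by blast
    from max[OF this] nB fin[OF B] show False by simp
  qed
  have "card B = CARD('d)"
  proof (rule ccontr)
    assume "card B \<noteq> CARD('d)"
    with fin[OF B] have "dim (span B) < CARD('d)"
      using ind[OF B] by (simp add: dim_eq_card_independent)
    then obtain x where x: "x \<noteq> 0" "\<And>y. y \<in> span B \<Longrightarrow> orthogonal x y"
      using orthogonal_to_subspace_exists[of "span B" thesis] by (simp add: span_span)
    have "x \<in> ?U"
      using x(2)[OF span_base] orthogonal_commute by blast
    then show False using U0 x(1) by blast
  qed
  then show ?thesis using that B fin[OF B] unfolding Q_def by blast
qed

lemma singular_basis:
  fixes A :: "real ^ 'd ^ 'd"
  obtains e :: "nat \<Rightarrow> real ^ 'd" and s :: "nat \<Rightarrow> real" where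
    "\<And>i j. i < CARD('d) \<Longrightarrow> j < CARD('d) \<Longrightarrow> e i \<bullet> e j = (if i = j then 1 else 0)"
    "\<And>i. i < CARD('d) \<Longrightarrow> (transpose A ** A) *v e i = (s i)\<^sup>2 *\<^sub>R e i"
    "\<And>i. i < CARD('d) \<Longrightarrow> 0 \<le> s i"
    "\<And>i j. i \<le> j \<Longrightarrow> j < CARD('d) \<Longrightarrow> s j \<le> s i"
proof -
  let ?S = "transpose A ** A"
  have "transpose ?S = ?S" by (simp add: matrix_transpose_mul)
  then obtain B where B: "finite B" "card B = CARD('d)" "pairwise orthogonal B"
    "\<And>b. b \<in> B \<Longrightarrow> norm b = 1" "\<And>b. b \<in> B \<Longrightarrow> \<exists>l. ?S *v b = l *\<^sub>R b"
    by (rule symmetric_orthonormal_eigenbasis[of ?S]) blast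
  \<comment> \<open>The inner product of \<open>b\<close> with its image under the transpose of
    \<open>A\<close> times \<open>A\<close> is the squared norm of \<open>A *v b\<close>; so
    \<open>l b\<close> is the root of the eigenvalue of \<open>b\<close>.\<close>
  define l where "l b = norm (A *v b)" for b
  have eig: "?S *v b = (l b)\<^sup>2 *\<^sub>R b" if b: "b \<in> B" for b
  proof -
    obtain m where m: "?S *v b = m *\<^sub>R b" using B(5)[OF b] by blast
    have "b \<bullet> (?S *v b) = (A *v b) \<bullet> (A *v b)"
      by (metis dot_lmul_matrix matrix_vector_mul_assoc vector_transpose_matrix inner_commute)
    then have "m = (l b)\<^sup>2"
      using m B(4)[OF b] by (simp add: l_def power2_norm_eq_inner) (metis dot_square_norm mult.right_neutral one_power2)
    then show ?thesis using m by simp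
  qed
  obtain bs where bs: "set bs = B" "distinct bs"
    using finite_distinct_list[OF B(1)] by blast
  define xs where "xs = rev (sort_key l bs)"
  have xs: "set xs = B" "distinct xs" "length xs = CARD('d)"
    using bs B distinct_card[of bs] by (auto simp: xs_def)
  have srt: "sorted_wrt (\<lambda>x y. l y \<le> l x) xs"
    unfolding xs_def sorted_wrt_rev
    using sorted_sort_key[of l bs] by (simp add: sorted_wrt_map)
  show ?thesis
  proof (rule that[of "\<lambda>i. xs ! i" "\<lambda>i. l (xs ! i)"])
    fix i j assume ij: "i < CARD('d)" "j < CARD('d)"
    then have inB: "xs ! i \<in> B" "xs ! j \<in> B" using xs nth_mem by metis+
    show "xs ! i \<bullet> xs ! j = (if i = j then 1 else 0)"
    proof (cases "i = j")
      case True
      then show ?thesis using B(4)[OF inB(1)] by (simp add: dot_square_norm)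
    next
      case False
      then have "xs ! i \<noteq> xs ! j" using xs ij by (simp add: nth_eq_iff_index_eq)
      then show ?thesis using B(3) inB False by (auto simp: pairwise_def orthogonal_def)
    qed
  next
    fix i assume "i < CARD('d)"
    then show "?S *v (xs ! i) = (l (xs ! i))\<^sup>2 *\<^sub>R xs ! i"
      using xs nth_mem eig by metis
    show "0 \<le> l (xs ! i)" by (simp add: l_def)
  next
    fix i j assume "i \<le> j" "j < CARD('d)"
    then show "l (xs ! j) \<le> l (xs ! i)"
      using sorted_wrt_nth_less[OF srt, of i j] xs by (cases "i = j") auto
  qed
qed

text \<open>Conjugation by the orthogonal matrix with columns \<open>e i\<close> makes
  \<open>S\<close> diagonal; \<open>\<pi>\<close> only translates between the index type and the
  natural numbers.\<close>

lemma det_mat_minus_orthonormal_eigenbasis: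
  fixes S :: "real ^ 'd ^ 'd" and e :: "nat \<Rightarrow> real ^ 'd"
  assumes on: "\<And>i j. i < CARD('d) \<Longrightarrow> j < CARD('d) \<Longrightarrow> e i \<bullet> e j = (if i = j then 1 else 0)"
    and eig: "\<And>i. i < CARD('d) \<Longrightarrow> S *v e i = l i *\<^sub>R e i"
  shows "det (mat x - S) = (\<Prod>i<CARD('d). x - l i)"
proof -
  obtain \<pi> :: "'d \<Rightarrow> nat" where \<pi>: "bij_betw \<pi> UNIV {..<CARD('d)}"
    using ex_bij_betw_finite_nat[of "UNIV :: 'd set"] by (auto simp: atLeast0LessThan)
  have lt: "\<pi> j < CARD('d)" for j using \<pi> by (auto simp: bij_betw_def)
  have inj: "\<pi> i = \<pi> j \<longleftrightarrow> i = j" for i j using \<pi> by (auto simp: bij_betw_def inj_on_def)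
  define Q :: "real ^ 'd ^ 'd" where "Q = (\<chi> i j. e (\<pi> j) $ i)"
  define D :: "real ^ 'd ^ 'd" where "D = (\<chi> i j. if i = j then x - l (\<pi> i) else 0)"
  have "transpose Q ** Q = mat 1"
    using on lt inj by (simp add: vec_eq_iff matrix_matrix_mult_def transpose_def Q_def mat_def inner_vec_def)
  then have "orthogonal_matrix Q" by (simp add: orthogonal_matrix)
  then have dQ: "det Q \<noteq> 0" using det_orthogonal_matrix[of Q] by auto
  have "(mat x - S) ** Q = Q ** D"
  proof (rule matrix_eq[THEN iffD2], rule allI)
    fix v
    show "((mat x - S) ** Q) *v v = (Q ** D) *v v"
    proof (subst (1 2) matrix_mult_sum, intro arg_cong[where f = "\<lambda>f. sum f UNIV"] ext arg_cong2[where f = "(*s)"] refl)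
      fix j
      have "column j ((mat x - S) ** Q) = (mat x - S) *v e (\<pi> j)"
        by (simp add: vec_eq_iff column_def matrix_matrix_mult_def matrix_vector_mult_def Q_def)
      also have "\<dots> = x *\<^sub>R e (\<pi> j) - l (\<pi> j) *\<^sub>R e (\<pi> j)"
        by (simp add: matrix_vector_mult_diff_rdistrib eig[OF lt])
          (simp add: vec_eq_iff matrix_vector_mult_def mat_def if_distrib if_distribR cong: if_cong)
      also have "\<dots> = column j (Q ** D)"
        by (simp add: vec_eq_iff column_def matrix_matrix_mult_def Q_def D_def if_distrib if_distribR
            algebra_simps cong: if_cong)
      finally show "column j ((mat x - S) ** Q) = column j (Q ** D)" .
    qed
  qed
  then have "det (mat x - S) * det Q = det Q * det D"
    by (metis det_mul)
  then have "det (mat x - S) = det D" using dQ by simp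
  also have "\<dots> = (\<Prod>j\<in>UNIV. x - l (\<pi> j))"
    by (subst det_diagonal) (auto simp: D_def)
  also have "\<dots> = (\<Prod>i<CARD('d). x - l i)"
    by (rule prod.reindex_bij_betw[OF \<pi>])
  finally show ?thesis .
qed

text \<open>The polynomial determines the multiset of squares as its roots; sorting fixes their
  order, and nonnegativity recovers the values from the squares.\<close>

lemma sorted_nonneg_root_list_unique:
  fixes ss ss' :: "real list"
  assumes "sorted_wrt (\<ge>) ss" "sorted_wrt (\<ge>) ss'" "\<forall>s\<in>set ss. 0 \<le> s" "\<forall>s\<in>set ss'. 0 \<le> s"
    and eq: "\<And>x. (\<Prod>s\<leftarrow>ss. x - s\<^sup>2) = (\<Prod>s\<leftarrow>ss'. x - s\<^sup>2)"
  shows "ss = ss'"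
proof -
  define p where "p ss = prod_list (map (\<lambda>s. [:- (s\<^sup>2), 1:]) ss)" for ss :: "real list"
  have poly: "poly (p ss) x = (\<Prod>s\<leftarrow>ss. x - s\<^sup>2)" for ss x
    unfolding p_def by (induction ss) (auto simp: algebra_simps)
  have "proots (p ss) = mset (map power2 ss)" for ss
  proof -
    have "p ss \<noteq> 0" unfolding p_def by (auto simp: prod_list_zero_iff)
    then show ?thesis unfolding p_def
      by (induction ss) (auto simp: proots_mult simp del: mult_pCons_left)
  qed
  moreover have "p ss = p ss'"
    using eq poly by (intro poly_eq_poly_eq_iff[THEN iffD1]) auto
  ultimately have ms: "mset (rev (map power2 ss)) = mset (rev (map power2 ss'))" by (metis mset_rev)
  have srt: "sorted (rev (map power2 ss))" if "sorted_wrt (\<ge>) ss" "\<forall>s\<in>set ss. 0 \<le> s" for ss :: "real list"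
    using that unfolding sorted_wrt_rev sorted_wrt_map
    by (induction ss) (auto intro!: power_mono)
  have "rev (map power2 ss) = rev (map power2 ss')"
    using properties_for_sort[OF ms] properties_for_sort[OF refl] srt assms by metis
  then have *: "map power2 ss = map power2 ss'" by simp
  show ?thesis
  proof (rule map_inj_on[OF *])
    show "inj_on power2 (set ss \<union> set ss')"
      using assms by (auto simp: inj_on_def power2_eq_iff_nonneg)
  qed
qed

text \<open>Resolves the definite description in \<open>singular_values\<close>: the orthonormal
  eigenbasis gives existence, the roots of the characteristic polynomial give uniqueness. Everything
  later on singular values rests on this lemma.\<close>

lemma singular_values_orthonormal_basis:
  fixes A :: "real ^ 'd ^ 'd"
  obtains e :: "nat \<Rightarrow> real ^ 'd" where
    "\<And>i j. i < CARD('d) \<Longrightarrow> j < CARD('d) \<Longrightarrow> e i \<bullet> e j = (if i = j then 1 else 0)"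
    "\<And>i. i < CARD('d) \<Longrightarrow> (transpose A ** A) *v e i = (singular_value (Suc i) A)\<^sup>2 *\<^sub>R e i"
    "\<And>i. i < CARD('d) \<Longrightarrow> 0 \<le> singular_value (Suc i) A"
    "\<And>i j. i \<le> j \<Longrightarrow> j < CARD('d) \<Longrightarrow> singular_value (Suc j) A \<le> singular_value (Suc i) A"
proof -
  obtain e :: "nat \<Rightarrow> real ^ 'd" and s :: "nat \<Rightarrow> real" where es:
    "\<And>i j. i < CARD('d) \<Longrightarrow> j < CARD('d) \<Longrightarrow> e i \<bullet> e j = (if i = j then 1 else 0)"
    "\<And>i. i < CARD('d) \<Longrightarrow> (transpose A ** A) *v e i = (s i)\<^sup>2 *\<^sub>R e i"
    "\<And>i. i < CARD('d) \<Longrightarrow> 0 \<le> s i"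
    "\<And>i j. i \<le> j \<Longrightarrow> j < CARD('d) \<Longrightarrow> s j \<le> s i"
    by (rule singular_basis[of A]) blast
  define P where "P ss \<longleftrightarrow> length ss = CARD('d) \<and> sorted_wrt (\<ge>) ss \<and> (\<forall>s\<in>set ss. 0 \<le> s) \<and>
     (\<forall>x. det (mat x - transpose A ** A) = (\<Prod>s\<leftarrow>ss. x - s\<^sup>2))" for ss
  let ?ss = "map s [0..<CARD('d)]"
  have "det (mat x - transpose A ** A) = (\<Prod>s\<leftarrow>?ss. x - s\<^sup>2)" for x
    using det_mat_minus_orthonormal_eigenbasis[of e "transpose A ** A" "\<lambda>i. (s i)\<^sup>2" x, OF es(1,2)]
     prod.distinct_set_conv_list[of "[0..<CARD('d)]" "\<lambda>i. x - (s i)\<^sup>2"]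
    by (simp add: comp_def atLeast0LessThan)
  then have "P ?ss"
    using es unfolding P_def by (auto simp: sorted_wrt_map sorted_wrt_iff_nth_less)
  moreover have "ss = ?ss" if "P ss" for ss
    by (rule sorted_nonneg_root_list_unique) (use that \<open>P ?ss\<close> in \<open>auto simp: P_def\<close>)
  ultimately have "singular_values A = ?ss"
    unfolding singular_values_def P_def by (rule the_equality)
  then have "singular_value (Suc i) A = s i" if "i < CARD('d)" for i
    using that by (simp add: singular_value_def)
  with es that[of e] show ?thesis by auto
qed

section \<open>Areas of parallelograms and the operator norm on the exterior square\<close>

text \<open>The squared area of the parallelogram, that is, the squared norm of the bivector of
  \<open>x\<close> and \<open>y\<close>. It stands in for the exterior square, which is never
  constructed.\<close>

definition gram2 :: "'a::real_inner \<Rightarrow> 'a \<Rightarrow> real" where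
  "gram2 x y = (norm x)\<^sup>2 * (norm y)\<^sup>2 - (x \<bullet> y)\<^sup>2"

lemma gram2_nonneg: "0 \<le> gram2 x y"
  using Cauchy_Schwarz_ineq[of x y] by (simp add: gram2_def power2_norm_eq_inner)

lemma gram2_le: "gram2 x y \<le> (norm x)\<^sup>2 * (norm y)\<^sup>2"
  by (simp add: gram2_def)

text \<open>Shearing \<open>y\<close> along \<open>x\<close> preserves the area, and an area is at
  most the product of the side lengths.\<close>

lemma gram2_le_shift: "gram2 x y \<le> (norm x)\<^sup>2 * (norm (y - t *\<^sub>R x))\<^sup>2"
proof -
  have "(norm x)\<^sup>2 * (norm (y - t *\<^sub>R x))\<^sup>2 = gram2 x y + (t * (norm x)\<^sup>2 - x \<bullet> y)\<^sup>2"
    unfolding gram2_def power2_norm_eq_inner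
    by (simp add: inner_diff_left inner_diff_right inner_commute power2_eq_square algebra_simps)
  then show ?thesis by simp
qed

lemma gram2_eq_shift:
  assumes "x \<noteq> 0"
  shows "gram2 x y = (norm x)\<^sup>2 * (norm (y - ((x \<bullet> y) / (norm x)\<^sup>2) *\<^sub>R x))\<^sup>2"
proof -
  let ?t = "(x \<bullet> y) / (norm x)\<^sup>2"
  have "(norm x)\<^sup>2 * (norm (y - ?t *\<^sub>R x))\<^sup>2 = gram2 x y + (?t * (norm x)\<^sup>2 - x \<bullet> y)\<^sup>2"
    unfolding gram2_def power2_norm_eq_inner
    by (simp add: inner_diff_left inner_diff_right inner_commute power2_eq_square algebra_simps)
  then show ?thesis using assms by simp
qed

text \<open>Shear \<open>y\<close> until it is orthogonal to \<open>x\<close>: the area becomes the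
  product of the two lengths, and \<open>P\<close> shrinks each of them.\<close>

lemma gram2_linear_contraction:
  fixes P :: "'a::real_inner \<Rightarrow> 'b::real_inner"
  assumes "linear P" "\<And>x. norm (P x) \<le> norm x"
  shows "gram2 (P x) (P y) \<le> gram2 x y"
proof (cases "x = 0")
  case True
  then show ?thesis using assms(1) by (simp add: gram2_def linear_0)
next
  case False
  let ?t = "(x \<bullet> y) / (norm x)\<^sup>2"
  have "gram2 (P x) (P y) \<le> (norm (P x))\<^sup>2 * (norm (P y - ?t *\<^sub>R P x))\<^sup>2"
    by (rule gram2_le_shift)
  also have "P y - ?t *\<^sub>R P x = P (y - ?t *\<^sub>R x)"
    using assms(1) by (simp add: linear_diff linear_scale)
  also have "(norm (P x))\<^sup>2 * (norm (P (y - ?t *\<^sub>R x)))\<^sup>2 \<le> (norm x)\<^sup>2 * (norm (y - ?t *\<^sub>R x))\<^sup>2"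
    by (intro mult_mono power_mono assms) auto
  finally show ?thesis unfolding gram2_eq_shift[OF False] .
qed

definition spectral_norm :: "real ^ 'd ^ 'd \<Rightarrow> real" where
  "spectral_norm A = singular_value 1 A"

text \<open>The operator norm of \<open>A\<close> on the exterior square, in the form that connects
  it with L_1 + L_2.\<close>

definition wedge_norm :: "real ^ 'd ^ 'd \<Rightarrow> real" where
  "wedge_norm A = spectral_norm A * singular_value 2 A"

text \<open>Weights 1 express the area of a pair of vectors by its two by two minors in an
  orthonormal basis; the squared singular values as weights express the area of the image.\<close>

lemma lagrange_identity_sum:
  fixes a b w :: "'i \<Rightarrow> real"
  assumes "finite I"
  shows "(\<Sum>i\<in>I. w i * (a i)\<^sup>2) * (\<Sum>i\<in>I. w i * (b i)\<^sup>2) - (\<Sum>i\<in>I. w i * (a i * b i))\<^sup>2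
    = (\<Sum>i\<in>I. \<Sum>j\<in>I. w i * w j * (a i * b j - a j * b i)\<^sup>2) / 2"
proof -
  let ?A = "\<Sum>i\<in>I. w i * (a i)\<^sup>2" and ?B = "\<Sum>i\<in>I. w i * (b i)\<^sup>2" and ?C = "\<Sum>i\<in>I. w i * (a i * b i)"
  have "(\<Sum>i\<in>I. \<Sum>j\<in>I. w i * w j * (a i * b j - a j * b i)\<^sup>2)
     = (\<Sum>i\<in>I. \<Sum>j\<in>I. (w i * (a i)\<^sup>2) * (w j * (b j)\<^sup>2) + (w i * (b i)\<^sup>2) * (w j * (a j)\<^sup>2)
        - 2 * ((w i * (a i * b i)) * (w j * (a j * b j))))"
    by (intro sum.cong refl) (simp add: power2_eq_square algebra_simps)
  also have "\<dots> = ?A * ?B + ?B * ?A - 2 * (?C * ?C)"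
    by (simp add: sum_subtractf sum.distrib sum_product) (simp add: sum_distrib_left)
  finally show ?thesis by (simp add: power2_eq_square)
qed

text \<open>In the basis of right singular vectors \<open>A\<close> scales the minor with indices i,
  j by s_i s_j. For i = j the minor is 0, and for i \<noteq> j the factor is at most the product of
  the two largest singular values. The first two basis vectors attain the bounds.\<close>

lemma
  fixes A :: "real ^ 'd ^ 'd"
  shows norm_le_spectral_norm: "norm (A *v x) \<le> spectral_norm A * norm x" (is ?a)
    and ex_norm_eq_spectral_norm: "\<exists>v. norm v = 1 \<and> norm (A *v v) = spectral_norm A" (is ?b)
    and gram2_le_wedge_norm: "2 \<le> CARD('d) \<Longrightarrow> gram2 (A *v x) (A *v y) \<le> (wedge_norm A)\<^sup>2 * gram2 x y" (is "_ \<Longrightarrow> ?c")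
    and ex_gram2_eq_wedge_norm: "2 \<le> CARD('d) \<Longrightarrow>
      \<exists>v w. gram2 v w = 1 \<and> gram2 (A *v v) (A *v w) = (wedge_norm A)\<^sup>2" (is "_ \<Longrightarrow> ?d")
    and wedge_norm_nonneg: "2 \<le> CARD('d) \<Longrightarrow> 0 \<le> wedge_norm A" (is "_ \<Longrightarrow> ?e")
    and spectral_norm_nonneg: "0 \<le> spectral_norm A" (is ?f)
    and wedge_norm_le: "2 \<le> CARD('d) \<Longrightarrow> wedge_norm A \<le> (spectral_norm A)\<^sup>2" (is "_ \<Longrightarrow> ?g")
proof -
  obtain e :: "nat \<Rightarrow> real ^ 'd" where on:
    "\<And>i j. i < CARD('d) \<Longrightarrow> j < CARD('d) \<Longrightarrow> e i \<bullet> e j = (if i = j then 1 else 0)"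
    and eig: "\<And>i. i < CARD('d) \<Longrightarrow> (transpose A ** A) *v e i = (singular_value (Suc i) A)\<^sup>2 *\<^sub>R e i"
    and pos: "\<And>i. i < CARD('d) \<Longrightarrow> 0 \<le> singular_value (Suc i) A"
    and dec: "\<And>i j. i \<le> j \<Longrightarrow> j < CARD('d) \<Longrightarrow> singular_value (Suc j) A \<le> singular_value (Suc i) A"
    by (rule singular_values_orthonormal_basis[of A]) blast
  \<comment> \<open>\<open>s\<close> counts from 0, \<open>singular_value\<close> from 1.\<close>
  define s where "s i = singular_value (Suc i) A" for i
  let ?I = "{..<CARD('d)}"
  have d: "0 < CARD('d)" by simp
  have inje: "inj_on e ?I"
  proof (rule inj_onI)
    fix i j assume "i \<in> ?I" "j \<in> ?I" "e i = e j"
    then show "i = j" using on[of i j] on[of i i] by (auto split: if_splits)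
  qed
  have ind: "independent (e ` ?I)"
  proof (rule pairwise_orthogonal_independent)
    show "pairwise orthogonal (e ` ?I)"
      using on by (auto simp: pairwise_def orthogonal_def)
    show "0 \<notin> e ` ?I" using on[of i i for i] by (metis imageE inner_zero_left lessThan_iff zero_neq_one)
  qed
  have "card (e ` ?I) = CARD('d)" using card_image[OF inje] by simp
  then have "span (e ` ?I) = UNIV"
    using card_eq_dim[of "e ` ?I" UNIV] ind by (simp add: top.extremum_unique)
  then have expand: "x = (\<Sum>i\<in>?I. (x \<bullet> e i) *\<^sub>R e i)" for x
  proof -
    let ?y = "x - (\<Sum>i\<in>?I. (x \<bullet> e i) *\<^sub>R e i)"
    have "orthogonal ?y b" if b: "b \<in> e ` ?I" for b
    proof -
      obtain j where j: "j < CARD('d)" "b = e j" using b by auto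
      have "(\<Sum>i\<in>?I. (x \<bullet> e i) *\<^sub>R e i) \<bullet> e j = (\<Sum>i\<in>?I. if i = j then x \<bullet> e j else 0)"
        unfolding inner_sum_left using on j by (intro sum.cong) auto
      then show ?thesis using j by (simp add: orthogonal_def inner_diff_left)
    qed
    then have "orthogonal ?y ?y"
      using \<open>span (e ` ?I) = UNIV\<close> orthogonal_to_span[of ?y "e ` ?I" ?y] by auto
    then show ?thesis by (simp add: orthogonal_def)
  qed
  have inner_expand: "x \<bullet> y = (\<Sum>i\<in>?I. 1 * ((x \<bullet> e i) * (y \<bullet> e i)))" for x y
  proof -
    have "x \<bullet> y = (\<Sum>i\<in>?I. (x \<bullet> e i) *\<^sub>R e i) \<bullet> y"
      by (rule arg_cong[where f = "\<lambda>x. x \<bullet> y"]) (rule expand)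
    also have "\<dots> = (\<Sum>i\<in>?I. 1 * ((x \<bullet> e i) * (y \<bullet> e i)))"
      unfolding inner_sum_left by (intro sum.cong) (auto simp: inner_commute)
    finally show ?thesis .
  qed
  have A_inner: "(A *v x) \<bullet> (A *v y) = (\<Sum>i\<in>?I. (s i)\<^sup>2 * ((x \<bullet> e i) * (y \<bullet> e i)))" for x y
  proof -
    have symd: "(A *v x) \<bullet> (A *v y) = (transpose A ** A *v x) \<bullet> y" for x y
      by (metis dot_lmul_matrix matrix_vector_mul_assoc transpose_matrix_vector)
    have "(A *v x) \<bullet> (A *v y) = (transpose A ** A *v (\<Sum>i\<in>?I. (x \<bullet> e i) *\<^sub>R e i)) \<bullet> y"
      unfolding symd by (rule arg_cong[where f = "\<lambda>x. (transpose A ** A *v x) \<bullet> y"]) (rule expand)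
    also have "transpose A ** A *v (\<Sum>i\<in>?I. (x \<bullet> e i) *\<^sub>R e i)
        = (\<Sum>i\<in>?I. (x \<bullet> e i) *\<^sub>R ((s i)\<^sup>2 *\<^sub>R e i))"
      unfolding linear_sum[OF matrix_vector_mul_linear]
      using eig by (intro sum.cong) (auto simp: matrix_vector_mult_scaleR s_def)
    finally have "(A *v x) \<bullet> (A *v y) = (\<Sum>i\<in>?I. (x \<bullet> e i) *\<^sub>R ((s i)\<^sup>2 *\<^sub>R e i)) \<bullet> y" .
    also have "\<dots> = (\<Sum>i\<in>?I. (s i)\<^sup>2 * ((x \<bullet> e i) * (y \<bullet> e i)))"
      unfolding inner_sum_left by (intro sum.cong) (auto simp: inner_commute)
    finally show ?thesis .
  qed
  have s0: "0 \<le> s i" "s i \<le> s 0" if "i < CARD('d)" for i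
    using pos dec that by (auto simp: s_def)
  have nA: "(norm (A *v x))\<^sup>2 = (\<Sum>i\<in>?I. (s i)\<^sup>2 * (x \<bullet> e i)\<^sup>2)" for x
    unfolding power2_norm_eq_inner A_inner by (simp add: power2_eq_square)
  have nI: "(norm x)\<^sup>2 = (\<Sum>i\<in>?I. 1 * (x \<bullet> e i)\<^sup>2)" for x
    unfolding power2_norm_eq_inner by (subst inner_expand) (simp add: power2_eq_square)
  show ?f using pos[OF d] by (simp add: spectral_norm_def)
  have "(norm (A *v x))\<^sup>2 \<le> (s 0)\<^sup>2 * (norm x)\<^sup>2"
    unfolding nA nI[of x] sum_distrib_left mult_1
    by (intro sum_mono mult_right_mono power_mono) (use s0 in auto)
  then have "(norm (A *v x))\<^sup>2 \<le> (s 0 * norm x)\<^sup>2" by (simp add: power_mult_distrib)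
  then show ?a using power2_le_imp_le[of "norm (A *v x)" "s 0 * norm x"] s0[OF d]
    by (simp add: s_def spectral_norm_def)
  have nAe: "(A *v e i) \<bullet> (A *v e j) = (if i = j then (s i)\<^sup>2 else 0)" if "i < CARD('d)" "j < CARD('d)" for i j
  proof -
    have "(A *v e i) \<bullet> (A *v e j) = (\<Sum>k\<in>?I. if k = i then (if i = j then (s i)\<^sup>2 else 0) else 0)"
      unfolding A_inner using on that by (intro sum.cong) auto
    then show ?thesis using that by simp
  qed
  have "(norm (A *v e 0))\<^sup>2 = (s 0)\<^sup>2" "norm (e 0) = 1"
    using nAe[of 0 0] on[of 0 0] by (auto simp: power2_norm_eq_inner norm_eq_1)
  then show ?b using s0[OF d] by (intro exI[of _ "e 0"]) (auto simp: s_def spectral_norm_def)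
  {
    assume d2: "2 \<le> CARD('d)"
    then have d1: "1 < CARD('d)" by simp
    have wn: "wedge_norm A = s 0 * s 1" by (simp add: wedge_norm_def s_def spectral_norm_def numeral_2_eq_2)
    show ?e unfolding wn using s0[OF d1] s0[OF d] by simp
    show ?g unfolding wn using s0[OF d1] s0[OF d] 
      by (simp add: s_def spectral_norm_def power2_eq_square mult_left_mono)
    have "gram2 (A *v x) (A *v y) = (\<Sum>i\<in>?I. \<Sum>j\<in>?I. (s i)\<^sup>2 * (s j)\<^sup>2 * ((x \<bullet> e i) * (y \<bullet> e j) - (x \<bullet> e j) * (y \<bullet> e i))\<^sup>2) / 2"
      unfolding gram2_def nA A_inner by (rule lagrange_identity_sum) simp
    also have "\<dots> \<le> (\<Sum>i\<in>?I. \<Sum>j\<in>?I. (wedge_norm A)\<^sup>2 * (1 * 1 * ((x \<bullet> e i) * (y \<bullet> e j) - (x \<bullet> e j) * (y \<bullet> e i))\<^sup>2)) / 2"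
    proof (intro divide_right_mono sum_mono)
      fix i j assume ij: "i \<in> ?I" "j \<in> ?I"
      show "(s i)\<^sup>2 * (s j)\<^sup>2 * ((x \<bullet> e i) * (y \<bullet> e j) - (x \<bullet> e j) * (y \<bullet> e i))\<^sup>2
        \<le> (wedge_norm A)\<^sup>2 * (1 * 1 * ((x \<bullet> e i) * (y \<bullet> e j) - (x \<bullet> e j) * (y \<bullet> e i))\<^sup>2)"
      proof (cases "i = j")
        case False
        have "s i * s j \<le> s 0 * s 1"
        proof (cases "i = 0")
          case True
          then show ?thesis using False ij s0 dec[of 1 j] by (auto simp: s_def intro!: mult_left_mono)
        next
          case i: False
          have "s j * s i \<le> s 0 * s 1"
            using i ij s0[of j] s0[of i] s0(1)[OF d] dec[of 1 i] by (intro mult_mono) (auto simp: s_def)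
          then show ?thesis by (simp add: mult.commute)
        qed
        then have "(s i * s j)\<^sup>2 \<le> (wedge_norm A)\<^sup>2"
          unfolding wn using s0 ij by (intro power_mono) auto
        then show ?thesis
          by (simp add: power_mult_distrib mult_right_mono)
      qed simp
    qed simp
    also have "\<dots> = (wedge_norm A)\<^sup>2 * ((\<Sum>i\<in>?I. \<Sum>j\<in>?I. 1 * 1 * ((x \<bullet> e i) * (y \<bullet> e j) - (x \<bullet> e j) * (y \<bullet> e i))\<^sup>2) / 2)"
      by (simp only: sum_distrib_left[symmetric] times_divide_eq_right)
    also have "\<dots> = (wedge_norm A)\<^sup>2 * gram2 x y"
      unfolding gram2_def nI inner_expand[of x y] by (subst lagrange_identity_sum) simp_all
    finally show ?c .
    show ?d
      using nAe[of 0 0] nAe[of 0 1] nAe[of 1 1] on[of 0 0] on[of 0 1] on[of 1 1] d d1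
      by (intro exI[of _ "e 0"] exI[of _ "e 1"])
        (simp add: gram2_def power2_norm_eq_inner wn power_mult_distrib)
  }
qed

section \<open>Independent sequences and subadditive processes\<close>

text \<open>For negative \<open>u\<close> multiply the claimed bound by the lower Taylor bound of
  \<open>exp (- u)\<close>; the product is at least 1.\<close>

lemma exp_le_quadratic:
  fixes u :: real
  assumes "\<bar>u\<bar> \<le> 1"
  shows "exp u \<le> 1 + u + u\<^sup>2"
proof (cases "0 \<le> u")
  case True
  then show ?thesis using exp_bound[of u] assms by simp
next
  case False
  then have lower: "1 - u + u\<^sup>2 / 2 \<le> exp (- u)"
    using exp_lower_Taylor_quadratic[of "- u"] by simp
  have pos: "0 < 1 - u + u\<^sup>2 / 2"
    using False by (simp add: add_pos_nonneg)
  have "u * u\<^sup>2 \<le> 0" using False by (simp add: mult_nonpos_nonneg)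
  moreover have "0 \<le> u\<^sup>2 * u\<^sup>2" by simp
  moreover have eq: "(1 + u + u\<^sup>2) * (1 - u + u\<^sup>2 / 2) = 1 + (u\<^sup>2 - u * u\<^sup>2 + u\<^sup>2 * u\<^sup>2) / 2"
    by (simp add: field_simps power2_eq_square)
  ultimately have "1 \<le> (1 + u + u\<^sup>2) * (1 - u + u\<^sup>2 / 2)"
  proof -
    have "1 \<le> 1 + (p - q + r) / 2" if "q \<le> 0" "0 \<le> r" "0 \<le> p" for p q r :: real
      using that by simp
    from this[OF \<open>u * u\<^sup>2 \<le> 0\<close> \<open>0 \<le> u\<^sup>2 * u\<^sup>2\<close> zero_le_power2[of u]] show ?thesis unfolding eq .
  qed
  then have "1 / (1 - u + u\<^sup>2 / 2) \<le> 1 + u + u\<^sup>2"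
    using pos by (simp add: field_simps)
  moreover have "exp u \<le> 1 / (1 - u + u\<^sup>2 / 2)"
    using lower pos by (simp add: exp_minus field_simps)
  ultimately show ?thesis by simp
qed

text \<open>Turns a bound on the mean of a bounded variable into a bound on a small exponential
  moment: the second order error \<open>s\<^sup>2 * L\<^sup>2\<close> is absorbed by the gap between
  \<open>m'\<close> and \<open>m\<close>. It is the bridge from mean logarithms to moments, which
  multiply along independent steps.\<close>

lemma (in prob_space) expectation_exp_le:
  fixes Y :: "'a \<Rightarrow> real"
  assumes [measurable]: "Y \<in> borel_measurable M" and bnd: "\<And>w. w \<in> space M \<Longrightarrow> \<bar>Y w\<bar> \<le> L"
    and m: "expectation Y \<le> m'" and s: "0 \<le> s" "s * L \<le> 1" "s * L\<^sup>2 \<le> m - m'"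
  shows "expectation (\<lambda>w. exp (s * Y w)) \<le> exp (s * m)"
proof -
  have sY: "\<bar>s * Y w\<bar> \<le> 1" if "w \<in> space M" for w
    using mult_left_mono[OF bnd[OF that] s(1)] s by (simp add: abs_mult)
  have int[simp]: "integrable M Y"
    by (rule integrable_const_bound[of _ L]) (use bnd in auto)
  have "expectation (\<lambda>w. exp (s * Y w)) \<le> expectation (\<lambda>w. 1 + s * Y w + s\<^sup>2 * L\<^sup>2)"
  proof (rule integral_mono)
    show "integrable M (\<lambda>w. exp (s * Y w))"
      by (rule integrable_const_bound[of _ "exp 1"]) (use sY abs_le_iff in force)+
  next
    fix w assume w: "w \<in> space M"
    have "(s * Y w)\<^sup>2 \<le> s\<^sup>2 * L\<^sup>2"
      unfolding power_mult_distrib using bnd[OF w] by (intro mult_left_mono) (auto simp: abs_le_square_iff[symmetric])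
    then show "exp (s * Y w) \<le> 1 + s * Y w + s\<^sup>2 * L\<^sup>2"
      using exp_le_quadratic[OF sY[OF w]] by simp
  qed simp
  also have "\<dots> = 1 + s * (expectation Y + s * L\<^sup>2)"
    by (simp add: prob_space power2_eq_square algebra_simps)
  also have "\<dots> \<le> 1 + s * m"
    using m s by (intro add_left_mono mult_left_mono) auto
  also have "\<dots> \<le> exp (s * m)" by (rule exp_ge_add_one_self)
  finally show ?thesis .
qed

definition seq_shift :: "nat \<Rightarrow> (nat \<Rightarrow> 'a) \<Rightarrow> nat \<Rightarrow> 'a" where
  "seq_shift k \<omega> = (\<lambda>i. \<omega> (k + i))"

lemma seq_shift_comb_seq [simp]: "seq_shift k (comb_seq k \<omega> \<omega>') = \<omega>'"
  by (auto simp: seq_shift_def comb_seq_def fun_eq_iff)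

lemma seq_shift_add: "seq_shift (k + l) \<omega> = seq_shift l (seq_shift k \<omega>)"
  by (simp add: seq_shift_def add.assoc)

lemma seq_shift_0 [simp]: "seq_shift 0 \<omega> = \<omega>"
  by (simp add: seq_shift_def)

context sequence_space
begin

lemma space_S: "\<omega> \<in> space S \<longleftrightarrow> (\<forall>i. \<omega> i \<in> space M)"
  by (auto simp: space_PiM PiE_def extensional_def)

lemma measurable_seq_shift [measurable]: "seq_shift k \<in> measurable S S"
  unfolding seq_shift_def by (rule measurable_PiM_single') (auto simp: space_PiM)

lemma seq_shift_space: "\<omega> \<in> space S \<Longrightarrow> seq_shift k \<omega> \<in> space S"
  by (auto simp: space_S seq_shift_def)

lemma comb_seq_space: "\<omega> \<in> space S \<Longrightarrow> \<omega>' \<in> space S \<Longrightarrow> comb_seq k \<omega> \<omega>' \<in> space S"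
  by (auto simp: space_S comb_seq_def)

lemma pair_prob_space_S: "pair_prob_space S S"
  by unfold_locales

text \<open>Independence of past and future: the first \<open>k\<close> entries and all later ones
  are integrated separately.\<close>

lemma nn_integral_comb_seq:
  assumes [measurable]: "f \<in> borel_measurable S"
  shows "(\<integral>\<^sup>+\<omega>. f \<omega> \<partial>S) = (\<integral>\<^sup>+\<omega>. \<integral>\<^sup>+\<omega>'. f (comb_seq k \<omega> \<omega>') \<partial>S \<partial>S)"
proof -
  interpret PP: pair_prob_space S S by (rule pair_prob_space_S)
  have "(\<integral>\<^sup>+\<omega>. f \<omega> \<partial>S) = (\<integral>\<^sup>+\<omega>. f \<omega> \<partial>distr (S \<Otimes>\<^sub>M S) S (\<lambda>(\<omega>, \<omega>'). comb_seq k \<omega> \<omega>'))"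
    unfolding PiM_comb_seq ..
  also have "\<dots> = (\<integral>\<^sup>+x. f (comb_seq k (fst x) (snd x)) \<partial>(S \<Otimes>\<^sub>M S))"
    by (subst nn_integral_distr) (auto simp: split_beta')
  also have "\<dots> = (\<integral>\<^sup>+\<omega>. \<integral>\<^sup>+\<omega>'. f (comb_seq k \<omega> \<omega>') \<partial>S \<partial>S)"
    by (subst P.nn_integral_fst[symmetric]) auto
  finally show ?thesis .
qed

lemma nn_integral_case_nat:
  assumes [measurable]: "f \<in> borel_measurable S"
  shows "(\<integral>\<^sup>+\<omega>. f \<omega> \<partial>S) = (\<integral>\<^sup>+s. \<integral>\<^sup>+\<omega>. f (case_nat s \<omega>) \<partial>S \<partial>M)"
proof -
  interpret PP: pair_prob_space M S by unfold_locales
  have "(\<integral>\<^sup>+\<omega>. f \<omega> \<partial>S) = (\<integral>\<^sup>+\<omega>. f \<omega> \<partial>distr (M \<Otimes>\<^sub>M S) S (\<lambda>(s, \<omega>). case_nat s \<omega>))"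
    unfolding PiM_iter ..
  also have "\<dots> = (\<integral>\<^sup>+x. f (case_nat (fst x) (snd x)) \<partial>(M \<Otimes>\<^sub>M S))"
    by (subst nn_integral_distr) (auto simp: split_beta')
  also have "\<dots> = (\<integral>\<^sup>+s. \<integral>\<^sup>+\<omega>. f (case_nat s \<omega>) \<partial>S \<partial>M)"
    by (subst P.nn_integral_fst[symmetric]) auto
  finally show ?thesis .
qed

lemma AE_case_nat:
  assumes "AE \<omega> in S. Q \<omega>"
  shows "AE s in M. AE \<omega> in S. Q (case_nat s \<omega>)"
proof -
  interpret PP: pair_prob_space M S by unfold_locales
  have "AE \<omega> in distr (M \<Otimes>\<^sub>M S) S (\<lambda>(s, \<omega>). case_nat s \<omega>). Q \<omega>"
    unfolding PiM_iter by (rule assms)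
  then have "AE x in M \<Otimes>\<^sub>M S. Q (case_nat (fst x) (snd x))"
    by (auto dest!: AE_distrD[rotated] simp: split_beta')
  from PP.AE_pair[OF this] show ?thesis by simp
qed

lemma integral_case_nat:
  fixes f :: "(nat \<Rightarrow> 'a) \<Rightarrow> real"
  assumes [measurable]: "f \<in> borel_measurable S" and bnd: "\<And>\<omega>. \<omega> \<in> space S \<Longrightarrow> \<bar>f \<omega>\<bar> \<le> C"
  shows "(\<integral>\<omega>. f \<omega> \<partial>S) = (\<integral>s. \<integral>\<omega>. f (case_nat s \<omega>) \<partial>S \<partial>M)"
proof -
  interpret PP: pair_prob_space M S by unfold_locales
  have int: "integrable (M \<Otimes>\<^sub>M S) (\<lambda>x. f (case_nat (fst x) (snd x)))"
  proof (rule PP.P.integrable_const_bound[of _ C])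
    have "case_nat s \<omega> \<in> space S" if "s \<in> space M" "\<omega> \<in> space S" for s \<omega>
      using that by (auto simp: space_S split: nat.split)
    then show "AE x in M \<Otimes>\<^sub>M S. norm (f (case_nat (fst x) (snd x))) \<le> C"
      using bnd by (auto simp: space_pair_measure)
  qed simp
  have "(\<integral>\<omega>. f \<omega> \<partial>S) = (\<integral>\<omega>. f \<omega> \<partial>distr (M \<Otimes>\<^sub>M S) S (\<lambda>(s, \<omega>). case_nat s \<omega>))"
    unfolding PiM_iter ..
  also have "\<dots> = (\<integral>x. f (case_nat (fst x) (snd x)) \<partial>(M \<Otimes>\<^sub>M S))"
    by (subst integral_distr) (auto simp: split_beta')
  also have "\<dots> = (\<integral>s. \<integral>\<omega>. f (case_nat s \<omega>) \<partial>S \<partial>M)"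
    using PP.integral_fst'[OF int] by simp
  finally show ?thesis .
qed

lemma measure_comb_seq:
  assumes [measurable]: "A \<in> sets S"
  shows "measure S A = (\<integral>\<omega>. measure S {\<omega>' \<in> space S. comb_seq k \<omega> \<omega>' \<in> A} \<partial>S)" (is ?eq)
    and "(\<lambda>\<omega>. measure S {\<omega>' \<in> space S. comb_seq k \<omega> \<omega>' \<in> A}) \<in> borel_measurable S" (is ?meas)
proof -
  interpret PP: pair_prob_space S S by (rule pair_prob_space_S)
  have "emeasure S A = (\<integral>\<^sup>+\<omega>. indicator A \<omega> \<partial>S)" by simp
  also have "\<dots> = (\<integral>\<^sup>+\<omega>. \<integral>\<^sup>+\<omega>'. indicator A (comb_seq k \<omega> \<omega>') \<partial>S \<partial>S)"
    by (rule nn_integral_comb_seq) simp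
  also have "\<dots> = (\<integral>\<^sup>+\<omega>. emeasure S {\<omega>' \<in> space S. comb_seq k \<omega> \<omega>' \<in> A} \<partial>S)"
  proof (rule nn_integral_cong)
    fix \<omega> assume [measurable]: "\<omega> \<in> space S"
    have "(\<integral>\<^sup>+\<omega>'. indicator A (comb_seq k \<omega> \<omega>') \<partial>S)
        = (\<integral>\<^sup>+\<omega>'. indicator {\<omega>' \<in> space S. comb_seq k \<omega> \<omega>' \<in> A} \<omega>' \<partial>S)"
      by (rule nn_integral_cong) (auto simp: indicator_def)
    also have "\<dots> = emeasure S {\<omega>' \<in> space S. comb_seq k \<omega> \<omega>' \<in> A}"
      by (rule nn_integral_indicator) measurable
    finally show "(\<integral>\<^sup>+\<omega>'. indicator A (comb_seq k \<omega> \<omega>') \<partial>S) = emeasure S {\<omega>' \<in> space S. comb_seq k \<omega> \<omega>' \<in> A}" .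
  qed
  finally have *: "emeasure S A = (\<integral>\<^sup>+\<omega>. ennreal (measure S {\<omega>' \<in> space S. comb_seq k \<omega> \<omega>' \<in> A}) \<partial>S)"
    by (simp add: P.emeasure_eq_measure)
  have "(\<lambda>\<omega>. \<integral>\<omega>'. indicator A (comb_seq k \<omega> \<omega>') \<partial>S :: real) \<in> borel_measurable S"
    by (rule P.borel_measurable_lebesgue_integral) simp
  moreover have "(\<integral>\<omega>'. indicator A (comb_seq k \<omega> \<omega>') \<partial>S :: real) = measure S {\<omega>' \<in> space S. comb_seq k \<omega> \<omega>' \<in> A}"
    if "\<omega> \<in> space S" for \<omega>
  proof -
    note [measurable] = that
    have "(\<integral>\<omega>'. indicat_real A (comb_seq k \<omega> \<omega>') \<partial>S)
        = (\<integral>\<omega>'. indicat_real {\<omega>' \<in> space S. comb_seq k \<omega> \<omega>' \<in> A} \<omega>' \<partial>S)"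
      by (rule Bochner_Integration.integral_cong) (auto simp: indicator_def)
    then show ?thesis by simp
  qed
  ultimately show m: ?meas by (simp cong: measurable_cong)
  show ?eq
    using m by (simp add: integral_eq_nn_integral *[symmetric] P.emeasure_eq_measure)
qed

definition cylinder :: "nat \<Rightarrow> (nat \<Rightarrow> 'a) set \<Rightarrow> bool" where
  "cylinder k B \<longleftrightarrow> B \<in> sets S \<and>
     (\<forall>\<omega>\<in>space S. \<forall>\<omega>'\<in>space S. (\<forall>i<k. \<omega> i = \<omega>' i) \<longrightarrow> (\<omega> \<in> B \<longleftrightarrow> \<omega>' \<in> B))"

text \<open>The sets approximable by cylinders contain the generators and are closed under
  complements and countable unions.\<close>

lemma cylinder_approximation:
  assumes "A \<in> sets S" "0 < e"
  shows "\<exists>k B. cylinder k B \<and> measure S ((A - B) \<union> (B - A)) < e"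
proof -
  let ?G = "{{f \<in> \<Pi>\<^sub>E i\<in>UNIV. space M. f i \<in> A} | i A. i \<in> (UNIV::nat set) \<and> A \<in> sets M}"
  have sets: "sets S = sigma_sets (space S) ?G"
    by (subst sets_PiM_single) (simp add: space_PiM)
  have "A \<in> sigma_sets (space S) ?G" using assms sets by simp
  then have "\<forall>e>0. \<exists>k B. cylinder k B \<and> measure S ((A - B) \<union> (B - A)) < e"
  proof induction
    case (Basic a)
    then obtain i D where a: "a = {f \<in> \<Pi>\<^sub>E i\<in>UNIV. space M. f i \<in> D}" "D \<in> sets M" by blast
    have "a \<in> sets S" unfolding sets using Basic by (rule sigma_sets.Basic)
    then have "cylinder (Suc i) a"
      using a by (auto simp: cylinder_def space_PiM)
    then show ?case by (intro allI impI exI[of _ "Suc i"] exI[of _ a]) simp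
  next
    case Empty
    have "cylinder 0 {}" by (simp add: cylinder_def)
    then show ?case by (intro allI impI exI[of _ 0] exI[of _ "{}"]) simp
  next
    case (Compl a)
    show ?case
    proof (intro allI impI)
      fix e :: real assume "0 < e"
      then obtain k B where B: "cylinder k B" "measure S ((a - B) \<union> (B - a)) < e"
        using Compl by blast
      have "cylinder k (space S - B)"
        unfolding cylinder_def
      proof (intro conjI ballI impI)
        show "space S - B \<in> sets S" using B(1) by (intro sets.compl_sets) (simp add: cylinder_def)
        fix \<omega> \<omega>' assume "\<omega> \<in> space S" "\<omega>' \<in> space S" "\<forall>i<k. \<omega> i = \<omega>' i"
        then show "\<omega> \<in> space S - B \<longleftrightarrow> \<omega>' \<in> space S - B"
          using B(1) unfolding cylinder_def by blast
      qed
      moreover have "a \<subseteq> space S" "B \<subseteq> space S"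
        using sets.sets_into_space[of a S] sets.sets_into_space[of B S] Compl(1) B(1) sets
        unfolding cylinder_def by blast+
      then have "(space S - a - (space S - B)) \<union> (space S - B - (space S - a)) = (a - B) \<union> (B - a)"
        by blast
      ultimately show "\<exists>k B. cylinder k B \<and> measure S ((space S - a - B) \<union> (B - (space S - a))) < e"
        using B by (intro exI[of _ k] exI[of _ "space S - B"]) auto
    qed
  next
    case (Union a)
    show ?case
    proof (intro allI impI)
      fix e :: real assume e: "0 < e"
      have am[measurable]: "a i \<in> sets S" for i using Union sets by blast
      have "(\<lambda>n. measure S (\<Union>i<n. a i)) \<longlonglongrightarrow> measure S (\<Union>n. \<Union>i<n. a i)"
        by (rule P.finite_Lim_measure_incseq) (auto simp: incseq_def intro: order_less_le_trans)
      moreover have "(\<Union>n. \<Union>i<n. a i) = (\<Union>i. a i)" by auto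
      ultimately have "eventually (\<lambda>n. measure S (\<Union>i. a i) - e / 2 < measure S (\<Union>i<n. a i)) sequentially"
        using e by (intro order_tendstoD) auto
      then obtain n where n: "measure S (\<Union>i. a i) - e / 2 < measure S (\<Union>i<n. a i)"
        by (auto simp: eventually_sequentially)
      \<comment> \<open>Half of \<open>e\<close> pays for truncating the union to \<open>n\<close>
        members; the other half is shared among these.\<close>
      have "\<forall>i. \<exists>k B. cylinder k B \<and> measure S ((a i - B) \<union> (B - a i)) < e / (2 * (real n + 1))"
        using Union e by simp
      then obtain k B where kB: "\<And>i. cylinder (k i) (B i)"
        "\<And>i. measure S ((a i - B i) \<union> (B i - a i)) < e / (2 * (real n + 1))" by metis
      have Bm[measurable]: "B i \<in> sets S" for i using kB by (simp add: cylinder_def)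
      define K where "K = (\<Sum>i<n. k i)"
      have kK: "k i \<le> K" if "i < n" for i
        unfolding K_def using that by (intro member_le_sum) auto
      have cyl: "cylinder K (\<Union>i<n. B i)"
        unfolding cylinder_def
      proof (intro conjI ballI impI)
        fix \<omega> \<omega>' assume w: "\<omega> \<in> space S" "\<omega>' \<in> space S" "\<forall>i<K. \<omega> i = \<omega>' i"
        have "\<omega> \<in> B i \<longleftrightarrow> \<omega>' \<in> B i" if "i < n" for i
        proof -
          have "\<forall>j<k i. \<omega> j = \<omega>' j" using w kK[OF that] by auto
          then show ?thesis using kB(1)[of i] w(1,2) unfolding cylinder_def by blast
        qed
        then show "\<omega> \<in> (\<Union>i<n. B i) \<longleftrightarrow> \<omega>' \<in> (\<Union>i<n. B i)" by auto
      qed auto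
      have "measure S ((\<Union>i. a i) - (\<Union>i<n. B i) \<union> ((\<Union>i<n. B i) - (\<Union>i. a i)))
         \<le> measure S (((\<Union>i. a i) - (\<Union>i<n. a i)) \<union> (\<Union>i<n. (a i - B i) \<union> (B i - a i)))"
        by (rule P.finite_measure_mono) auto
      also have "\<dots> \<le> measure S ((\<Union>i. a i) - (\<Union>i<n. a i)) + measure S (\<Union>i<n. (a i - B i) \<union> (B i - a i))"
        by (rule measure_Un_le) auto
      also have "measure S (\<Union>i<n. (a i - B i) \<union> (B i - a i)) \<le> (\<Sum>i<n. measure S ((a i - B i) \<union> (B i - a i)))"
        by (rule measure_UNION_le) auto
      also have "\<dots> \<le> (\<Sum>i<n. e / (2 * (real n + 1)))"
        using kB(2) by (intro sum_mono less_imp_le)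
      also have "\<dots> \<le> e / 2" using e by (simp add: field_simps)
      also have "measure S ((\<Union>i. a i) - (\<Union>i<n. a i)) = measure S (\<Union>i. a i) - measure S (\<Union>i<n. a i)"
        by (rule P.finite_measure_Diff) auto
      finally show "\<exists>k B. cylinder k B \<and> measure S ((\<Union>i. a i) - B \<union> (B - (\<Union>i. a i))) < e"
        using cyl n by (intro exI[of _ K] exI[of _ "\<Union>i<n. B i"]) auto
    qed
  qed
  then show ?thesis using assms by blast
qed

text \<open>A substitute for Levy's zero-one law.\<close>

lemma ex_prefix_measure_near_1:
  assumes A[measurable]: "A \<in> sets S" and "0 < measure S A" "0 < e"
  shows "\<exists>k. \<exists>\<omega>\<in>space S. 1 - e \<le> measure S {\<omega>' \<in> space S. comb_seq k \<omega> \<omega>' \<in> A}"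
proof (rule ccontr)
  assume neg: "\<not> ?thesis"
  \<comment> \<open>If every conditional probability of \<open>A\<close> were below
    \<open>1 - e\<close>, integrating over a cylinder \<open>B\<close> within \<delta> of
    \<open>A\<close> would give \<open>e * measure S A \<le> 2 * \<delta>\<close>; the divisor 3
    excludes this.\<close>
  define \<delta> where "\<delta> = e * measure S A / 3"
  have \<delta>: "0 < \<delta>" using assms by (simp add: \<delta>_def)
  obtain k B where B: "cylinder k B" "measure S ((A - B) \<union> (B - A)) < \<delta>"
    using cylinder_approximation[OF A \<delta>] by blast
  have Bm[measurable]: "B \<in> sets S" using B by (simp add: cylinder_def)
  let ?m = "\<lambda>\<omega>. measure S {\<omega>' \<in> space S. comb_seq k \<omega> \<omega>' \<in> A}"
  have le: "?m \<omega> \<le> 1 - e" if "\<omega> \<in> space S" for \<omega>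
    using neg that by (meson less_imp_le not_le)
  have cyl: "comb_seq k \<omega> \<omega>' \<in> B \<longleftrightarrow> \<omega> \<in> B" if "\<omega> \<in> space S" "\<omega>' \<in> space S" for \<omega> \<omega>'
    using B(1) that comb_seq_space[OF that, of k] unfolding cylinder_def
    by (metis comb_seq_def)
  have "measure S (A \<inter> B) = (\<integral>\<omega>. measure S {\<omega>' \<in> space S. comb_seq k \<omega> \<omega>' \<in> A \<inter> B} \<partial>S)"
    by (rule measure_comb_seq) simp
  also have "\<dots> \<le> (\<integral>\<omega>. (1 - e) * indicator B \<omega> \<partial>S)"
  proof (rule integral_mono)
    show "integrable S (\<lambda>\<omega>. measure S {\<omega>' \<in> space S. comb_seq k \<omega> \<omega>' \<in> A \<inter> B})"
      by (rule P.integrable_const_bound[of _ 1]) (auto intro!: measure_comb_seq(2))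
    fix \<omega> assume w: "\<omega> \<in> space S"
    show "measure S {\<omega>' \<in> space S. comb_seq k \<omega> \<omega>' \<in> A \<inter> B} \<le> (1 - e) * indicator B \<omega>"
    proof (cases "\<omega> \<in> B")
      case True
      then have "{\<omega>' \<in> space S. comb_seq k \<omega> \<omega>' \<in> A \<inter> B} = {\<omega>' \<in> space S. comb_seq k \<omega> \<omega>' \<in> A}"
        using cyl[OF w] by auto
      then show ?thesis using le[OF w] True by simp
    next
      case False
      then have empty: "{\<omega>' \<in> space S. comb_seq k \<omega> \<omega>' \<in> A \<inter> B} = {}"
        using cyl[OF w] by auto
      show ?thesis unfolding empty using False by simp
    qed
  qed (auto simp: P.emeasure_eq_measure)
  also have "\<dots> = (1 - e) * measure S B" by simp
  finally have AB: "measure S (A \<inter> B) \<le> (1 - e) * measure S B" .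
  have "measure S A \<le> measure S ((A \<inter> B) \<union> ((A - B) \<union> (B - A)))"
    by (rule P.finite_measure_mono) auto
  also have "\<dots> \<le> measure S (A \<inter> B) + measure S ((A - B) \<union> (B - A))"
    by (rule measure_Un_le) auto
  finally have 1: "measure S A \<le> measure S (A \<inter> B) + \<delta>" using B by simp
  have "measure S B \<le> measure S (A \<union> ((A - B) \<union> (B - A)))"
    by (rule P.finite_measure_mono) auto
  also have "\<dots> \<le> measure S A + measure S ((A - B) \<union> (B - A))"
    by (rule measure_Un_le) auto
  finally have 2: "measure S B \<le> measure S A + \<delta>" using B by simp
  obtain \<omega>0 where "\<omega>0 \<in> space S" using P.not_empty by blast
  with le[OF this] have e1: "0 \<le> 1 - e" by (meson measure_nonneg order_trans)
  have "measure S A \<le> (1 - e) * (measure S A + \<delta>) + \<delta>"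
    using 1 AB mult_left_mono[OF 2 e1] by simp
  also have "\<dots> \<le> (1 - e) * measure S A + 2 * \<delta>"
    using \<delta> \<open>0 < e\<close> by (simp add: algebra_simps)
  finally have "e * measure S A \<le> 2 * \<delta>" by (simp add: algebra_simps)
  then show False using assms by (simp add: \<delta>_def)
qed

text \<open>Every time from which the bound \<open>c\<close> per step is reached within \<open>N\<close> steps starts a block on
  which it holds; the remaining times cost at most \<open>C + \<bar>c\<bar>\<close> each.\<close>

lemma expectation_le_hitting:
  fixes a :: "nat \<Rightarrow> 'x \<Rightarrow> (nat \<Rightarrow> 'a) \<Rightarrow> real" and orb :: "nat \<Rightarrow> 'x \<Rightarrow> (nat \<Rightarrow> 'a) \<Rightarrow> 'x"
    and C c e :: real and N :: nat
  assumes C: "0 \<le> C"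
    and orb: "\<And>k x \<omega>. x \<in> X \<Longrightarrow> \<omega> \<in> space S \<Longrightarrow> orb k x \<omega> \<in> X"
      "\<And>x \<omega>. orb 0 x \<omega> = x"
      "\<And>k l x \<omega>. orb (k + l) x \<omega> = orb l (orb k x \<omega>) (seq_shift k \<omega>)"
      "\<And>k x \<omega> \<omega>'. orb k x (comb_seq k \<omega> \<omega>') = orb k x \<omega>"
    and meas: "\<And>k n x. x \<in> X \<Longrightarrow> (\<lambda>\<omega>. a n (orb k x \<omega>) (seq_shift k \<omega>)) \<in> borel_measurable S"
    and bnd: "\<And>n x \<omega>. x \<in> X \<Longrightarrow> \<omega> \<in> space S \<Longrightarrow> \<bar>a n x \<omega>\<bar> \<le> C * n"
    and sub: "\<And>k n x \<omega>. x \<in> X \<Longrightarrow> \<omega> \<in> space S \<Longrightarrow>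
      a (k + n) x \<omega> \<le> a k x \<omega> + a n (orb k x \<omega>) (seq_shift k \<omega>)"
    and hit: "\<And>x. x \<in> X \<Longrightarrow> 1 - e \<le> measure S {\<omega> \<in> space S. \<exists>n\<in>{1..N}. a n x \<omega> \<le> c * n}"
    and x: "x \<in> X"
  shows "(\<integral>\<omega>. a n x \<omega> \<partial>S) \<le> c * n + (C + \<bar>c\<bar>) * (e * n + N)"
proof -
  define D where "D = C + \<bar>c\<bar>"
  have D: "0 \<le> D" using C by (simp add: D_def)
  \<comment> \<open>\<open>b\<close> marks the starting points from which no block of length at most
    \<open>N\<close> attains the rate; each such time will cost \<open>D\<close>.\<close>
  define b :: "'x \<Rightarrow> (nat \<Rightarrow> 'a) \<Rightarrow> real" where
    "b x \<omega> = (if \<exists>n\<in>{1..N}. a n x \<omega> \<le> c * n then 0 else 1)" for x \<omega>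
  have b0: "0 \<le> b x \<omega>" for x \<omega> by (simp add: b_def)
  have path: "a n x \<omega> \<le> c * n + D * ((\<Sum>i<n. b (orb i x \<omega>) (seq_shift i \<omega>)) + N)"
    if "x \<in> X" "\<omega> \<in> space S" for n x \<omega>
    using that
  proof (induction n arbitrary: x \<omega> rule: less_induct)
    case (less n)
    \<comment> \<open>An initial block whose own bound holds reduces the claim to the shifted path
      of length \<open>n - k\<close>.\<close>
    have step: "a n x \<omega> \<le> c * n + D * ((\<Sum>i<n. b (orb i x \<omega>) (seq_shift i \<omega>)) + N)"
      if k: "1 \<le> k" "k \<le> n" and ak: "a k x \<omega> \<le> c * k + D * (\<Sum>i<k. b (orb i x \<omega>) (seq_shift i \<omega>))" for k
    proof -
      let ?x = "orb k x \<omega>" and ?\<omega> = "seq_shift k \<omega>"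
      have "a n x \<omega> \<le> a k x \<omega> + a (n - k) ?x ?\<omega>"
        using sub[OF less.prems, of k "n - k"] k by simp
      moreover have "a (n - k) ?x ?\<omega> \<le> c * real (n - k) + D * ((\<Sum>i<n - k. b (orb i ?x ?\<omega>) (seq_shift i ?\<omega>)) + N)"
        using k less.prems by (intro less.IH orb seq_shift_space) auto
      moreover have "(\<Sum>i<n - k. b (orb i ?x ?\<omega>) (seq_shift i ?\<omega>)) = (\<Sum>i<n - k. b (orb (k + i) x \<omega>) (seq_shift (k + i) \<omega>))"
        by (simp add: orb(3) seq_shift_add)
      moreover have "\<dots> = (\<Sum>i\<in>{k..<n}. b (orb i x \<omega>) (seq_shift i \<omega>))"
        by (rule sum.reindex_bij_witness[of _ "\<lambda>i. i - k" "\<lambda>i. k + i"]) auto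
      ultimately have "a n x \<omega> \<le> a k x \<omega> + (c * real (n - k) + D * ((\<Sum>i\<in>{k..<n}. b (orb i x \<omega>) (seq_shift i \<omega>)) + N))" by simp
      moreover have "(\<Sum>i<n. b (orb i x \<omega>) (seq_shift i \<omega>))
         = (\<Sum>i<k. b (orb i x \<omega>) (seq_shift i \<omega>)) + (\<Sum>i\<in>{k..<n}. b (orb i x \<omega>) (seq_shift i \<omega>))"
        using sum.atLeastLessThan_concat[of 0 k n "\<lambda>i. b (orb i x \<omega>) (seq_shift i \<omega>)"] k
        by (simp add: atLeast0LessThan)
      ultimately show ?thesis using ak k by (simp add: of_nat_diff algebra_simps)
    qed
    show ?case
    proof (cases "n \<le> N")
      case True
      \<comment> \<open>A last stretch of length at most \<open>N\<close> is bounded crudely; this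
        is the origin of the summand \<open>D * N\<close>.\<close>
      have "a n x \<omega> \<le> C * n" using bnd[OF less.prems, of n] by simp
      also have "\<dots> \<le> c * n + D * n"
        unfolding D_def distrib_right[symmetric] by (intro mult_right_mono) auto
      also have "\<dots> \<le> c * n + D * ((\<Sum>i<n. b (orb i x \<omega>) (seq_shift i \<omega>)) + N)"
      proof -
        have "0 \<le> (\<Sum>i<n. b (orb i x \<omega>) (seq_shift i \<omega>))" by (intro sum_nonneg b0)
        then show ?thesis using True D by (intro add_left_mono mult_left_mono) (auto simp: add_increasing)
      qed
      finally show ?thesis .
    next
      case False
      show ?thesis
      proof (cases "\<exists>n\<in>{1..N}. a n x \<omega> \<le> c * n")
        case True
        then obtain k where k: "k \<in> {1..N}" "a k x \<omega> \<le> c * k" by blast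
        have "0 \<le> D * (\<Sum>i<k. b (orb i x \<omega>) (seq_shift i \<omega>))"
          by (intro mult_nonneg_nonneg sum_nonneg b0 D)
        with k False show ?thesis by (intro step[of k]) auto
      next
        case nohit: False
        then have "b x \<omega> = 1" by (simp add: b_def)
        moreover have "a 1 x \<omega> \<le> c + D"
          using bnd[OF less.prems, of 1] by (simp add: D_def)
        ultimately show ?thesis using False by (intro step[of 1]) (auto simp: orb)
      qed
    qed
  qed
  have bm[measurable]: "(\<lambda>\<omega>. b (orb i x \<omega>) (seq_shift i \<omega>)) \<in> borel_measurable S" if "x \<in> X" for i x
    using meas[OF that, measurable] unfolding b_def by measurable
  have bint: "integrable S (\<lambda>\<omega>. b (orb i x \<omega>) (seq_shift i \<omega>))" if "x \<in> X" for i x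
    by (rule P.integrable_const_bound[of _ 1]) (use bm[OF that] in \<open>auto simp: b_def\<close>)
  \<comment> \<open>The point reached after \<open>i\<close> steps depends on the first
    \<open>i\<close> entries only, the event on the later ones. Conditionally on those first entries
    the uniform bound \<open>hit\<close> applies.\<close>
  have be: "(\<integral>\<omega>. b (orb i x \<omega>) (seq_shift i \<omega>) \<partial>S) \<le> e" for i
  proof -
    let ?A = "{\<omega> \<in> space S. \<exists>n\<in>{1..N}. a n (orb i x \<omega>) (seq_shift i \<omega>) \<le> c * n}"
    have A[measurable]: "?A \<in> sets S" using meas[OF x, measurable] by measurable
    have "1 - e \<le> (\<integral>\<omega>. measure S {\<omega>' \<in> space S. comb_seq i \<omega> \<omega>' \<in> ?A} \<partial>S)"
    proof (rule P.integral_ge_const)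
      show "integrable S (\<lambda>\<omega>. measure S {\<omega>' \<in> space S. comb_seq i \<omega> \<omega>' \<in> ?A})"
        using measure_comb_seq(2)[OF A, of i]
        by (intro P.integrable_const_bound[of _ 1]) simp_all
      show "AE \<omega> in S. 1 - e \<le> measure S {\<omega>' \<in> space S. comb_seq i \<omega> \<omega>' \<in> ?A}"
      proof (rule AE_I2)
        fix \<omega> assume w: "\<omega> \<in> space S"
        have "{\<omega>' \<in> space S. comb_seq i \<omega> \<omega>' \<in> ?A} = {\<omega>' \<in> space S. \<exists>n\<in>{1..N}. a n (orb i x \<omega>) \<omega>' \<le> c * n}"
          using comb_seq_space[OF w] by (auto simp: orb(4))
        then show "1 - e \<le> measure S {\<omega>' \<in> space S. comb_seq i \<omega> \<omega>' \<in> ?A}"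
          using hit[OF orb(1)[OF x w]] by simp
      qed
    qed
    also have "\<dots> = measure S ?A"
      by (rule measure_comb_seq(1)[OF A, symmetric])
    finally have "1 - e \<le> measure S ?A" .
    moreover have "(\<integral>\<omega>. b (orb i x \<omega>) (seq_shift i \<omega>) \<partial>S) = (\<integral>\<omega>. 1 - indicator ?A \<omega> \<partial>S)"
      by (rule Bochner_Integration.integral_cong) (auto simp: b_def)
    moreover have "(\<integral>\<omega>. 1 - indicat_real D \<omega> \<partial>S) = 1 - measure S D" if "D \<in> sets S" for D
      using that sets.Int_space_eq2[OF that]
      by (subst Bochner_Integration.integral_diff) (auto simp: P.prob_space P.emeasure_eq_measure)
    from this[OF A] have "(\<integral>\<omega>. 1 - indicat_real ?A \<omega> \<partial>S) = 1 - measure S ?A" .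
    ultimately show ?thesis by linarith
  qed
  have "(\<integral>\<omega>. a n x \<omega> \<partial>S) \<le> (\<integral>\<omega>. c * n + D * ((\<Sum>i<n. b (orb i x \<omega>) (seq_shift i \<omega>)) + N) \<partial>S)"
  proof (rule integral_mono)
    show "integrable S (a n x)"
      using meas[OF x, of n 0] bnd[OF x, of _ n]
      by (intro P.integrable_const_bound[of _ "C * n"]) (auto simp: orb(2))
  qed (use bint[OF x] path[OF x] in auto)
  also have "\<dots> = c * n + D * ((\<Sum>i<n. \<integral>\<omega>. b (orb i x \<omega>) (seq_shift i \<omega>) \<partial>S) + N)"
    using bint[OF x] by (simp add: P.prob_space)
  also have "\<dots> \<le> c * n + D * ((\<Sum>i<n. e) + N)"
    by (intro add_left_mono mult_left_mono add_right_mono sum_mono be D)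
  finally show ?thesis by (simp add: D_def mult.commute)
qed


text \<open>Kingman's theorem for bounded increments of an i.i.d. sequence. From above, exponential
  moments multiply over independent blocks, and Borel-Cantelli applies. From below, falling
  infinitely often under a rate c < \<gamma> is, up to a constant, invariant under the shift, so it
  has probability 0 or 1; probability 1 would push the means below \<open>\<gamma> * n\<close>. The
  assumption \<open>first\<close> provides the invariance.\<close>

theorem subadditive_AE_limit:
  fixes a :: "nat \<Rightarrow> (nat \<Rightarrow> 'a) \<Rightarrow> real" and C :: real
  assumes C: "0 \<le> C"
    and meas [measurable]: "\<And>n. a n \<in> borel_measurable S"
    and bnd: "\<And>n \<omega>. \<omega> \<in> space S \<Longrightarrow> \<bar>a n \<omega>\<bar> \<le> C * n"
    and sub: "\<And>k n \<omega>. \<omega> \<in> space S \<Longrightarrow> a (k + n) \<omega> \<le> a k \<omega> + a n (seq_shift k \<omega>)"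
    and pre: "\<And>k \<omega> \<omega>'. a k (comb_seq k \<omega> \<omega>') = a k \<omega>"
    and first: "\<And>n \<omega>. \<omega> \<in> space S \<Longrightarrow> \<bar>a (Suc n) \<omega> - a n (seq_shift 1 \<omega>)\<bar> \<le> C"
  obtains \<gamma> where "AE \<omega> in S. (\<lambda>n. a n \<omega> / n) \<longlonglongrightarrow> \<gamma>"
    "(\<lambda>n. (\<integral>\<omega>. a n \<omega> \<partial>S) / n) \<longlonglongrightarrow> \<gamma>" "\<And>n. \<gamma> * n \<le> (\<integral>\<omega>. a n \<omega> \<partial>S)"
proof -
  define E where "E n = (\<integral>\<omega>. a n \<omega> \<partial>S)" for n
  \<comment> \<open>The limit that Fekete's lemma gives for the subadditive means.\<close>
  define \<gamma> where "\<gamma> = (INF n\<in>{1..}. E n / real n)"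
  have int[simp]: "integrable S (a n)" for n
    by (rule P.integrable_const_bound[of _ "C * n"]) (use bnd in auto)
  have Ebnd: "\<bar>E n\<bar> \<le> C * n" for n
  proof -
    have "\<bar>E n\<bar> \<le> (\<integral>\<omega>. \<bar>a n \<omega>\<bar> \<partial>S)"
      unfolding E_def by (rule integral_abs_bound)
    also have "\<dots> \<le> (\<integral>\<omega>. C * n \<partial>S)"
      by (intro integral_mono) (auto simp: bnd)
    finally show ?thesis by (simp add: P.prob_space)
  qed
  have "\<bar>E n / real n\<bar> \<le> C" if "1 \<le> n" for n
    using Ebnd[of n] that by (simp add: field_simps abs_le_iff)
  then have bdd: "bdd_below ((\<lambda>n. E n / real n) ` {1..})"
    unfolding abs_le_iff by (intro bdd_belowI[of _ "- C"]) fastforce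
  have E_ge: "\<gamma> * n \<le> E n" for n
  proof (cases "n = 0")
    case True
    then show ?thesis using Ebnd[of 0] by simp
  next
    case False
    then have "\<gamma> \<le> E n / n" unfolding \<gamma>_def by (intro cINF_lower bdd) auto
    then show ?thesis using False by (simp add: field_simps)
  qed
  have upper: "AE \<omega> in S. eventually (\<lambda>n. a n \<omega> \<le> t * n) sequentially" if t: "\<gamma> < t" for t :: real
  proof -
    define t' where "t' = (\<gamma> + t) / 2"
    have t': "\<gamma> < t'" "t' < t" using t by (auto simp: t'_def)
    then obtain N where N: "1 \<le> N" "E N / real N < t'"
      unfolding \<gamma>_def using cINF_less_iff[OF _ bdd, of t'] by auto
    define L where "L = C * N"
    have L: "0 \<le> L" using C by (simp add: L_def)
    have EN: "E N < t' * N" using N by (simp add: field_simps)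
    \<comment> \<open>The two terms secure the two smallness conditions of
      \<open>expectation_exp_le\<close> for the block length \<open>N\<close> and the gap
      \<open>t' * N - E N\<close>; the added 1 keeps the denominators positive.\<close>
    define s where "s = min (1 / (L + 1)) ((t' * N - E N) / (L\<^sup>2 + 1))"
    have s: "0 < s"
      using L EN by (simp add: s_def add_nonneg_pos)
    have "s * L \<le> 1 / (L + 1) * L" using L by (intro mult_right_mono) (auto simp: s_def)
    also have "\<dots> \<le> 1" using L by (simp add: field_simps)
    finally have sL: "s * L \<le> 1" .
    have "s * L\<^sup>2 \<le> (t' * N - E N) / (L\<^sup>2 + 1) * L\<^sup>2" by (intro mult_right_mono) (auto simp: s_def)
    also have "\<dots> \<le> (t' * N - E N) / (L\<^sup>2 + 1) * (L\<^sup>2 + 1)"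
      using EN by (intro mult_left_mono) auto
    also have "\<dots> = t' * N - E N" using zero_le_power2[of L] by (simp add: add_nonneg_pos[THEN less_imp_neq, symmetric])
    finally have sL2: "s * L\<^sup>2 \<le> t' * N - E N" .
    have base: "(\<integral>\<^sup>+\<omega>. exp (s * a N \<omega>) \<partial>S) \<le> ennreal (exp (s * (t' * N)))"
    proof -
      have "(\<integral>\<omega>. exp (s * a N \<omega>) \<partial>S) \<le> exp (s * (t' * N))"
        by (rule P.expectation_exp_le[where L = L and m' = "E N"])
          (use s sL sL2 bnd in \<open>auto simp: L_def E_def\<close>)
      moreover have "integrable S (\<lambda>\<omega>. exp (s * a N \<omega>))"
      proof (rule P.integrable_const_bound[of _ "exp (s * L)"])
        show "AE \<omega> in S. norm (exp (s * a N \<omega>)) \<le> exp (s * L)"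
          using s bnd[of _ N] by (intro AE_I2) (auto simp: L_def abs_le_iff)
      qed simp
      ultimately show ?thesis by (simp add: nn_integral_eq_integral)
    qed
    have blocks: "(\<integral>\<^sup>+\<omega>. exp (s * a (k * N) \<omega>) \<partial>S) \<le> ennreal (exp (s * (t' * (k * N))))" for k
    proof (induction k)
      case 0
      have "a 0 \<omega> = 0" if "\<omega> \<in> space S" for \<omega> using bnd[OF that, of 0] by simp
      then have "(\<integral>\<^sup>+\<omega>. exp (s * a (0 * N) \<omega>) \<partial>S) = (\<integral>\<^sup>+\<omega>. 1 \<partial>S)"
        by (intro nn_integral_cong) simp
      then show ?case by (simp add: P.emeasure_space_1)
    next
      case (Suc k)
      have "(\<integral>\<^sup>+\<omega>. exp (s * a (Suc k * N) \<omega>) \<partial>S)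
         = (\<integral>\<^sup>+\<omega>. \<integral>\<^sup>+\<omega>'. exp (s * a (Suc k * N) (comb_seq N \<omega> \<omega>')) \<partial>S \<partial>S)"
        by (rule nn_integral_comb_seq) simp
      also have "\<dots> \<le> (\<integral>\<^sup>+\<omega>. \<integral>\<^sup>+\<omega>'. ennreal (exp (s * a N \<omega>)) * ennreal (exp (s * a (k * N) \<omega>')) \<partial>S \<partial>S)"
      proof (intro nn_integral_mono)
        fix \<omega> \<omega>' assume w: "\<omega> \<in> space S" "\<omega>' \<in> space S"
        have "a (Suc k * N) (comb_seq N \<omega> \<omega>') \<le> a N \<omega> + a (k * N) \<omega>'"
          using sub[OF comb_seq_space[OF w, of N], of N "k * N"] by (simp add: pre)
        then have "s * a (Suc k * N) (comb_seq N \<omega> \<omega>') \<le> s * a N \<omega> + s * a (k * N) \<omega>'"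
          using s by (simp add: distrib_left[symmetric])
        then show "ennreal (exp (s * a (Suc k * N) (comb_seq N \<omega> \<omega>')))
           \<le> ennreal (exp (s * a N \<omega>)) * ennreal (exp (s * a (k * N) \<omega>'))"
          by (simp add: ennreal_mult[symmetric] exp_add[symmetric] ennreal_leI)
      qed
      also have "\<dots> = (\<integral>\<^sup>+\<omega>. exp (s * a N \<omega>) \<partial>S) * (\<integral>\<^sup>+\<omega>. exp (s * a (k * N) \<omega>) \<partial>S)"
        by (simp add: nn_integral_cmult nn_integral_multc)
      also have "\<dots> \<le> ennreal (exp (s * (t' * N))) * ennreal (exp (s * (t' * (k * N))))"
        by (intro mult_mono base Suc) auto
      also have "\<dots> = ennreal (exp (s * (t' * (Suc k * N))))"
        by (simp add: ennreal_mult[symmetric] exp_add[symmetric] algebra_simps)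
      finally show ?case .
    qed
    \<comment> \<open>\<open>K\<close> pays for the incomplete last block when \<open>N\<close> does
      not divide \<open>n\<close>.\<close>
    define K where "K = exp (s * (C * N + \<bar>t'\<bar> * N))"
    have tail: "measure S {\<omega> \<in> space S. t * n < a n \<omega>} \<le> K * exp (- (s * (t - t'))) ^ n" for n
    proof -
      define k where "k = n div N"
      have kn: "k * N \<le> n" "n < k * N + N"
        using N div_mult_mod_eq[of n N] mod_less_divisor[of N n] unfolding k_def by linarith+
      have "emeasure S {\<omega> \<in> space S. t * n < a n \<omega>} = (\<integral>\<^sup>+\<omega>. indicator {\<omega> \<in> space S. t * n < a n \<omega>} \<omega> \<partial>S)"
        by simp
      also have "\<dots> \<le> (\<integral>\<^sup>+\<omega>. ennreal (exp (s * (C * N - t * n))) * ennreal (exp (s * a (k * N) \<omega>)) \<partial>S)"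
      proof (rule nn_integral_mono)
        fix \<omega> assume w: "\<omega> \<in> space S"
        have "a n \<omega> \<le> a (k * N) \<omega> + a (n - k * N) (seq_shift (k * N) \<omega>)"
          using sub[OF w, of "k * N" "n - k * N"] kn by simp
        also have "a (n - k * N) (seq_shift (k * N) \<omega>) \<le> C * real (n - k * N)"
          using bnd[OF seq_shift_space[OF w], of "n - k * N" "k * N"] by (simp add: abs_le_iff)
        also have "C * real (n - k * N) \<le> C * N"
          using kn C by (intro mult_left_mono) linarith+
        finally have "0 \<le> C * N - t * n + a (k * N) \<omega>" if "t * n < a n \<omega>" using that by linarith
        then have "0 \<le> s * (C * N - t * n) + s * a (k * N) \<omega>" if "t * n < a n \<omega>"
          using that s by (simp add: distrib_left[symmetric])
        then show "indicator {\<omega> \<in> space S. t * n < a n \<omega>} \<omega>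
            \<le> ennreal (exp (s * (C * N - t * n))) * ennreal (exp (s * a (k * N) \<omega>))"
          by (auto simp: indicator_def ennreal_mult[symmetric] exp_add[symmetric])
      qed
      also have "\<dots> = ennreal (exp (s * (C * N - t * n))) * (\<integral>\<^sup>+\<omega>. ennreal (exp (s * a (k * N) \<omega>)) \<partial>S)"
        by (rule nn_integral_cmult) simp
      also have "\<dots> \<le> ennreal (exp (s * (C * N - t * n))) * ennreal (exp (s * (t' * (k * N))))"
        by (intro mult_left_mono blocks) auto
      also have "\<dots> = ennreal (exp (s * (C * N - t * n) + s * (t' * (k * N))))"
        by (simp add: ennreal_mult[symmetric] exp_add)
      also have "\<dots> \<le> ennreal (exp (s * (C * N + \<bar>t'\<bar> * N) + n * (- (s * (t - t')))))"
      proof (intro ennreal_leI exp_le_cancel_iff[THEN iffD2])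
        have "t' * (k * N) - t' * n \<le> \<bar>t'\<bar> * N"
        proof -
          have "t' * (k * N) - t' * n = (- t') * (real n - real (k * N))" by (simp add: algebra_simps)
          also have "\<dots> \<le> \<bar>t'\<bar> * (real n - real (k * N))"
            using kn by (intro mult_right_mono) (auto simp del: of_nat_mult)
          also have "\<dots> \<le> \<bar>t'\<bar> * N"
          proof (intro mult_left_mono)
            have "real n \<le> real (k * N + N)" using kn(2) by (intro of_nat_mono less_imp_le)
            then show "real n - real (k * N) \<le> real N" by simp
          qed simp
          finally show ?thesis .
        qed
        from mult_left_mono[OF this, of s] s
        show "s * (C * N - t * n) + s * (t' * (k * N)) \<le> s * (C * N + \<bar>t'\<bar> * N) + n * (- (s * (t - t')))"
          by (simp add: algebra_simps)
      qed
      also have "\<dots> = ennreal (K * exp (- (s * (t - t'))) ^ n)"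
        unfolding K_def exp_of_nat_mult[symmetric] exp_add ..
      finally show ?thesis by (simp add: P.emeasure_eq_measure K_def)
    qed
    have "AE \<omega> in S. eventually (\<lambda>n. \<omega> \<in> space S - {\<omega> \<in> space S. t * n < a n \<omega>}) sequentially"
    proof (rule borel_cantelli_AE1)
      have "summable (\<lambda>n. K * exp (- (s * (t - t'))) ^ n)"
        using s t' by (intro summable_mult summable_geometric) simp
      then show "summable (\<lambda>n. measure S {\<omega> \<in> space S. t * n < a n \<omega>})"
        by (rule summable_comparison_test'[where N = 0]) (use tail in simp)
    qed (auto simp: P.emeasure_eq_measure)
    then show ?thesis
      by eventually_elim (auto elim!: eventually_mono)
  qed
  have lower: "AE \<omega> in S. eventually (\<lambda>n. c * n \<le> a n \<omega>) sequentially" if c: "c < \<gamma>" for c :: real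
  proof -
    \<comment> \<open>The free constant \<open>K\<close> makes the event insensitive to removing the
      first entry, which changes the process by at most \<open>C\<close>.\<close>
    define Bad where "Bad = {\<omega> \<in> space S. \<exists>K::nat. \<forall>m. \<exists>j. a (m + j) \<omega> \<le> c * real (m + j) + real K}"
    have Bad[measurable]: "Bad \<in> sets S" unfolding Bad_def by measurable
    have shift1: "\<omega> \<in> Bad \<longleftrightarrow> seq_shift 1 \<omega> \<in> Bad" if w: "\<omega> \<in> space S" for \<omega>
    proof
      assume "\<omega> \<in> Bad"
      then obtain K :: nat where K: "\<And>m. \<exists>j. a (m + j) \<omega> \<le> c * real (m + j) + real K"
        by (auto simp: Bad_def)
      have "\<exists>j. a (m + j) (seq_shift 1 \<omega>) \<le> c * real (m + j) + real (nat \<lceil>K + \<bar>c\<bar> + C\<rceil>)" for m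
      proof -
        obtain j where j: "a (Suc m + j) \<omega> \<le> c * real (Suc m + j) + real K" using K by blast
        have "a (m + j) (seq_shift 1 \<omega>) \<le> c * real (m + j) + (K + \<bar>c\<bar> + C)"
          using first[OF w, of "m + j"] j abs_ge_self[of c] abs_ge_minus_self[of c] by (simp add: abs_le_iff algebra_simps)
        then show ?thesis using real_nat_ceiling_ge[of "K + \<bar>c\<bar> + C"] by (intro exI[of _ j]) linarith
      qed
      then show "seq_shift 1 \<omega> \<in> Bad" using seq_shift_space[OF w] by (auto simp: Bad_def)
    next
      assume "seq_shift 1 \<omega> \<in> Bad"
      then obtain K :: nat where K: "\<And>m. \<exists>j. a (m + j) (seq_shift 1 \<omega>) \<le> c * real (m + j) + real K"
        by (auto simp: Bad_def)
      have "\<exists>j. a (m + j) \<omega> \<le> c * real (m + j) + real (nat \<lceil>K + \<bar>c\<bar> + C\<rceil>)" for m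
      proof -
        obtain j where j: "a (m + j) (seq_shift 1 \<omega>) \<le> c * real (m + j) + real K" using K by blast
        have "a (m + Suc j) \<omega> \<le> c * real (m + Suc j) + (K + \<bar>c\<bar> + C)"
          using first[OF w, of "m + j"] j abs_ge_self[of c] abs_ge_minus_self[of c] by (simp add: abs_le_iff algebra_simps)
        then show ?thesis using real_nat_ceiling_ge[of "K + \<bar>c\<bar> + C"] by (intro exI[of _ "Suc j"]) linarith
      qed
      then show "\<omega> \<in> Bad" using w by (auto simp: Bad_def)
    qed
    have shift: "\<omega> \<in> Bad \<longleftrightarrow> seq_shift k \<omega> \<in> Bad" if w: "\<omega> \<in> space S" for \<omega> k
      using w
    proof (induction k arbitrary: \<omega>)
      case (Suc k)
      then show ?case
        using shift1[OF Suc.prems] Suc.IH[OF seq_shift_space[OF Suc.prems, of 1]] seq_shift_add[of 1 k \<omega>]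
        by simp
    qed simp
    have "measure S Bad = 0"
    proof (rule ccontr)
      assume "measure S Bad \<noteq> 0"
      then have pos: "0 < measure S Bad" by (simp add: zero_less_measure_iff)
      have near: "1 - e \<le> measure S Bad" if e: "0 < e" for e
      proof -
        obtain k \<omega> where k: "\<omega> \<in> space S" "1 - e \<le> measure S {\<omega>' \<in> space S. comb_seq k \<omega> \<omega>' \<in> Bad}"
          using ex_prefix_measure_near_1[OF Bad pos e] by blast
        have "{\<omega>' \<in> space S. comb_seq k \<omega> \<omega>' \<in> Bad} = Bad"
        proof -
          have "comb_seq k \<omega> \<omega>' \<in> Bad \<longleftrightarrow> \<omega>' \<in> Bad" if "\<omega>' \<in> space S" for \<omega>'
            using shift[OF comb_seq_space[OF k(1) that], of k k] by simp
          moreover have "Bad \<subseteq> space S" by (rule sets.sets_into_space[OF Bad])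
          ultimately show ?thesis by blast
        qed
        then show ?thesis using k by simp
      qed
      have "1 \<le> measure S Bad"
      proof (rule field_le_epsilon)
        fix e :: real assume "0 < e"
        from near[OF this] show "1 \<le> measure S Bad + e" by linarith
      qed
      then have "measure S Bad = 1" by (intro antisym) auto
      then have AEBad: "AE \<omega> in S. \<omega> \<in> Bad" by (simp add: P.prob_eq_1)
      \<comment> \<open>At late times the margin between \<open>c\<close> and \<open>c'\<close>
        absorbs the constant \<open>K\<close>, so almost every path reaches the rate
        \<open>c'\<close> at some positive time.\<close>
      define c' where "c' = (c + \<gamma>) / 2"
      have c': "c < c'" "c' < \<gamma>" using c by (auto simp: c'_def)
      define D where "D = C + \<bar>c'\<bar> + 1"
      have D: "0 < D" using C by (simp add: D_def)
      \<comment> \<open>Then \<open>D * e\<close> is a quarter of \<open>\<gamma> - c'\<close>, and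
        the mean rate stays below \<gamma>.\<close>
      define e where "e = (\<gamma> - c') / (4 * D)"
      have e: "0 < e" using c' D by (simp add: e_def)
      let ?A = "\<lambda>N. {\<omega> \<in> space S. \<exists>n\<in>{1..N}. a n \<omega> \<le> c' * real n}"
      have A[measurable]: "?A N \<in> sets S" for N by measurable
      have "AE \<omega> in S. \<omega> \<in> (\<Union>N. ?A N)"
        using AEBad AE_space
      proof eventually_elim
        case (elim \<omega>)
        then obtain K :: nat where K: "\<And>m. \<exists>j. a (m + j) \<omega> \<le> c * real (m + j) + real K"
          by (auto simp: Bad_def)
        obtain m :: nat where m: "K / (c' - c) < m" using reals_Archimedean2 by blast
        obtain j where j: "a (Suc m + j) \<omega> \<le> c * real (Suc m + j) + real K" using K by blast
        have "K < m * (c' - c)" using m c' by (simp add: field_simps)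
        also have "\<dots> \<le> real (Suc m + j) * (c' - c)" using c' by (intro mult_right_mono) auto
        finally have "a (Suc m + j) \<omega> \<le> c' * real (Suc m + j)"
          using j by (simp add: algebra_simps)
        then have "\<omega> \<in> ?A (Suc m + j)" using elim by (auto intro!: bexI[of _ "Suc m + j"])
        then show ?case by blast
      qed
      then have "measure S (\<Union>N. ?A N) = 1" by (subst P.prob_eq_1) auto
      moreover have "(\<lambda>N. measure S (?A N)) \<longlonglongrightarrow> measure S (\<Union>N. ?A N)"
        by (rule P.finite_Lim_measure_incseq) (auto simp: incseq_def)
      ultimately have "eventually (\<lambda>N. 1 - e < measure S (?A N)) sequentially"
        using e by (intro order_tendstoD) auto
      then obtain N where N: "1 - e < measure S (?A N)" by (auto simp: eventually_sequentially)
      have bound: "E n \<le> c' * n + (C + \<bar>c'\<bar>) * (e * n + N)" for n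
        unfolding E_def
        \<comment> \<open>The process depends on no point here, so the orbit is taken
          constant.\<close>
        by (rule expectation_le_hitting[where a = "\<lambda>n x. a n" and X = UNIV and orb = "\<lambda>k x \<omega>. x", OF C])
          (use N bnd sub pre in \<open>auto intro: less_imp_le\<close>)
      obtain n :: nat where n: "2 * (D * N) / (\<gamma> - c') < n" using reals_Archimedean2 by blast
      have "0 \<le> 2 * (D * N) / (\<gamma> - c')" using c' D by simp
      with n have "0 < real n" by linarith
      then have n0: "0 < n" "2 * (D * N) < n * (\<gamma> - c')"
        using c' n by (simp_all add: pos_divide_less_eq)
      have "\<gamma> * n \<le> c' * n + (C + \<bar>c'\<bar>) * (e * n + N)" using E_ge bound order_trans by blast
      also have "\<dots> \<le> c' * n + D * (e * n + N)"
        using e by (intro add_left_mono mult_right_mono) (auto simp: D_def)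
      also have "\<dots> = c' * n + (\<gamma> - c') / 4 * n + D * N"
        using D by (simp add: e_def field_simps)
      finally have "3 * ((\<gamma> - c') * n) \<le> 4 * (D * N)" by (simp add: field_simps)
      moreover have "0 < (\<gamma> - c') * n" using c' n0 by simp
      ultimately show False using n0 by (simp add: mult.commute)
    qed
    then have "AE \<omega> in S. \<omega> \<notin> Bad" by (simp add: P.prob_eq_0)
    then show ?thesis
      using AE_space
    proof eventually_elim
      case (elim \<omega>)
      then obtain m where m: "\<And>j. \<not> a (m + j) \<omega> \<le> c * real (m + j) + real 0"
        unfolding Bad_def by blast
      show ?case
        unfolding eventually_sequentially
      proof (intro exI allI impI)
        fix n assume "m \<le> n"
        then show "c * n \<le> a n \<omega>" using m[of "n - m"] by simp
      qed
    qed
  qed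
  have lim: "AE \<omega> in S. (\<lambda>n. a n \<omega> / n) \<longlonglongrightarrow> \<gamma>"
  proof -
    have "AE \<omega> in S. \<forall>k. eventually (\<lambda>n. a n \<omega> \<le> (\<gamma> + 1 / Suc k) * n) sequentially"
      unfolding AE_all_countable by (intro allI upper) simp
    moreover have "AE \<omega> in S. \<forall>k. eventually (\<lambda>n. (\<gamma> - 1 / Suc k) * n \<le> a n \<omega>) sequentially"
      unfolding AE_all_countable by (intro allI lower) simp
    ultimately show ?thesis
    proof eventually_elim
      case (elim \<omega>)
      show ?case
      proof (rule LIMSEQ_I)
        fix r :: real assume "0 < r"
        then obtain k where k: "1 / Suc k < r" using nat_approx_posE by blast
        have "eventually (\<lambda>n. norm (a n \<omega> / n - \<gamma>) < r) sequentially"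
          using elim[THEN spec, of k] eventually_gt_at_top[of 0]
        proof eventually_elim
          case (elim n)
          then have "a n \<omega> / n \<le> \<gamma> + 1 / Suc k" "\<gamma> - 1 / Suc k \<le> a n \<omega> / n"
            by (simp_all add: pos_divide_le_eq pos_le_divide_eq)
          then show ?case using k by (simp add: abs_less_iff)
        qed
        then show "\<exists>no. \<forall>n\<ge>no. norm (a n \<omega> / n - \<gamma>) < r" by (simp add: eventually_sequentially)
      qed
    qed
  qed
  have "(\<lambda>n. \<integral>\<omega>. a n \<omega> / n \<partial>S) \<longlonglongrightarrow> (\<integral>\<omega>. \<gamma> \<partial>S)"
  proof (rule integral_dominated_convergence[where w = "\<lambda>_. C"])
    show "AE \<omega> in S. norm (a n \<omega> / n) \<le> C" for n
      using bnd[of _ n] C by (intro AE_I2) (auto simp: divide_le_eq)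
  qed (use lim in auto)
  then have "(\<lambda>n. E n / n) \<longlonglongrightarrow> \<gamma>" by (simp add: E_def P.prob_space)
  then show ?thesis using that lim E_ge unfolding E_def by blast
qed

end

section \<open>Analytic perturbation of a contracting transfer operator\<close>

definition multilinear_on :: "('a \<Rightarrow> real) set \<Rightarrow> nat \<Rightarrow> (('a \<Rightarrow> real) list \<Rightarrow> real) \<Rightarrow> bool" where
  "multilinear_on W n T \<longleftrightarrow> (\<forall>xs. length xs = n \<longrightarrow> set xs \<subseteq> W \<longrightarrow>
     (\<forall>i<n. \<forall>x\<in>W. \<forall>y\<in>W. \<forall>a b.
        T (xs[i := (\<lambda>t. a * x t + b * y t)]) = a * T (xs[i := x]) + b * T (xs[i := y])))"

text \<open>The perturbation series yields ordered products of operators, which need not be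
  symmetric in their arguments. Averaging over permutations makes them symmetric and keeps the
  diagonal values, the only ones a power series uses.\<close>

definition symmetrize :: "nat \<Rightarrow> ('b list \<Rightarrow> real) \<Rightarrow> 'b list \<Rightarrow> real" where
  "symmetrize n T xs = (\<Sum>p\<in>{p. p permutes {..<n}}. T (permute_list p xs)) / fact n"

lemma permute_list_replicate:
  assumes "p permutes {..<n}"
  shows "permute_list p (replicate n x) = replicate n x"
  using permutes_in_image[OF assms] by (intro nth_equalityI) (auto simp: permute_list_def)

lemma symmetrize_replicate: "symmetrize n T (replicate n x) = T (replicate n x)"
  by (simp add: symmetrize_def permute_list_replicate card_permutations)

lemma permute_list_update:
  assumes p: "p permutes {..<n}" and len: "length xs = n" and j: "p j = i" "j < n"
  shows "permute_list p (xs[i := z]) = (permute_list p xs)[j := z]"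
proof (rule nth_equalityI)
  fix k assume "k < length (permute_list p (xs[i := z]))"
  then have k: "k < n" using len by simp
  have pk: "p k < n" using permutes_in_image[OF p, of k] k by simp
  have i: "i < n" using permutes_in_image[OF p, of j] j by simp
  have "p k = i \<longleftrightarrow> k = j" using j permutes_inj[OF p] by (auto dest: injD)
  then show "permute_list p (xs[i := z]) ! k = (permute_list p xs)[j := z] ! k"
    using k len pk i j by (auto simp: permute_list_def nth_list_update)
qed simp

lemma multilinear_on_symmetrize:
  assumes "multilinear_on W n T"
  shows "multilinear_on W n (symmetrize n T)"
  unfolding multilinear_on_def
proof (intro allI impI ballI)
  fix xs :: "('a \<Rightarrow> real) list" and i x y and a b :: real
  assume len: "length xs = n" and W: "set xs \<subseteq> W" and i: "i < n" and xy: "x \<in> W" "y \<in> W"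
  have "T (permute_list p (xs[i := (\<lambda>t. a * x t + b * y t)]))
      = a * T (permute_list p (xs[i := x])) + b * T (permute_list p (xs[i := y]))"
    if p: "p permutes {..<n}" for p
  proof -
    obtain j where j: "p j = i" using permutes_surj[OF p] by (metis surjD)
    then have jn: "j < n" using permutes_in_image[OF p, of j] i by simp
    have "set (permute_list p xs) \<subseteq> W" "length (permute_list p xs) = n"
      using W len p by simp_all
    then show ?thesis
      using assms jn xy unfolding permute_list_update[OF p len j jn] multilinear_on_def by blast
  qed
  then show "symmetrize n T (xs[i := (\<lambda>t. a * x t + b * y t)])
      = a * symmetrize n T (xs[i := x]) + b * symmetrize n T (xs[i := y])"
    by (simp add: symmetrize_def sum.distrib sum_distrib_left add_divide_distrib)
qed

lemma abs_symmetrize_le: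
  assumes "\<And>xs. length xs = n \<Longrightarrow> set xs \<subseteq> W \<Longrightarrow> \<bar>T xs\<bar> \<le> A * prod_list (map nrm xs)"
    and "length xs = n" "set xs \<subseteq> W"
  shows "\<bar>symmetrize n T xs\<bar> \<le> A * prod_list (map nrm xs)"
proof -
  have "\<bar>T (permute_list p xs)\<bar> \<le> A * prod_list (map nrm xs)" if p: "p permutes {..<n}" for p
  proof -
    have "\<bar>T (permute_list p xs)\<bar> \<le> A * prod_list (map nrm (permute_list p xs))"
      using assms p by (intro assms(1)) auto
    also have "prod_list (map nrm (permute_list p xs)) = prod_list (map nrm xs)"
      using p assms(2) by (metis mset_map mset_permute_list prod_mset_prod_list)
    finally show ?thesis .
  qed
  then have "\<bar>\<Sum>p\<in>{p. p permutes {..<n}}. T (permute_list p xs)\<bar>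
      \<le> (\<Sum>p\<in>{p. p permutes {..<n}}. A * prod_list (map nrm xs))"
    by (intro order_trans[OF sum_abs] sum_mono) auto
  also have "\<dots> = fact n * (A * prod_list (map nrm xs))"
    by (simp add: card_permutations)
  finally show ?thesis
    by (simp add: symmetrize_def abs_div_pos[symmetric] pos_divide_le_eq mult.commute)
qed

lemma symmetrize_cong_mset:
  assumes "length xs = n" "mset ys = mset xs"
  shows "symmetrize n T ys = symmetrize n T xs"
proof -
  obtain q where q: "q permutes {..<length xs}" "permute_list q xs = ys"
    using mset_eq_permutation[OF assms(2)] by metis
  have "(\<Sum>p\<in>{p. p permutes {..<n}}. T (permute_list p ys))
      = (\<Sum>p\<in>{p. p permutes {..<n}}. T (permute_list (q \<circ> p) xs))"
  proof (intro sum.cong refl)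
    fix p assume "p \<in> {p. p permutes {..<n}}"
    then show "T (permute_list p ys) = T (permute_list (q \<circ> p) xs)"
      using q assms(1) permute_list_compose[of p xs q] by (auto simp: permute_list_compose)
  qed
  also have "\<dots> = (\<Sum>p\<in>{p. p permutes {..<n}}. T (permute_list p xs))"
  proof (rule sum.reindex_bij_witness[of _ "\<lambda>p. inv q \<circ> p" "\<lambda>p. q \<circ> p"])
    have q': "q permutes {..<n}" using q assms(1) by simp
    note inv = permutes_inv_o[OF q'] permutes_inv[OF q']
    show "inv q \<circ> (q \<circ> p) = p" "q \<circ> (inv q \<circ> p) = p" for p
      by (simp_all add: o_assoc inv)
    show "inv q \<circ> p \<in> {p. p permutes {..<n}}" "q \<circ> p \<in> {p. p permutes {..<n}}"
      if "p \<in> {p. p permutes {..<n}}" for p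
      using that by (auto intro: permutes_compose inv(3) q')
  qed simp
  finally show ?thesis by (simp add: symmetrize_def)
qed

text \<open>Replace the entries of \<open>xs\<close> by those of \<open>ys\<close> one at a time.
  Each replacement changes the value by a term with one difference as entry, at most
  \<open>A * (d * R ^ (n - 1))\<close>, where \<open>R\<close> bounds the entries of both
  lists.\<close>

lemma multilinear_bounded_continuous:
  assumes T: "multilinear_on W n T"
    and bnd: "\<And>xs. length xs = n \<Longrightarrow> set xs \<subseteq> W \<Longrightarrow> \<bar>T xs\<bar> \<le> A * prod_list (map nrm xs)"
    and A: "0 \<le> A" and nrm0: "\<And>x. 0 \<le> nrm x"
    and tri: "\<And>x y. x \<in> W \<Longrightarrow> y \<in> W \<Longrightarrow> nrm y \<le> nrm x + nrm (\<lambda>t. y t - x t)"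
    and diff: "\<And>x y. x \<in> W \<Longrightarrow> y \<in> W \<Longrightarrow> (\<lambda>t. y t - x t) \<in> W"
    and xs: "length xs = n" "set xs \<subseteq> W" and e: "0 < e"
  shows "\<exists>d>0. \<forall>ys. length ys = n \<longrightarrow> set ys \<subseteq> W \<longrightarrow>
    (\<forall>i<n. nrm (\<lambda>t. (ys ! i) t - (xs ! i) t) < d) \<longrightarrow> \<bar>T ys - T xs\<bar> < e"
proof -
  define R where "R = 1 + (\<Sum>i<n. nrm (xs ! i))"
  have R1: "1 \<le> R" unfolding R_def using nrm0 by (simp add: sum_nonneg)
  have R: "nrm (xs ! i) + 1 \<le> R" if "i < n" for i
    unfolding R_def using member_le_sum[of i "{..<n}" "\<lambda>i. nrm (xs ! i)"] that nrm0 by simp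
  define d where "d = min 1 (e / (A * R ^ (n - 1) * n + 1))"
  have den: "0 < A * R ^ (n - 1) * n + 1" using A R1 by (simp add: add_nonneg_pos)
  have d: "0 < d" "d \<le> 1" using e den by (simp_all add: d_def)
  show ?thesis
  proof (intro exI conjI allI impI)
    show "0 < d" by (rule d)
    fix ys assume len: "length ys = n" and W: "set ys \<subseteq> W"
      and close: "\<forall>i<n. nrm (\<lambda>t. (ys ! i) t - (xs ! i) t) < d"
    define H where "H i = take i ys @ drop i xs" for i
    have H: "length (H i) = n" "set (H i) \<subseteq> W" if "i \<le> n" for i
      using len xs W that set_take_subset[of i ys] set_drop_subset[of i xs] by (auto simp: H_def)
    have Hnth: "H i ! j = (if j < i then ys ! j else xs ! j)" if "i \<le> n" "j < n" for i j
      using that len xs by (auto simp: H_def nth_append)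
    have yW: "ys ! i \<in> W" "xs ! i \<in> W" if "i < n" for i
      using that len xs W by (metis nth_mem subsetD)+
    have nH: "nrm (H i ! j) \<le> R" if "i \<le> n" "j < n" for i j
    proof (cases "j < i")
      case True
      have "nrm (ys ! j) \<le> nrm (xs ! j) + nrm (\<lambda>t. (ys ! j) t - (xs ! j) t)"
        by (rule tri) (use yW that in auto)
      also have "\<dots> \<le> R" using close d R[of j] that by force
      finally show ?thesis using Hnth[OF that] True by simp
    next
      case False
      then show ?thesis using Hnth[OF that] R[of j] that by simp
    qed
    have step: "\<bar>T (H (Suc i)) - T (H i)\<bar> \<le> A * (d * R ^ (n - 1))" if i: "i < n" for i
    proof -
      let ?z = "\<lambda>t. (ys ! i) t - (xs ! i) t"
      have "H (Suc i) = (H i)[i := ys ! i]"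
        by (rule nth_equalityI) (use i H[of "Suc i"] H[of i] Hnth in \<open>auto simp: nth_list_update less_Suc_eq\<close>)
      moreover have "H i = (H i)[i := xs ! i]"
        by (rule nth_equalityI) (use i H[of i] Hnth in \<open>auto simp: nth_list_update\<close>)
      moreover have "T ((H i)[i := (\<lambda>t. 1 * (ys ! i) t + (- 1) * (xs ! i) t)])
          = 1 * T ((H i)[i := ys ! i]) + (- 1) * T ((H i)[i := xs ! i])"
        by (rule T[unfolded multilinear_on_def, rule_format, OF H(1)[OF less_imp_le[OF i]] H(2)[OF less_imp_le[OF i]] i yW[OF i]])
      ultimately have eq: "T (H (Suc i)) - T (H i) = T ((H i)[i := ?z])"
        by (simp add: minus_mult_left[symmetric])
      let ?G = "(H i)[i := ?z]"
      have G: "length ?G = n" "set ?G \<subseteq> W"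
        using H[of i] i set_update_subset_insert[of "H i" i ?z] diff[OF yW(2)[OF i] yW(1)[OF i]] by auto
      have "prod_list (map nrm ?G) = (\<Prod>j<n. nrm (?G ! j))"
        using G(1) by (simp add: prod.list_conv_set_nth atLeast0LessThan)
      also have "\<dots> = nrm (?G ! i) * (\<Prod>j\<in>{..<n} - {i}. nrm (?G ! j))"
        using i by (subst prod.remove[of _ i]) auto
      also have "\<dots> \<le> d * (\<Prod>j\<in>{..<n} - {i}. R)"
      proof (intro mult_mono prod_mono)
        show "nrm (?G ! i) \<le> d" using close i H[of i] by (simp add: less_imp_le)
        fix j assume "j \<in> {..<n} - {i}"
        then show "0 \<le> nrm (?G ! j) \<and> nrm (?G ! j) \<le> R" using nrm0 nH[of i j] i by auto
      qed (use d nrm0 in \<open>auto intro: prod_nonneg\<close>)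
      also have "\<dots> = d * R ^ (n - 1)" using i by simp
      finally have "A * prod_list (map nrm ?G) \<le> A * (d * R ^ (n - 1))" using A by (rule mult_left_mono)
      then show ?thesis unfolding eq using bnd[OF G] by simp
    qed
    have "T ys - T xs = (\<Sum>i<n. T (H (Suc i)) - T (H i))"
      using len xs by (subst sum_lessThan_telescope) (simp add: H_def)
    also have "\<bar>\<dots>\<bar> \<le> (\<Sum>i<n. A * (d * R ^ (n - 1)))"
      by (intro order_trans[OF sum_abs] sum_mono step) auto
    also have "\<dots> = d * (A * R ^ (n - 1) * n)" by simp
    also have "\<dots> < d * (A * R ^ (n - 1) * n + 1)" using d by simp
    also have "\<dots> \<le> e / (A * R ^ (n - 1) * n + 1) * (A * R ^ (n - 1) * n + 1)"
      using den by (intro mult_right_mono) (auto simp: d_def)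
    also have "\<dots> = e" using den by simp
    finally show "\<bar>T ys - T xs\<bar> < e" .
  qed
qed

text \<open>Two norms occur because the estimates are made for \<open>nrm\<close>, later the L^1
  norm, on the large space \<open>W\<close>, while continuity is required for the stronger
  \<open>N\<close>, later the L^p norm, on \<open>V\<close>.\<close>

lemma cont_sym_multilinear_symmetrize:
  assumes T: "multilinear_on W n T"
    and bnd: "\<And>xs. length xs = n \<Longrightarrow> set xs \<subseteq> W \<Longrightarrow> \<bar>T xs\<bar> \<le> A * prod_list (map nrm xs)"
    and A: "0 \<le> A" and nrm0: "\<And>x. 0 \<le> nrm x"
    and tri: "\<And>x y. x \<in> W \<Longrightarrow> y \<in> W \<Longrightarrow> nrm y \<le> nrm x + nrm (\<lambda>t. y t - x t)"
    and diff: "\<And>x y. x \<in> W \<Longrightarrow> y \<in> W \<Longrightarrow> (\<lambda>t. y t - x t) \<in> W"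
    and V: "V \<subseteq> W" "\<And>x y. x \<in> V \<Longrightarrow> y \<in> V \<Longrightarrow> nrm (\<lambda>t. y t - x t) \<le> N (\<lambda>t. y t - x t)"
  shows "cont_sym_multilinear V N n (symmetrize n T)"
  unfolding cont_sym_multilinear_def
proof (intro ballI conjI allI impI)
  fix xs assume "xs \<in> {xs. length xs = n \<and> set xs \<subseteq> V}"
  then have xs: "length xs = n" "set xs \<subseteq> V" "set xs \<subseteq> W" using V by auto
  note ml = multilinear_on_symmetrize[OF T]
  show "symmetrize n T (xs[i := (\<lambda>t. a * x t + b * y t)])
      = a * symmetrize n T (xs[i := x]) + b * symmetrize n T (xs[i := y])"
    if "i < n" "x \<in> V" "y \<in> V" for i x y a b
    using ml xs that V unfolding multilinear_on_def by blast
  show "symmetrize n T ys = symmetrize n T xs" if "mset ys = mset xs" for ys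
    by (rule symmetrize_cong_mset[OF xs(1) that])
  fix e :: real assume e: "0 < e"
  obtain d where d: "0 < d" "\<And>ys. length ys = n \<Longrightarrow> set ys \<subseteq> W \<Longrightarrow>
      (\<forall>i<n. nrm (\<lambda>t. (ys ! i) t - (xs ! i) t) < d) \<Longrightarrow> \<bar>symmetrize n T ys - symmetrize n T xs\<bar> < e"
    using multilinear_bounded_continuous[OF ml abs_symmetrize_le[of n W T A nrm, OF bnd] A nrm0 tri diff xs(1,3) e]
    by blast
  show "\<exists>d>0. \<forall>ys\<in>{ys. length ys = n \<and> set ys \<subseteq> V}.
      (\<forall>i<n. N (\<lambda>t. (ys ! i) t - (xs ! i) t) < d) \<longrightarrow> \<bar>symmetrize n T ys - symmetrize n T xs\<bar> < e"
  proof (intro exI conjI ballI impI)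
    show "0 < d" by (rule d)
    fix ys assume ys: "ys \<in> {ys. length ys = n \<and> set ys \<subseteq> V}"
      and close: "\<forall>i<n. N (\<lambda>t. (ys ! i) t - (xs ! i) t) < d"
    have "nrm (\<lambda>t. (ys ! i) t - (xs ! i) t) < d" if "i < n" for i
    proof -
      have "ys ! i \<in> V" "xs ! i \<in> V" using that ys xs by (auto intro: subsetD[OF _ nth_mem])
      with V(2)[of "xs ! i" "ys ! i"] close that show ?thesis by fastforce
    qed
    then show "\<bar>symmetrize n T ys - symmetrize n T xs\<bar> < e"
      using d(2)[of ys] ys V by blast
  qed
qed

lemma geometric_steps_limit:
  fixes a :: "nat \<Rightarrow> real"
  assumes "\<And>n. \<bar>a (Suc n) - a n\<bar> \<le> A * q ^ n" and q: "0 \<le> q" "q < 1"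
  obtains l where "a \<longlonglongrightarrow> l" "\<And>n. \<bar>a n - l\<bar> \<le> A / (1 - q) * q ^ n"
proof -
  define d where "d n = a (Suc n) - a n" for n
  have sg: "summable (\<lambda>n. A * q ^ n)" using q by (intro summable_mult summable_geometric) simp
  then have sd: "summable d"
    by (rule summable_comparison_test'[where N = 0]) (use assms in \<open>simp add: d_def\<close>)
  define l where "l = a 0 + (\<Sum>n. d n)"
  have an: "a n = a 0 + (\<Sum>k<n. d k)" for n
    unfolding d_def by (subst sum_lessThan_telescope) simp
  have "(\<lambda>n. a 0 + (\<Sum>k<n. d k)) \<longlonglongrightarrow> l"
    unfolding l_def by (intro tendsto_add tendsto_const summable_LIMSEQ[OF sd])
  then have "a \<longlonglongrightarrow> l" unfolding an[symmetric] .
  moreover have "\<bar>a n - l\<bar> \<le> A / (1 - q) * q ^ n" for n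
  proof -
    have "l - a n = (\<Sum>k. d (k + n))"
      unfolding l_def an[of n] using suminf_minus_initial_segment[OF sd, of n] by simp
    also have "\<bar>\<dots>\<bar> \<le> (\<Sum>k. A * q ^ (k + n))"
    proof -
      have s2: "summable (\<lambda>k. A * q ^ (k + n))" using sg by (subst summable_iff_shift)
      have s1: "summable (\<lambda>k. \<bar>d (k + n)\<bar>)"
        by (rule summable_comparison_test'[OF s2, where N = 0]) (use assms in \<open>simp add: d_def\<close>)
      have "\<bar>\<Sum>k. d (k + n)\<bar> \<le> (\<Sum>k. \<bar>d (k + n)\<bar>)" by (rule summable_rabs[OF s1])
      also have "\<dots> \<le> (\<Sum>k. A * q ^ (k + n))"
        by (rule suminf_le[OF _ s1 s2]) (use assms in \<open>simp add: d_def\<close>)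
      finally show ?thesis .
    qed
    also have "\<dots> = A * q ^ n * (\<Sum>k. q ^ k)"
      using q by (subst suminf_mult[symmetric]) (auto simp: power_add mult_ac summable_geometric)
    also have "\<dots> = A / (1 - q) * q ^ n" using q by (simp add: suminf_geometric)
    finally show ?thesis by (simp add: abs_minus_commute)
  qed
  ultimately show ?thesis using that by blast
qed

section \<open>The transfer operator, its invariant functional and its resolvent\<close>

text \<open>\<open>c\<close> gauges oscillations and takes the place of a power of a distance. It
  contracts by \<theta> only in the mean over \<open>M\<close>; pointwise it may grow by
  \<open>B\<close>, which is what a signed perturbation of the density sees. \<open>lip_meas\<close>
  isolates the one fact that would need a topology on \<open>X\<close>.\<close>

locale contracting_cocycle = prob_space M for M :: "'a measure" +
  fixes X :: "'x set" and x0 :: 'x and act :: "'a \<Rightarrow> 'x \<Rightarrow> 'x" and c :: "'x \<Rightarrow> 'x \<Rightarrow> real"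
    and \<sigma> :: "'a \<Rightarrow> 'x \<Rightarrow> real" and \<theta> B D L :: real
  assumes x0: "x0 \<in> X"
    and act_in: "g \<in> space M \<Longrightarrow> x \<in> X \<Longrightarrow> act g x \<in> X"
    and c_nonneg: "x \<in> X \<Longrightarrow> y \<in> X \<Longrightarrow> 0 \<le> c x y"
    and c_le: "x \<in> X \<Longrightarrow> y \<in> X \<Longrightarrow> c x y \<le> D"
    and c_act: "g \<in> space M \<Longrightarrow> x \<in> X \<Longrightarrow> y \<in> X \<Longrightarrow> c (act g x) (act g y) \<le> B * c x y"
    and c_meas: "x \<in> X \<Longrightarrow> y \<in> X \<Longrightarrow> (\<lambda>g. c (act g x) (act g y)) \<in> borel_measurable M"
    and contraction: "x \<in> X \<Longrightarrow> y \<in> X \<Longrightarrow> (\<integral>g. c (act g x) (act g y) \<partial>M) \<le> \<theta> * c x y"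
    and \<theta>: "0 \<le> \<theta>" "\<theta> < 1" and B: "0 \<le> B" and D: "0 \<le> D" and L: "0 \<le> L"
    and lip_meas: "(\<And>x y. x \<in> X \<Longrightarrow> y \<in> X \<Longrightarrow> \<bar>\<phi> x - \<phi> y\<bar> \<le> K * c x y) \<Longrightarrow> x \<in> X \<Longrightarrow>
      (\<lambda>g. \<phi> (act g x)) \<in> borel_measurable M"
    and \<sigma>_meas: "x \<in> X \<Longrightarrow> (\<lambda>g. \<sigma> g x) \<in> borel_measurable M"
    and \<sigma>_bnd: "g \<in> space M \<Longrightarrow> x \<in> X \<Longrightarrow> \<bar>\<sigma> g x\<bar> \<le> L"
    and \<sigma>_lip: "g \<in> space M \<Longrightarrow> x \<in> X \<Longrightarrow> y \<in> X \<Longrightarrow> \<bar>\<sigma> g x - \<sigma> g y\<bar> \<le> L * c x y"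
begin

text \<open>The constant of a seminorm that vanishes on constants: contraction is possible only
  modulo constants, which the operator fixes.\<close>

definition lip :: "real \<Rightarrow> ('x \<Rightarrow> real) \<Rightarrow> bool" where
  "lip K \<phi> \<longleftrightarrow> 0 \<le> K \<and> (\<forall>x\<in>X. \<forall>y\<in>X. \<bar>\<phi> x - \<phi> y\<bar> \<le> K * c x y)"

definition L1 :: "('a \<Rightarrow> real) \<Rightarrow> real" where
  "L1 f = (\<integral>g. \<bar>f g\<bar> \<partial>M)"

definition T :: "('a \<Rightarrow> real) \<Rightarrow> ('x \<Rightarrow> real) \<Rightarrow> 'x \<Rightarrow> real" where
  "T f \<phi> x = (\<integral>g. \<phi> (act g x) * f g \<partial>M)"

definition \<psi> :: "('a \<Rightarrow> real) \<Rightarrow> 'x \<Rightarrow> real" where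
  "\<psi> f x = (\<integral>g. \<sigma> g x * f g \<partial>M)"

lemma lipD: "lip K \<phi> \<Longrightarrow> x \<in> X \<Longrightarrow> y \<in> X \<Longrightarrow> \<bar>\<phi> x - \<phi> y\<bar> \<le> K * c x y"
  by (simp add: lip_def)

lemma lip_nonneg: "lip K \<phi> \<Longrightarrow> 0 \<le> K" by (simp add: lip_def)

lemma lip_osc: "lip K \<phi> \<Longrightarrow> x \<in> X \<Longrightarrow> y \<in> X \<Longrightarrow> \<bar>\<phi> x - \<phi> y\<bar> \<le> K * D"
  by (rule order_trans[OF lipD mult_left_mono[OF c_le lip_nonneg]])

lemma lip_mono: "lip K \<phi> \<Longrightarrow> K \<le> K' \<Longrightarrow> lip K' \<phi>"
  unfolding lip_def by (meson c_nonneg mult_right_mono order_trans)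

lemma lip_const: "lip 0 (\<lambda>x. k)" by (simp add: lip_def)

lemma lip_add:
  assumes "lip K \<phi>" "lip K' \<phi>'"
  shows "lip (K + K') (\<lambda>x. \<phi> x + \<phi>' x)"
  unfolding lip_def
proof (intro conjI ballI)
  show "0 \<le> K + K'" using lip_nonneg[OF assms(1)] lip_nonneg[OF assms(2)] by simp
  fix x y assume xy: "x \<in> X" "y \<in> X"
  show "\<bar>\<phi> x + \<phi>' x - (\<phi> y + \<phi>' y)\<bar> \<le> (K + K') * c x y"
    using lipD[OF assms(1) xy] lipD[OF assms(2) xy] by (simp add: distrib_right)
qed

lemma lip_scale:
  assumes "lip K \<phi>"
  shows "lip (\<bar>a\<bar> * K) (\<lambda>x. a * \<phi> x)"
  unfolding lip_def
proof (intro conjI ballI)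
  show "0 \<le> \<bar>a\<bar> * K" using assms lip_nonneg by simp
  fix x y assume xy: "x \<in> X" "y \<in> X"
  have "\<bar>a * \<phi> x - a * \<phi> y\<bar> = \<bar>a\<bar> * \<bar>\<phi> x - \<phi> y\<bar>"
    by (simp add: abs_mult[symmetric] algebra_simps)
  also have "\<dots> \<le> \<bar>a\<bar> * (K * c x y)" using lipD[OF assms xy] by (rule mult_left_mono) simp
  finally show "\<bar>a * \<phi> x - a * \<phi> y\<bar> \<le> \<bar>a\<bar> * K * c x y" by (simp add: mult.assoc)
qed

lemma lip_sum:
  assumes "\<And>i. i \<in> I \<Longrightarrow> lip (K i) (\<phi> i)" "finite I"
  shows "lip (\<Sum>i\<in>I. K i) (\<lambda>x. \<Sum>i\<in>I. \<phi> i x)"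
  using assms(2,1) by (induction I rule: finite_induct) (auto simp: lip_const intro: lip_add)

lemma integrable_product_bounded:
  fixes u :: "'a \<Rightarrow> real"
  assumes [measurable]: "u \<in> borel_measurable M" and f: "integrable M f"
    and "\<And>g. g \<in> space M \<Longrightarrow> \<bar>u g\<bar> \<le> C"
  shows "integrable M (\<lambda>g. u g * f g)" and "\<bar>\<integral>g. u g * f g \<partial>M\<bar> \<le> C * L1 f"
proof -
  have fm[measurable]: "f \<in> borel_measurable M" using f by simp
  have b: "\<bar>u g * f g\<bar> \<le> C * \<bar>f g\<bar>" if "g \<in> space M" for g
    unfolding abs_mult using assms(3)[OF that] by (rule mult_right_mono) simp
  show i: "integrable M (\<lambda>g. u g * f g)"
  proof (rule Bochner_Integration.integrable_bound)
    show "integrable M (\<lambda>g. C * \<bar>f g\<bar>)" using f by simp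
    show "AE g in M. norm (u g * f g) \<le> norm (C * \<bar>f g\<bar>)"
      using b by (intro AE_I2) (fastforce intro: order_trans)
  qed simp
  have "\<bar>\<integral>g. u g * f g \<partial>M\<bar> \<le> (\<integral>g. \<bar>u g * f g\<bar> \<partial>M)" by (rule integral_abs_bound)
  also have "\<dots> \<le> (\<integral>g. C * \<bar>f g\<bar> \<partial>M)"
    by (rule integral_mono) (use i f b in auto)
  finally show "\<bar>\<integral>g. u g * f g \<partial>M\<bar> \<le> C * L1 f" by (simp add: L1_def)
qed

lemma lip_measurable: "lip K \<phi> \<Longrightarrow> x \<in> X \<Longrightarrow> (\<lambda>g. \<phi> (act g x)) \<in> borel_measurable M"
  by (rule lip_meas[of \<phi> K]) (auto simp: lip_def)

lemma T_integrable:
  assumes "lip K \<phi>" "integrable M f" "x \<in> X"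
  shows "integrable M (\<lambda>g. \<phi> (act g x) * f g)"
proof (rule integrable_product_bounded(1)[OF lip_measurable[OF assms(1,3)] assms(2)])
  fix g assume "g \<in> space M"
  then have "\<bar>\<phi> (act g x) - \<phi> x0\<bar> \<le> K * D"
    using assms x0 act_in by (intro lip_osc) auto
  then show "\<bar>\<phi> (act g x)\<bar> \<le> \<bar>\<phi> x0\<bar> + K * D" by linarith
qed

lemma \<psi>_integrable: "integrable M f \<Longrightarrow> x \<in> X \<Longrightarrow> integrable M (\<lambda>g. \<sigma> g x * f g)"
  using integrable_product_bounded(1)[OF \<sigma>_meas, of x f L] \<sigma>_bnd by blast

lemma \<psi>_bound: "integrable M f \<Longrightarrow> x \<in> X \<Longrightarrow> \<bar>\<psi> f x\<bar> \<le> L * L1 f"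
  unfolding \<psi>_def using integrable_product_bounded(2)[OF \<sigma>_meas, of x f L] \<sigma>_bnd by blast

lemma L1_nonneg: "0 \<le> L1 f" by (simp add: L1_def)

lemma \<psi>_lip:
  assumes "integrable M f"
  shows "lip (L * L1 f) (\<psi> f)"
  unfolding lip_def
proof (intro conjI ballI)
  fix x y assume xy: "x \<in> X" "y \<in> X"
  have "\<psi> f x - \<psi> f y = (\<integral>g. (\<sigma> g x - \<sigma> g y) * f g \<partial>M)"
    unfolding \<psi>_def using \<psi>_integrable[OF assms] xy by (simp add: left_diff_distrib)
  also have "\<bar>\<dots>\<bar> \<le> (L * c x y) * L1 f"
    using xy \<sigma>_lip \<sigma>_meas by (intro integrable_product_bounded(2) assms) auto
  finally show "\<bar>\<psi> f x - \<psi> f y\<bar> \<le> L * L1 f * c x y" by (simp add: mult_ac)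
qed (simp add: L L1_nonneg)

lemma T_diff:
  assumes "lip K \<phi>" "integrable M f" "x \<in> X" "y \<in> X"
  shows "T f \<phi> x - T f \<phi> y = (\<integral>g. (\<phi> (act g x) - \<phi> (act g y)) * f g \<partial>M)"
  unfolding T_def using T_integrable[OF assms(1,2)] assms by (simp add: left_diff_distrib)

text \<open>For an arbitrary \<open>f\<close> only the pointwise constant \<open>B\<close> is
  available. This bound is meant for the increments of the density.\<close>

lemma T_lip:
  assumes "lip K \<phi>" "integrable M f"
  shows "lip (B * L1 f * K) (T f \<phi>)"
  unfolding lip_def
proof (intro conjI ballI)
  fix x y assume xy: "x \<in> X" "y \<in> X"
  have "\<bar>\<phi> (act g x) - \<phi> (act g y)\<bar> \<le> K * (B * c x y)" if "g \<in> space M" for g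
    using lipD[OF assms(1) act_in[OF that xy(1)] act_in[OF that xy(2)]]
      mult_left_mono[OF c_act[OF that xy] lip_nonneg[OF assms(1)]] by simp
  then have "\<bar>\<integral>g. (\<phi> (act g x) - \<phi> (act g y)) * f g \<partial>M\<bar> \<le> K * (B * c x y) * L1 f"
    using xy lip_measurable[OF assms(1)] by (intro integrable_product_bounded(2) assms) auto
  then show "\<bar>T f \<phi> x - T f \<phi> y\<bar> \<le> B * L1 f * K * c x y"
    unfolding T_diff[OF assms xy] by (simp add: mult_ac)
qed (use B L1_nonneg lip_nonneg[OF assms(1)] in auto)

text \<open>Write f = 1 + (f - 1). The density 1 contracts by \<theta> in the mean; the signed
  remainder is controlled pointwise by \<open>B\<close> and paid for in the L^1 norm.\<close>

lemma T_lip_contract: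
  assumes "lip K \<phi>" "integrable M f"
  shows "lip ((\<theta> + B * L1 (\<lambda>g. f g - 1)) * K) (T f \<phi>)"
  unfolding lip_def
proof (intro conjI ballI)
  note K = lip_nonneg[OF assms(1)]
  fix x y assume xy: "x \<in> X" "y \<in> X"
  let ?u = "\<lambda>g. \<phi> (act g x) - \<phi> (act g y)"
  have um[measurable]: "?u \<in> borel_measurable M" "(\<lambda>g. c (act g x) (act g y)) \<in> borel_measurable M"
    using xy lip_measurable[OF assms(1)] c_meas by auto
  have b: "\<bar>?u g\<bar> \<le> K * c (act g x) (act g y)" "c (act g x) (act g y) \<le> B * c x y"
    "0 \<le> c (act g x) (act g y)" if "g \<in> space M" for g
    using lipD[OF assms(1) act_in[OF that xy(1)] act_in[OF that xy(2)]] c_act[OF that xy]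
      c_nonneg act_in that xy by auto
  have b2: "\<bar>?u g\<bar> \<le> K * (B * c x y)" if "g \<in> space M" for g
    using b[OF that] mult_left_mono[OF b(2)[OF that] K] by simp
  have f1: "integrable M (\<lambda>g. f g - 1)" using assms(2) by simp
  have u1: "integrable M ?u"
    using integrable_product_bounded(1)[OF um(1) _ b2, of "\<lambda>_. 1"] by simp
  have uf: "integrable M (\<lambda>g. ?u g * (f g - 1))"
    using integrable_product_bounded(1)[OF um(1) f1 b2] .
  have ic: "integrable M (\<lambda>g. c (act g x) (act g y))"
    by (rule integrable_const_bound[of _ "B * c x y"]) (use b in auto)
  have "T f \<phi> x - T f \<phi> y = (\<integral>g. ?u g + ?u g * (f g - 1) \<partial>M)"
    unfolding T_diff[OF assms xy] by (simp add: algebra_simps)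
  also have "\<dots> = (\<integral>g. ?u g \<partial>M) + (\<integral>g. ?u g * (f g - 1) \<partial>M)"
    by (rule Bochner_Integration.integral_add[OF u1 uf])
  also have "\<bar>\<dots>\<bar> \<le> \<bar>\<integral>g. ?u g \<partial>M\<bar> + \<bar>\<integral>g. ?u g * (f g - 1) \<partial>M\<bar>" by simp
  also have "\<bar>\<integral>g. ?u g * (f g - 1) \<partial>M\<bar> \<le> K * (B * c x y) * L1 (\<lambda>g. f g - 1)"
    by (rule integrable_product_bounded(2)[OF um(1) f1 b2])
  also have "\<bar>\<integral>g. ?u g \<partial>M\<bar> \<le> (\<integral>g. \<bar>?u g\<bar> \<partial>M)" by (rule integral_abs_bound)
  also have "\<dots> \<le> (\<integral>g. K * c (act g x) (act g y) \<partial>M)"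
    by (rule integral_mono) (use u1 ic b in auto)
  also have "\<dots> \<le> K * (\<theta> * c x y)"
    using mult_left_mono[OF contraction[OF xy] K] by simp
  finally show "\<bar>T f \<phi> x - T f \<phi> y\<bar> \<le> (\<theta> + B * L1 (\<lambda>g. f g - 1)) * K * c x y"
    by (simp add: algebra_simps)
qed (use \<theta> B L1_nonneg lip_nonneg[OF assms(1)] in auto)

lemma T_cong: "(\<And>x. x \<in> X \<Longrightarrow> \<phi> x = \<phi>' x) \<Longrightarrow> x \<in> X \<Longrightarrow> T f \<phi> x = T f \<phi>' x"
  unfolding T_def by (rule Bochner_Integration.integral_cong) (auto simp: act_in)

lemma T_linear:
  assumes "lip K \<phi>" "lip K' \<phi>'" "integrable M f" "x \<in> X"
  shows "T f (\<lambda>x. a * \<phi> x + b * \<phi>' x) x = a * T f \<phi> x + b * T f \<phi>' x"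
proof -
  have "T f (\<lambda>x. a * \<phi> x + b * \<phi>' x) x = (\<integral>g. a * (\<phi> (act g x) * f g) + b * (\<phi>' (act g x) * f g) \<partial>M)"
    unfolding T_def by (simp add: algebra_simps)
  also have "\<dots> = a * T f \<phi> x + b * T f \<phi>' x"
    unfolding T_def using T_integrable assms by (subst Bochner_Integration.integral_add) auto
  finally show ?thesis .
qed

lemma T_linear_density:
  assumes "lip K \<phi>" "integrable M f" "integrable M h" "x \<in> X"
  shows "T (\<lambda>g. a * f g + b * h g) \<phi> x = a * T f \<phi> x + b * T h \<phi> x"
proof -
  have "T (\<lambda>g. a * f g + b * h g) \<phi> x = (\<integral>g. a * (\<phi> (act g x) * f g) + b * (\<phi> (act g x) * h g) \<partial>M)"
    unfolding T_def by (simp add: algebra_simps)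
  also have "\<dots> = a * T f \<phi> x + b * T h \<phi> x"
    unfolding T_def using T_integrable assms by (subst Bochner_Integration.integral_add) auto
  finally show ?thesis .
qed

lemma \<psi>_linear:
  assumes "integrable M f" "integrable M h" "x \<in> X"
  shows "\<psi> (\<lambda>g. a * f g + b * h g) x = a * \<psi> f x + b * \<psi> h x"
proof -
  have "\<psi> (\<lambda>g. a * f g + b * h g) x = (\<integral>g. a * (\<sigma> g x * f g) + b * (\<sigma> g x * h g) \<partial>M)"
    unfolding \<psi>_def by (simp add: algebra_simps)
  also have "\<dots> = a * \<psi> f x + b * \<psi> h x"
    unfolding \<psi>_def using \<psi>_integrable assms by (subst Bochner_Integration.integral_add) auto
  finally show ?thesis .
qed

lemma T_sum:
  assumes "\<And>i. i \<in> I \<Longrightarrow> lip (K i) (\<phi> i)" "finite I" "integrable M f" "x \<in> X"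
  shows "T f (\<lambda>x. \<Sum>i\<in>I. \<phi> i x) x = (\<Sum>i\<in>I. T f (\<phi> i) x)"
proof -
  have "T f (\<lambda>x. \<Sum>i\<in>I. \<phi> i x) x = (\<integral>g. (\<Sum>i\<in>I. \<phi> i (act g x) * f g) \<partial>M)"
    unfolding T_def by (simp add: sum_distrib_right)
  also have "\<dots> = (\<Sum>i\<in>I. T f (\<phi> i) x)"
    unfolding T_def by (rule Bochner_Integration.integral_sum) (rule T_integrable[OF assms(1,3,4)])
  finally show ?thesis .
qed

definition q :: real where "q = (1 + \<theta>) / 2"

text \<open>The radius for which \<open>\<theta> + B * \<delta>\<close> stays below
  \<open>q\<close>, the midpoint of \<theta> and 1. The summand 1 also covers \<open>B = 0\<close>
  and gives \<delta> \<le> 1.\<close>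

definition \<delta> :: real where "\<delta> = (1 - \<theta>) / (2 * (B + 1))"

definition near :: "('a \<Rightarrow> real) \<Rightarrow> bool" where
  "near f \<longleftrightarrow> integrable M f \<and> (\<integral>g. f g \<partial>M) = 1 \<and> L1 (\<lambda>g. f g - 1) \<le> \<delta>"

lemma q: "0 \<le> q" "q < 1" using \<theta> by (auto simp: q_def)

lemma \<delta>: "0 < \<delta>" "\<delta> \<le> 1" "\<theta> + B * \<delta> \<le> q"
proof -
  show "0 < \<delta>" using \<theta> B by (simp add: \<delta>_def)
  have "(1 - \<theta>) * 1 \<le> 1 * (2 * (B + 1))" using \<theta> B by (intro mult_mono) auto
  then show "\<delta> \<le> 1" using B by (simp add: \<delta>_def divide_le_eq)
  have "B * \<delta> = (1 - \<theta>) / 2 * (B / (B + 1))" using B by (simp add: \<delta>_def)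
  also have "\<dots> \<le> (1 - \<theta>) / 2 * 1" using B \<theta> by (intro mult_left_mono) auto
  finally show "\<theta> + B * \<delta> \<le> q" by (simp add: q_def field_simps)
qed

lemma nearD: "near f \<Longrightarrow> integrable M f" "near f \<Longrightarrow> (\<integral>g. f g \<partial>M) = 1"
  by (auto simp: near_def)

lemma L1_triangle:
  assumes "integrable M f" "integrable M h"
  shows "L1 h \<le> L1 f + L1 (\<lambda>g. h g - f g)"
proof -
  have "L1 h \<le> (\<integral>g. \<bar>f g\<bar> + \<bar>h g - f g\<bar> \<partial>M)"
    unfolding L1_def by (rule integral_mono) (use assms in auto)
  then show ?thesis using assms by (simp add: L1_def)
qed

lemma near_L1: "near f \<Longrightarrow> L1 f \<le> 2"
  using L1_triangle[of "\<lambda>_. 1" f] \<delta> by (auto simp: near_def L1_def prob_space)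

lemma near_lip: "near f \<Longrightarrow> lip K \<phi> \<Longrightarrow> lip (q * K) (T f \<phi>)"
proof -
  assume f: "near f" and \<phi>: "lip K \<phi>"
  have "\<theta> + B * L1 (\<lambda>g. f g - 1) \<le> \<theta> + B * \<delta>"
    using f B by (intro add_left_mono mult_left_mono) (auto simp: near_def)
  then show ?thesis
    using \<delta> lip_nonneg[OF \<phi>]
    by (intro lip_mono[OF T_lip_contract[OF \<phi> nearD(1)[OF f]]] mult_right_mono) auto
qed

lemma T_pow_lip: "near f \<Longrightarrow> lip K \<phi> \<Longrightarrow> lip (q ^ n * K) ((T f ^^ n) \<phi>)"
proof (induction n)
  case (Suc n)
  then show ?case using near_lip[of f "q ^ n * K" "(T f ^^ n) \<phi>"] by (simp add: mult.assoc)
qed simp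

lemma T_const: "near f \<Longrightarrow> T f (\<lambda>_. k) x = k"
  by (simp add: T_def near_def)

lemma T_step:
  assumes "near f" "lip K \<phi>" "x \<in> X"
  shows "\<bar>T f \<phi> x - \<phi> x\<bar> \<le> 2 * D * K"
proof -
  have "T f \<phi> x - \<phi> x = T f \<phi> x - T f (\<lambda>_. \<phi> x) x" using T_const[OF assms(1)] by simp
  also have "\<dots> = (\<integral>g. (\<phi> (act g x) - \<phi> x) * f g \<partial>M)"
    unfolding T_def using T_integrable[OF assms(2) nearD(1)[OF assms(1)] assms(3)] nearD(1)[OF assms(1)]
    by (subst Bochner_Integration.integral_diff[symmetric]) (auto simp: left_diff_distrib)
  also have "\<bar>\<dots>\<bar> \<le> K * D * L1 f"
    using lip_measurable[OF assms(2,3)] act_in assms(3) lip_osc[OF assms(2)]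
    by (intro integrable_product_bounded(2) nearD(1)[OF assms(1)]) auto
  also have "\<dots> \<le> K * D * 2"
    using near_L1[OF assms(1)] D lip_nonneg[OF assms(2)] by (intro mult_left_mono) auto
  finally show ?thesis by (simp add: mult_ac)
qed

text \<open>For nonnegative \<open>f\<close> this is integration against the stationary measure of
  the random walk; the limit of iterates makes sense for signed \<open>f\<close> as well.\<close>

definition \<eta> :: "('a \<Rightarrow> real) \<Rightarrow> ('x \<Rightarrow> real) \<Rightarrow> real" where
  "\<eta> f \<phi> = lim (\<lambda>n. (T f ^^ n) \<phi> x0)"

definition E :: real where "E = 2 * D / (1 - q)"

lemma E_nonneg: "0 \<le> E" using D q by (simp add: E_def)

text \<open>The operator fixes constants, so one application moves a function by at most its
  oscillation. Oscillations of the iterates decay like \<open>q ^ n\<close>, hence the iterates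
  converge geometrically, and to the same limit at every point.\<close>

lemma \<eta>_approx:
  assumes "near f" "lip K \<phi>" "x \<in> X"
  shows "(\<lambda>n. (T f ^^ n) \<phi> x) \<longlonglongrightarrow> \<eta> f \<phi>" "\<bar>(T f ^^ n) \<phi> x - \<eta> f \<phi>\<bar> \<le> E * K * q ^ n"
proof -
  have steps: "\<bar>(T f ^^ Suc n) \<phi> x - (T f ^^ n) \<phi> x\<bar> \<le> 2 * D * K * q ^ n" if "x \<in> X" for x n
    using T_step[OF assms(1) T_pow_lip[OF assms(1,2), of n] that] by (simp add: mult_ac)
  obtain l where l: "(\<lambda>n. (T f ^^ n) \<phi> x) \<longlonglongrightarrow> l"
    "\<And>n. \<bar>(T f ^^ n) \<phi> x - l\<bar> \<le> 2 * D * K / (1 - q) * q ^ n"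
    using geometric_steps_limit[of "\<lambda>n. (T f ^^ n) \<phi> x", OF steps[OF assms(3)] q] by metis
  obtain l0 where l0: "(\<lambda>n. (T f ^^ n) \<phi> x0) \<longlonglongrightarrow> l0"
    using geometric_steps_limit[of "\<lambda>n. (T f ^^ n) \<phi> x0", OF steps[OF x0] q] by metis
  have "(\<lambda>n. (T f ^^ n) \<phi> x - (T f ^^ n) \<phi> x0) \<longlonglongrightarrow> 0"
  proof (rule Lim_null_comparison)
    show "eventually (\<lambda>n. norm ((T f ^^ n) \<phi> x - (T f ^^ n) \<phi> x0) \<le> q ^ n * K * D) sequentially"
      using lip_osc[OF T_pow_lip[OF assms(1,2)] assms(3) x0] by simp
    have "(\<lambda>n. q ^ n) \<longlonglongrightarrow> 0" using q by (intro LIMSEQ_realpow_zero) auto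
    then show "(\<lambda>n. q ^ n * K * D) \<longlonglongrightarrow> 0"
      by (auto intro!: tendsto_mult_left_zero)
  qed
  with tendsto_diff[OF l(1) l0] have "l - l0 = 0" by (rule LIMSEQ_unique)
  moreover have "\<eta> f \<phi> = l0" unfolding \<eta>_def using l0 by (rule limI)
  ultimately show "(\<lambda>n. (T f ^^ n) \<phi> x) \<longlonglongrightarrow> \<eta> f \<phi>" "\<bar>(T f ^^ n) \<phi> x - \<eta> f \<phi>\<bar> \<le> E * K * q ^ n"
    using l(1) l(2)[of n] by (simp_all add: E_def)
qed

lemma \<eta>_bound: "near f \<Longrightarrow> lip K \<phi> \<Longrightarrow> \<bar>\<eta> f \<phi>\<bar> \<le> \<bar>\<phi> x0\<bar> + E * K"
  using \<eta>_approx(2)[of f K \<phi> x0 0] x0 by simp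

lemma T_pow_cong: "(\<And>x. x \<in> X \<Longrightarrow> \<phi> x = \<phi>' x) \<Longrightarrow> x \<in> X \<Longrightarrow> (T f ^^ n) \<phi> x = (T f ^^ n) \<phi>' x"
  by (induction n arbitrary: x) (auto intro: T_cong)

lemma \<eta>_cong: "(\<And>x. x \<in> X \<Longrightarrow> \<phi> x = \<phi>' x) \<Longrightarrow> \<eta> f \<phi> = \<eta> f \<phi>'"
  unfolding \<eta>_def using T_pow_cong[of \<phi> \<phi>' x0, where f = f] x0 by simp

lemma T_pow_linear:
  assumes "near f" "lip K \<phi>" "lip K' \<phi>'" "x \<in> X"
  shows "(T f ^^ n) (\<lambda>x. a * \<phi> x + b * \<phi>' x) x = a * (T f ^^ n) \<phi> x + b * (T f ^^ n) \<phi>' x"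
  using assms(4)
proof (induction n arbitrary: x)
  case (Suc n)
  have "(T f ^^ Suc n) (\<lambda>x. a * \<phi> x + b * \<phi>' x) x = T f (\<lambda>x. a * (T f ^^ n) \<phi> x + b * (T f ^^ n) \<phi>' x) x"
    using T_cong[OF Suc.IH Suc.prems] by simp
  also have "\<dots> = a * (T f ^^ Suc n) \<phi> x + b * (T f ^^ Suc n) \<phi>' x"
    using T_linear[OF T_pow_lip[OF assms(1,2), of n] T_pow_lip[OF assms(1,3), of n] nearD(1)[OF assms(1)] Suc.prems]
    by simp
  finally show ?case .
qed simp

lemma \<eta>_linear:
  assumes "near f" "lip K \<phi>" "lip K' \<phi>'"
  shows "\<eta> f (\<lambda>x. a * \<phi> x + b * \<phi>' x) = a * \<eta> f \<phi> + b * \<eta> f \<phi>'"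
proof -
  have "(\<lambda>n. (T f ^^ n) (\<lambda>x. a * \<phi> x + b * \<phi>' x) x0) \<longlonglongrightarrow> a * \<eta> f \<phi> + b * \<eta> f \<phi>'"
    unfolding T_pow_linear[OF assms x0]
    by (intro tendsto_intros \<eta>_approx(1)[OF assms(1,2) x0] \<eta>_approx(1)[OF assms(1,3) x0])
  then show ?thesis unfolding \<eta>_def[of f "\<lambda>x. a * \<phi> x + b * \<phi>' x"] by (rule limI)
qed

lemma \<eta>_const:
  assumes "near f"
  shows "\<eta> f (\<lambda>_. k) = k"
proof -
  have "(T f ^^ n) (\<lambda>_. k) = (\<lambda>_. k)" for n
    by (induction n) (auto simp: T_const[OF assms])
  then show ?thesis by (simp add: \<eta>_def)
qed

lemma \<eta>_T:
  assumes "near f" "lip K \<phi>"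
  shows "\<eta> f (T f \<phi>) = \<eta> f \<phi>"
proof -
  have "(\<lambda>n. (T f ^^ n) (T f \<phi>) x0) \<longlonglongrightarrow> \<eta> f \<phi>"
    using LIMSEQ_Suc[OF \<eta>_approx(1)[OF assms x0]] by (simp add: funpow_Suc_right del: funpow.simps)
  then show ?thesis unfolding \<eta>_def[of f "T f \<phi>"] by (rule limI)
qed

text \<open>The Neumann series of the inverse of \<open>1 - T f\<close>, with the invariant part
  removed to make it converge.\<close>

definition R :: "('a \<Rightarrow> real) \<Rightarrow> ('x \<Rightarrow> real) \<Rightarrow> 'x \<Rightarrow> real" where
  "R f \<phi> x = (\<Sum>n. (T f ^^ n) \<phi> x - \<eta> f \<phi>)"

lemma R_summable:
  assumes "near f" "lip K \<phi>" "x \<in> X"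
  shows "summable (\<lambda>n. (T f ^^ n) \<phi> x - \<eta> f \<phi>)"
proof (rule summable_comparison_test'[where N = 0])
  show "summable (\<lambda>n. E * K * q ^ n)" using q by (intro summable_mult summable_geometric) simp
qed (use \<eta>_approx(2)[OF assms] in simp)

lemma R_cong: "(\<And>x. x \<in> X \<Longrightarrow> \<phi> x = \<phi>' x) \<Longrightarrow> x \<in> X \<Longrightarrow> R f \<phi> x = R f \<phi>' x"
  unfolding R_def using T_pow_cong[of \<phi> \<phi>' x, where f = f] \<eta>_cong[of \<phi> \<phi>', where f = f] by simp

lemma R_lip:
  assumes "near f" "lip K \<phi>"
  shows "lip (K / (1 - q)) (R f \<phi>)"
  unfolding lip_def
proof (intro conjI ballI)
  fix x y assume xy: "x \<in> X" "y \<in> X"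
  have sg: "summable (\<lambda>n. q ^ n * K * c x y)"
    using q by (intro summable_mult2 summable_geometric) simp
  have b: "\<bar>(T f ^^ n) \<phi> x - (T f ^^ n) \<phi> y\<bar> \<le> q ^ n * K * c x y" for n
    by (rule lipD[OF T_pow_lip[OF assms] xy])
  have sa: "summable (\<lambda>n. \<bar>(T f ^^ n) \<phi> x - (T f ^^ n) \<phi> y\<bar>)"
    by (rule summable_comparison_test'[OF sg, where N = 0]) (use b in simp)
  have "R f \<phi> x - R f \<phi> y = (\<Sum>n. (T f ^^ n) \<phi> x - (T f ^^ n) \<phi> y)"
    unfolding R_def using suminf_diff[OF R_summable[OF assms xy(1)] R_summable[OF assms xy(2)]] by simp
  also have "\<bar>\<dots>\<bar> \<le> (\<Sum>n. \<bar>(T f ^^ n) \<phi> x - (T f ^^ n) \<phi> y\<bar>)" by (rule summable_rabs[OF sa])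
  also have "\<dots> \<le> (\<Sum>n. q ^ n * K * c x y)" by (rule suminf_le[OF b sa sg])
  also have "\<dots> = (\<Sum>n. q ^ n) * K * c x y"
    using q by (simp add: suminf_mult2[symmetric] summable_geometric summable_mult2)
  also have "\<dots> = K / (1 - q) * c x y" using q by (simp add: suminf_geometric)
  finally show "\<bar>R f \<phi> x - R f \<phi> y\<bar> \<le> K / (1 - q) * c x y" .
qed (use q lip_nonneg[OF assms(2)] in auto)

lemma R_linear:
  assumes "near f" "lip K \<phi>" "lip K' \<phi>'" "x \<in> X"
  shows "R f (\<lambda>x. a * \<phi> x + b * \<phi>' x) x = a * R f \<phi> x + b * R f \<phi>' x"
proof -
  have s: "summable (\<lambda>n. a * ((T f ^^ n) \<phi> x - \<eta> f \<phi>))" "summable (\<lambda>n. b * ((T f ^^ n) \<phi>' x - \<eta> f \<phi>'))"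
    using R_summable assms by (auto intro!: summable_mult)
  have "R f (\<lambda>x. a * \<phi> x + b * \<phi>' x) x
      = (\<Sum>n. a * ((T f ^^ n) \<phi> x - \<eta> f \<phi>) + b * ((T f ^^ n) \<phi>' x - \<eta> f \<phi>'))"
    unfolding R_def T_pow_linear[OF assms] \<eta>_linear[OF assms(1-3)] by (simp add: algebra_simps)
  also have "\<dots> = a * R f \<phi> x + b * R f \<phi>' x"
    using suminf_add[OF s] suminf_mult[OF R_summable[OF assms(1,2,4)], of a]
      suminf_mult[OF R_summable[OF assms(1,3,4)], of b] by (simp add: R_def)
  finally show ?thesis .
qed

text \<open>For partial sums the identity telescopes. They converge uniformly on \<open>X\<close>,
  so the operator, bounded by the L^1 norm of \<open>f\<close>, can be taken through the
  limit.\<close>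

lemma poisson_equation:
  assumes "near f" "lip K \<phi>" "x \<in> X"
  shows "R f \<phi> x - T f (R f \<phi>) x = \<phi> x - \<eta> f \<phi>"
proof -
  note f = nearD(1)[OF assms(1)]
  define RN where "RN N x = (\<Sum>n<N. (T f ^^ n) \<phi> x - \<eta> f \<phi>)" for N x
  have liph: "lip (q ^ n * K) (\<lambda>x. (T f ^^ n) \<phi> x - \<eta> f \<phi>)" for n
    using lip_add[OF T_pow_lip[OF assms(1,2)] lip_const, of n "- \<eta> f \<phi>"] by simp
  have lipN: "lip (\<Sum>n<N. q ^ n * K) (RN N)" for N
    unfolding RN_def[abs_def] by (rule lip_sum[OF liph]) simp
  have TN: "T f (RN N) x = (\<Sum>n<N. (T f ^^ Suc n) \<phi> x - \<eta> f \<phi>)" for N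
  proof -
    have "T f (\<lambda>x. (T f ^^ n) \<phi> x - \<eta> f \<phi>) x = (T f ^^ Suc n) \<phi> x - \<eta> f \<phi>" for n
      using T_linear[OF T_pow_lip[OF assms(1,2), of n] lip_const[of "\<eta> f \<phi>"] f assms(3), of 1 "- 1"]
        T_const[OF assms(1)] by simp
    then show ?thesis
      unfolding RN_def[abs_def] using T_sum[of "{..<N}", OF liph _ f assms(3)] by simp
  qed
  have close: "\<bar>RN N y - R f \<phi> y\<bar> \<le> E * K / (1 - q) * q ^ N" if y: "y \<in> X" for N y
  proof -
    obtain l where l: "(\<lambda>N. RN N y) \<longlonglongrightarrow> l" "\<And>N. \<bar>RN N y - l\<bar> \<le> E * K / (1 - q) * q ^ N"
      using geometric_steps_limit[of "\<lambda>N. RN N y" "E * K" q] \<eta>_approx(2)[OF assms(1,2) y] q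
      by (auto simp: RN_def)
    have "(\<lambda>N. RN N y) \<longlonglongrightarrow> R f \<phi> y"
      unfolding RN_def R_def by (rule summable_LIMSEQ[OF R_summable[OF assms(1,2) y]])
    with l(1) have "l = R f \<phi> y" by (rule LIMSEQ_unique)
    with l(2) show ?thesis by simp
  qed
  have "(\<lambda>N. T f (RN N) x) \<longlonglongrightarrow> T f (R f \<phi>) x"
  proof (rule LIM_zero_cancel, rule Lim_null_comparison)
    have "norm (T f (RN N) x - T f (R f \<phi>) x) \<le> E * K / (1 - q) * q ^ N * L1 f" for N
    proof -
      have "T f (RN N) x - T f (R f \<phi>) x = (\<integral>g. (RN N (act g x) - R f \<phi> (act g x)) * f g \<partial>M)"
        unfolding T_def using T_integrable[OF lipN f assms(3)] T_integrable[OF R_lip[OF assms(1,2)] f assms(3)]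
        by (simp add: left_diff_distrib)
      also have "\<bar>\<dots>\<bar> \<le> E * K / (1 - q) * q ^ N * L1 f"
        using lip_measurable[OF lipN assms(3)] lip_measurable[OF R_lip[OF assms(1,2)] assms(3)]
          close act_in assms(3) by (intro integrable_product_bounded(2) f) auto
      finally show ?thesis by simp
    qed
    then show "eventually (\<lambda>N. norm (T f (RN N) x - T f (R f \<phi>) x) \<le> E * K / (1 - q) * q ^ N * L1 f) sequentially"
      by simp
    have "(\<lambda>n. q ^ n) \<longlonglongrightarrow> 0" using q by (intro LIMSEQ_realpow_zero) auto
    then show "(\<lambda>N. E * K / (1 - q) * q ^ N * L1 f) \<longlonglongrightarrow> 0"
      by (intro tendsto_mult_left_zero tendsto_mult_right_zero)
  qed
  moreover have "(\<lambda>N. T f (RN N) x) \<longlonglongrightarrow> R f \<phi> x - (\<phi> x - \<eta> f \<phi>)"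
  proof -
    have "T f (RN N) x = RN (Suc N) x - (\<phi> x - \<eta> f \<phi>)" for N
      unfolding TN RN_def sum.lessThan_Suc_shift by simp
    moreover have "(\<lambda>N. RN (Suc N) x) \<longlonglongrightarrow> R f \<phi> x"
      unfolding RN_def R_def by (rule LIMSEQ_Suc[OF summable_LIMSEQ[OF R_summable[OF assms]]])
    ultimately show ?thesis by (simp add: tendsto_diff)
  qed
  ultimately have "T f (R f \<phi>) x = R f \<phi> x - (\<phi> x - \<eta> f \<phi>)" by (rule LIMSEQ_unique)
  then show ?thesis by simp
qed

text \<open>\<open>\<eta> a (Z a [h, \<dots>, h])\<close> is the homogeneous part of degree \<open>n\<close> of \<open>F (a + h)\<close>.\<close>

fun Z :: "('a \<Rightarrow> real) \<Rightarrow> ('a \<Rightarrow> real) list \<Rightarrow> 'x \<Rightarrow> real" where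
  "Z a [] = \<psi> a"
| "Z a (h # hs) = (\<lambda>x. T h (R a (Z a hs)) x + (if hs = [] then \<psi> h x else 0))"

definition mean0 :: "('a \<Rightarrow> real) set" where
  "mean0 = {h. integrable M h \<and> (\<integral>g. h g \<partial>M) = 0}"

text \<open>One factor per degree that covers the growth of both the Lipschitz constant (through
  \<open>B\<close>) and the value at \<open>x0\<close> (through \<open>D\<close>); the summand 1
  pays for \<open>\<psi> h\<close> in degree one.\<close>

definition \<kappa> :: real where "\<kappa> = (B + D) / (1 - q) + 1"

lemma \<kappa>: "1 \<le> \<kappa>" "B / (1 - q) + 1 \<le> \<kappa>" "D / (1 - q) + 1 \<le> \<kappa>"
  using B D q by (auto simp: \<kappa>_def add_divide_distrib)

lemma prod_L1_nonneg: "0 \<le> prod_list (map L1 hs)"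
  by (induction hs) (auto simp: L1_nonneg)

text \<open>The value at \<open>x0\<close> is carried along because \<eta> is bounded by it together
  with the Lipschitz constant.\<close>

lemma Z_bounds:
  assumes a: "near a" and "set hs \<subseteq> mean0"
  shows "lip (2 * L * \<kappa> ^ length hs * prod_list (map L1 hs)) (Z a hs)"
    and "\<bar>Z a hs x0\<bar> \<le> 2 * L * \<kappa> ^ length hs * prod_list (map L1 hs)"
proof -
  have "lip (2 * L * \<kappa> ^ length hs * prod_list (map L1 hs)) (Z a hs) \<and>
    \<bar>Z a hs x0\<bar> \<le> 2 * L * \<kappa> ^ length hs * prod_list (map L1 hs)"
    using assms(2)
  proof (induction hs)
    case Nil
    have "L * L1 a \<le> L * 2" using near_L1[OF a] L by (rule mult_left_mono)
    then show ?case
      using lip_mono[OF \<psi>_lip[OF nearD(1)[OF a]]] \<psi>_bound[OF nearD(1)[OF a] x0] by simp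
  next
    case (Cons h hs)
    define P where "P = \<kappa> ^ length hs * prod_list (map L1 hs)"
    define l where "l = L1 h"
    have P: "0 \<le> P" "hs = [] \<Longrightarrow> P = 1" and l: "0 \<le> l"
      using \<kappa>(1) by (auto simp: P_def l_def L1_nonneg intro!: prod_L1_nonneg mult_nonneg_nonneg)
    have IH: "lip (2 * L * P) (Z a hs)" using Cons by (simp add: P_def mult.assoc)
    have h: "integrable M h" "(\<integral>g. h g \<partial>M) = 0" using Cons by (auto simp: mean0_def)
    \<comment> \<open>\<open>I\<close> marks degree one, the only degree with a term
      \<open>\<psi> h\<close>, since the observable is linear in the density.\<close>
    define I where "I = (if hs = [] then 1 else 0 :: real)"
    have I: "0 \<le> I" "I \<le> P" using P by (auto simp: I_def)
    have arith: "s / (1 - q) * (2 * L * P) * l + I * (L * l) \<le> 2 * L * (\<kappa> * P) * l"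
      if s: "s / (1 - q) + 1 \<le> \<kappa>" for s
    proof -
      have "s / (1 - q) * (2 * L * P) * l + I * (L * l) \<le> s / (1 - q) * (2 * L * P) * l + 2 * L * P * l"
        using mult_right_mono[of I "2 * P" "L * l"] I P L l by (simp add: mult_ac)
      also have "\<dots> = (s / (1 - q) + 1) * (2 * L * P * l)" by (simp add: algebra_simps)
      also have "\<dots> \<le> \<kappa> * (2 * L * P * l)"
        using s L P l by (intro mult_right_mono) auto
      finally show ?thesis by (simp add: mult_ac)
    qed
    have lR: "lip (2 * L * P / (1 - q)) (R a (Z a hs))" by (rule R_lip[OF a IH])
    have "lip (B * L1 h * (2 * L * P / (1 - q)) + I * (L * L1 h)) (Z a (h # hs))"
    proof (cases "hs = []")
      case True
      then show ?thesis using lip_add[OF T_lip[OF lR h(1)] \<psi>_lip[OF h(1)]] by (simp add: I_def)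
    next
      case False
      then show ?thesis using T_lip[OF lR h(1)] by (simp add: I_def)
    qed
    moreover have "B * L1 h * (2 * L * P / (1 - q)) + I * (L * L1 h) \<le> 2 * L * (\<kappa> * P) * l"
      using arith[OF \<kappa>(2)] by (simp add: l_def mult_ac)
    ultimately have 1: "lip (2 * L * (\<kappa> * P) * l) (Z a (h # hs))" by (rule lip_mono)
    let ?r = "R a (Z a hs)"
    \<comment> \<open>The resolvent is controlled only up to constants. As \<open>h\<close> has mean
      zero, a constant may be subtracted, and the oscillation of \<open>?r\<close> suffices.\<close>
    have "T h ?r x0 = (\<integral>g. (?r (act g x0) - ?r x0) * h g \<partial>M)"
      unfolding T_def using T_integrable[OF lR h(1) x0] h by (simp add: left_diff_distrib)
    also have "\<bar>\<dots>\<bar> \<le> 2 * L * P / (1 - q) * D * L1 h"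
      using lip_measurable[OF lR x0] lip_osc[OF lR act_in x0] x0
      by (intro integrable_product_bounded(2) h) auto
    finally have "\<bar>T h ?r x0\<bar> \<le> 2 * L * P / (1 - q) * D * L1 h" .
    moreover have "\<bar>if hs = [] then \<psi> h x0 else 0\<bar> \<le> I * (L * L1 h)"
      using \<psi>_bound[OF h(1) x0] by (simp add: I_def)
    ultimately have "\<bar>Z a (h # hs) x0\<bar> \<le> 2 * L * P / (1 - q) * D * L1 h + I * (L * L1 h)"
      unfolding Z.simps by linarith
    also have "\<dots> \<le> 2 * L * (\<kappa> * P) * l"
      using arith[OF \<kappa>(3)] by (simp add: l_def mult_ac)
    finally have 2: "\<bar>Z a (h # hs) x0\<bar> \<le> 2 * L * (\<kappa> * P) * l" .
    have "2 * L * (\<kappa> * P) * l = 2 * L * \<kappa> ^ length (h # hs) * prod_list (map L1 (h # hs))"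
      by (simp add: P_def l_def mult_ac)
    with 1 2 show ?case by simp
  qed
  then show "lip (2 * L * \<kappa> ^ length hs * prod_list (map L1 hs)) (Z a hs)"
    "\<bar>Z a hs x0\<bar> \<le> 2 * L * \<kappa> ^ length hs * prod_list (map L1 hs)" by auto
qed

lemma \<eta>_Z_bound:
  assumes "near f" "near a" "set hs \<subseteq> mean0"
  shows "\<bar>\<eta> f (Z a hs)\<bar> \<le> (1 + E) * (2 * L) * \<kappa> ^ length hs * prod_list (map L1 hs)"
  using \<eta>_bound[OF assms(1) Z_bounds(1)[OF assms(2,3)]] Z_bounds(2)[OF assms(2,3)]
  by (simp add: algebra_simps)

lemma mean0_comb: "x \<in> mean0 \<Longrightarrow> y \<in> mean0 \<Longrightarrow> (\<lambda>t. a * x t + b * y t) \<in> mean0"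
  by (auto simp: mean0_def)

lemma Z_multilinear:
  assumes a: "near a" and "set hs \<subseteq> mean0" "i < length hs" "h \<in> mean0" "h' \<in> mean0" "x \<in> X"
  shows "Z a (hs[i := (\<lambda>t. b * h t + b' * h' t)]) x = b * Z a (hs[i := h]) x + b' * Z a (hs[i := h']) x"
  using assms(2,3,6)
proof (induction hs arbitrary: i x)
  case (Cons k ks)
  have hint: "integrable M h" "integrable M h'" using assms by (auto simp: mean0_def)
  show ?case
  proof (cases i)
    case 0
    have lR: "lip (2 * L * \<kappa> ^ length ks * prod_list (map L1 ks) / (1 - q)) (R a (Z a ks))"
      using Cons by (intro R_lip[OF a] Z_bounds(1)[OF a]) auto
    show ?thesis
      using T_linear_density[OF lR hint Cons.prems(3)] \<psi>_linear[OF hint Cons.prems(3)] 0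
      by (simp add: algebra_simps)
  next
    case (Suc j)
    have k: "integrable M k" using Cons by (auto simp: mean0_def)
    have j: "j < length ks" "set ks \<subseteq> mean0" using Suc Cons by auto
    have sub: "set (ks[j := h]) \<subseteq> mean0" "set (ks[j := h']) \<subseteq> mean0"
      using j set_update_subset_insert[of ks j] assms by blast+
    note lZ = Z_bounds(1)[OF a sub(1)] Z_bounds(1)[OF a sub(2)]
    have "R a (Z a (ks[j := (\<lambda>t. b * h t + b' * h' t)])) y
        = b * R a (Z a (ks[j := h])) y + b' * R a (Z a (ks[j := h'])) y" if y: "y \<in> X" for y
      using R_cong[OF Cons.IH[OF j(2,1)] y, where f = a] R_linear[OF a lZ y] by simp
    from T_cong[OF this Cons.prems(3), where f = k]
    have "T k (R a (Z a (ks[j := (\<lambda>t. b * h t + b' * h' t)]))) x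
        = b * T k (R a (Z a (ks[j := h]))) x + b' * T k (R a (Z a (ks[j := h']))) x"
      using T_linear[OF R_lip[OF a lZ(1)] R_lip[OF a lZ(2)] k Cons.prems(3)] by simp
    then show ?thesis using Suc j by (auto simp: list_update_nonempty)
  qed
qed simp

lemma \<eta>_Z_multilinear:
  assumes a: "near a"
  shows "multilinear_on mean0 n (\<lambda>hs. \<eta> a (Z a hs))"
  unfolding multilinear_on_def
proof (intro allI impI ballI)
  fix hs i h h' and b b' :: real
  assume hs: "length hs = n" "set hs \<subseteq> mean0" and i: "i < n" and h: "h \<in> mean0" "h' \<in> mean0"
  have sub: "set (hs[i := h]) \<subseteq> mean0" "set (hs[i := h']) \<subseteq> mean0"
    using hs set_update_subset_insert[of hs i] h by blast+
  have "Z a (hs[i := (\<lambda>t. b * h t + b' * h' t)]) x = b * Z a (hs[i := h]) x + b' * Z a (hs[i := h']) x"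
    if "x \<in> X" for x
    using Z_multilinear[OF a hs(2) _ h that] i hs(1) by simp
  note eq = \<eta>_cong[OF this, where f = a]
  show "\<eta> a (Z a (hs[i := (\<lambda>t. b * h t + b' * h' t)])) = b * \<eta> a (Z a (hs[i := h])) + b' * \<eta> a (Z a (hs[i := h']))"
    using eq \<eta>_linear[OF a Z_bounds(1)[OF a sub(1)] Z_bounds(1)[OF a sub(2)], of b b'] by simp
qed

text \<open>For nonnegative \<open>f\<close> this is Furstenberg's formula: the stationary mean of
  the growth in one step.\<close>

definition F :: "('a \<Rightarrow> real) \<Rightarrow> real" where "F f = \<eta> f (\<psi> f)"

text \<open>Apply the invariant functional \<open>\<eta> f\<close> of \<open>f = a + h\<close> to \<open>u - T f u\<close>, where \<open>u\<close> is a partial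
  sum of the perturbation series of the solution of the Poisson equation.\<close>

lemma F_expansion:
  assumes a: "near a" and h: "h \<in> mean0" and f: "near (\<lambda>g. a g + h g)"
  shows "F (\<lambda>g. a g + h g) = (\<Sum>m\<le>n. \<eta> a (Z a (replicate m h)))
    + \<eta> (\<lambda>g. a g + h g) (Z a (replicate (Suc n) h))"
proof -
  let ?f = "\<lambda>g. a g + h g"
  define Y where "Y m = Z a (replicate m h)" for m
  have hi: "integrable M h" using h by (simp add: mean0_def)
  have lY: "lip (2 * L * \<kappa> ^ m * L1 h ^ m) (Y m)" for m
    using Z_bounds(1)[OF a, of "replicate m h"] h
    by (simp add: Y_def set_replicate_conv_if split: if_splits)
  note lR = R_lip[OF a lY]
  define u where "u x = (\<Sum>m\<le>n. R a (Y m) x)" for x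
  have lu: "lip (\<Sum>m\<le>n. 2 * L * \<kappa> ^ m * L1 h ^ m / (1 - q)) u"
    unfolding u_def[abs_def] by (rule lip_sum[OF lR]) simp
  \<comment> \<open>In degree m the Poisson equation for \<open>a\<close> turns \<open>T a\<close>
    of the resolvent into a term cancelled by \<open>T h\<close> of the preceding degree. Only
    \<open>\<psi> ?f\<close>, the constants and the term of degree \<open>Suc n\<close>
    survive.\<close>
  have key: "T ?f u x = u x + (- 1) * (\<psi> ?f x + (- 1) * (Y (Suc n) x + (\<Sum>m\<le>n. \<eta> a (Y m))))"
    if x: "x \<in> X" for x
  proof -
    have "T ?f u x = T a u x + T h u x"
      using T_linear_density[OF lu nearD(1)[OF a] hi x, of 1 1] by simp
    also have "T a u x = (\<Sum>m\<le>n. T a (R a (Y m)) x)"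
      unfolding u_def[abs_def] using T_sum[of "{..n}", OF lR _ nearD(1)[OF a] x] by simp
    also have "\<dots> = (\<Sum>m\<le>n. R a (Y m) x - Y m x + \<eta> a (Y m))"
    proof (intro sum.cong refl)
      fix m show "T a (R a (Y m)) x = R a (Y m) x - Y m x + \<eta> a (Y m)"
        using poisson_equation[OF a lY x, of m] by simp
    qed
    also have "\<dots> = u x - (\<Sum>m\<le>n. Y m x) + (\<Sum>m\<le>n. \<eta> a (Y m))"
      by (simp add: u_def sum.distrib sum_subtractf)
    also have "T h u x = (\<Sum>m\<le>n. T h (R a (Y m)) x)"
      unfolding u_def[abs_def] using T_sum[of "{..n}", OF lR _ hi x] by simp
    also have "\<dots> = (\<Sum>m\<le>n. Y (Suc m) x) - \<psi> h x"
    proof -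
      have "T h (R a (Y m)) x = Y (Suc m) x - (if m = 0 then \<psi> h x else 0)" for m
        by (simp add: Y_def)
      then show ?thesis by (simp add: sum_subtractf)
    qed
    also have "(\<Sum>m\<le>n. Y (Suc m) x) = (\<Sum>m\<le>n. Y m x) + Y (Suc n) x - \<psi> a x"
    proof -
      have "(\<Sum>m\<le>n. Y m x) + Y (Suc n) x = Y 0 x + (\<Sum>m\<le>n. Y (Suc m) x)"
        using sum.atMost_Suc_shift[of "\<lambda>m. Y m x" n] by simp
      then show ?thesis by (simp add: Y_def)
    qed
    finally show ?thesis
      using \<psi>_linear[OF nearD(1)[OF a] hi x, of 1 1] by simp
  qed
  define k where "k = (\<Sum>m\<le>n. \<eta> a (Y m))"
  note lf = \<psi>_lip[OF nearD(1)[OF f]]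
  have l1: "lip (2 * L * \<kappa> ^ Suc n * L1 h ^ Suc n + 0) (\<lambda>x. Y (Suc n) x + k)"
    by (rule lip_add[OF lY lip_const])
  have l2: "lip (L * L1 ?f + \<bar>- 1\<bar> * (2 * L * \<kappa> ^ Suc n * L1 h ^ Suc n + 0))
      (\<lambda>x. \<psi> ?f x + (- 1) * (Y (Suc n) x + k))"
    by (rule lip_add[OF lf lip_scale[OF l1]])
  \<comment> \<open>Invariance of \<open>\<eta> ?f\<close> removes \<open>u\<close> from the
    identity \<open>key\<close>; what remains is the claim.\<close>
  have "\<eta> ?f u = \<eta> ?f (T ?f u)" by (rule \<eta>_T[OF f lu, symmetric])
  also have "\<dots> = \<eta> ?f (\<lambda>x. 1 * u x + (- 1) * (\<psi> ?f x + (- 1) * (Y (Suc n) x + k)))"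
    by (rule \<eta>_cong) (simp add: key k_def)
  also have "\<dots> = \<eta> ?f u - \<eta> ?f (\<lambda>x. \<psi> ?f x + (- 1) * (Y (Suc n) x + k))"
    using \<eta>_linear[OF f lu l2, of 1 "- 1"] by simp
  also have "\<eta> ?f (\<lambda>x. \<psi> ?f x + (- 1) * (Y (Suc n) x + k)) = F ?f - \<eta> ?f (\<lambda>x. Y (Suc n) x + k)"
    using \<eta>_linear[OF f lf l1, of 1 "- 1"] by (simp add: F_def)
  also have "\<eta> ?f (\<lambda>x. Y (Suc n) x + k) = \<eta> ?f (Y (Suc n)) + k"
    using \<eta>_linear[OF f lY[of "Suc n"] lip_const[of k], of 1 1] by (simp add: \<eta>_const[OF f])
  finally show ?thesis by (simp add: k_def Y_def)
qed

text \<open>The bound on \<eta> is uniform over all \<open>near\<close> densities, so it also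
  controls the remainder, which is evaluated by the functional of the perturbed density.\<close>

lemma F_remainder:
  assumes a: "near a" and h: "h \<in> mean0" and f: "near (\<lambda>g. a g + h g)"
  shows "\<bar>F (\<lambda>g. a g + h g) - (\<Sum>m\<le>n. \<eta> a (Z a (replicate m h)))\<bar>
    \<le> (1 + E) * (2 * L) * (\<kappa> * L1 h) ^ Suc n"
proof -
  have "set (replicate (Suc n) h) \<subseteq> mean0" using h by auto
  from \<eta>_Z_bound[OF f a this] show ?thesis
    unfolding F_expansion[OF assms, of n] by (simp add: power_mult_distrib mult_ac del: Z.simps)
qed

lemma F_sums:
  assumes a: "near a" and h: "h \<in> mean0" and f: "near (\<lambda>g. a g + h g)" and small: "\<kappa> * L1 h < 1"
  shows "(\<lambda>n. symmetrize n (\<lambda>hs. \<eta> a (Z a hs)) (replicate n h)) sums F (\<lambda>g. a g + h g)"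
  unfolding symmetrize_replicate sums_def_le
proof (rule LIM_zero_cancel, rule Lim_null_comparison)
  show "eventually (\<lambda>n. norm ((\<Sum>m\<le>n. \<eta> a (Z a (replicate m h))) - F (\<lambda>g. a g + h g))
      \<le> (1 + E) * (2 * L) * (\<kappa> * L1 h) ^ Suc n) sequentially"
    using F_remainder[OF a h f] by (simp add: abs_minus_commute)
  have "(\<lambda>n. (\<kappa> * L1 h) ^ Suc n) \<longlonglongrightarrow> 0"
    using small \<kappa>(1) L1_nonneg by (intro LIMSEQ_Suc LIMSEQ_realpow_zero) auto
  then show "(\<lambda>n. (1 + E) * (2 * L) * (\<kappa> * L1 h) ^ Suc n) \<longlonglongrightarrow> 0"
    by (rule tendsto_mult_right_zero)
qed

lemma F_lipschitz_at:
  assumes a: "near a" and h: "h \<in> mean0" and f: "near (\<lambda>g. a g + h g)"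
  shows "\<bar>F (\<lambda>g. a g + h g) - F a\<bar> \<le> (1 + E) * (2 * L) * (\<kappa> * L1 h)"
  using F_remainder[OF assms, of 0] by (simp add: F_def)

lemma cont_sym_multilinear_coefficients:
  assumes a: "near a" and V: "V \<subseteq> mean0"
    and N: "\<And>x y. x \<in> V \<Longrightarrow> y \<in> V \<Longrightarrow> L1 (\<lambda>t. y t - x t) \<le> N (\<lambda>t. y t - x t)"
  shows "cont_sym_multilinear V N n (symmetrize n (\<lambda>hs. \<eta> a (Z a hs)))"
proof (rule cont_sym_multilinear_symmetrize[OF \<eta>_Z_multilinear[OF a], where nrm = L1])
  show "\<bar>\<eta> a (Z a xs)\<bar> \<le> (1 + E) * (2 * L) * \<kappa> ^ n * prod_list (map L1 xs)"
    if "length xs = n" "set xs \<subseteq> mean0" for xs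
    using \<eta>_Z_bound[OF a a that(2)] that(1) by simp
  show "0 \<le> (1 + E) * (2 * L) * \<kappa> ^ n" using E_nonneg L \<kappa>(1) by simp
  show "L1 y \<le> L1 x + L1 (\<lambda>t. y t - x t)" if "x \<in> mean0" "y \<in> mean0" for x y
    using that by (intro L1_triangle) (auto simp: mean0_def)
  show "(\<lambda>t. y t - x t) \<in> mean0" if "x \<in> mean0" "y \<in> mean0" for x y
    using mean0_comb[OF that(2,1), of 1 "- 1"] by simp
qed (use V N L1_nonneg in auto)

end

section \<open>Random matrix products\<close>

lemma borel_measurable_matrix_vector_mult [measurable (raw)]:
  fixes f :: "'a \<Rightarrow> real ^ 'd ^ 'd"
  assumes "f \<in> borel_measurable N" "g \<in> borel_measurable N"
  shows "(\<lambda>x. f x *v g x) \<in> borel_measurable N"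
  using assms
proof (rule borel_measurable_continuous_Pair[where H = "(*v)"])
  show "continuous_on UNIV (\<lambda>x :: (real^'d^'d) \<times> (real^'d). fst x *v snd x)"
    unfolding matrix_vector_mult_def by (intro continuous_intros)
qed

lemma borel_measurable_matrix_matrix_mult [measurable (raw)]:
  fixes f g :: "'a \<Rightarrow> real ^ 'd ^ 'd"
  assumes "f \<in> borel_measurable N" "g \<in> borel_measurable N"
  shows "(\<lambda>x. f x ** g x) \<in> borel_measurable N"
  using assms
proof (rule borel_measurable_continuous_Pair[where H = "(**)"])
  show "continuous_on UNIV (\<lambda>x :: (real^'d^'d) \<times> (real^'d^'d). fst x ** snd x)"
    unfolding matrix_matrix_mult_def by (intro continuous_intros)
qed

lemma matrix_product_shift:
  "matrix_product \<omega> (k + n) = matrix_product (seq_shift k \<omega>) n ** matrix_product \<omega> k"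
  by (induction n) (simp_all add: seq_shift_def matrix_mul_assoc)

lemma matrix_product_cong: "(\<And>i. i < n \<Longrightarrow> \<omega> i = \<omega>' i) \<Longrightarrow> matrix_product \<omega> n = matrix_product \<omega>' n"
  by (induction n) auto

lemma matrix_product_comb_seq: "matrix_product (comb_seq k \<omega> \<omega>') k = matrix_product \<omega> k"
  by (rule matrix_product_cong) (simp add: comb_seq_def)

lemma matrix_product_case_nat: "matrix_product (case_nat g \<omega>) (Suc n) = matrix_product \<omega> n ** g"
  by (induction n) (simp_all add: matrix_mul_assoc)

lemma matrix_inv:
  fixes A :: "real ^ 'd ^ 'd"
  assumes "invertible A"
  shows "A ** matrix_inv A = mat 1" "matrix_inv A ** A = mat 1"
  using someI_ex[of "\<lambda>A'. A ** A' = mat 1 \<and> A' ** A = mat 1"] assms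
  unfolding invertible_def matrix_inv_def by auto

text \<open>On the compact product of \<open>S\<close> with the unit sphere the norm of the image
  attains a maximum and a minimum, and invertibility makes the minimum positive.\<close>

lemma compact_invertible_norm_bounds:
  fixes S :: "(real ^ 'd ^ 'd) set"
  assumes "compact S" "\<forall>A\<in>S. invertible A"
  obtains b where "1 \<le> b" "\<And>A x. A \<in> S \<Longrightarrow> norm (A *v x) \<le> b * norm x"
    "\<And>A x. A \<in> S \<Longrightarrow> norm x \<le> b * norm (A *v x)"
proof (cases "S = {}")
  case True
  then show ?thesis using that[of 1] by auto
next
  case False
  let ?K = "S \<times> sphere (0 :: real ^ 'd) 1"
  have K: "compact ?K" "?K \<noteq> {}"
    using assms False by (auto simp: compact_Times)
  have cont: "continuous_on ?K (\<lambda>p. norm (fst p *v snd p))"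
    unfolding matrix_vector_mult_def by (intro continuous_intros)
  obtain p where p: "p \<in> ?K" "\<And>y. y \<in> ?K \<Longrightarrow> norm (fst y *v snd y) \<le> norm (fst p *v snd p)"
    using continuous_attains_sup[OF K cont] by blast
  obtain r where r: "r \<in> ?K" "\<And>y. y \<in> ?K \<Longrightarrow> norm (fst r *v snd r) \<le> norm (fst y *v snd y)"
    using continuous_attains_inf[OF K cont] by blast
  define u where "u = norm (fst p *v snd p)"
  define l where "l = norm (fst r *v snd r)"
  have "snd r \<noteq> 0" "invertible (fst r)" using r(1) assms by auto
  then have l: "0 < l"
    unfolding l_def by (metis invertible_def matrix_vector_mul_assoc matrix_vector_mul_lid
        matrix_vector_mult_0_right zero_less_norm_iff)
  have u: "0 \<le> u" by (simp add: u_def)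
  have bounds: "norm (A *v x) \<le> u * norm x" "l * norm x \<le> norm (A *v x)" if A: "A \<in> S" for A and x :: "real ^ 'd"
  proof -
    have "norm (A *v x) \<le> u * norm x \<and> l * norm x \<le> norm (A *v x)"
    proof (cases "x = 0")
      case False
      then have "(A, x /\<^sub>R norm x) \<in> ?K" using A by simp
      from p(2)[OF this] r(2)[OF this] have "norm (A *v x) / norm x \<le> u" "l \<le> norm (A *v x) / norm x"
        by (simp_all add: u_def l_def matrix_vector_mult_scaleR divide_inverse mult.commute)
      then show ?thesis using False by (simp add: field_simps)
    qed simp
    then show "norm (A *v x) \<le> u * norm x" "l * norm x \<le> norm (A *v x)" by auto
  qed
  define b where "b = max 1 (max u (1 / l))"
  show ?thesis
  proof (rule that[of b])
    show "1 \<le> b" by (simp add: b_def)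
    fix A and x :: "real ^ 'd" assume A: "A \<in> S"
    have "u * norm x \<le> b * norm x" by (intro mult_right_mono) (auto simp: b_def)
    with bounds(1)[OF A, of x] show "norm (A *v x) \<le> b * norm x" by linarith
    have "norm x \<le> 1 / l * norm (A *v x)" using bounds(2)[OF A, of x] l by (simp add: field_simps)
    also have "\<dots> \<le> b * norm (A *v x)" by (intro mult_right_mono) (auto simp: b_def)
    finally show "norm x \<le> b * norm (A *v x)" .
  qed
qed

text \<open>In this variational form sublevel sets are intersections of closed conditions, which
  gives measurability, and submultiplicativity follows by composing two bounds.\<close>

lemma spectral_norm_le_iff:
  fixes A :: "real ^ 'd ^ 'd"
  assumes "0 \<le> r"
  shows "spectral_norm A \<le> r \<longleftrightarrow> (\<forall>x. norm (A *v x) \<le> r * norm x)"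
proof
  show "\<forall>x. norm (A *v x) \<le> r * norm x" if "spectral_norm A \<le> r"
    using norm_le_spectral_norm[of A] mult_right_mono[OF that norm_ge_zero] order_trans by blast
  show "spectral_norm A \<le> r" if "\<forall>x. norm (A *v x) \<le> r * norm x"
    using ex_norm_eq_spectral_norm[of A] that by (metis mult.right_neutral)
qed

lemma wedge_norm_le_iff:
  fixes A :: "real ^ 'd ^ 'd"
  assumes d: "2 \<le> CARD('d)" and "0 \<le> r"
  shows "wedge_norm A \<le> r \<longleftrightarrow> (\<forall>x y. gram2 (A *v x) (A *v y) \<le> r\<^sup>2 * gram2 x y)"
proof
  assume "wedge_norm A \<le> r"
  then have "(wedge_norm A)\<^sup>2 \<le> r\<^sup>2" using wedge_norm_nonneg[OF d] by (intro power_mono)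
  then show "\<forall>x y. gram2 (A *v x) (A *v y) \<le> r\<^sup>2 * gram2 x y"
    using gram2_le_wedge_norm[OF d, of A] gram2_nonneg mult_right_mono order_trans by meson
next
  assume *: "\<forall>x y. gram2 (A *v x) (A *v y) \<le> r\<^sup>2 * gram2 x y"
  obtain v w where "gram2 v w = 1" "gram2 (A *v v) (A *v w) = (wedge_norm A)\<^sup>2"
    using ex_gram2_eq_wedge_norm[OF d, of A] by blast
  with * have "(wedge_norm A)\<^sup>2 \<le> r\<^sup>2" by (metis mult.right_neutral)
  then show "wedge_norm A \<le> r" using assms(2) by (rule power2_le_imp_le)
qed

lemma borel_measurable_spectral_norm [measurable]:
  "(spectral_norm :: real ^ 'd ^ 'd \<Rightarrow> real) \<in> borel_measurable borel"
proof (rule borel_measurable_iff_le[THEN iffD2], rule allI)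
  fix r :: real
  show "{A \<in> space borel. spectral_norm (A :: real ^ 'd ^ 'd) \<le> r} \<in> sets borel"
  proof (cases "0 \<le> r")
    case True
    have "{A \<in> space borel. spectral_norm (A :: real ^ 'd ^ 'd) \<le> r} = (\<Inter>x. {A. norm (A *v x) \<le> r * norm x})"
      using spectral_norm_le_iff[OF True] by auto
    moreover have "closed (\<Inter>x. {A :: real ^ 'd ^ 'd. norm (A *v x) \<le> r * norm x})"
      unfolding matrix_vector_mult_def by (intro closed_INT ballI closed_Collect_le continuous_intros)
    ultimately show ?thesis by simp
  next
    case False
    then have "{A \<in> space borel. spectral_norm (A :: real ^ 'd ^ 'd) \<le> r} = {}"
      using spectral_norm_nonneg by (auto intro: order_trans)
    then show ?thesis by simp
  qed
qed

lemma borel_measurable_wedge_norm: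
  assumes d: "2 \<le> CARD('d)"
  shows "(wedge_norm :: real ^ 'd ^ 'd \<Rightarrow> real) \<in> borel_measurable borel"
proof (rule borel_measurable_iff_le[THEN iffD2], rule allI)
  fix r :: real
  show "{A \<in> space borel. wedge_norm (A :: real ^ 'd ^ 'd) \<le> r} \<in> sets borel"
  proof (cases "0 \<le> r")
    case True
    have "{A \<in> space borel. wedge_norm (A :: real ^ 'd ^ 'd) \<le> r}
        = (\<Inter>x. \<Inter>y. {A. gram2 (A *v x) (A *v y) \<le> r\<^sup>2 * gram2 x y})"
      using wedge_norm_le_iff[OF d True] by auto
    moreover have "closed (\<Inter>x. \<Inter>y. {A :: real ^ 'd ^ 'd. gram2 (A *v x) (A *v y) \<le> r\<^sup>2 * gram2 x y})"
      unfolding matrix_vector_mult_def gram2_def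
      by (intro closed_INT ballI closed_Collect_le continuous_intros)
    ultimately show ?thesis by simp
  next
    case False
    then have "{A \<in> space borel. wedge_norm (A :: real ^ 'd ^ 'd) \<le> r} = {}"
      using wedge_norm_nonneg[OF d] by (auto intro: order_trans)
    then show ?thesis by simp
  qed
qed

lemma spectral_norm_mult:
  fixes A B :: "real ^ 'd ^ 'd"
  shows "spectral_norm (A ** B) \<le> spectral_norm A * spectral_norm B"
proof -
  have "norm ((A ** B) *v x) \<le> spectral_norm A * spectral_norm B * norm x" for x
    using norm_le_spectral_norm[of A "B *v x"]
      mult_left_mono[OF norm_le_spectral_norm[of B x] spectral_norm_nonneg[of A]]
    by (simp add: matrix_vector_mul_assoc[symmetric] mult.assoc)
  then show ?thesis
    by (subst spectral_norm_le_iff) (auto simp: spectral_norm_nonneg)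
qed

lemma spectral_norm_mat: "spectral_norm (mat 1 :: real ^ 'd ^ 'd) = 1"
  using ex_norm_eq_spectral_norm[of "mat 1 :: real ^ 'd ^ 'd"] by auto

lemma wedge_norm_mult:
  fixes A B :: "real ^ 'd ^ 'd"
  assumes d: "2 \<le> CARD('d)"
  shows "wedge_norm (A ** B) \<le> wedge_norm A * wedge_norm B"
proof -
  have "gram2 ((A ** B) *v x) ((A ** B) *v y) \<le> (wedge_norm A * wedge_norm B)\<^sup>2 * gram2 x y" for x y
    using gram2_le_wedge_norm[OF d, of A "B *v x" "B *v y"]
      mult_left_mono[OF gram2_le_wedge_norm[OF d, of B x y] zero_le_power2[of "wedge_norm A"]]
    by (simp add: matrix_vector_mul_assoc[symmetric] mult.assoc power_mult_distrib)
  then show ?thesis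
    by (subst wedge_norm_le_iff[OF d]) (auto simp: wedge_norm_nonneg[OF d])
qed

lemma wedge_norm_mat:
  assumes d: "2 \<le> CARD('d)"
  shows "wedge_norm (mat 1 :: real ^ 'd ^ 'd) = 1"
proof -
  have "(wedge_norm (mat 1 :: real ^ 'd ^ 'd))\<^sup>2 = 1"
    using ex_gram2_eq_wedge_norm[OF d, of "mat 1"] by auto
  then show ?thesis using wedge_norm_nonneg[OF d, of "mat 1"] by (simp add: power2_eq_1_iff)
qed

text \<open>\<Sigma> and \<open>b\<close> are kept apart from the law because the same pair serves
  every density with respect to \<mu>_0. One \<open>b\<close> for both directions bounds all
  logarithms of growth after n steps by \<open>ln b * n\<close>.\<close>

locale matrix_law =
  fixes \<Sigma> :: "(real ^ 'd ^ 'd) set" and \<nu> :: "(real ^ 'd ^ 'd) measure" and b :: real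
  assumes prob_space_\<nu>: "prob_space \<nu>"
    and sets_\<nu>: "sets \<nu> = sets (restrict_space borel \<Sigma>)"
    and inv_\<Sigma>: "A \<in> \<Sigma> \<Longrightarrow> invertible A"
    and b1: "1 \<le> b"
    and norm_le_b: "A \<in> \<Sigma> \<Longrightarrow> norm (A *v x) \<le> b * norm x"
    and norm_ge_b: "A \<in> \<Sigma> \<Longrightarrow> norm x \<le> b * norm (A *v x)"

sublocale matrix_law \<subseteq> sequence_space \<nu>
proof -
  interpret prob_space \<nu> by (rule prob_space_\<nu>)
  show "sequence_space \<nu>" by unfold_locales
qed

context matrix_law
begin

abbreviation MP :: "nat \<Rightarrow> (nat \<Rightarrow> real ^ 'd ^ 'd) \<Rightarrow> real ^ 'd ^ 'd" where
  "MP n \<omega> \<equiv> matrix_product \<omega> n"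

lemma space_\<nu>: "space \<nu> = \<Sigma>"
  using sets_eq_imp_space_eq[OF sets_\<nu>] by (simp add: space_restrict_space)

lemma measurable_ident_\<nu> [measurable]: "(\<lambda>g. g) \<in> borel_measurable \<nu>"
  using measurable_restrict_space1[OF measurable_ident, of borel \<Sigma>]
  by (simp add: id_def measurable_cong_sets[OF sets_\<nu> refl])

lemma measurable_coordinate [measurable]: "(\<lambda>\<omega>. \<omega> n) \<in> borel_measurable S"
  using measurable_compose[OF measurable_component_singleton[of n UNIV "\<lambda>_. \<nu>"] measurable_ident_\<nu>] by simp

lemma measurable_MP [measurable]: "(\<lambda>\<omega>. MP n \<omega>) \<in> borel_measurable S"
  by (induction n) simp_all

lemma measurable_MP_shift [measurable]: "(\<lambda>\<omega>. MP n (seq_shift k \<omega>)) \<in> borel_measurable S"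
  using measurable_compose[OF measurable_seq_shift measurable_MP] .

lemma invertible_MP: "\<omega> \<in> space S \<Longrightarrow> invertible (MP n \<omega>)"
proof (induction n)
  case 0
  then show ?case by (simp add: invertible_def exI[of _ "mat 1"])
next
  case (Suc n)
  then show ?case using inv_\<Sigma> space_S space_\<nu> by (auto intro!: invertible_mult)
qed

text \<open>Common to the operator norms on vectors and on the exterior square. The bound for
  inverses makes the logarithm change by a bounded amount with each factor.\<close>

lemma submultiplicative_limit:
  fixes \<Phi> :: "real ^ 'd ^ 'd \<Rightarrow> real"
  assumes meas: "\<Phi> \<in> borel_measurable borel"
    and one: "\<Phi> (mat 1) = 1" and nonneg: "\<And>A. 0 \<le> \<Phi> A"
    and mult: "\<And>A B. \<Phi> (A ** B) \<le> \<Phi> A * \<Phi> B"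
    and bnd: "\<And>A. A \<in> \<Sigma> \<Longrightarrow> \<Phi> A \<le> C" "\<And>A. A \<in> \<Sigma> \<Longrightarrow> \<Phi> (matrix_inv A) \<le> C"
  obtains \<gamma> where "AE \<omega> in S. (\<lambda>n. ln (\<Phi> (MP n \<omega>)) / n) \<longlonglongrightarrow> \<gamma>"
    "(\<lambda>n. (\<integral>\<omega>. ln (\<Phi> (MP n \<omega>)) \<partial>S) / n) \<longlonglongrightarrow> \<gamma>"
    "\<And>n. \<gamma> * n \<le> (\<integral>\<omega>. ln (\<Phi> (MP n \<omega>)) \<partial>S)"
    "\<And>n \<omega>. \<omega> \<in> space S \<Longrightarrow> 0 < \<Phi> (MP n \<omega>)"
    "\<And>n \<omega>. \<omega> \<in> space S \<Longrightarrow> \<bar>ln (\<Phi> (MP n \<omega>))\<bar> \<le> ln (max 1 C) * n"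
proof -
  define c where "c = ln (max 1 C)"
  have pos: "0 < \<Phi> A" if "invertible A" for A
  proof -
    have "1 \<le> \<Phi> A * \<Phi> (matrix_inv A)"
      using mult[of A "matrix_inv A"] matrix_inv[OF that] one by simp
    then show ?thesis using nonneg[of A] by (cases "\<Phi> A = 0") auto
  qed
  have posMP: "0 < \<Phi> (MP n \<omega>)" if "\<omega> \<in> space S" for n \<omega>
    using pos invertible_MP[OF that] by simp
  have inSig: "\<omega> n \<in> \<Sigma>" if "\<omega> \<in> space S" for n \<omega> using that by (simp add: space_S space_\<nu>)
  \<comment> \<open>Both sides are needed: a new step multiplies from the left, whereas dropping the
    first entry of the sequence strips a factor on the right.\<close>
  have factor: "\<bar>ln (\<Phi> (A ** B)) - ln (\<Phi> A)\<bar> \<le> c \<and> \<bar>ln (\<Phi> (B ** A)) - ln (\<Phi> A)\<bar> \<le> c"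
    if A: "invertible A" and B: "B \<in> \<Sigma>" for A B
  proof -
    have iB: "invertible B" using inv_\<Sigma>[OF B] .
    have p: "0 < \<Phi> A" "0 < \<Phi> (A ** B)" "0 < \<Phi> (B ** A)"
      using pos A iB by (auto intro: invertible_mult)
    have lnle: "ln u \<le> ln v + c" if uv: "u \<le> v * w" "w \<le> C" and "0 < u" "0 < v" for u v w
    proof -
      have "v * w \<le> v * max 1 C" using that by (intro mult_left_mono) auto
      with uv(1) have "u \<le> v * max 1 C" by (rule order_trans)
      then have "ln u \<le> ln (v * max 1 C)" using that by (subst ln_le_cancel_iff) auto
      also have "\<dots> = ln v + c" using that by (simp add: ln_mult c_def)
      finally show ?thesis .
    qed
    have AB: "(A ** B) ** matrix_inv B = A" "matrix_inv B ** (B ** A) = A"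
      using matrix_inv[OF iB] by (simp_all add: matrix_mul_assoc[symmetric])
      (simp add: matrix_mul_assoc)
    have 1: "ln (\<Phi> (A ** B)) \<le> ln (\<Phi> A) + c" by (rule lnle[OF mult bnd(1)[OF B] p(2,1)])
    have 2: "ln (\<Phi> (B ** A)) \<le> ln (\<Phi> A) + c"
      using lnle[OF _ bnd(1)[OF B] p(3,1)] mult[of B A] by (simp add: mult.commute)
    have 3: "ln (\<Phi> A) \<le> ln (\<Phi> (A ** B)) + c"
      using lnle[OF _ bnd(2)[OF B] p(1,2)] mult[of "A ** B" "matrix_inv B"] AB by simp
    have 4: "ln (\<Phi> A) \<le> ln (\<Phi> (B ** A)) + c"
      using lnle[OF _ bnd(2)[OF B] p(1,3)] mult[of "matrix_inv B" "B ** A"] AB by (simp add: mult.commute)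
    show ?thesis using 1 2 3 4 by (simp add: abs_le_iff)
  qed
  have c: "0 \<le> c" by (simp add: c_def)
  have abs: "\<bar>ln (\<Phi> (MP n \<omega>))\<bar> \<le> c * n" if w: "\<omega> \<in> space S" for n \<omega>
  proof (induction n)
    case (Suc n)
    have "\<bar>ln (\<Phi> (\<omega> n ** MP n \<omega>)) - ln (\<Phi> (MP n \<omega>))\<bar> \<le> c"
      using factor[OF invertible_MP[OF w] inSig[OF w], of n n] by simp
    with Suc show ?case by (simp add: distrib_left)
  qed (simp add: one)
  note [measurable] = meas
  obtain \<gamma> where "AE \<omega> in S. (\<lambda>n. ln (\<Phi> (MP n \<omega>)) / n) \<longlonglongrightarrow> \<gamma>"
    "(\<lambda>n. (\<integral>\<omega>. ln (\<Phi> (MP n \<omega>)) \<partial>S) / n) \<longlonglongrightarrow> \<gamma>"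
    "\<And>n. \<gamma> * n \<le> (\<integral>\<omega>. ln (\<Phi> (MP n \<omega>)) \<partial>S)"
  proof (rule subadditive_AE_limit[OF c, where a = "\<lambda>n \<omega>. ln (\<Phi> (MP n \<omega>))"])
    show "(\<lambda>\<omega>. ln (\<Phi> (MP n \<omega>))) \<in> borel_measurable S" for n by measurable
    show "ln (\<Phi> (MP (k + n) \<omega>)) \<le> ln (\<Phi> (MP k \<omega>)) + ln (\<Phi> (MP n (seq_shift k \<omega>)))"
      if "\<omega> \<in> space S" for k n \<omega>
    proof -
      let ?u = "\<Phi> (MP (k + n) \<omega>)" and ?v = "\<Phi> (MP k \<omega>)" and ?w = "\<Phi> (MP n (seq_shift k \<omega>))"
      have pos: "0 < ?u" "0 < ?v" "0 < ?w" using posMP that seq_shift_space by auto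
      have "?u \<le> ?v * ?w"
        unfolding matrix_product_shift
        using mult[of "MP n (seq_shift k \<omega>)" "MP k \<omega>"] by (simp add: mult.commute)
      then have "ln ?u \<le> ln (?v * ?w)" using pos by (subst ln_le_cancel_iff) auto
      then show ?thesis using pos by (simp add: ln_mult)
    qed
    show "\<bar>ln (\<Phi> (MP (Suc n) \<omega>)) - ln (\<Phi> (MP n (seq_shift 1 \<omega>)))\<bar> \<le> c" if "\<omega> \<in> space S" for n \<omega>
    proof -
      have "MP (Suc n) \<omega> = MP n (seq_shift 1 \<omega>) ** \<omega> 0"
        using matrix_product_shift[of \<omega> 1 n] by simp
      then show ?thesis
        using factor[OF invertible_MP[OF seq_shift_space[OF that, of 1], of n] inSig[OF that, of 0]] by simp
    qed
  qed (auto simp: abs matrix_product_comb_seq)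
  then show ?thesis using that posMP abs unfolding c_def by blast
qed

lemma spectral_norm_bounds:
  assumes "A \<in> \<Sigma>"
  shows "spectral_norm A \<le> b" "spectral_norm (matrix_inv A) \<le> b"
proof -
  show "spectral_norm A \<le> b"
    using b1 norm_le_b[OF assms] by (subst spectral_norm_le_iff) auto
  have "norm (matrix_inv A *v x) \<le> b * norm x" for x
    using norm_ge_b[OF assms, of "matrix_inv A *v x"] matrix_inv[OF inv_\<Sigma>[OF assms]]
    by (simp add: matrix_vector_mul_assoc)
  then show "spectral_norm (matrix_inv A) \<le> b"
    using b1 by (subst spectral_norm_le_iff) auto
qed

lemma wedge_norm_bounds:
  assumes d: "2 \<le> CARD('d)" and "A \<in> \<Sigma>"
  shows "wedge_norm A \<le> b\<^sup>2" "wedge_norm (matrix_inv A) \<le> b\<^sup>2"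
  using wedge_norm_le[OF d, of A] wedge_norm_le[OF d, of "matrix_inv A"]
    power_mono[OF spectral_norm_bounds(1)[OF assms(2)] spectral_norm_nonneg, of 2]
    power_mono[OF spectral_norm_bounds(2)[OF assms(2)] spectral_norm_nonneg, of 2]
  by linarith+

lemma AE_limit_unique:
  assumes "AE \<omega> in S. f \<omega> \<longlonglongrightarrow> (l :: real)"
  shows "(THE l. AE \<omega> in S. f \<omega> \<longlonglongrightarrow> l) = l"
proof (rule the_equality)
  fix l' assume "AE \<omega> in S. f \<omega> \<longlonglongrightarrow> l'"
  with assms have "AE \<omega> in S. l' = l"
    by eventually_elim (rule LIMSEQ_unique)
  then show "l' = l" by simp
qed (rule assms)

text \<open>Resolves the definite description in \<open>lyapunov_exponent\<close> for the top
  exponent.\<close>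

lemma lyapunov_exponent_1:
  "AE \<omega> in S. (\<lambda>n. ln (spectral_norm (MP n \<omega>)) / n) \<longlonglongrightarrow> lyapunov_exponent 1 \<nu>" (is ?a)
  "(\<lambda>n. (\<integral>\<omega>. ln (spectral_norm (MP n \<omega>)) \<partial>S) / n) \<longlonglongrightarrow> lyapunov_exponent 1 \<nu>" (is ?b)
  "lyapunov_exponent 1 \<nu> * n \<le> (\<integral>\<omega>. ln (spectral_norm (MP n \<omega>)) \<partial>S)" (is "?c n")
  "\<omega> \<in> space S \<Longrightarrow> 0 < spectral_norm (MP n \<omega>)" (is "?A \<omega> \<Longrightarrow> ?d \<omega> n")
  "\<omega> \<in> space S \<Longrightarrow> \<bar>ln (spectral_norm (MP n \<omega>))\<bar> \<le> ln b * n" (is "_ \<Longrightarrow> ?e \<omega> n")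
proof -
  obtain \<gamma> where \<gamma>: "AE \<omega> in S. (\<lambda>n. ln (spectral_norm (MP n \<omega>)) / n) \<longlonglongrightarrow> \<gamma>"
    "(\<lambda>n. (\<integral>\<omega>. ln (spectral_norm (MP n \<omega>)) \<partial>S) / n) \<longlonglongrightarrow> \<gamma>"
    "\<And>n. \<gamma> * n \<le> (\<integral>\<omega>. ln (spectral_norm (MP n \<omega>)) \<partial>S)"
    "\<And>n \<omega>. \<omega> \<in> space S \<Longrightarrow> 0 < spectral_norm (MP n \<omega>)"
    "\<And>n \<omega>. \<omega> \<in> space S \<Longrightarrow> \<bar>ln (spectral_norm (MP n \<omega>))\<bar> \<le> ln (max 1 b) * n"
    by (rule submultiplicative_limit[where \<Phi> = "spectral_norm" and C = b])
      (auto simp: spectral_norm_mat spectral_norm_nonneg spectral_norm_mult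
        spectral_norm_bounds)
  have "lyapunov_exponent 1 \<nu> = \<gamma>"
    unfolding lyapunov_exponent_def spectral_norm_def[symmetric] by (rule AE_limit_unique) (rule \<gamma>(1))
  with \<gamma> b1 show ?a ?b "?c n" "?A \<omega> \<Longrightarrow> ?d \<omega> n" "?A \<omega> \<Longrightarrow> ?e \<omega> n" by (simp_all add: max_absorb2)
qed

text \<open>The logarithm of the second singular value is that of \<open>wedge_norm\<close> minus
  that of \<open>spectral_norm\<close>, so its rate is a difference of two known limits.\<close>

lemma lyapunov_exponent_2:
  assumes d: "2 \<le> CARD('d)"
  shows "(\<lambda>n. (\<integral>\<omega>. ln (wedge_norm (MP n \<omega>)) \<partial>S) / n) \<longlonglongrightarrow> lyapunov_exponent 1 \<nu> + lyapunov_exponent 2 \<nu>" (is ?a)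
    and "\<omega> \<in> space S \<Longrightarrow> 0 < wedge_norm (MP n \<omega>)" (is "_ \<Longrightarrow> ?b")
    and "\<omega> \<in> space S \<Longrightarrow> \<bar>ln (wedge_norm (MP n \<omega>))\<bar> \<le> ln (b\<^sup>2) * n" (is "_ \<Longrightarrow> ?c")
proof -
  obtain \<gamma> where \<gamma>: "AE \<omega> in S. (\<lambda>n. ln (wedge_norm (MP n \<omega>)) / n) \<longlonglongrightarrow> \<gamma>"
    "(\<lambda>n. (\<integral>\<omega>. ln (wedge_norm (MP n \<omega>)) \<partial>S) / n) \<longlonglongrightarrow> \<gamma>"
    "\<And>n. \<gamma> * n \<le> (\<integral>\<omega>. ln (wedge_norm (MP n \<omega>)) \<partial>S)"
    "\<And>n \<omega>. \<omega> \<in> space S \<Longrightarrow> 0 < wedge_norm (MP n \<omega>)"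
    "\<And>n \<omega>. \<omega> \<in> space S \<Longrightarrow> \<bar>ln (wedge_norm (MP n \<omega>))\<bar> \<le> ln (max 1 (b\<^sup>2)) * n"
    by (rule submultiplicative_limit[where \<Phi> = wedge_norm and C = "b\<^sup>2"])
      (auto simp: wedge_norm_mat wedge_norm_nonneg wedge_norm_mult wedge_norm_bounds
        borel_measurable_wedge_norm d)
  have "AE \<omega> in S. (\<lambda>n. ln (singular_value 2 (MP n \<omega>)) / n) \<longlonglongrightarrow> \<gamma> - lyapunov_exponent 1 \<nu>"
    using \<gamma>(1) lyapunov_exponent_1(1) AE_space
  proof eventually_elim
    case (elim \<omega>)
    have "ln (singular_value 2 (MP n \<omega>)) = ln (wedge_norm (MP n \<omega>)) - ln (spectral_norm (MP n \<omega>))" for n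
      using lyapunov_exponent_1(4)[OF elim(3), of n] \<gamma>(4)[OF elim(3), of n]
      by (simp add: wedge_norm_def ln_mult zero_less_mult_iff)
    then show ?case using tendsto_diff[OF elim(1,2)] by (simp add: diff_divide_distrib)
  qed
  then have "lyapunov_exponent 2 \<nu> = \<gamma> - lyapunov_exponent 1 \<nu>"
    unfolding lyapunov_exponent_def[of 2] by (rule AE_limit_unique)
  moreover have "1 \<le> b\<^sup>2" using b1 by simp
  ultimately show ?a "\<omega> \<in> space S \<Longrightarrow> ?b" "\<omega> \<in> space S \<Longrightarrow> ?c" using \<gamma> by (simp_all add: max_absorb2)
qed

end


section \<open>Adapted weights and growth of moments\<close>

lemma powr_add_le_add:
  fixes a b s :: real
  assumes "0 \<le> a" "0 \<le> b" "0 < s" "s \<le> 1"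
  shows "(a + b) powr s \<le> a powr s + b powr s"
proof (cases "a + b = 0")
  case False
  then have pos: "0 < a + b" using assms by simp
  have le: "u \<le> u powr s" if "0 \<le> u" "u \<le> 1" for u :: real
    using powr_mono'[of s 1 u] that assms by (cases "u = 0") auto
  have "1 = a / (a + b) + b / (a + b)" using pos by (simp add: add_divide_distrib[symmetric])
  also have "\<dots> \<le> (a / (a + b)) powr s + (b / (a + b)) powr s"
    using assms pos by (intro add_mono le) auto
  also have "\<dots> = (a powr s + b powr s) / (a + b) powr s"
    using assms pos by (simp add: powr_divide add_divide_distrib)
  finally show ?thesis using pos by (simp add: field_simps)
qed (use assms in simp)

text \<open>A concave power lies below its tangent at \<open>m\<close>; integrating this in
  \<open>y\<close> is Jensen's inequality. It comes from \<open>exp z \<ge> 1 + z\<close> at two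
  points.\<close>

lemma powr_le_tangent:
  fixes y m r :: real
  assumes "0 \<le> y" "0 < m" "0 < r" "r \<le> 1"
  shows "y powr r \<le> m powr r * ((1 - r) + r * (y / m))"
proof (cases "y = 0")
  case True
  then show ?thesis using assms by simp
next
  case False
  define u where "u = y / m"
  have u: "0 < u" using False assms by (simp add: u_def)
  have "1 = r * (1 + (1 - r) * ln u) + (1 - r) * (1 + (- r) * ln u)"
    by (simp add: algebra_simps)
  also have "\<dots> \<le> r * exp ((1 - r) * ln u) + (1 - r) * exp ((- r) * ln u)"
    using assms by (intro add_mono mult_left_mono exp_ge_add_one_self) auto
  finally have "exp (r * ln u) * 1 \<le> exp (r * ln u) * (r * exp ((1 - r) * ln u) + (1 - r) * exp ((- r) * ln u))"
    by (rule mult_left_mono) simp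
  also have "\<dots> = r * exp (r * ln u + (1 - r) * ln u) + (1 - r) * exp (r * ln u + (- r) * ln u)"
    unfolding exp_add by (simp add: algebra_simps)
  also have "\<dots> = (1 - r) + r * u" using u by (simp add: algebra_simps)
  finally have "u powr r \<le> (1 - r) + r * u" using u by (simp add: powr_def)
  then have "m powr r * u powr r \<le> m powr r * ((1 - r) + r * u)"
    by (rule mult_left_mono) simp
  moreover have "m powr r * u powr r = y powr r"
    using assms by (simp add: u_def powr_divide)
  ultimately show ?thesis by (simp add: u_def)
qed

context sequence_space
begin

definition kernel :: "('a \<Rightarrow> 'x \<Rightarrow> 'x) \<Rightarrow> ('x \<Rightarrow> ennreal) \<Rightarrow> 'x \<Rightarrow> ennreal" where
  "kernel act \<phi> x = (\<integral>\<^sup>+g. \<phi> (act g x) \<partial>M)"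

lemma measurable_kernel:
  fixes act :: "'a \<Rightarrow> 'x::topological_space \<Rightarrow> 'x"
  assumes act: "(\<lambda>p. act (fst p) (snd p)) \<in> borel_measurable (M \<Otimes>\<^sub>M borel)"
    and \<phi>: "\<phi> \<in> borel_measurable borel"
  shows "kernel act \<phi> \<in> borel_measurable borel"
proof -
  have "(\<lambda>p. \<phi> (act (fst p) (snd p))) \<in> borel_measurable (M \<Otimes>\<^sub>M borel)"
    using measurable_compose[OF act \<phi>] .
  then have "(\<lambda>(x, g). \<phi> (act g x)) \<in> borel_measurable (borel \<Otimes>\<^sub>M M)"
    by (subst (asm) measurable_pair_swap_iff) (simp add: split_beta')
  then show ?thesis
    unfolding kernel_def[abs_def] by (rule M.borel_measurable_nn_integral)
qed

lemma measurable_kernel_pow: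
  fixes act :: "'a \<Rightarrow> 'x::topological_space \<Rightarrow> 'x"
  assumes act: "(\<lambda>p. act (fst p) (snd p)) \<in> borel_measurable (M \<Otimes>\<^sub>M borel)"
    and "\<phi> \<in> borel_measurable borel"
  shows "(kernel act ^^ n) \<phi> \<in> borel_measurable borel"
  by (induction n) (auto intro: measurable_kernel[OF act] assms)

lemma measurable_act:
  fixes act :: "'a \<Rightarrow> 'x::topological_space \<Rightarrow> 'x"
  assumes act: "(\<lambda>p. act (fst p) (snd p)) \<in> borel_measurable (M \<Otimes>\<^sub>M borel)"
  shows "(\<lambda>g. act g x) \<in> borel_measurable M"
  using measurable_compose[OF measurable_Pair2' act, of x] by simp

text \<open>The first entry of the sequence acts first, so splitting it off is one application of
  the operator.\<close>

lemma kernel_pow_eq: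
  assumes orb: "\<And>\<omega> x. orb 0 \<omega> x = x" "\<And>n g \<omega> x. orb (Suc n) (case_nat g \<omega>) x = orb n \<omega> (act g x)"
    and meas: "\<And>n x. (\<lambda>\<omega>. \<rho> (orb n \<omega> x)) \<in> borel_measurable S"
  shows "(kernel act ^^ n) \<rho> x = (\<integral>\<^sup>+\<omega>. \<rho> (orb n \<omega> x) \<partial>S)"
proof (induction n arbitrary: x)
  case 0
  then show ?case by (simp add: orb P.emeasure_space_1)
next
  case (Suc n)
  have "(kernel act ^^ Suc n) \<rho> x = (\<integral>\<^sup>+g. \<integral>\<^sup>+\<omega>. \<rho> (orb n \<omega> (act g x)) \<partial>S \<partial>M)"
    by (simp add: kernel_def Suc)
  also have "\<dots> = (\<integral>\<^sup>+g. \<integral>\<^sup>+\<omega>. \<rho> (orb (Suc n) (case_nat g \<omega>) x) \<partial>S \<partial>M)"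
    by (simp add: orb)
  also have "\<dots> = (\<integral>\<^sup>+\<omega>. \<rho> (orb (Suc n) \<omega> x) \<partial>S)"
    by (rule nn_integral_case_nat[OF meas, symmetric])
  finally show ?case .
qed

text \<open>The sum over \<open>N\<close> steps turns a contraction after \<open>N\<close> steps into a contraction in one step.\<close>

definition adapted_weight :: "('a \<Rightarrow> 'x \<Rightarrow> 'x) \<Rightarrow> real \<Rightarrow> nat \<Rightarrow> ('x \<Rightarrow> ennreal) \<Rightarrow> 'x \<Rightarrow> ennreal" where
  "adapted_weight act q N \<rho> x = (\<Sum>k<N. ennreal ((1 / q) ^ k) * (kernel act ^^ k) \<rho> x)"

text \<open>The operator moves each summand to the next up to the factor \<open>q\<close>; the last
  one lands on the contraction after \<open>N\<close> steps, which returns it to the first.\<close>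

lemma kernel_adapted_weight:
  fixes act :: "'a \<Rightarrow> 'x::topological_space \<Rightarrow> 'x"
  assumes act: "(\<lambda>p. act (fst p) (snd p)) \<in> borel_measurable (M \<Otimes>\<^sub>M borel)"
    and \<rho>: "\<rho> \<in> borel_measurable borel" and q: "0 < q"
    and step: "(kernel act ^^ N) \<rho> x \<le> ennreal (q ^ N) * \<rho> x"
  shows "kernel act (adapted_weight act q N \<rho>) x \<le> ennreal q * adapted_weight act q N \<rho> x"
proof (cases N)
  case 0
  then show ?thesis by (simp add: adapted_weight_def[abs_def] kernel_def)
next
  case (Suc m)
  let ?K = "kernel act"
  have c: "ennreal q * (ennreal ((1 / q) ^ Suc k) * y) = ennreal ((1 / q) ^ k) * y" for k y
    using q by (simp add: mult.assoc[symmetric] ennreal_mult[symmetric])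
  have "?K (adapted_weight act q N \<rho>) x = (\<Sum>k<N. ennreal ((1 / q) ^ k) * (?K ^^ Suc k) \<rho> x)"
  proof -
    have "(\<lambda>g. (?K ^^ k) \<rho> (act g x)) \<in> borel_measurable M" for k
      using measurable_compose[OF measurable_act[OF act] measurable_kernel_pow[OF act \<rho>]] .
    then show ?thesis
      unfolding adapted_weight_def[abs_def] kernel_def[of act "\<lambda>x. \<Sum>k<N. ennreal ((1 / q) ^ k) * (?K ^^ k) \<rho> x"]
      by (simp add: nn_integral_sum nn_integral_cmult kernel_def)
  qed
  also have "\<dots> = (\<Sum>k<N. ennreal q * (ennreal ((1 / q) ^ Suc k) * (?K ^^ Suc k) \<rho> x))"
    unfolding c ..
  also have "\<dots> = ennreal q * (\<Sum>k<Suc m. ennreal ((1 / q) ^ Suc k) * (?K ^^ Suc k) \<rho> x)"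
    unfolding Suc by (rule sum_distrib_left[symmetric])
  also have "(\<Sum>k<Suc m. ennreal ((1 / q) ^ Suc k) * (?K ^^ Suc k) \<rho> x)
      = (\<Sum>k<m. ennreal ((1 / q) ^ Suc k) * (?K ^^ Suc k) \<rho> x) + ennreal ((1 / q) ^ N) * (?K ^^ N) \<rho> x"
    unfolding Suc by (rule sum.lessThan_Suc)
  also have "\<dots> \<le> (\<Sum>k<m. ennreal ((1 / q) ^ Suc k) * (?K ^^ Suc k) \<rho> x) + \<rho> x"
  proof (rule add_left_mono)
    have "ennreal ((1 / q) ^ N) * (?K ^^ N) \<rho> x \<le> ennreal ((1 / q) ^ N) * (ennreal (q ^ N) * \<rho> x)"
      by (rule mult_left_mono[OF step]) simp
    also have "\<dots> = \<rho> x"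
      using q by (simp add: mult.assoc[symmetric] ennreal_mult[symmetric] power_mult_distrib[symmetric])
    finally show "ennreal ((1 / q) ^ N) * (?K ^^ N) \<rho> x \<le> \<rho> x" .
  qed
  also have "\<dots> = adapted_weight act q N \<rho> x"
    unfolding adapted_weight_def Suc sum.lessThan_Suc_shift by (simp add: add.commute)
  finally show ?thesis by (simp add: mult_left_mono)
qed

end

text \<open>
  In the mean of the \<open>s\<close>-th power, \<open>N\<close> grows on \<open>W\<close> at rate at most \<open>t\<close>. Witnessing this by a weight
  \<open>w\<close> equivalent to \<open>N powr s\<close> that satisfies a one-step inequality makes the property stable under
  perturbations of \<open>\<nu>\<close>, and it needs no logarithms, which would be wrong on the zero space.
\<close>

definition moment_growth ::
  "(real ^ 'd ^ 'd) measure \<Rightarrow> (real ^ 'd) set \<Rightarrow> (real ^ 'd \<Rightarrow> real) \<Rightarrow> real \<Rightarrow> real \<Rightarrow> bool" where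
  "moment_growth \<nu> W N s t \<longleftrightarrow> (\<exists>w C. w \<in> borel_measurable borel \<and> 0 \<le> C \<and>
     (\<forall>x\<in>W. N x powr s \<le> w x \<and> w x \<le> C * N x powr s) \<and>
     (\<forall>x\<in>W. \<forall>y\<in>W. w (x + y) \<le> w x + w y) \<and>
     (\<forall>x\<in>W. (\<integral>\<^sup>+g. ennreal (w (g *v x)) \<partial>\<nu>) \<le> ennreal (exp (s * t) * w x)))"

context matrix_law
begin

lemma measurable_matvec_act: "(\<lambda>p. fst p *v snd p) \<in> borel_measurable (\<nu> \<Otimes>\<^sub>M borel)"
proof -
  have [measurable]: "fst \<in> borel_measurable (\<nu> \<Otimes>\<^sub>M (borel :: (real ^ 'd) measure))"
    using measurable_compose[OF measurable_fst measurable_ident_\<nu>] .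
  show ?thesis by measurable
qed

lemma kernel_pow_matvec:
  assumes [measurable]: "\<rho> \<in> borel_measurable borel"
  shows "(kernel (*v) ^^ n) \<rho> x = (\<integral>\<^sup>+\<omega>. \<rho> (MP n \<omega> *v x) \<partial>S)"
  by (rule kernel_pow_eq[where orb = "\<lambda>n \<omega> x. MP n \<omega> *v x"])
    (simp_all del: matrix_product.simps(2) add: matrix_product_case_nat matrix_vector_mul_assoc)

text \<open>The weight is the adapted weight of \<open>N powr s\<close>. Its first summand gives the
  lower bound, \<open>b\<close> the upper one, and \<open>s \<le> 1\<close> makes it
  subadditive.\<close>

lemma moment_growth_of_steps:
  assumes W: "subspace W" and inv: "\<And>g x. g \<in> \<Sigma> \<Longrightarrow> x \<in> W \<Longrightarrow> g *v x \<in> W"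
    and Nm[measurable]: "N \<in> borel_measurable borel" and N0: "\<And>x. 0 \<le> N x"
    and Nb: "\<And>g x. g \<in> \<Sigma> \<Longrightarrow> x \<in> W \<Longrightarrow> N (g *v x) \<le> b * N x"
    and Nadd: "\<And>x y. x \<in> W \<Longrightarrow> y \<in> W \<Longrightarrow> N (x + y) \<le> N x + N y"
    and s: "0 < s" "s \<le> 1" and n: "1 \<le> n"
    and step: "\<And>x. x \<in> W \<Longrightarrow> (\<integral>\<^sup>+\<omega>. ennreal (N (MP n \<omega> *v x) powr s) \<partial>S) \<le> ennreal (exp (s * n * t) * N x powr s)"
  shows "moment_growth \<nu> W N s t"
proof -
  define \<rho> where "\<rho> x = ennreal (N x powr s)" for x
  let ?K = "kernel (*v)"
  have \<rho>m[measurable]: "\<rho> \<in> borel_measurable borel" unfolding \<rho>_def by measurable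
  define q where "q = exp (s * t)"
  have q: "0 < q" by (simp add: q_def)
  have invK: "g *v x \<in> W" if "g \<in> space \<nu>" "x \<in> W" for g x using that inv space_\<nu> by simp
  have Kb: "(?K ^^ k) \<rho> x \<le> ennreal (b powr (s * k) * N x powr s)" if "x \<in> W" for k x
    using that
  proof (induction k arbitrary: x)
    case 0
    then show ?case using b1 by (simp add: \<rho>_def)
  next
    case (Suc k)
    have "(?K ^^ Suc k) \<rho> x \<le> (\<integral>\<^sup>+g. ennreal (b powr (s * Suc k) * N x powr s) \<partial>\<nu>)"
      unfolding funpow.simps(2) comp_def kernel_def[of "(*v)" "(?K ^^ k) \<rho>"]
    proof (rule nn_integral_mono)
      fix g assume g: "g \<in> space \<nu>"
      have "(?K ^^ k) \<rho> (g *v x) \<le> ennreal (b powr (s * k) * N (g *v x) powr s)"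
        using Suc invK[OF g] by blast
      also have "\<dots> \<le> ennreal (b powr (s * k) * (b * N x) powr s)"
        using Nb[of g x] g Suc.prems space_\<nu> N0 s by (intro ennreal_leI mult_left_mono powr_mono2) auto
      also have "b powr (s * k) * (b * N x) powr s = b powr (s * Suc k) * N x powr s"
        using b1 N0[of x] by (simp add: powr_mult powr_add[symmetric] algebra_simps)
      finally show "(?K ^^ k) \<rho> (g *v x) \<le> ennreal (b powr (s * Suc k) * N x powr s)" .
    qed
    then show ?case by (simp add: M.emeasure_space_1)
  qed
  have Kadd: "(?K ^^ k) \<rho> (x + y) \<le> (?K ^^ k) \<rho> x + (?K ^^ k) \<rho> y" if "x \<in> W" "y \<in> W" for k x y
    using that
  proof (induction k arbitrary: x y)
    case 0
    have "N (x + y) powr s \<le> (N x + N y) powr s"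
      using Nadd 0 N0 s by (intro powr_mono2) auto
    also have "\<dots> \<le> N x powr s + N y powr s"
      using N0 s by (intro powr_add_le_add) auto
    finally show ?case by (simp add: \<rho>_def ennreal_plus[symmetric] del: ennreal_plus)
  next
    case (Suc k)
    have [measurable]: "(\<lambda>g. (?K ^^ k) \<rho> (g *v z)) \<in> borel_measurable \<nu>" for z
      using measurable_compose[OF measurable_act[OF measurable_matvec_act] measurable_kernel_pow[OF measurable_matvec_act \<rho>m]] .
    have "(?K ^^ Suc k) \<rho> (x + y) \<le> (\<integral>\<^sup>+g. (?K ^^ k) \<rho> (g *v x) + (?K ^^ k) \<rho> (g *v y) \<partial>\<nu>)"
      unfolding funpow.simps(2) comp_def kernel_def[of "(*v)" "(?K ^^ k) \<rho>"]
      using Suc invK by (intro nn_integral_mono) (simp add: matrix_vector_right_distrib)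
    also have "\<dots> = (?K ^^ Suc k) \<rho> x + (?K ^^ Suc k) \<rho> y"
      unfolding funpow.simps(2) comp_def kernel_def[of "(*v)" "(?K ^^ k) \<rho>"]
      by (rule nn_integral_add) auto
    finally show ?case .
  qed
  define we where "we = adapted_weight (*v) q n \<rho>"
  define w where "w x = enn2real (we x)" for x
  define C where "C = (\<Sum>k<n. (1 / q) ^ k * b powr (s * k))"
  have we_m[measurable]: "we \<in> borel_measurable borel"
    unfolding we_def adapted_weight_def[abs_def]
    using measurable_kernel_pow[OF measurable_matvec_act \<rho>m, measurable] by measurable
  have C0: "0 \<le> C" unfolding C_def using q by (intro sum_nonneg) auto
  have we_le: "we x \<le> ennreal (C * N x powr s)" if "x \<in> W" for x
  proof -
    have "we x \<le> (\<Sum>k<n. ennreal ((1 / q) ^ k) * ennreal (b powr (s * k) * N x powr s))"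
      unfolding we_def adapted_weight_def by (intro sum_mono mult_left_mono Kb that) auto
    also have "\<dots> = ennreal (\<Sum>k<n. (1 / q) ^ k * (b powr (s * k) * N x powr s))"
      using q by (subst sum_ennreal[symmetric]) (auto simp: ennreal_mult)
    also have "(\<Sum>k<n. (1 / q) ^ k * (b powr (s * k) * N x powr s)) = C * N x powr s"
      unfolding C_def sum_distrib_right by (simp add: mult.assoc)
    finally show ?thesis .
  qed
  then have we_fin: "we x < \<top>" if "x \<in> W" for x
    using that by (meson ennreal_less_top le_less_trans)
  have we_w: "we x = ennreal (w x)" if "x \<in> W" for x
    unfolding w_def using we_fin[OF that] by simp
  have w0: "0 \<le> w x" for x by (simp add: w_def)
  show ?thesis
    unfolding moment_growth_def
  proof (intro exI conjI ballI)
    show "w \<in> borel_measurable borel" unfolding w_def by measurable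
    show "0 \<le> C" by (rule C0)
  next
    fix x assume x: "x \<in> W"
    have "\<rho> x = ennreal ((1 / q) ^ 0) * (?K ^^ 0) \<rho> x" by simp
    also have "\<dots> \<le> we x"
      unfolding we_def adapted_weight_def using n by (intro member_le_sum) auto
    finally show "N x powr s \<le> w x"
      using we_w[OF x] w0[of x] by (simp add: \<rho>_def)
    show "w x \<le> C * N x powr s"
      using we_le[OF x] C0 we_w[OF x] by (simp add: ennreal_le_iff)
  next
    fix x y assume x: "x \<in> W" "y \<in> W"
    have "we (x + y) \<le> we x + we y"
      unfolding we_def adapted_weight_def sum.distrib[symmetric] distrib_left[symmetric]
      by (intro sum_mono mult_left_mono Kadd x) auto
    then show "w (x + y) \<le> w x + w y"
      using we_w x subspace_add[OF W x] w0 by (simp add: ennreal_plus[symmetric] del: ennreal_plus)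
  next
    fix x assume x: "x \<in> W"
    have "(\<integral>\<^sup>+g. ennreal (w (g *v x)) \<partial>\<nu>) = ?K we x"
      unfolding kernel_def using x invK we_w by (intro nn_integral_cong) auto
    also have "\<dots> \<le> ennreal q * we x"
      unfolding we_def
    proof (rule kernel_adapted_weight[OF measurable_matvec_act \<rho>m q])
      have "(?K ^^ n) \<rho> x \<le> ennreal (exp (s * n * t) * N x powr s)"
        unfolding kernel_pow_matvec[OF \<rho>m] using step[OF x] by (simp add: \<rho>_def)
      also have "exp (s * n * t) = q ^ n" by (simp add: q_def exp_of_nat_mult[symmetric] mult_ac)
      finally show "(?K ^^ n) \<rho> x \<le> ennreal (q ^ n) * \<rho> x"
        using q by (simp add: \<rho>_def[of x] ennreal_mult)
    qed
    also have "\<dots> = ennreal (exp (s * t) * w x)"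
      using we_w[OF x] w0 by (simp add: q_def ennreal_mult)
    finally show "(\<integral>\<^sup>+g. ennreal (w (g *v x)) \<partial>\<nu>) \<le> ennreal (exp (s * t) * w x)" .
  qed
qed


text \<open>Jensen's inequality for the power \<open>r = s' / s\<close> of the weight, in the form
  of the tangent at \<open>m\<close>. It serves to bring two subspaces to a common exponent.\<close>

lemma moment_growth_exponent_mono:
  assumes W: "subspace W" and inv: "\<And>g x. g \<in> \<Sigma> \<Longrightarrow> x \<in> W \<Longrightarrow> g *v x \<in> W"
    and mg: "moment_growth \<nu> W N s t" and s': "0 < s'" "s' \<le> s"
  shows "moment_growth \<nu> W N s' t"
proof -
  obtain w C where w[measurable]: "w \<in> borel_measurable borel" and C: "0 \<le> C"
    and lo: "\<And>x. x \<in> W \<Longrightarrow> N x powr s \<le> w x" and up: "\<And>x. x \<in> W \<Longrightarrow> w x \<le> C * N x powr s"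
    and add: "\<And>x y. x \<in> W \<Longrightarrow> y \<in> W \<Longrightarrow> w (x + y) \<le> w x + w y"
    and int: "\<And>x. x \<in> W \<Longrightarrow> (\<integral>\<^sup>+g. ennreal (w (g *v x)) \<partial>\<nu>) \<le> ennreal (exp (s * t) * w x)"
    using mg unfolding moment_growth_def by blast
  define r where "r = s' / s"
  have r: "0 < r" "r \<le> 1" "s * r = s'" using s' by (auto simp: r_def)
  have w0: "0 \<le> w x" if "x \<in> W" for x using lo[OF that] powr_ge_zero order_trans by blast
  have pw: "(N x powr s) powr r = N x powr s'" for x using r by (simp add: powr_powr)
  have gW: "g *v x \<in> W" if "g \<in> space \<nu>" "x \<in> W" for g x using that inv space_\<nu> by simp
  show ?thesis
    unfolding moment_growth_def
  proof (intro exI[of _ "\<lambda>x. w x powr r"] exI[of _ "C powr r"] conjI ballI)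
    fix x assume x: "x \<in> W"
    show "N x powr s' \<le> w x powr r"
      unfolding pw[symmetric] using lo[OF x] r by (intro powr_mono2) auto
    have "w x powr r \<le> (C * N x powr s) powr r"
      using up[OF x] r w0[OF x] by (intro powr_mono2) auto
    then show "w x powr r \<le> C powr r * N x powr s'"
      using C by (simp add: powr_mult pw)
    show "w (x + y) powr r \<le> w x powr r + w y powr r" if y: "y \<in> W" for y
    proof -
      have "w (x + y) powr r \<le> (w x + w y) powr r"
        using add[OF x y] w0[OF subspace_add[OF W x y]] r by (intro powr_mono2) auto
      also have "\<dots> \<le> w x powr r + w y powr r"
        using w0 x y r by (intro powr_add_le_add) auto
      finally show ?thesis .
    qed
    define m where "m = exp (s * t) * w x"
    show "(\<integral>\<^sup>+g. ennreal (w (g *v x) powr r) \<partial>\<nu>) \<le> ennreal (exp (s' * t) * w x powr r)"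
    \<comment> \<open>There is no tangent at 0; in that case the weight vanishes almost surely after
      one step.\<close>
    proof (cases "m = 0")
      case True
      then have "(\<integral>\<^sup>+g. ennreal (w (g *v x)) \<partial>\<nu>) = 0" using int[OF x] by (simp add: m_def)
      then have "AE g in \<nu>. ennreal (w (g *v x)) = 0" by (subst (asm) nn_integral_0_iff_AE) auto
      then have "AE g in \<nu>. ennreal (w (g *v x) powr r) = 0"
        using AE_space
      proof eventually_elim
        case (elim g)
        then show ?case using w0[OF gW[OF elim(2) x]] by (simp add: ennreal_eq_0_iff)
      qed
      then have "(\<integral>\<^sup>+g. ennreal (w (g *v x) powr r) \<partial>\<nu>) = (\<integral>\<^sup>+g. 0 \<partial>\<nu>)"
        by (rule nn_integral_cong_AE)
      then show ?thesis by simp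
    next
      case False
      then have m: "0 < m" using w0[OF x] by (simp add: m_def less_le)
      have "(\<integral>\<^sup>+g. ennreal (w (g *v x) powr r) \<partial>\<nu>)
          \<le> (\<integral>\<^sup>+g. ennreal (m powr r * (1 - r)) + ennreal (m powr r * r / m) * ennreal (w (g *v x)) \<partial>\<nu>)"
      proof (rule nn_integral_mono)
        fix g assume g: "g \<in> space \<nu>"
        have "w (g *v x) powr r \<le> m powr r * (1 - r) + m powr r * r / m * w (g *v x)"
          using powr_le_tangent[OF w0[OF gW[OF g x]] m r(1,2)] by (simp add: algebra_simps)
        then show "ennreal (w (g *v x) powr r)
            \<le> ennreal (m powr r * (1 - r)) + ennreal (m powr r * r / m) * ennreal (w (g *v x))"
          using r m w0[OF gW[OF g x]] by (simp add: ennreal_mult[symmetric] ennreal_plus[symmetric] ennreal_leI del: ennreal_plus)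
      qed
      also have "\<dots> = ennreal (m powr r * (1 - r)) + ennreal (m powr r * r / m) * (\<integral>\<^sup>+g. ennreal (w (g *v x)) \<partial>\<nu>)"
        by (subst nn_integral_add) (auto simp: nn_integral_cmult M.emeasure_space_1)
      also have "\<dots> \<le> ennreal (m powr r * (1 - r)) + ennreal (m powr r * r / m) * ennreal m"
        using int[OF x] by (intro add_left_mono mult_left_mono) (auto simp: m_def)
      also have "\<dots> = ennreal (m powr r)"
        using r m by (simp add: ennreal_mult[symmetric] ennreal_plus[symmetric] algebra_simps del: ennreal_plus)
      also have "m powr r = exp (s' * t) * w x powr r"
        using w0[OF x] r by (simp add: m_def powr_mult) (simp add: powr_def mult_ac)
      finally show ?thesis .
    qed
  qed simp_all
qed

text \<open>
  In \<open>k * u x + w (x - P x)\<close> a large \<open>k\<close> absorbs the off-diagonal block of the action on \<open>V \<subseteq> V'\<close>.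
\<close>

lemma moment_growth_extension:
  assumes V': "subspace V'" and V: "subspace V" "V \<subseteq> V'"
    and inv': "\<And>g x. g \<in> \<Sigma> \<Longrightarrow> x \<in> V' \<Longrightarrow> g *v x \<in> V'"
    and inv: "\<And>g x. g \<in> \<Sigma> \<Longrightarrow> x \<in> V \<Longrightarrow> g *v x \<in> V"
    and P: "linear P" "\<And>x. norm (P x) \<le> norm x" "\<And>x. x - P x \<in> V" "\<And>x. x \<in> V \<Longrightarrow> P x = 0"
    and mV: "moment_growth \<nu> V norm s t" and mQ: "moment_growth \<nu> V' (\<lambda>x. norm (P x)) s t"
    and s: "0 < s" "s \<le> 1" and t: "t < t'"
  shows "moment_growth \<nu> V' norm s t'"
proof -
  obtain w C where w[measurable]: "w \<in> borel_measurable borel" and C: "0 \<le> C"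
    and lo: "\<And>x. x \<in> V \<Longrightarrow> norm x powr s \<le> w x" and up: "\<And>x. x \<in> V \<Longrightarrow> w x \<le> C * norm x powr s"
    and add: "\<And>x y. x \<in> V \<Longrightarrow> y \<in> V \<Longrightarrow> w (x + y) \<le> w x + w y"
    and int: "\<And>x. x \<in> V \<Longrightarrow> (\<integral>\<^sup>+g. ennreal (w (g *v x)) \<partial>\<nu>) \<le> ennreal (exp (s * t) * w x)"
    using mV unfolding moment_growth_def by blast
  obtain u D where u[measurable]: "u \<in> borel_measurable borel" and D: "0 \<le> D"
    and ulo: "\<And>x. x \<in> V' \<Longrightarrow> norm (P x) powr s \<le> u x" and uup: "\<And>x. x \<in> V' \<Longrightarrow> u x \<le> D * norm (P x) powr s"
    and uadd: "\<And>x y. x \<in> V' \<Longrightarrow> y \<in> V' \<Longrightarrow> u (x + y) \<le> u x + u y"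
    and uint: "\<And>x. x \<in> V' \<Longrightarrow> (\<integral>\<^sup>+g. ennreal (u (g *v x)) \<partial>\<nu>) \<le> ennreal (exp (s * t) * u x)"
    using mQ unfolding moment_growth_def by blast
  have Pm[measurable]: "P \<in> borel_measurable borel"
    by (intro borel_measurable_continuous_onI linear_continuous_on) (use P(1) linear_conv_bounded_linear in blast)
  define R where "R x = x - P x" for x
  have RV: "R x \<in> V" for x using P(3) by (simp add: R_def)
  have Rm[measurable]: "R \<in> borel_measurable borel" unfolding R_def by measurable
  have Rlin: "R (x + y) = R x + R y" "R (x - y) = R x - R y" for x y
    using P(1) by (simp_all add: R_def linear_add linear_diff)
  have RVid: "R x = x" if "x \<in> V" for x using P(4)[OF that] by (simp add: R_def)
  have PV': "P x \<in> V'" if "x \<in> V'" for x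
    using subspace_diff[OF V' that subsetD[OF V(2) P(3)[of x]]] by simp
  have normR: "norm (R x) \<le> 2 * norm x" for x
    using norm_triangle_ineq4[of x "P x"] P(2)[of x] by (simp add: R_def)
  \<comment> \<open>Bounds the block that maps the quotient into \<open>V\<close>: \<open>R\<close>
    at most doubles a norm and an element of \<Sigma> multiplies it by at most
    \<open>b\<close>.\<close>
  define c where "c = C * (2 * b) powr s"
  have c: "0 \<le> c" using C by (simp add: c_def)
  \<comment> \<open>Solves \<open>exp (s * t) * k + c \<le> exp (s * t') * k\<close>; this is where
    the rate \<open>t\<close> has to be raised to \<open>t'\<close>.\<close>
  define k where "k = max 1 (c / (exp (s * t') - exp (s * t)))"
  have ex: "exp (s * t) < exp (s * t')" using s t by simp
  have k: "1 \<le> k" "exp (s * t) * k + c \<le> exp (s * t') * k"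
  proof -
    show "1 \<le> k" by (simp add: k_def)
    have "c / (exp (s * t') - exp (s * t)) \<le> k" by (simp add: k_def)
    then show "exp (s * t) * k + c \<le> exp (s * t') * k" using ex by (simp add: field_simps)
  qed
  have u0: "0 \<le> u x" if "x \<in> V'" for x using ulo[OF that] powr_ge_zero order_trans by blast
  have w0: "0 \<le> w x" if "x \<in> V" for x using lo[OF that] powr_ge_zero order_trans by blast
  have gV: "g *v x \<in> V" "g *v y \<in> V'" if "g \<in> space \<nu>" "x \<in> V" "y \<in> V'" for g x y
    using that inv inv' space_\<nu> by auto
  show ?thesis
    unfolding moment_growth_def
  proof (intro exI[of _ "\<lambda>x. k * u x + w (R x)"] exI[of _ "k * D + C * 2 powr s"] conjI ballI)
    fix x assume x: "x \<in> V'"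
    have "norm x powr s \<le> (norm (P x) + norm (R x)) powr s"
      using s norm_triangle_ineq[of "P x" "R x"] by (intro powr_mono2) (auto simp: R_def)
    also have "\<dots> \<le> norm (P x) powr s + norm (R x) powr s"
      using s by (intro powr_add_le_add) auto
    also have "\<dots> \<le> k * u x + w (R x)"
      using ulo[OF x] lo[OF RV] mult_right_mono[OF k(1) u0[OF x]] by (intro add_mono) auto
    finally show "norm x powr s \<le> k * u x + w (R x)" .
    have "u x \<le> D * norm x powr s"
      using uup[OF x] mult_left_mono[OF powr_mono2[of s "norm (P x)" "norm x"] D] P(2) s by fastforce
    moreover have "w (R x) \<le> C * (2 * norm x) powr s"
      using up[OF RV, of x] mult_left_mono[OF powr_mono2[of s "norm (R x)" "2 * norm x"] C] normR s by fastforce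
    ultimately have "k * u x + w (R x) \<le> k * (D * norm x powr s) + C * (2 * norm x) powr s"
      using k by (intro add_mono mult_left_mono) auto
    then show "k * u x + w (R x) \<le> (k * D + C * 2 powr s) * norm x powr s"
      by (simp add: powr_mult algebra_simps)
    show "k * u (x + y) + w (R (x + y)) \<le> k * u x + w (R x) + (k * u y + w (R y))" if y: "y \<in> V'" for y
      using mult_left_mono[OF uadd[OF x y], of k] k add[OF RV RV, of x y] by (simp add: Rlin algebra_simps)
    have "(\<integral>\<^sup>+g. ennreal (k * u (g *v x) + w (R (g *v x))) \<partial>\<nu>)
        \<le> (\<integral>\<^sup>+g. ennreal k * ennreal (u (g *v x)) + ennreal (w (g *v R x)) + ennreal (c * u x) \<partial>\<nu>)"
    proof (rule nn_integral_mono)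
      fix g assume g: "g \<in> space \<nu>"
      \<comment> \<open>The first summand stays in \<open>V\<close>, so \<open>R\<close> fixes it;
        the second is the off-diagonal contribution.\<close>
      have "g *v x = g *v R x + g *v P x"
        by (simp add: R_def matrix_vector_right_distrib[symmetric])
      then have "R (g *v x) = g *v R x + R (g *v P x)"
        using gV(1)[OF g RV x] by (simp add: Rlin RVid)
      then have "w (R (g *v x)) \<le> w (g *v R x) + w (R (g *v P x))"
        using add[OF gV(1)[OF g RV x] RV] by simp
      also have "w (R (g *v P x)) \<le> C * norm (R (g *v P x)) powr s" by (rule up[OF RV])
      also have "\<dots> \<le> C * (2 * b * norm (P x)) powr s"
        using normR[of "g *v P x"] norm_le_b[of g "P x"] g space_\<nu> s C
        by (intro mult_left_mono powr_mono2) auto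
      also have "\<dots> = c * norm (P x) powr s" using b1 by (simp add: c_def powr_mult)
      also have "\<dots> \<le> c * u x" using ulo[OF x] c by (intro mult_left_mono)
      finally have "k * u (g *v x) + w (R (g *v x)) \<le> k * u (g *v x) + w (g *v R x) + c * u x" by simp
      then show "ennreal (k * u (g *v x) + w (R (g *v x)))
         \<le> ennreal k * ennreal (u (g *v x)) + ennreal (w (g *v R x)) + ennreal (c * u x)"
        using k c u0[OF x] u0[OF gV(2)[OF g RV x]] w0[OF gV(1)[OF g RV x]]
        by (simp add: ennreal_mult[symmetric] ennreal_plus[symmetric] ennreal_leI del: ennreal_plus)
    qed
    also have "\<dots> = ennreal k * (\<integral>\<^sup>+g. ennreal (u (g *v x)) \<partial>\<nu>) + (\<integral>\<^sup>+g. ennreal (w (g *v R x)) \<partial>\<nu>) + ennreal (c * u x)"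
      by (simp add: nn_integral_add nn_integral_cmult M.emeasure_space_1)
    also have "\<dots> \<le> ennreal k * ennreal (exp (s * t) * u x) + ennreal (exp (s * t) * w (R x)) + ennreal (c * u x)"
      by (intro add_mono mult_left_mono uint[OF x] int[OF RV]) auto
    also have "\<dots> = ennreal (k * (exp (s * t) * u x) + exp (s * t) * w (R x) + c * u x)"
      using k c u0[OF x] w0[OF RV]
      by (simp add: ennreal_mult[symmetric] ennreal_plus[symmetric] del: ennreal_plus)
    also have "\<dots> \<le> ennreal (exp (s * t') * (k * u x + w (R x)))"
    proof (rule ennreal_leI)
      have "(exp (s * t) * k + c) * u x \<le> exp (s * t') * k * u x"
        using k(2) u0[OF x] by (rule mult_right_mono)
      moreover have "exp (s * t) * w (R x) \<le> exp (s * t') * w (R x)"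
        using ex w0[OF RV] by (intro mult_right_mono) auto
      ultimately show "k * (exp (s * t) * u x) + exp (s * t) * w (R x) + c * u x \<le> exp (s * t') * (k * u x + w (R x))"
        by (simp add: algebra_simps)
    qed
    finally show "(\<integral>\<^sup>+g. ennreal (k * u (g *v x) + w (R (g *v x))) \<partial>\<nu>) \<le> ennreal (exp (s * t') * (k * u x + w (R x)))" .
  qed (use k D C in auto)
qed

lemma moment_growth_pow:
  assumes inv: "\<And>g x. g \<in> \<Sigma> \<Longrightarrow> x \<in> W \<Longrightarrow> g *v x \<in> W"
    and mg: "moment_growth \<nu> W N s t"
    and Nm[measurable]: "N \<in> borel_measurable borel"
  obtains C where "0 \<le> C" "\<And>n x. x \<in> W \<Longrightarrow>
    (\<integral>\<^sup>+\<omega>. ennreal (N (MP n \<omega> *v x) powr s) \<partial>S) \<le> ennreal (C * exp (s * n * t) * N x powr s)"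
proof -
  obtain w C where w[measurable]: "w \<in> borel_measurable borel" and C: "0 \<le> C"
    and lo: "\<And>x. x \<in> W \<Longrightarrow> N x powr s \<le> w x" and up: "\<And>x. x \<in> W \<Longrightarrow> w x \<le> C * N x powr s"
    and int: "\<And>x. x \<in> W \<Longrightarrow> (\<integral>\<^sup>+g. ennreal (w (g *v x)) \<partial>\<nu>) \<le> ennreal (exp (s * t) * w x)"
    using mg unfolding moment_growth_def by blast
  let ?K = "kernel (*v)"
  have w0: "0 \<le> w x" if "x \<in> W" for x using lo[OF that] powr_ge_zero order_trans by blast
  have gW: "g *v x \<in> W" if "g \<in> space \<nu>" "x \<in> W" for g x using that inv space_\<nu> by simp
  have MPW: "MP n \<omega> *v x \<in> W" if "\<omega> \<in> space S" "x \<in> W" for n \<omega> x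
  proof (induction n)
    case (Suc n)
    then show ?case using gW[of "\<omega> n" "MP n \<omega> *v x"] that
      by (simp add: matrix_vector_mul_assoc[symmetric] space_S)
  qed (use that in simp)
  have pow: "(?K ^^ n) (\<lambda>x. ennreal (w x)) x \<le> ennreal (exp (s * t) ^ n * w x)" if "x \<in> W" for n x
    using that
  proof (induction n arbitrary: x)
    case (Suc n)
    have "(?K ^^ Suc n) (\<lambda>x. ennreal (w x)) x \<le> (\<integral>\<^sup>+g. ennreal (exp (s * t) ^ n) * ennreal (w (g *v x)) \<partial>\<nu>)"
      unfolding funpow.simps(2) comp_def kernel_def[of "(*v)" "(?K ^^ n) (\<lambda>x. ennreal (w x))"]
      using Suc gW w0 by (intro nn_integral_mono) (simp add: ennreal_mult[symmetric])
    also have "\<dots> = ennreal (exp (s * t) ^ n) * (\<integral>\<^sup>+g. ennreal (w (g *v x)) \<partial>\<nu>)"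
      by (rule nn_integral_cmult) simp
    also have "\<dots> \<le> ennreal (exp (s * t) ^ n) * ennreal (exp (s * t) * w x)"
      by (intro mult_left_mono int Suc.prems) simp
    also have "\<dots> = ennreal (exp (s * t) ^ Suc n * w x)"
      using w0[OF Suc.prems] by (simp add: ennreal_mult[symmetric] mult_ac)
    finally show ?case .
  qed simp
  show ?thesis
  proof (rule that[OF C])
    fix n x assume x: "x \<in> W"
    have "(\<integral>\<^sup>+\<omega>. ennreal (N (MP n \<omega> *v x) powr s) \<partial>S) \<le> (\<integral>\<^sup>+\<omega>. ennreal (w (MP n \<omega> *v x)) \<partial>S)"
      using lo[OF MPW[OF _ x]] by (intro nn_integral_mono ennreal_leI) auto
    also have "\<dots> = (?K ^^ n) (\<lambda>x. ennreal (w x)) x"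
      by (rule kernel_pow_matvec[symmetric]) measurable
    also have "\<dots> \<le> ennreal (exp (s * t) ^ n * w x)" by (rule pow[OF x])
    also have "\<dots> \<le> ennreal (C * exp (s * n * t) * N x powr s)"
    proof (rule ennreal_leI)
      have "exp (s * t) ^ n = exp (s * n * t)" by (simp add: exp_of_nat_mult[symmetric] mult_ac)
      then show "exp (s * t) ^ n * w x \<le> C * exp (s * n * t) * N x powr s"
        using mult_left_mono[OF up[OF x], of "exp (s * n * t)"] by (simp add: mult_ac)
    qed
    finally show "(\<integral>\<^sup>+\<omega>. ennreal (N (MP n \<omega> *v x) powr s) \<partial>S) \<le> ennreal (C * exp (s * n * t) * N x powr s)" .
  qed
qed

text \<open>The s-th power of the operator norm is at most the sum of those of the images of the
  unit vectors, so its mean obeys the moment bound. Jensen's inequality for the logarithm then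
  bounds the mean logarithm.\<close>

lemma lyapunov_exponent_le_moment_growth:
  assumes mg: "moment_growth \<nu> UNIV norm s t" and s: "0 < s" "s \<le> 1"
  shows "lyapunov_exponent 1 \<nu> \<le> t"
proof -
  obtain C where C: "0 \<le> C" and le: "\<And>n x. (\<integral>\<^sup>+\<omega>. ennreal (norm (MP n \<omega> *v x) powr s) \<partial>S)
      \<le> ennreal (C * exp (s * n * t) * norm x powr s)"
    using moment_growth_pow[OF _ mg] by (metis UNIV_I borel_measurable_norm measurable_ident_sets)
  define D where "D = C * (\<Sum>i\<in>(UNIV :: 'd set). norm (axis i (1::real)) powr s)"
  have D: "0 \<le> D" unfolding D_def using C by (intro mult_nonneg_nonneg sum_nonneg) auto
  have sum_powr: "(\<Sum>i\<in>I. f i) powr s \<le> (\<Sum>i\<in>I. f i powr s)"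
    if "finite I" "\<And>i. 0 \<le> f i" for I :: "'d set" and f :: "'d \<Rightarrow> real"
    using that(1)
  proof (induction I rule: finite_induct)
    case (insert i I)
    have "(\<Sum>j\<in>insert i I. f j) powr s \<le> f i powr s + (\<Sum>j\<in>I. f j) powr s"
      using insert that(2) s by (simp add: powr_add_le_add sum_nonneg)
    then show ?case using insert by simp
  qed simp
  have sn: "spectral_norm A powr s \<le> (\<Sum>i\<in>UNIV. norm (A *v axis i 1) powr s)" for A :: "real ^ 'd ^ 'd"
  proof -
    obtain v where v: "norm v = 1" "norm (A *v v) = spectral_norm A"
      using ex_norm_eq_spectral_norm[of A] by blast
    have "A *v v = (\<Sum>i\<in>UNIV. v $ i *\<^sub>R (A *v axis i 1))"
      by (simp only: matrix_mult_sum[of A v] matrix_vector_mult_basis scalar_mult_eq_scaleR)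
    then have "norm (A *v v) \<le> (\<Sum>i\<in>UNIV. norm (v $ i *\<^sub>R (A *v axis i 1)))"
      by (metis norm_sum)
    also have "\<dots> \<le> (\<Sum>i\<in>UNIV. norm (A *v axis i 1))"
    proof (intro sum_mono)
      fix i show "norm (v $ i *\<^sub>R (A *v axis i 1)) \<le> norm (A *v axis i 1)"
        using component_le_norm_cart[of v i] v(1) mult_right_mono[of "\<bar>v $ i\<bar>" 1 "norm (A *v axis i 1)"] by simp
    qed
    finally have "spectral_norm A powr s \<le> (\<Sum>i\<in>UNIV. norm (A *v axis i 1)) powr s"
      using s spectral_norm_nonneg[of A] unfolding v(2) by (intro powr_mono2) auto
    also have "\<dots> \<le> (\<Sum>i\<in>UNIV. norm (A *v axis i 1) powr s)"
      by (rule sum_powr) auto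
    finally show ?thesis .
  qed
  have bound: "s * (\<integral>\<omega>. ln (spectral_norm (MP n \<omega>)) \<partial>S) \<le> D + s * n * t" for n
  proof -
    let ?Y = "\<lambda>\<omega>. spectral_norm (MP n \<omega>) powr s"
    have "(\<integral>\<^sup>+\<omega>. ennreal (?Y \<omega>) \<partial>S) \<le> (\<integral>\<^sup>+\<omega>. (\<Sum>i\<in>UNIV. ennreal (norm (MP n \<omega> *v axis i 1) powr s)) \<partial>S)"
      using sn by (intro nn_integral_mono) (simp add: ennreal_leI)
    also have "\<dots> = (\<Sum>i\<in>UNIV. \<integral>\<^sup>+\<omega>. ennreal (norm (MP n \<omega> *v axis i 1) powr s) \<partial>S)"
      by (rule nn_integral_sum) simp
    also have "\<dots> \<le> (\<Sum>i\<in>(UNIV :: 'd set). ennreal (C * exp (s * n * t) * norm (axis i (1::real)) powr s))"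
      by (intro sum_mono le)
    also have "\<dots> = ennreal (D * exp (s * n * t))"
      by (subst sum_ennreal) (use C in \<open>auto simp: D_def mult_ac\<close>)
    finally have nn: "(\<integral>\<^sup>+\<omega>. ennreal (?Y \<omega>) \<partial>S) \<le> ennreal (D * exp (s * n * t))" .
    then have int: "integrable S ?Y"
      by (intro integrableI_bounded) (auto intro: le_less_trans)
    have EY: "(\<integral>\<omega>. ?Y \<omega> \<partial>S) \<le> D * exp (s * n * t)"
      using nn D by (simp add: nn_integral_eq_integral[OF int])
    have "s * (\<integral>\<omega>. ln (spectral_norm (MP n \<omega>)) \<partial>S) = (\<integral>\<omega>. s * ln (spectral_norm (MP n \<omega>)) \<partial>S)" by simp
    also have "\<dots> \<le> (\<integral>\<omega>. exp (- (s * n * t)) * ?Y \<omega> + s * n * t \<partial>S)"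
    proof (rule integral_mono)
      show "integrable S (\<lambda>\<omega>. s * ln (spectral_norm (MP n \<omega>)))"
        using lyapunov_exponent_1(5)[of _ n]
        by (intro integrable_mult_right P.integrable_const_bound[of _ "ln b * n"]) auto
      show "integrable S (\<lambda>\<omega>. exp (- (s * n * t)) * ?Y \<omega> + s * n * t)"
        using int by simp
      fix \<omega> assume w: "\<omega> \<in> space S"
      let ?z = "s * ln (spectral_norm (MP n \<omega>)) - s * n * t"
      \<comment> \<open>This replaces Jensen's inequality; the error is a constant independent of
        \<open>n\<close>.\<close>
      have "?z \<le> exp ?z" using exp_ge_add_one_self[of ?z] by linarith
      also have "exp ?z = exp (- (s * n * t)) * ?Y \<omega>"
        using lyapunov_exponent_1(4)[OF w, of n] by (simp add: powr_def exp_diff exp_minus field_simps)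
      finally show "s * ln (spectral_norm (MP n \<omega>)) \<le> exp (- (s * n * t)) * ?Y \<omega> + s * n * t" by simp
    qed
    also have "\<dots> = exp (- (s * n * t)) * (\<integral>\<omega>. ?Y \<omega> \<partial>S) + s * n * t"
      using int by (simp add: P.prob_space)
    also have "\<dots> \<le> exp (- (s * n * t)) * (D * exp (s * n * t)) + s * n * t"
      using EY by (intro add_right_mono mult_left_mono) auto
    also have "\<dots> = D + s * n * t" by (simp add: exp_minus)
    finally show ?thesis .
  qed
  show ?thesis
  proof (rule LIMSEQ_le[OF lyapunov_exponent_1(2)])
    have "(\<lambda>n. t + D / s * (1 / n)) \<longlonglongrightarrow> t + D / s * 0"
      by (intro tendsto_intros lim_1_over_n)
    then show "(\<lambda>n. t + D / s * (1 / n)) \<longlonglongrightarrow> t" by simp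
    show "\<exists>N. \<forall>n\<ge>N. (\<integral>\<omega>. ln (spectral_norm (MP n \<omega>)) \<partial>S) / n \<le> t + D / s * (1 / n)"
    proof (intro exI[of _ 1] allI impI)
      fix n :: nat assume "1 \<le> n"
      then show "(\<integral>\<omega>. ln (spectral_norm (MP n \<omega>)) \<partial>S) / n \<le> t + D / s * (1 / n)"
        using bound[of n] s by (simp add: field_simps)
    qed
  qed
qed

end

lemma moment_growth_mono:
  assumes "moment_growth \<nu> W N s t" "0 < s" "t \<le> t'"
  shows "moment_growth \<nu> W N s t'"
proof -
  obtain w C where w: "w \<in> borel_measurable borel" "0 \<le> C"
    "\<forall>x\<in>W. N x powr s \<le> w x \<and> w x \<le> C * N x powr s" "\<forall>x\<in>W. \<forall>y\<in>W. w (x + y) \<le> w x + w y"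
    "\<forall>x\<in>W. (\<integral>\<^sup>+g. ennreal (w (g *v x)) \<partial>\<nu>) \<le> ennreal (exp (s * t) * w x)"
    using assms(1) unfolding moment_growth_def by blast
  have "ennreal (exp (s * t) * w x) \<le> ennreal (exp (s * t') * w x)" if "x \<in> W" for x
  proof -
    have "0 \<le> w x" using w(3) that powr_ge_zero order_trans by blast
    then show ?thesis using assms(2,3) by (intro ennreal_leI mult_right_mono) auto
  qed
  then have "\<forall>x\<in>W. (\<integral>\<^sup>+g. ennreal (w (g *v x)) \<partial>\<nu>) \<le> ennreal (exp (s * t') * w x)"
    using w(5) order_trans by blast
  then show ?thesis unfolding moment_growth_def using w(1-4) by blast
qed

text \<open>The weight for \<mu> is kept for the new law. Since
  \<open>w (g *v x) \<le> c * w x\<close>, the change of density adds at most c times the L^1 norm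
  of f - 1 to the one-step factor.\<close>

lemma moment_growth_density:
  fixes \<mu> :: "(real ^ 'd ^ 'd) measure"
  assumes law: "matrix_law \<Sigma> \<mu> b"
    and inv: "\<And>g x. g \<in> \<Sigma> \<Longrightarrow> x \<in> W \<Longrightarrow> g *v x \<in> W"
    and mg: "moment_growth \<mu> W N s t" and t: "t < t'" and s: "0 < s"
    and N0: "\<And>x. 0 \<le> N x"
    and Nb: "\<And>g x. g \<in> \<Sigma> \<Longrightarrow> x \<in> W \<Longrightarrow> N (g *v x) \<le> b * N x"
  obtains \<delta> where "0 < \<delta>" "\<And>f. integrable \<mu> f \<Longrightarrow> (AE g in \<mu>. 0 \<le> f g) \<Longrightarrow>
    (\<integral>g. \<bar>f g - 1\<bar> \<partial>\<mu>) < \<delta> \<Longrightarrow> moment_growth (density \<mu> (\<lambda>x. ennreal (f x))) W N s t'"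
proof -
  interpret matrix_law \<Sigma> \<mu> b by (rule law)
  obtain w C where w[measurable]: "w \<in> borel_measurable borel" and C: "0 \<le> C"
    and lo: "\<And>x. x \<in> W \<Longrightarrow> N x powr s \<le> w x" and up: "\<And>x. x \<in> W \<Longrightarrow> w x \<le> C * N x powr s"
    and add: "\<And>x y. x \<in> W \<Longrightarrow> y \<in> W \<Longrightarrow> w (x + y) \<le> w x + w y"
    and int: "\<And>x. x \<in> W \<Longrightarrow> (\<integral>\<^sup>+g. ennreal (w (g *v x)) \<partial>\<mu>) \<le> ennreal (exp (s * t) * w x)"
    using mg unfolding moment_growth_def by blast
  define c where "c = C * b powr s + 1"
  have c: "0 < c" using C b1 by (simp add: c_def add_nonneg_pos)
  \<comment> \<open>Exactly what the gap between the two rates can absorb.\<close>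
  define \<delta> where "\<delta> = (exp (s * t') - exp (s * t)) / c"
  have \<delta>: "0 < \<delta>" using c s t by (simp add: \<delta>_def)
  have w0: "0 \<le> w x" if "x \<in> W" for x using lo[OF that] powr_ge_zero order_trans by blast
  have gW: "g *v x \<in> W" if "g \<in> space \<mu>" "x \<in> W" for g x using that inv space_\<nu> by simp
  show ?thesis
  proof (rule that[OF \<delta>])
    fix f assume f: "integrable \<mu> f" and f0: "AE g in \<mu>. 0 \<le> f g" and close: "(\<integral>g. \<bar>f g - 1\<bar> \<partial>\<mu>) < \<delta>"
    have fm[measurable]: "f \<in> borel_measurable \<mu>" using f by simp
    have i1: "integrable \<mu> (\<lambda>g. f g - 1)" using f by simp
    show "moment_growth (density \<mu> (\<lambda>x. ennreal (f x))) W N s t'"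
      unfolding moment_growth_def
    proof (intro exI[of _ w] exI[of _ C] conjI ballI)
      fix x assume x: "x \<in> W"
      have "(\<integral>\<^sup>+g. ennreal (w (g *v x)) \<partial>density \<mu> (\<lambda>x. ennreal (f x)))
          = (\<integral>\<^sup>+g. ennreal (f g) * ennreal (w (g *v x)) \<partial>\<mu>)"
        by (rule nn_integral_density) measurable
      also have "\<dots> \<le> (\<integral>\<^sup>+g. ennreal (w (g *v x)) + ennreal (c * w x) * ennreal \<bar>f g - 1\<bar> \<partial>\<mu>)"
      proof (rule nn_integral_mono)
        fix g assume g: "g \<in> space \<mu>"
        have g': "0 \<le> w (g *v x)" using w0[OF gW[OF g x]] .
        have "w (g *v x) \<le> C * N (g *v x) powr s" by (rule up[OF gW[OF g x]])
        also have "\<dots> \<le> C * (b * N x) powr s"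
          using Nb[of g x] g x space_\<nu> N0 s C by (intro mult_left_mono powr_mono2) auto
        also have "\<dots> = C * b powr s * N x powr s" using b1 N0 by (simp add: powr_mult)
        also have "\<dots> \<le> c * N x powr s" by (intro mult_right_mono) (auto simp: c_def)
        also have "\<dots> \<le> c * w x" using lo[OF x] c by (intro mult_left_mono) auto
        finally have gw: "w (g *v x) \<le> c * w x" .
        have "ennreal (f g) * ennreal (w (g *v x)) \<le> ennreal (1 + \<bar>f g - 1\<bar>) * ennreal (w (g *v x))"
          by (intro mult_right_mono ennreal_leI) auto
        also have "\<dots> = ennreal (w (g *v x) + \<bar>f g - 1\<bar> * w (g *v x))"
          using g' by (simp add: ennreal_mult[symmetric] algebra_simps)
        also have "\<dots> \<le> ennreal (w (g *v x) + c * w x * \<bar>f g - 1\<bar>)"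
          using mult_left_mono[OF gw, of "\<bar>f g - 1\<bar>"] by (intro ennreal_leI) (simp add: mult_ac)
        also have "\<dots> = ennreal (w (g *v x)) + ennreal (c * w x) * ennreal \<bar>f g - 1\<bar>"
          using g' c w0[OF x] by (simp add: ennreal_plus ennreal_mult)
        finally show "ennreal (f g) * ennreal (w (g *v x)) \<le> ennreal (w (g *v x)) + ennreal (c * w x) * ennreal \<bar>f g - 1\<bar>" .
      qed
      also have "\<dots> = (\<integral>\<^sup>+g. ennreal (w (g *v x)) \<partial>\<mu>) + ennreal (c * w x) * (\<integral>\<^sup>+g. ennreal \<bar>f g - 1\<bar> \<partial>\<mu>)"
        by (simp add: nn_integral_add nn_integral_cmult)
      also have "(\<integral>\<^sup>+g. ennreal \<bar>f g - 1\<bar> \<partial>\<mu>) = ennreal (\<integral>g. \<bar>f g - 1\<bar> \<partial>\<mu>)"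
        using i1 by (intro nn_integral_eq_integral) auto
      also have "(\<integral>\<^sup>+g. ennreal (w (g *v x)) \<partial>\<mu>) + ennreal (c * w x) * ennreal (\<integral>g. \<bar>f g - 1\<bar> \<partial>\<mu>)
         \<le> ennreal (exp (s * t) * w x) + ennreal (c * w x) * ennreal \<delta>"
        using close by (intro add_mono mult_left_mono int x ennreal_leI) auto
      also have "\<dots> = ennreal (exp (s * t) * w x + c * w x * \<delta>)"
        using c w0[OF x] \<delta> by (simp add: ennreal_mult[symmetric] ennreal_plus[symmetric] del: ennreal_plus)
      also have "exp (s * t) * w x + c * w x * \<delta> = exp (s * t') * w x"
        using c by (simp add: \<delta>_def field_simps)
      finally show "(\<integral>\<^sup>+g. ennreal (w (g *v x)) \<partial>density \<mu> (\<lambda>x. ennreal (f x))) \<le> ennreal (exp (s * t') * w x)" .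
    qed (use C lo up add in auto)
  qed
qed

section \<open>Uniform growth on the quotient by the slow subspace\<close>

lemma orthogonal_projection_exists:
  fixes V :: "'a::euclidean_space set"
  assumes V: "subspace V"
  obtains P where "linear P" "\<And>x. norm (P x) \<le> norm x" "\<And>x. x - P x \<in> V" "\<And>x. x \<in> V \<Longrightarrow> P x = 0"
proof -
  obtain B where B: "B \<subseteq> V" "pairwise orthogonal B" "\<And>x. x \<in> B \<Longrightarrow> norm x = 1"
    "independent B" "card B = dim V" "span B = V"
    by (rule orthonormal_basis_subspace[OF V]) blast
  have fin: "finite B" using B(4) independent_imp_finite by blast
  define Q where "Q x = (\<Sum>u\<in>B. (x \<bullet> u) *\<^sub>R u)" for x
  have Q: "linear Q"
    unfolding Q_def by (rule linearI) (simp_all add: inner_add_left scaleR_add_left sum.distrib scaleR_sum_right)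
  have QV: "Q x \<in> V" for x
    unfolding Q_def using B(1) V by (intro subspace_sum subspace_scale) auto
  have Qu: "Q x \<bullet> u = x \<bullet> u" if "u \<in> B" for x u
  proof -
    have "Q x \<bullet> u = (\<Sum>v\<in>B. if v = u then x \<bullet> u else 0)"
      unfolding Q_def inner_sum_left
      using B(2,3) that by (intro sum.cong) (auto simp: pairwise_def orthogonal_def norm_eq_1)
    then show ?thesis using fin that by simp
  qed
  have orth: "(x - Q x) \<bullet> v = 0" if "v \<in> V" for x v
  proof -
    have "orthogonal (x - Q x) v"
      by (rule orthogonal_to_span[of v B]) (use that B(6) Qu in \<open>auto simp: orthogonal_def inner_diff_left\<close>)
    then show ?thesis by (simp add: orthogonal_def)
  qed
  show ?thesis
  proof (rule that[of "\<lambda>x. x - Q x"])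
    show "linear (\<lambda>x. x - Q x)" using Q by (intro linear_compose_sub linear_ident)
    show "x - (x - Q x) \<in> V" for x using QV by simp
    fix x
    have "(norm x)\<^sup>2 = (norm (x - Q x))\<^sup>2 + (norm (Q x))\<^sup>2"
    proof -
      have "x \<bullet> x = ((x - Q x) + Q x) \<bullet> ((x - Q x) + Q x)" by simp
      also have "\<dots> = (x - Q x) \<bullet> (x - Q x) + 2 * ((x - Q x) \<bullet> Q x) + Q x \<bullet> Q x"
        unfolding inner_add_left inner_add_right by (simp add: inner_commute)
      finally show ?thesis using orth[OF QV, of x x] by (simp add: power2_norm_eq_inner)
    qed
    then have "(norm (x - Q x))\<^sup>2 \<le> (norm x)\<^sup>2" using zero_le_power2[of "norm (Q x)"] by linarith
    then show "norm (x - Q x) \<le> norm x" by (rule power2_le_imp_le) simp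
    assume x: "x \<in> V"
    then have "(x - Q x) \<bullet> (x - Q x) = 0" using QV V by (intro orth subspace_diff)
    then show "x - Q x = 0" by simp
  qed
qed

text \<open>The quotient by \<open>V\<close> is modelled on a complement: \<open>norm (P x)\<close>
  is the size of the class of \<open>x\<close>. The complement need not be invariant, but
  \<open>P\<close> after \<open>g\<close> depends only on the class, because \<open>V\<close> is
  invariant.\<close>

locale quotient_law = matrix_law \<Sigma> \<nu> b
  for \<Sigma> :: "(real ^ 'd ^ 'd) set" and \<nu> :: "(real ^ 'd ^ 'd) measure" and b :: real +
  fixes V :: "(real ^ 'd) set" and P :: "real ^ 'd \<Rightarrow> real ^ 'd"
  assumes V: "subspace V" and V_inv: "g \<in> \<Sigma> \<Longrightarrow> x \<in> V \<Longrightarrow> g *v x \<in> V"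
    and P_linear: "linear P" and P_le: "norm (P x) \<le> norm x"
    and P_diff: "x - P x \<in> V" and P_V: "x \<in> V \<Longrightarrow> P x = 0"
begin

text \<open>The vectors with nonzero class. Projective space is not formed; vectors serve as
  representatives of their directions.\<close>

definition X :: "(real ^ 'd) set" where "X = {x. P x \<noteq> 0}"

definition a :: "nat \<Rightarrow> real ^ 'd \<Rightarrow> (nat \<Rightarrow> real ^ 'd ^ 'd) \<Rightarrow> real" where
  "a n x \<omega> = ln (norm (P (MP n \<omega> *v x)) / norm (P x))"

lemma P_cont: "continuous_on A P"
  using P_linear linear_conv_bounded_linear linear_continuous_on by blast

lemma P_measurable [measurable]: "P \<in> borel_measurable borel"
  by (intro borel_measurable_continuous_onI P_cont)

lemma P_idem: "P (P x) = P x"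
  using P_V[OF P_diff[of x]] P_linear by (simp add: linear_diff)

lemma P_eq_0: "P x = 0 \<longleftrightarrow> x \<in> V"
  using P_diff[of x] P_V by auto

lemma P_eqI: "x - y \<in> V \<Longrightarrow> P x = P y"
  using P_V[of "x - y"] P_linear by (simp add: linear_diff)

lemma MP_V: "\<omega> \<in> space S \<Longrightarrow> x \<in> V \<Longrightarrow> MP n \<omega> *v x \<in> V"
proof (induction n)
  case (Suc n)
  then show ?case using V_inv[of "\<omega> n" "MP n \<omega> *v x"]
    by (simp add: matrix_vector_mul_assoc[symmetric] space_S space_\<nu>)
qed simp

lemma P_MP_P: "\<omega> \<in> space S \<Longrightarrow> P (MP n \<omega> *v P x) = P (MP n \<omega> *v x)"
  using MP_V[OF _ P_diff[of x], of \<omega> n] P_eqI[of "MP n \<omega> *v x" "MP n \<omega> *v P x"]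
  by (simp add: matrix_vector_mult_diff_distrib)

lemma P_act_P: "g \<in> \<Sigma> \<Longrightarrow> P (g *v P x) = P (g *v x)"
  using V_inv[OF _ P_diff[of x], of g] P_eqI[of "g *v x" "g *v P x"]
  by (simp add: matrix_vector_mult_diff_distrib)

text \<open>An injective linear map of a finite-dimensional space into itself is onto.\<close>

lemma inv_V:
  assumes "g \<in> \<Sigma>" "x \<in> V"
  shows "matrix_inv g *v x \<in> V"
proof -
  note gi = matrix_inv[OF inv_\<Sigma>[OF assms(1)]]
  have inj: "inj ((*v) g)"
    by (rule inj_on_inverseI[of _ "(*v) (matrix_inv g)"]) (simp add: matrix_vector_mul_assoc gi)
  have "(*v) g ` V = V"
  proof (rule subspace_dim_equal)
    show "subspace ((*v) g ` V)" using V by (intro linear_subspace_image) auto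
    show "(*v) g ` V \<subseteq> V" using V_inv[OF assms(1)] by auto
    show "dim V \<le> dim ((*v) g ` V)"
      using dim_image_eq[of "(*v) g" V] inj by (simp add: inj_on_subset)
  qed (rule V)
  then obtain y where "y \<in> V" "x = g *v y" using assms(2) by auto
  then show ?thesis by (simp add: matrix_vector_mul_assoc gi)
qed

lemma P_act_le: "g \<in> \<Sigma> \<Longrightarrow> norm (P (g *v x)) \<le> b * norm (P x)"
  using norm_le_b[of g "P x"] P_le[of "g *v P x"] P_act_P[of g x] by simp

lemma P_act_ge:
  assumes g: "g \<in> \<Sigma>"
  shows "norm (P x) \<le> b * norm (P (g *v x))"
proof -
  note gi = matrix_inv[OF inv_\<Sigma>[OF g]]
  let ?y = "g *v x"
  have "matrix_inv g *v (?y - P ?y) \<in> V" by (rule inv_V[OF g P_diff])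
  then have "P x = P (matrix_inv g *v P ?y)"
    by (intro P_eqI) (simp add: matrix_vector_mult_diff_distrib matrix_vector_mul_assoc gi)
  then have "norm (P x) \<le> norm (matrix_inv g *v P ?y)" using P_le by simp
  also have "\<dots> \<le> b * norm (g *v (matrix_inv g *v P ?y))" by (rule norm_ge_b[OF g])
  also have "g *v (matrix_inv g *v P ?y) = P ?y" by (simp add: matrix_vector_mul_assoc gi)
  finally show ?thesis .
qed

lemma P_MP_le: "\<omega> \<in> space S \<Longrightarrow> norm (P (MP n \<omega> *v x)) \<le> b ^ n * norm (P x)"
proof (induction n)
  case (Suc n)
  have "norm (P (MP (Suc n) \<omega> *v x)) \<le> b * norm (P (MP n \<omega> *v x))"
    using P_act_le[of "\<omega> n"] Suc.prems by (simp add: matrix_vector_mul_assoc[symmetric] space_S space_\<nu>)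
  also have "\<dots> \<le> b * (b ^ n * norm (P x))" using Suc b1 by (intro mult_left_mono) auto
  finally show ?case by simp
qed simp

lemma P_MP_ge: "\<omega> \<in> space S \<Longrightarrow> norm (P x) \<le> b ^ n * norm (P (MP n \<omega> *v x))"
proof (induction n)
  case (Suc n)
  have "norm (P (MP n \<omega> *v x)) \<le> b * norm (P (MP (Suc n) \<omega> *v x))"
    using P_act_ge[of "\<omega> n"] Suc.prems by (simp add: matrix_vector_mul_assoc[symmetric] space_S space_\<nu>)
  then have "b ^ n * norm (P (MP n \<omega> *v x)) \<le> b ^ n * (b * norm (P (MP (Suc n) \<omega> *v x)))"
    using b1 by (intro mult_left_mono) auto
  with Suc show ?case by (simp add: mult_ac)
qed simp

lemma X_act: "g \<in> \<Sigma> \<Longrightarrow> x \<in> X \<Longrightarrow> g *v x \<in> X"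
  using P_act_ge[of g x] by (auto simp: X_def)

lemma X_MP: "\<omega> \<in> space S \<Longrightarrow> x \<in> X \<Longrightarrow> MP n \<omega> *v x \<in> X"
  using P_MP_ge[of \<omega> x n] by (auto simp: X_def)

lemma a_bound:
  assumes "\<omega> \<in> space S" "x \<in> X"
  shows "\<bar>a n x \<omega>\<bar> \<le> ln b * n"
proof -
  define y where "y = norm (P (MP n \<omega> *v x))"
  define z where "z = norm (P x)"
  have pos: "0 < y" "0 < z" "0 < b" using X_MP[OF assms] assms b1 by (auto simp: X_def y_def z_def)
  have "y \<le> b ^ n * z" "z \<le> b ^ n * y"
    unfolding y_def z_def using P_MP_le[OF assms(1)] P_MP_ge[OF assms(1)] by auto
  then have "ln y \<le> ln (b ^ n * z)" "ln z \<le> ln (b ^ n * y)"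
    using pos by (auto simp: ln_le_cancel_iff[symmetric] simp del: ln_le_cancel_iff)
  then have "ln y \<le> n * ln b + ln z" "ln z \<le> n * ln b + ln y"
    using pos by (simp_all add: ln_mult ln_realpow)
  then show ?thesis
    unfolding a_def y_def[symmetric] z_def[symmetric] using pos by (simp add: ln_div abs_le_iff mult.commute)
qed

lemma a_measurable [measurable]: "a n x \<in> borel_measurable S"
  unfolding a_def[abs_def] by measurable

lemma a_cocycle:
  assumes "\<omega> \<in> space S" "x \<in> X"
  shows "a (k + n) x \<omega> = a k x \<omega> + a n (MP k \<omega> *v x) (seq_shift k \<omega>)"
proof -
  have "P (MP k \<omega> *v x) \<noteq> 0" "P (MP n (seq_shift k \<omega>) *v (MP k \<omega> *v x)) \<noteq> 0" "P x \<noteq> 0"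
    using X_MP[OF assms] X_MP[OF seq_shift_space[OF assms(1)] X_MP[OF assms]] assms by (auto simp: X_def)
  then show ?thesis
    by (simp add: a_def matrix_product_shift matrix_vector_mul_assoc ln_div)
qed

lemma a_scale_P: "\<omega> \<in> space S \<Longrightarrow> r \<noteq> 0 \<Longrightarrow> a n (r *\<^sub>R P x) \<omega> = a n x \<omega>"
  using P_MP_P[of \<omega> n x] P_linear
  by (simp add: a_def matrix_vector_mult_scaleR linear_scale P_idem)

text \<open>The cocycle \<open>a\<close> is additive along orbits, so \<open>- a\<close> is
  subadditive too, and the upper bound by hitting times becomes a lower bound for
  \<open>a\<close>.\<close>

lemma expectation_a_ge:
  fixes \<beta> e :: real and N :: nat
  assumes hit: "\<And>x. x \<in> X \<Longrightarrow> 1 - e \<le> measure S {\<omega> \<in> space S. \<exists>n\<in>{1..N}. \<beta> * n \<le> a n x \<omega>}"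
    and x: "x \<in> X"
  shows "\<beta> * n - (ln b + \<bar>\<beta>\<bar>) * (e * n + N) \<le> (\<integral>\<omega>. a n x \<omega> \<partial>S)"
proof -
  have "(\<integral>\<omega>. - a n x \<omega> \<partial>S) \<le> (- \<beta>) * n + (ln b + \<bar>- \<beta>\<bar>) * (e * n + N)"
  proof (rule expectation_le_hitting[where a = "\<lambda>n x \<omega>. - a n x \<omega>" and X = X
        and orb = "\<lambda>k x \<omega>. MP k \<omega> *v x"])
    show "0 \<le> ln b" using b1 by simp
    show "(\<lambda>\<omega>. - a n (MP k \<omega> *v x) (seq_shift k \<omega>)) \<in> borel_measurable S" for k n x
      unfolding a_def by measurable
    show "1 - e \<le> measure S {\<omega> \<in> space S. \<exists>n\<in>{1..N}. - a n x \<omega> \<le> - \<beta> * n}" if "x \<in> X" for x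
      using hit[OF that] by simp
  qed (use x X_MP a_bound a_cocycle in
      \<open>auto simp: matrix_product_shift matrix_vector_mul_assoc matrix_product_comb_seq\<close>)
  then show ?thesis by simp
qed

lemma normalized_point:
  assumes "x \<in> X"
  obtains r where "r \<noteq> 0" "norm (r *\<^sub>R P x) = 1" "P (r *\<^sub>R P x) = r *\<^sub>R P x" "r *\<^sub>R P x \<in> X"
proof (rule that[of "1 / norm (P x)"])
  show "P ((1 / norm (P x)) *\<^sub>R P x) = (1 / norm (P x)) *\<^sub>R P x"
    using P_linear by (simp add: linear_scale P_idem)
  then show "(1 / norm (P x)) *\<^sub>R P x \<in> X" using assms by (simp add: X_def)
qed (use assms in \<open>auto simp: X_def\<close>)

text \<open>Being fixed by \<open>P\<close> is a closed condition, so a limit of normalised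
  representatives is again one.\<close>

lemma convergent_subsequence:
  assumes "\<And>n :: nat. norm (z n) = 1" "\<And>n. P (z n) = z n"
  obtains r x where "strict_mono (r :: nat \<Rightarrow> nat)" "(\<lambda>n. z (r n)) \<longlonglongrightarrow> x" "norm x = 1" "P x = x"
proof -
  have "seq_compact (sphere (0 :: real ^ 'd) 1)"
    using compact_sphere compact_imp_seq_compact by blast
  then obtain x r where x: "x \<in> sphere 0 1" "strict_mono r" "(z \<circ> r) \<longlonglongrightarrow> x"
    unfolding seq_compact_def using assms(1) by (metis mem_sphere_0)
  have "(\<lambda>n. P (z (r n))) \<longlonglongrightarrow> P x"
    using continuous_on_tendsto_compose[OF P_cont[of UNIV] x(3)] by (simp add: comp_def)
  then have "P x = x" using x(3) assms(2) LIMSEQ_unique by (auto simp: comp_def)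
  then show ?thesis using that[of r x] x by (simp add: comp_def)
qed

text \<open>
  If the rate \<open>\<beta>1\<close> is not reached within \<open>N\<close> steps with probability close to 1, uniformly in the
  direction, then a limit of exceptional directions is slow forever with positive probability.
\<close>

lemma slow_point_exists:
  fixes \<beta>1 \<beta>2 e :: real
  assumes e: "0 < e" and \<beta>: "\<beta>1 < \<beta>2"
    and nohit: "\<And>N :: nat. \<exists>x\<in>X. measure S {\<omega> \<in> space S. \<exists>n\<in>{1..N}. \<beta>1 * n \<le> a n x \<omega>} < 1 - e"
  obtains x where "x \<in> X" "e \<le> measure S {\<omega> \<in> space S. \<forall>n\<ge>1. norm (P (MP n \<omega> *v x)) \<le> exp (\<beta>2 * n)}"
proof -
  have ex: "\<exists>z. norm z = 1 \<and> P z = z \<and> measure S {\<omega> \<in> space S. \<exists>n\<in>{1..N}. \<beta>1 * n \<le> a n z \<omega>} < 1 - e" for N :: nat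
  proof -
    obtain x where x: "x \<in> X" "measure S {\<omega> \<in> space S. \<exists>n\<in>{1..N}. \<beta>1 * n \<le> a n x \<omega>} < 1 - e"
      using nohit by blast
    obtain r where r: "r \<noteq> 0" "norm (r *\<^sub>R P x) = 1" "P (r *\<^sub>R P x) = r *\<^sub>R P x"
      using normalized_point[OF x(1)] by metis
    have "{\<omega> \<in> space S. \<exists>n\<in>{1..N}. \<beta>1 * n \<le> a n (r *\<^sub>R P x) \<omega>} = {\<omega> \<in> space S. \<exists>n\<in>{1..N}. \<beta>1 * n \<le> a n x \<omega>}"
      using a_scale_P[OF _ r(1)] by auto
    then show ?thesis using r x(2) by (intro exI[of _ "r *\<^sub>R P x"]) simp
  qed
  have "\<exists>z. \<forall>N. norm (z N) = 1 \<and> P (z N) = z N \<and>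
      measure S {\<omega> \<in> space S. \<exists>n\<in>{1..N}. \<beta>1 * n \<le> a n (z N) \<omega>} < 1 - e"
    by (rule choice) (use ex in blast)
  then obtain z where z: "\<And>N. norm (z N) = 1" "\<And>N. P (z N) = z N"
    "\<And>N :: nat. measure S {\<omega> \<in> space S. \<exists>n\<in>{1..N}. \<beta>1 * n \<le> a n (z N) \<omega>} < 1 - e" by blast
  obtain r x where r: "strict_mono (r :: nat \<Rightarrow> nat)" "(\<lambda>n. z (r n)) \<longlonglongrightarrow> x" "norm x = 1" "P x = x"
    by (rule convergent_subsequence[OF z(1,2)]) (rule that)
  let ?A = "\<lambda>N. {\<omega> \<in> space S. \<forall>n\<in>{1..N}. norm (P (MP n \<omega> *v x)) \<le> exp (\<beta>2 * n)}"
  have Am: "?A N \<in> sets S" for N by measurable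
  have "e \<le> measure S (?A N)" for N :: nat
  proof -
    \<comment> \<open>The least margin between the two rates up to time \<open>N\<close>; the
      element 1 keeps the set nonempty when \<open>N\<close> is 0.\<close>
    define m where "m = Min ((\<lambda>n. exp (\<beta>2 * real n) - exp (\<beta>1 * real n)) ` {1..N} \<union> {1})"
    \<comment> \<open>Directions closer than this differ by at most \<open>m\<close> after any
      product of at most \<open>N\<close> factors.\<close>
    define \<eta> where "\<eta> = m / b ^ N"
    have "0 < m" unfolding m_def using \<beta> by (subst Min_gr_iff) auto
    then have \<eta>: "0 < \<eta>" using b1 by (simp add: \<eta>_def)
    have \<eta>n: "b ^ N * \<eta> \<le> exp (\<beta>2 * real n) - exp (\<beta>1 * real n)" if "n \<in> {1..N}" for n
    proof -
      have "m \<le> exp (\<beta>2 * real n) - exp (\<beta>1 * real n)"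
        unfolding m_def by (rule Min_le) (use that in auto)
      then show ?thesis using b1 by (simp add: \<eta>_def)
    qed
    obtain j where j: "N \<le> r j" "norm (z (r j) - x) < \<eta>"
    proof -
      obtain j0 where "\<And>j. j0 \<le> j \<Longrightarrow> norm (z (r j) - x) < \<eta>"
        using LIMSEQ_D[OF r(2) \<eta>] by blast
      moreover have "N \<le> r (max N j0)"
        using seq_suble[OF r(1), of "max N j0"] by simp
      ultimately show ?thesis using that[of "max N j0"] by simp
    qed
    let ?B = "{\<omega> \<in> space S. \<exists>n\<in>{1..r j}. \<beta>1 * n \<le> a n (z (r j)) \<omega>}"
    have Bm: "?B \<in> sets S" by measurable
    \<comment> \<open>As \<open>N \<le> r j\<close>, off \<open>?B\<close> the approximating
      direction stays below the rate \<open>\<beta>1\<close> up to time \<open>N\<close>; closeness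
      then keeps \<open>x\<close> below \<open>\<beta>2\<close>.\<close>
    have "space S - ?B \<subseteq> ?A N"
    proof
      fix \<omega> assume w: "\<omega> \<in> space S - ?B"
      then have ws: "\<omega> \<in> space S" by simp
      have "norm (P (MP n \<omega> *v x)) \<le> exp (\<beta>2 * n)" if n: "n \<in> {1..N}" for n
      proof -
        have zX: "z (r j) \<in> X" using z(1,2)[of "r j"] by (auto simp: X_def)
        have pos: "0 < norm (P (MP n \<omega> *v z (r j)))" using X_MP[OF ws zX] by (simp add: X_def)
        have "a n (z (r j)) \<omega> < \<beta>1 * n" using w n j(1) by force
        then have "ln (norm (P (MP n \<omega> *v z (r j)))) < \<beta>1 * n"
          unfolding a_def using z(1,2)[of "r j"] by simp
        then have 1: "norm (P (MP n \<omega> *v z (r j))) < exp (\<beta>1 * n)"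
          using pos by (metis exp_less_cancel_iff exp_ln)
        have "norm (P (MP n \<omega> *v (x - z (r j)))) \<le> b ^ n * norm (P (x - z (r j)))"
          by (rule P_MP_le[OF ws])
        also have "\<dots> \<le> b ^ N * \<eta>"
        proof (rule mult_mono)
          show "b ^ n \<le> b ^ N" using n b1 by (intro power_increasing) auto
          show "norm (P (x - z (r j))) \<le> \<eta>"
            using P_le[of "x - z (r j)"] j(2) by (simp add: norm_minus_commute)
        qed (use b1 in auto)
        also have "\<dots> \<le> exp (\<beta>2 * n) - exp (\<beta>1 * n)" by (rule \<eta>n[OF n])
        finally have 2: "norm (P (MP n \<omega> *v (x - z (r j)))) \<le> exp (\<beta>2 * n) - exp (\<beta>1 * n)" .
        have "P (MP n \<omega> *v x) = P (MP n \<omega> *v z (r j)) + P (MP n \<omega> *v (x - z (r j)))"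
          using P_linear by (simp add: linear_add[symmetric] matrix_vector_right_distrib[symmetric])
        then have "norm (P (MP n \<omega> *v x)) \<le> norm (P (MP n \<omega> *v z (r j))) + norm (P (MP n \<omega> *v (x - z (r j))))"
          by (metis norm_triangle_ineq)
        then show ?thesis using 1 2 by linarith
      qed
      then show "\<omega> \<in> ?A N" using ws by blast
    qed
    then have "measure S (space S - ?B) \<le> measure S (?A N)"
      by (rule P.finite_measure_mono) (rule Am)
    moreover have "measure S (space S - ?B) = 1 - measure S ?B"
      by (rule P.prob_compl[OF Bm])
    ultimately show ?thesis using z(3)[of "r j"] by linarith
  qed
  moreover have "(\<lambda>N. measure S (?A N)) \<longlonglongrightarrow> measure S (\<Inter>N. ?A N)"
    by (rule P.finite_Lim_measure_decseq) (use Am in \<open>auto simp: decseq_def\<close>)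
  ultimately have "e \<le> measure S (\<Inter>N. ?A N)" by (intro LIMSEQ_le_const) auto
  also have "(\<Inter>N. ?A N) = {\<omega> \<in> space S. \<forall>n\<ge>1. norm (P (MP n \<omega> *v x)) \<le> exp (\<beta>2 * n)}"
    by (auto 4 3)
  finally have *: "e \<le> measure S {\<omega> \<in> space S. \<forall>n\<ge>1. norm (P (MP n \<omega> *v x)) \<le> exp (\<beta>2 * n)}" .
  have "x \<noteq> 0" using r(3) by auto
  then have "x \<in> X" using r(4) by (simp add: X_def)
  then show ?thesis using * by (rule that)
qed

text \<open>A constant ranging over the natural numbers makes slowness of a vector a countable
  combination of events.\<close>

definition slow :: "real \<Rightarrow> (nat \<Rightarrow> real ^ 'd ^ 'd) \<Rightarrow> (real ^ 'd) set" where
  "slow \<beta> \<omega> = {x. \<exists>K::nat. \<forall>n. norm (P (MP n \<omega> *v x)) \<le> K * exp (\<beta> * n)}"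

lemma slowI:
  fixes K :: real
  shows "(\<And>n. norm (P (MP n \<omega> *v x)) \<le> K * exp (\<beta> * n)) \<Longrightarrow> x \<in> slow \<beta> \<omega>"
proof -
  assume *: "\<And>n. norm (P (MP n \<omega> *v x)) \<le> K * exp (\<beta> * n)"
  have "norm (P (MP n \<omega> *v x)) \<le> real (nat \<lceil>K\<rceil>) * exp (\<beta> * n)" for n
    by (rule order_trans[OF * mult_right_mono[OF real_nat_ceiling_ge]]) simp
  then show ?thesis unfolding slow_def by blast
qed

lemma slow_subspace: "subspace (slow \<beta> \<omega>)"
proof (rule subspaceI)
  show "0 \<in> slow \<beta> \<omega>"
    using P_linear by (intro slowI[where K = 0]) (simp add: linear_0)
next
  fix x y assume "x \<in> slow \<beta> \<omega>" "y \<in> slow \<beta> \<omega>"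
  then obtain K K' :: nat where K: "\<And>n. norm (P (MP n \<omega> *v x)) \<le> K * exp (\<beta> * n)"
    "\<And>n. norm (P (MP n \<omega> *v y)) \<le> K' * exp (\<beta> * n)" unfolding slow_def by blast
  show "x + y \<in> slow \<beta> \<omega>"
  proof (rule slowI)
    fix n
    have "norm (P (MP n \<omega> *v (x + y))) \<le> norm (P (MP n \<omega> *v x)) + norm (P (MP n \<omega> *v y))"
      using P_linear by (simp add: matrix_vector_right_distrib linear_add norm_triangle_ineq)
    also have "\<dots> \<le> (real K + real K') * exp (\<beta> * n)"
      using add_mono[OF K(1)[of n] K(2)[of n]] by (simp add: distrib_right)
    finally show "norm (P (MP n \<omega> *v (x + y))) \<le> (real K + real K') * exp (\<beta> * n)" .
  qed
next
  fix r x assume "x \<in> slow \<beta> \<omega>"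
  then obtain K :: nat where K: "\<And>n. norm (P (MP n \<omega> *v x)) \<le> K * exp (\<beta> * n)" unfolding slow_def by blast
  show "r *\<^sub>R x \<in> slow \<beta> \<omega>"
  proof (rule slowI)
    fix n show "norm (P (MP n \<omega> *v (r *\<^sub>R x))) \<le> (\<bar>r\<bar> * K) * exp (\<beta> * n)"
      using P_linear mult_left_mono[OF K, of "\<bar>r\<bar>" n] by (simp add: matrix_vector_mult_scaleR linear_scale mult.assoc)
  qed
qed

lemma slow_measurable [measurable]: "{\<omega> \<in> space S. x \<in> slow \<beta> \<omega>} \<in> sets S"
  unfolding slow_def mem_Collect_eq by measurable

lemma slow_V: "\<omega> \<in> space S \<Longrightarrow> x \<in> V \<Longrightarrow> x \<in> slow \<beta> \<omega>"
  using P_V[OF MP_V] by (intro slowI[where K = 0]) simp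

lemma slow_scale_P:
  assumes "\<omega> \<in> space S" "x \<in> slow \<beta> \<omega>"
  shows "r *\<^sub>R P x \<in> slow \<beta> \<omega>"
proof -
  have "x - (x - P x) \<in> slow \<beta> \<omega>"
    by (rule subspace_diff[OF slow_subspace assms(2) slow_V[OF assms(1) P_diff]])
  moreover have "x - (x - P x) = P x" by simp
  ultimately show ?thesis using subspace_scale[OF slow_subspace, of "P x"] by metis
qed

text \<open>The first \<open>k\<close> steps affect only the constant in the bound.\<close>

lemma slow_shift:
  assumes "\<omega> \<in> space S"
  shows "x \<in> slow \<beta> \<omega> \<longleftrightarrow> MP k \<omega> *v x \<in> slow \<beta> (seq_shift k \<omega>)"
proof
  assume "x \<in> slow \<beta> \<omega>"
  then obtain K :: nat where K: "\<And>n. norm (P (MP n \<omega> *v x)) \<le> K * exp (\<beta> * n)" unfolding slow_def by blast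
  show "MP k \<omega> *v x \<in> slow \<beta> (seq_shift k \<omega>)"
  proof (rule slowI)
    fix n
    have "norm (P (MP n (seq_shift k \<omega>) *v (MP k \<omega> *v x))) = norm (P (MP (k + n) \<omega> *v x))"
      by (simp add: matrix_product_shift matrix_vector_mul_assoc)
    also have "\<dots> \<le> (K * exp (\<beta> * k)) * exp (\<beta> * n)"
      using K[of "k + n"] by (simp add: exp_add distrib_left mult_ac)
    finally show "norm (P (MP n (seq_shift k \<omega>) *v (MP k \<omega> *v x))) \<le> (K * exp (\<beta> * k)) * exp (\<beta> * n)" .
  qed
next
  assume "MP k \<omega> *v x \<in> slow \<beta> (seq_shift k \<omega>)"
  then obtain K :: nat where K: "\<And>n. norm (P (MP n (seq_shift k \<omega>) *v (MP k \<omega> *v x))) \<le> K * exp (\<beta> * n)"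
    unfolding slow_def by blast
  \<comment> \<open>Covers the finitely many times before \<open>k\<close>, about which the shifted
    path says nothing.\<close>
  define D where "D = (\<Sum>j<k. norm (P (MP j \<omega> *v x)) * exp (- (\<beta> * j)))"
  have D: "0 \<le> D" unfolding D_def by (intro sum_nonneg) auto
  show "x \<in> slow \<beta> \<omega>"
  proof (rule slowI)
    fix n
    show "norm (P (MP n \<omega> *v x)) \<le> (K * exp (- (\<beta> * k)) + D) * exp (\<beta> * n)"
    proof (cases "n < k")
      case True
      then have "norm (P (MP n \<omega> *v x)) * exp (- (\<beta> * n)) \<le> D"
        unfolding D_def by (intro member_le_sum) auto
      also have "\<dots> \<le> K * exp (- (\<beta> * k)) + D" by simp
      finally show ?thesis by (simp add: exp_minus field_simps)
    next
      case False
      then have n: "n = k + (n - k)" by simp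
      have "norm (P (MP n \<omega> *v x)) = norm (P (MP (n - k) (seq_shift k \<omega>) *v (MP k \<omega> *v x)))"
        by (subst n) (simp only: matrix_product_shift matrix_vector_mul_assoc)
      also have "\<dots> \<le> K * exp (\<beta> * real (n - k))" by (rule K)
      also have "\<dots> = K * exp (- (\<beta> * k)) * exp (\<beta> * n)"
        using False by (simp add: of_nat_diff exp_add[symmetric] algebra_simps)
      also have "\<dots> \<le> (K * exp (- (\<beta> * k)) + D) * exp (\<beta> * n)"
        using D by (intro mult_right_mono) auto
      finally show ?thesis .
    qed
  qed
qed

text \<open>
  By the zero-one law some directions are slow with probability close to 1. As \<open>slow \<beta> \<omega>\<close> is closed,
  Borel-Cantelli yields a limit direction that is almost surely slow.
\<close>

lemma AE_slow_point_exists: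
  assumes x: "x \<in> X" and e: "0 < e"
    and m: "e \<le> measure S {\<omega> \<in> space S. \<forall>n\<ge>1. norm (P (MP n \<omega> *v x)) \<le> exp (\<beta> * n)}"
  obtains y where "y \<in> X" "AE \<omega> in S. y \<in> slow \<beta> \<omega>"
proof -
  let ?G = "\<lambda>y. {\<omega> \<in> space S. y \<in> slow \<beta> \<omega>}"
  have "{\<omega> \<in> space S. \<forall>n\<ge>1. norm (P (MP n \<omega> *v x)) \<le> exp (\<beta> * n)} \<subseteq> ?G x"
  proof safe
    fix \<omega> assume w: "\<omega> \<in> space S" "\<forall>n\<ge>1. norm (P (MP n \<omega> *v x)) \<le> exp (\<beta> * n)"
    have "norm (P (MP n \<omega> *v x)) \<le> max 1 (norm (P x)) * exp (\<beta> * n)" for n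
    proof (cases "n = 0")
      case False
      then have "norm (P (MP n \<omega> *v x)) \<le> 1 * exp (\<beta> * n)" using w(2) by simp
      also have "\<dots> \<le> max 1 (norm (P x)) * exp (\<beta> * n)" by (intro mult_right_mono) auto
      finally show ?thesis .
    qed simp
    then show "x \<in> slow \<beta> \<omega>" by (rule slowI)
  qed
  then have "e \<le> measure S (?G x)"
    using m by (elim order_trans) (intro P.finite_measure_mono slow_measurable)
  then have pos: "0 < measure S (?G x)" using e by simp
  \<comment> \<open>The direction is the normalised image of \<open>x\<close> under a suitable
    prefix. The errors \<open>(1/2) ^ j\<close> are summable, as Borel-Cantelli requires.\<close>
  have ex: "\<exists>z. norm z = 1 \<and> P z = z \<and> 1 - (1/2) ^ j \<le> measure S (?G z)" for j :: nat
  proof -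
    obtain k \<omega> where k: "\<omega> \<in> space S" "1 - (1/2) ^ j \<le> measure S {\<omega>' \<in> space S. comb_seq k \<omega> \<omega>' \<in> ?G x}"
      using ex_prefix_measure_near_1[OF slow_measurable pos, of "(1/2) ^ j"] by auto
    have "MP k \<omega> *v x \<in> X" by (rule X_MP[OF k(1) x])
    then obtain r where r: "r \<noteq> 0" "norm (r *\<^sub>R P (MP k \<omega> *v x)) = 1"
      "P (r *\<^sub>R P (MP k \<omega> *v x)) = r *\<^sub>R P (MP k \<omega> *v x)"
      using normalized_point by metis
    have "{\<omega>' \<in> space S. comb_seq k \<omega> \<omega>' \<in> ?G x} \<subseteq> ?G (r *\<^sub>R P (MP k \<omega> *v x))"
    proof safe
      fix \<omega>' assume w: "\<omega>' \<in> space S" and sl: "x \<in> slow \<beta> (comb_seq k \<omega> \<omega>')"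
      have "MP k \<omega> *v x \<in> slow \<beta> \<omega>'"
        using slow_shift[OF comb_seq_space[OF k(1) w, of k], of x \<beta> k] sl
        by (simp add: matrix_product_comb_seq)
      then show "r *\<^sub>R P (MP k \<omega> *v x) \<in> slow \<beta> \<omega>'" by (rule slow_scale_P[OF w])
    qed
    then have "1 - (1/2) ^ j \<le> measure S (?G (r *\<^sub>R P (MP k \<omega> *v x)))"
      using k(2) by (elim order_trans) (intro P.finite_measure_mono slow_measurable)
    with r show ?thesis by blast
  qed
  have "\<exists>z. \<forall>j. norm (z j) = 1 \<and> P (z j) = z j \<and> 1 - (1/2) ^ j \<le> measure S (?G (z j))"
    by (rule choice) (use ex in blast)
  then obtain z where z: "\<And>j. norm (z j) = 1" "\<And>j. P (z j) = z j"
    "\<And>j :: nat. 1 - (1/2) ^ j \<le> measure S (?G (z j))" by blast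
  obtain r y where r: "strict_mono (r :: nat \<Rightarrow> nat)" "(\<lambda>n. z (r n)) \<longlonglongrightarrow> y" "norm y = 1" "P y = y"
    by (rule convergent_subsequence[OF z(1,2)]) (rule that)
  have "AE \<omega> in S. eventually (\<lambda>j. \<omega> \<in> space S - (space S - ?G (z (r j)))) sequentially"
  proof (rule borel_cantelli_AE1)
    show "summable (\<lambda>j. measure S (space S - ?G (z (r j))))"
    proof (rule summable_comparison_test'[where N = 0])
      show "summable (\<lambda>j. (1/2 :: real) ^ j)" by (rule summable_geometric) simp
      fix j :: nat
      have "measure S (space S - ?G (z (r j))) = 1 - measure S (?G (z (r j)))"
        by (rule P.prob_compl[OF slow_measurable])
      also have "\<dots> \<le> (1/2) ^ r j" using z(3)[of "r j"] by simp
      also have "\<dots> \<le> (1/2) ^ j" using seq_suble[OF r(1), of j] by (intro power_decreasing) auto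
      finally show "norm (measure S (space S - ?G (z (r j)))) \<le> (1/2) ^ j" by simp
    qed
  qed (auto simp: P.emeasure_eq_measure)
  then have "AE \<omega> in S. y \<in> slow \<beta> \<omega>"
  proof eventually_elim
    case (elim \<omega>)
    then have "eventually (\<lambda>j. z (r j) \<in> slow \<beta> \<omega>) sequentially"
      by (auto elim!: eventually_mono)
    moreover have "closed (slow \<beta> \<omega>)" by (rule closed_subspace[OF slow_subspace])
    ultimately show ?case using r(2) by (intro Lim_in_closed_set) auto
  qed
  moreover have "y \<in> X" using r by (auto simp: X_def)
  ultimately show ?thesis using that by blast
qed

definition slow_space :: "real \<Rightarrow> (real ^ 'd) set" where
  "slow_space \<beta> = {x. AE \<omega> in S. x \<in> slow \<beta> \<omega>}"

lemma slow_space_subspace: "subspace (slow_space \<beta>)"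
proof (rule subspaceI)
  show "0 \<in> slow_space \<beta>"
    using subspace_0[OF slow_subspace] by (simp add: slow_space_def)
  show "x + y \<in> slow_space \<beta>" if xy: "x \<in> slow_space \<beta>" "y \<in> slow_space \<beta>" for x y
    using xy unfolding slow_space_def mem_Collect_eq
    by eventually_elim (rule subspace_add[OF slow_subspace])
  show "r *\<^sub>R x \<in> slow_space \<beta>" if "x \<in> slow_space \<beta>" for r x
    using that unfolding slow_space_def mem_Collect_eq
    by eventually_elim (rule subspace_scale[OF slow_subspace])
qed

lemma V_slow_space: "V \<subseteq> slow_space \<beta>"
  unfolding slow_space_def using slow_V by (auto intro!: AE_I2)

text \<open>If \<open>x\<close> is almost surely slow, then so is \<open>h *v x\<close> for almost
  every \<open>h\<close>. The exceptional \<open>h\<close> form an open set, because a subspace is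
  closed, and full support forbids a null open set that meets \<Sigma>.\<close>

lemma slow_space_inv:
  assumes supp: "supp_measure \<nu> = \<Sigma>" and g: "g \<in> \<Sigma>" and x: "x \<in> slow_space \<beta>"
  shows "g *v x \<in> slow_space \<beta>"
proof (rule ccontr)
  assume neg: "g *v x \<notin> slow_space \<beta>"
  let ?O = "{h. h *v x \<notin> slow_space \<beta>}"
  have "AE h in \<nu>. AE \<omega> in S. x \<in> slow \<beta> (case_nat h \<omega>)"
    using x by (intro AE_case_nat) (simp add: slow_space_def)
  then have AE: "AE h in \<nu>. h \<notin> ?O"
    using AE_space
  proof eventually_elim
    case (elim h)
    from elim(1) have "AE \<omega> in S. h *v x \<in> slow \<beta> \<omega>"
      using AE_space
    proof eventually_elim
      case (elim \<omega>)
      have "case_nat h \<omega> \<in> space S"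
        using elim(2) \<open>h \<in> space \<nu>\<close> by (auto simp: space_S split: nat.split)
      from slow_shift[OF this, of x \<beta> 1] elim(1) show ?case
        by (simp add: seq_shift_def)
    qed
    then show ?case by (simp add: slow_space_def)
  qed
  have op: "open ?O"
  proof -
    have "continuous_on UNIV (\<lambda>h :: real ^ 'd ^ 'd. h *v x)"
      unfolding matrix_vector_mult_def by (intro continuous_intros)
    then have "open ((\<lambda>h :: real ^ 'd ^ 'd. h *v x) -` (- slow_space \<beta>))"
      using closed_subspace[OF slow_space_subspace] by (intro open_vimage) auto
    then show ?thesis by (simp add: vimage_def)
  qed
  have "?O \<inter> space \<nu> \<in> sets \<nu>"
    unfolding sets_\<nu> space_\<nu> sets_restrict_space
    by (rule image_eqI[of _ _ ?O]) (use borel_open[OF op] in \<open>simp_all add: Int_commute\<close>)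
  then have "emeasure \<nu> (?O \<inter> space \<nu>) = 0"
    using AE by (subst (asm) AE_iff_measurable[of "?O \<inter> space \<nu>"]) auto
  moreover have "0 < emeasure \<nu> (?O \<inter> space \<nu>)"
    using supp g op neg unfolding supp_measure_def by blast
  ultimately show False by simp
qed

text \<open>For large \<open>n\<close> all vectors of an orthonormal basis are slow at time
  \<open>n\<close> up to an event of small probability. With exponent \<open>1 / n\<close> the
  growth on that event costs no more than the factor \<open>b\<close>, whatever \<open>n\<close>
  is.\<close>

lemma moment_growth_slow_space:
  assumes supp: "supp_measure \<nu> = \<Sigma>" and t: "\<beta> < t"
  obtains s where "0 < s" "s \<le> 1" "moment_growth \<nu> (slow_space \<beta>) (\<lambda>x. norm (P x)) s t"
proof -
  let ?V = "slow_space \<beta>"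
  obtain B where B: "B \<subseteq> ?V" "pairwise orthogonal B" "\<And>x. x \<in> B \<Longrightarrow> norm x = 1"
    "independent B" "card B = dim ?V" "span B = ?V"
    by (rule orthonormal_basis_subspace[OF slow_space_subspace]) blast
  have fin: "finite B" using B(4) independent_imp_finite by blast
  define \<beta>' where "\<beta>' = (\<beta> + t) / 2"
  have \<beta>': "\<beta> < \<beta>'" "\<beta>' < t" using t by (auto simp: \<beta>'_def)
  let ?E = "\<lambda>n. {\<omega> \<in> space S. (\<Sum>u\<in>B. norm (P (MP n \<omega> *v u))) \<le> exp (\<beta>' * n)}"
  have Em[measurable]: "?E n \<in> sets S" for n by measurable
  have "AE \<omega> in S. \<forall>u\<in>B. u \<in> slow \<beta> \<omega>"
    using B(1) fin by (subst AE_finite_all) (auto simp: slow_space_def)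
  then have ev: "AE \<omega> in S. eventually (\<lambda>n. \<omega> \<in> ?E n) sequentially"
    using AE_space
  proof eventually_elim
    case (elim \<omega>)
    then have "\<forall>u\<in>B. \<exists>K::nat. \<forall>n. norm (P (MP n \<omega> *v u)) \<le> K * exp (\<beta> * n)"
      by (auto simp: slow_def)
    then obtain K :: "_ \<Rightarrow> nat" where K: "\<And>u n. u \<in> B \<Longrightarrow> norm (P (MP n \<omega> *v u)) \<le> K u * exp (\<beta> * n)"
      by metis
    define k where "k = (\<Sum>u\<in>B. real (K u))"
    have le: "(\<Sum>u\<in>B. norm (P (MP n \<omega> *v u))) \<le> k * exp (\<beta> * n)" for n
      unfolding k_def sum_distrib_right by (intro sum_mono K)
    have "filterlim (\<lambda>n. (\<beta>' - \<beta>) * real n) at_top sequentially"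
      using \<beta>' by (intro filterlim_tendsto_pos_mult_at_top[OF tendsto_const]) (auto simp: filterlim_real_sequentially)
    then have "filterlim (\<lambda>n. exp ((\<beta>' - \<beta>) * real n)) at_top sequentially"
      by (rule filterlim_compose[OF exp_at_top])
    then have "eventually (\<lambda>n. k \<le> exp ((\<beta>' - \<beta>) * real n)) sequentially"
      by (simp add: filterlim_at_top)
    then show ?case
    proof eventually_elim
      case (elim n)
      have "k * exp (\<beta> * n) \<le> exp ((\<beta>' - \<beta>) * real n) * exp (\<beta> * n)"
        using elim by (rule mult_right_mono) simp
      also have "\<dots> = exp (\<beta>' * n)" by (simp add: exp_add[symmetric] algebra_simps)
      finally show ?case using le[of n] \<open>\<omega> \<in> space S\<close> by simp
    qed
  qed
  have "(\<lambda>n. \<integral>\<omega>. indicat_real (?E n) \<omega> \<partial>S) \<longlonglongrightarrow> (\<integral>\<omega>. 1 \<partial>S)"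
  proof (rule integral_dominated_convergence[where w = "\<lambda>_. 1"])
    show "AE \<omega> in S. (\<lambda>n. indicat_real (?E n) \<omega>) \<longlonglongrightarrow> 1"
      using ev
    proof eventually_elim
      case (elim \<omega>)
      then show ?case by (intro tendsto_eventually) (auto elim!: eventually_mono)
    qed
  qed auto
  then have lim: "(\<lambda>n. measure S (?E n)) \<longlonglongrightarrow> 1" by (simp add: P.prob_space)
  \<comment> \<open>The exceptional event may have any probability \<open>p\<close> with
    \<open>exp \<beta>' + b * p \<le> exp t\<close>.\<close>
  have "1 - (exp t - exp \<beta>') / b < 1" using \<beta>' b1 by simp
  then have "eventually (\<lambda>n. 1 - (exp t - exp \<beta>') / b < measure S (?E n)) sequentially"
    using lim by (intro order_tendstoD(1))
  then have "eventually (\<lambda>n. 1 \<le> n \<and> 1 - (exp t - exp \<beta>') / b < measure S (?E n)) sequentially"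
    using eventually_ge_at_top[of 1] by eventually_elim simp
  then obtain n where n: "1 \<le> n" "1 - (exp t - exp \<beta>') / b < measure S (?E n)"
    by (auto simp: eventually_sequentially)
  \<comment> \<open>Makes the s-th power of \<open>b ^ n\<close> equal to \<open>b\<close>, so that
    the loss does not grow with \<open>n\<close>.\<close>
  define s where "s = 1 / real n"
  have s: "0 < s" "s \<le> 1" "s * n = 1" using n by (auto simp: s_def)
  have pw: "(exp (\<beta>' * n) * y) powr s = exp \<beta>' * y powr s" "(b ^ n * y) powr s = b * y powr s" if "0 \<le> y" for y
  proof -
    have "exp (\<beta>' * n) powr s = exp \<beta>'" using n by (simp add: powr_def s_def)
    then show "(exp (\<beta>' * n) * y) powr s = exp \<beta>' * y powr s" using that by (simp add: powr_mult)
    have "(b ^ n) powr s = b powr (n * s)" using b1 by (simp add: powr_realpow[symmetric] powr_powr)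
    then have "(b ^ n) powr s = b" using s(3) b1 by (simp add: mult.commute)
    then show "(b ^ n * y) powr s = b * y powr s" using that b1 by (simp add: powr_mult)
  qed
  define p where "p = 1 - measure S (?E n)"
  have p0: "0 \<le> p" by (simp add: p_def)
  have "moment_growth \<nu> ?V (\<lambda>x. norm (P x)) s t"
  proof (rule moment_growth_of_steps[OF slow_space_subspace slow_space_inv[OF supp] _ _ _ _ s(1,2) n(1)])
    show "norm (P (x + y)) \<le> norm (P x) + norm (P y)" for x y
      using P_linear by (simp add: linear_add norm_triangle_ineq)
    fix x assume x: "x \<in> ?V"
    have Px: "P x \<in> ?V"
      using subspace_diff[OF slow_space_subspace x subsetD[OF V_slow_space P_diff[of x]]] by simp
    have expand: "P x = (\<Sum>u\<in>B. (P x \<bullet> u) *\<^sub>R u)"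
    proof -
      let ?y = "P x - (\<Sum>u\<in>B. (P x \<bullet> u) *\<^sub>R u)"
      have yV: "?y \<in> span B"
        using Px B(6) by (intro span_diff span_sum span_scale) (auto intro: span_base)
      have "orthogonal ?y u" if u: "u \<in> B" for u
      proof -
        have "(\<Sum>v\<in>B. (P x \<bullet> v) *\<^sub>R v) \<bullet> u = (\<Sum>v\<in>B. if v = u then P x \<bullet> u else 0)"
          unfolding inner_sum_left
          using B(2,3) u by (intro sum.cong) (auto simp: pairwise_def orthogonal_def norm_eq_1)
        then show ?thesis using fin u by (simp add: orthogonal_def inner_diff_left)
      qed
      then have "orthogonal ?y ?y" by (rule orthogonal_to_span[OF yV])
      then show ?thesis by (simp add: orthogonal_def)
    qed
    have bnd: "norm (P (MP n \<omega> *v x)) powr s \<le> exp \<beta>' * norm (P x) powr s + indicator (space S - ?E n) \<omega> * (b * norm (P x) powr s)"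
      if w: "\<omega> \<in> space S" for \<omega>
    proof (cases "\<omega> \<in> ?E n")
      case True
      have "P (MP n \<omega> *v x) = P (MP n \<omega> *v P x)" using P_MP_P[OF w] by simp
      also have "\<dots> = (\<Sum>u\<in>B. (P x \<bullet> u) *\<^sub>R P (MP n \<omega> *v u))"
        by (subst expand) (simp add: linear_sum[OF P_linear] linear_sum[OF matrix_vector_mul_linear]
            matrix_vector_mult_scaleR linear_scale[OF P_linear])
      also have "norm \<dots> \<le> (\<Sum>u\<in>B. norm ((P x \<bullet> u) *\<^sub>R P (MP n \<omega> *v u)))" by (rule norm_sum)
      also have "\<dots> \<le> (\<Sum>u\<in>B. norm (P x) * norm (P (MP n \<omega> *v u)))"
      proof (rule sum_mono)
        fix u assume "u \<in> B"
        then have "\<bar>P x \<bullet> u\<bar> \<le> norm (P x)"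
          using Cauchy_Schwarz_ineq2[of "P x" u] B(3)[of u] by simp
        then show "norm ((P x \<bullet> u) *\<^sub>R P (MP n \<omega> *v u)) \<le> norm (P x) * norm (P (MP n \<omega> *v u))"
          by (simp add: mult_right_mono)
      qed
      also have "\<dots> = norm (P x) * (\<Sum>u\<in>B. norm (P (MP n \<omega> *v u)))" by (simp add: sum_distrib_left)
      also have "\<dots> \<le> norm (P x) * exp (\<beta>' * n)" using True by (intro mult_left_mono) auto
      finally have "norm (P (MP n \<omega> *v x)) powr s \<le> (exp (\<beta>' * n) * norm (P x)) powr s"
        using s by (intro powr_mono2) (auto simp: mult.commute)
      then show ?thesis using True pw(1)[of "norm (P x)"] by simp
    next
      case False
      have "norm (P (MP n \<omega> *v x)) powr s \<le> (b ^ n * norm (P x)) powr s"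
        using s P_MP_le[OF w] by (intro powr_mono2) auto
      also have "\<dots> \<le> exp \<beta>' * norm (P x) powr s + b * norm (P x) powr s" by (simp add: pw)
      finally show ?thesis using False w by simp
    qed
    have "(\<integral>\<^sup>+\<omega>. ennreal (norm (P (MP n \<omega> *v x)) powr s) \<partial>S)
       \<le> (\<integral>\<^sup>+\<omega>. ennreal (exp \<beta>' * norm (P x) powr s) + ennreal (b * norm (P x) powr s) * indicator (space S - ?E n) \<omega> \<partial>S)"
    proof (rule nn_integral_mono)
      fix \<omega> assume w: "\<omega> \<in> space S"
      from bnd[OF w] have "ennreal (norm (P (MP n \<omega> *v x)) powr s)
          \<le> ennreal (exp \<beta>' * norm (P x) powr s + indicator (space S - ?E n) \<omega> * (b * norm (P x) powr s))"
        by (rule ennreal_leI)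
      also have "\<dots> = ennreal (exp \<beta>' * norm (P x) powr s) + ennreal (b * norm (P x) powr s) * indicator (space S - ?E n) \<omega>"
        using b1 by (cases "\<omega> \<in> space S - ?E n") (auto simp: ennreal_plus)
      finally show "ennreal (norm (P (MP n \<omega> *v x)) powr s)
          \<le> ennreal (exp \<beta>' * norm (P x) powr s) + ennreal (b * norm (P x) powr s) * indicator (space S - ?E n) \<omega>" .
    qed
    also have "\<dots> = ennreal (exp \<beta>' * norm (P x) powr s) + ennreal (b * norm (P x) powr s) * emeasure S (space S - ?E n)"
      by (subst nn_integral_add) (auto simp: P.emeasure_space_1 nn_integral_cmult)
    also have "emeasure S (space S - ?E n) = ennreal p"
      unfolding p_def P.emeasure_eq_measure P.prob_compl[OF Em] ..
    also have "ennreal (exp \<beta>' * norm (P x) powr s) + ennreal (b * norm (P x) powr s) * ennreal p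
        = ennreal ((exp \<beta>' + b * p) * norm (P x) powr s)"
      using b1 p0 by (simp add: ennreal_plus[symmetric] ennreal_mult[symmetric] algebra_simps del: ennreal_plus)
    also have "\<dots> \<le> ennreal (exp t * norm (P x) powr s)"
    proof (intro ennreal_leI mult_right_mono)
      have "p < (exp t - exp \<beta>') / b" using n(2) by (simp add: p_def)
      then show "exp \<beta>' + b * p \<le> exp t" using b1 by (simp add: field_simps)
    qed simp
    also have "exp t = exp (s * n * t)" using s by simp
    finally show "(\<integral>\<^sup>+\<omega>. ennreal (norm (P (MP n \<omega> *v x)) powr s) \<partial>S) \<le> ennreal (exp (s * n * t) * norm (P x) powr s)" .
  qed (auto intro: P_act_le)
  then show ?thesis using that s by blast
qed


text \<open>Either a rate above \<beta> is reached within bounded time with high probability from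
  every direction, which bounds the means below; or some direction outside \<open>V\<close> is
  almost surely slow. In the second case the slow space strictly contains \<open>V\<close> and still
  grows below L_1, against maximality.\<close>

lemma uniform_lower_bound:
  assumes supp: "supp_measure \<nu> = \<Sigma>"
    and low: "0 < s" "s \<le> 1" "t < lyapunov_exponent 1 \<nu>" "moment_growth \<nu> V norm s t"
    and max: "\<forall>V' s' t'. subspace V' \<and> (\<forall>g\<in>\<Sigma>. \<forall>x\<in>V'. g *v x \<in> V') \<and> 0 < s' \<and> s' \<le> 1 \<and>
      t' < lyapunov_exponent 1 \<nu> \<and> moment_growth \<nu> V' norm s' t' \<longrightarrow> dim V' \<le> dim V"
    and \<beta>: "\<beta> < lyapunov_exponent 1 \<nu>"
  obtains n0 where "\<And>n x. n0 \<le> n \<Longrightarrow> x \<in> X \<Longrightarrow> \<beta> * n \<le> (\<integral>\<omega>. a n x \<omega> \<partial>S)"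
proof -
  \<comment> \<open>Four equal gaps separate \<beta>, the hitting rate \<open>\<beta>1\<close>, the
    rate \<open>\<beta>2\<close> of slow vectors, their moment rate \<open>\<beta>3\<close> and
    L_1.\<close>
  define h where "h = (lyapunov_exponent 1 \<nu> - \<beta>) / 4"
  define \<beta>1 where "\<beta>1 = \<beta> + h"
  define \<beta>2 where "\<beta>2 = \<beta> + 2 * h"
  define \<beta>3 where "\<beta>3 = \<beta> + 3 * h"
  have h: "0 < h" "lyapunov_exponent 1 \<nu> = \<beta> + 4 * h" using \<beta> by (simp_all add: h_def field_simps)
  define D where "D = ln b + \<bar>\<beta>1\<bar> + 1"
  have D: "0 < D" using b1 by (simp add: D_def add_nonneg_pos)
  \<comment> \<open>Half of the margin between \<open>\<beta>1\<close> and \<beta> pays for the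
    times without a hit, the other half for the summand \<open>D * N\<close> once \<open>n\<close>
    is large.\<close>
  define e where "e = h / (2 * D)"
  have e: "0 < e" using h D by (simp add: e_def)
  show ?thesis
  proof (cases "\<exists>N::nat. \<forall>x\<in>X. 1 - e \<le> measure S {\<omega> \<in> space S. \<exists>n\<in>{1..N}. \<beta>1 * n \<le> a n x \<omega>}")
    case True
    then obtain N :: nat where N: "\<And>x. x \<in> X \<Longrightarrow> 1 - e \<le> measure S {\<omega> \<in> space S. \<exists>n\<in>{1..N}. \<beta>1 * n \<le> a n x \<omega>}"
      by blast
    obtain n0 :: nat where n0: "D * N / (h / 2) < n0" using reals_Archimedean2 by blast
    show ?thesis
    proof (rule that)
      fix n x assume n: "n0 \<le> n" and x: "x \<in> X"
      have "D * N / (h / 2) < n" using n0 n by simp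
      then have "D * N < n * (h / 2)" using h by (subst (asm) pos_divide_less_eq) auto
      moreover have "D * (e * n) = n * (h / 2)" using D by (simp add: e_def)
      moreover have "(ln b + \<bar>\<beta>1\<bar>) * (e * n + N) \<le> D * (e * n + N)"
        using e by (intro mult_right_mono) (auto simp: D_def)
      moreover have "\<beta>1 * n = \<beta> * n + n * h" by (simp add: \<beta>1_def algebra_simps)
      ultimately show "\<beta> * n \<le> (\<integral>\<omega>. a n x \<omega> \<partial>S)"
        using expectation_a_ge[OF N x, of n] distrib_left[of D "e * n" N] field_sum_of_halves[of h]
          distrib_left[of n "h / 2" "h / 2"] by linarith
    qed
  next
    case False
    then have "\<exists>x\<in>X. measure S {\<omega> \<in> space S. \<exists>n\<in>{1..N}. \<beta>1 * n \<le> a n x \<omega>} < 1 - e" for N :: nat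
      by (meson not_le)
    then obtain x where x: "x \<in> X" "e \<le> measure S {\<omega> \<in> space S. \<forall>n\<ge>1. norm (P (MP n \<omega> *v x)) \<le> exp (\<beta>2 * n)}"
      using slow_point_exists[OF e, of \<beta>1 \<beta>2] h by (auto simp: \<beta>1_def \<beta>2_def)
    obtain y where y: "y \<in> X" "AE \<omega> in S. y \<in> slow \<beta>2 \<omega>"
      by (rule AE_slow_point_exists[OF x(1) e x(2)])
    let ?V' = "slow_space \<beta>2"
    define t1 where "t1 = max t \<beta>3"
    obtain s1 where s1: "0 < s1" "s1 \<le> 1" "moment_growth \<nu> ?V' (\<lambda>x. norm (P x)) s1 \<beta>3"
      using moment_growth_slow_space[OF supp, of \<beta>2 \<beta>3] h by (auto simp: \<beta>2_def \<beta>3_def)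
    \<comment> \<open>The two growth statements come with different exponents and rates; they are
      brought to common ones before \<open>V\<close> and the quotient are combined.\<close>
    define s2 where "s2 = min s s1"
    have s2: "0 < s2" "s2 \<le> 1" "s2 \<le> s" "s2 \<le> s1" using s1 low by (auto simp: s2_def)
    note inv' = slow_space_inv[OF supp, of _ _ \<beta>2]
    have m1: "moment_growth \<nu> V norm s2 t1"
      by (rule moment_growth_mono[OF moment_growth_exponent_mono[OF V V_inv low(4) s2(1,3)]])
        (use s2 in \<open>auto simp: t1_def\<close>)
    have m2: "moment_growth \<nu> ?V' (\<lambda>x. norm (P x)) s2 t1"
      by (rule moment_growth_mono[OF moment_growth_exponent_mono[OF slow_space_subspace inv' s1(3) s2(1,4)]])
        (use s2 in \<open>auto simp: t1_def\<close>)
    define t2 where "t2 = (t1 + lyapunov_exponent 1 \<nu>) / 2"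
    have t2: "t1 < t2" "t2 < lyapunov_exponent 1 \<nu>"
      using low(3) h by (auto simp: t2_def t1_def \<beta>3_def)
    have mg: "moment_growth \<nu> ?V' norm s2 t2"
      by (rule moment_growth_extension[OF slow_space_subspace V V_slow_space inv' V_inv P_linear P_le
            P_diff P_V m1 m2 s2(1,2) t2(1)])
    have "dim ?V' \<le> dim V"
      using max slow_space_subspace[of \<beta>2] inv' s2(1,2) t2(2) mg by blast
    then have "V = ?V'"
      by (intro subspace_dim_equal V slow_space_subspace V_slow_space)
    moreover have "y \<in> ?V'" using y by (simp add: slow_space_def)
    ultimately show ?thesis using y(1) P_V by (auto simp: X_def)
  qed
qed

end

section \<open>Contraction on the projective space of the quotient\<close>

context matrix_law
begin

text \<open>The zero subspace qualifies with the weight 0, and dimensions are bounded.\<close>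

lemma maximal_low_growth_subspace:
  obtains V s t where "subspace V" "\<And>g x. g \<in> \<Sigma> \<Longrightarrow> x \<in> V \<Longrightarrow> g *v x \<in> V"
    "0 < s" "s \<le> 1" "t < lyapunov_exponent 1 \<nu>" "moment_growth \<nu> V norm s t"
    "\<forall>V' s' t'. subspace V' \<and> (\<forall>g\<in>\<Sigma>. \<forall>x\<in>V'. g *v x \<in> V') \<and> 0 < s' \<and> s' \<le> 1 \<and>
      t' < lyapunov_exponent 1 \<nu> \<and> moment_growth \<nu> V' norm s' t' \<longrightarrow> dim V' \<le> dim V"
proof -
  define Q where "Q V \<longleftrightarrow> subspace V \<and> (\<forall>g\<in>\<Sigma>. \<forall>x\<in>V. g *v x \<in> V) \<and>
    (\<exists>s t. 0 < s \<and> s \<le> 1 \<and> t < lyapunov_exponent 1 \<nu> \<and> moment_growth \<nu> V norm s t)" for V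
  have "moment_growth \<nu> {0} norm 1 (lyapunov_exponent 1 \<nu> - 1)"
    unfolding moment_growth_def by (intro exI[of _ "\<lambda>_. 0"] exI[of _ 0]) auto
  then have Q0: "Q {0}"
    unfolding Q_def
    by (intro conjI exI[of _ "1 :: real"] exI[of _ "lyapunov_exponent 1 \<nu> - 1"])
      (auto simp: subspace_single_0)
  have "\<exists>V. Q V \<and> (\<forall>V'. Q V' \<longrightarrow> dim V' \<le> dim V)"
    by (rule Lattices_Big.ex_has_greatest_nat[of Q "{0}" dim "CARD('d) + 1", OF Q0])
      (simp add: le_imp_less_Suc dim_subset_UNIV_cart)
  then obtain V where V: "Q V" "\<And>V'. Q V' \<Longrightarrow> dim V' \<le> dim V" by blast
  from V(1) obtain s t where st: "subspace V" "\<And>g x. g \<in> \<Sigma> \<Longrightarrow> x \<in> V \<Longrightarrow> g *v x \<in> V"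
    "0 < s" "s \<le> 1" "t < lyapunov_exponent 1 \<nu>" "moment_growth \<nu> V norm s t"
    unfolding Q_def by blast
  have "\<forall>V' s' t'. subspace V' \<and> (\<forall>g\<in>\<Sigma>. \<forall>x\<in>V'. g *v x \<in> V') \<and> 0 < s' \<and> s' \<le> 1 \<and>
      t' < lyapunov_exponent 1 \<nu> \<and> moment_growth \<nu> V' norm s' t' \<longrightarrow> dim V' \<le> dim V"
  proof (intro allI impI)
    fix V' s' t'
    assume "subspace V' \<and> (\<forall>g\<in>\<Sigma>. \<forall>x\<in>V'. g *v x \<in> V') \<and> 0 < s' \<and> s' \<le> 1 \<and>
      t' < lyapunov_exponent 1 \<nu> \<and> moment_growth \<nu> V' norm s' t'"
    then have "Q V'" unfolding Q_def by blast
    then show "dim V' \<le> dim V" by (rule V(2))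
  qed
  with st show ?thesis by (rule that)
qed

end

context quotient_law
begin

text \<open>\<open>pd x y\<close> is the squared sine of the angle between \<open>x\<close> and \<open>y\<close> in the quotient by \<open>V\<close>.\<close>

definition pd :: "real ^ 'd \<Rightarrow> real ^ 'd \<Rightarrow> real" where
  "pd x y = gram2 (P x) (P y) / ((norm (P x))\<^sup>2 * (norm (P y))\<^sup>2)"

lemma pd_nonneg: "0 \<le> pd x y"
  by (simp add: pd_def gram2_nonneg)

lemma pd_le_1: "pd x y \<le> 1"
proof (cases "(norm (P x))\<^sup>2 * (norm (P y))\<^sup>2 = 0")
  case False
  then have "0 < (norm (P x))\<^sup>2 * (norm (P y))\<^sup>2" by simp
  then show ?thesis using gram2_le[of "P x" "P y"] unfolding pd_def by (subst pos_divide_le_eq) auto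
qed (auto simp: pd_def)

lemma gram2_P_le:
  assumes d: "2 \<le> CARD('d)" and A: "\<And>z. P (A *v P z) = P (A *v z)"
  shows "gram2 (P (A *v x)) (P (A *v y)) \<le> (wedge_norm A)\<^sup>2 * gram2 (P x) (P y)"
  using gram2_linear_contraction[OF P_linear P_le, of "A *v P x" "A *v P y"]
    gram2_le_wedge_norm[OF d, of A "P x" "P y"] unfolding A by linarith

text \<open>The squared \<open>wedge_norm\<close> contributes \<open>b ^ 4\<close>, the two squared
  norms in the denominator contribute \<open>b ^ 4\<close> more.\<close>

lemma pd_act:
  assumes d: "2 \<le> CARD('d)" and g: "g \<in> \<Sigma>" and x: "x \<in> X" "y \<in> X"
  shows "pd (g *v x) (g *v y) \<le> b ^ 8 * pd x y"
proof -
  define G where "G = gram2 (P x) (P y)"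
  define u where "u = norm (P x)"
  define v where "v = norm (P y)"
  define u' where "u' = norm (P (g *v x))"
  define v' where "v' = norm (P (g *v y))"
  have pos: "0 < u" "0 < v" "0 < u'" "0 < v'" "0 < b"
    using x X_act[OF g] b1 by (auto simp: u_def v_def u'_def v'_def X_def)
  have "u \<le> b * u'" "v \<le> b * v'"
    using P_act_ge[OF g] by (auto simp: u_def v_def u'_def v'_def)
  then have "u\<^sup>2 * v\<^sup>2 \<le> (b * u')\<^sup>2 * (b * v')\<^sup>2"
    using pos by (intro mult_mono power_mono) auto
  then have uv: "u\<^sup>2 * v\<^sup>2 \<le> b ^ 4 * (u'\<^sup>2 * v'\<^sup>2)"
    by (simp add: power_mult_distrib power2_eq_square power4_eq_xxxx mult_ac)
  have G: "0 \<le> G" by (simp add: G_def gram2_nonneg)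
  have "(wedge_norm g)\<^sup>2 \<le> (b\<^sup>2)\<^sup>2"
    using wedge_norm_bounds(1)[OF d g] wedge_norm_nonneg[OF d] by (rule power_mono)
  then have "gram2 (P (g *v x)) (P (g *v y)) \<le> b ^ 4 * G"
    using gram2_P_le[OF d P_act_P[OF g], of x y] mult_right_mono[of "(wedge_norm g)\<^sup>2" "b ^ 4" G] G
    by (simp add: G_def power_mult[symmetric])
  then have "pd (g *v x) (g *v y) \<le> b ^ 4 * G / (u'\<^sup>2 * v'\<^sup>2)"
    unfolding pd_def u'_def[symmetric] v'_def[symmetric] by (rule divide_right_mono) simp
  also have "\<dots> \<le> b ^ 4 * G * b ^ 4 / (u\<^sup>2 * v\<^sup>2)"
    using mult_left_mono[OF uv, of "b ^ 4 * G"] G pos by (simp add: divide_simps mult_ac)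
  also have "\<dots> = b ^ 8 * pd x y"
    by (simp add: pd_def G_def u_def v_def power_add[symmetric])
  finally show ?thesis .
qed

text \<open>The area grows by at most the norm on the exterior square while the lengths grow by the
  exponentials of \<open>a\<close>; the factor 2 reflects the square of the sine.\<close>

lemma pd_MP:
  assumes d: "2 \<le> CARD('d)" and w: "\<omega> \<in> space S" and x: "x \<in> X" "y \<in> X"
  shows "pd (MP n \<omega> *v x) (MP n \<omega> *v y)
    \<le> exp (2 * (ln (wedge_norm (MP n \<omega>)) - a n x \<omega> - a n y \<omega>)) * pd x y"
proof -
  let ?A = "MP n \<omega>"
  define G where "G = gram2 (P x) (P y)"
  define u where "u = norm (P x)"
  define v where "v = norm (P y)"
  define u' where "u' = norm (P (?A *v x))"
  define v' where "v' = norm (P (?A *v y))"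
  define k where "k = wedge_norm ?A"
  have pos: "0 < u" "0 < v" "0 < u'" "0 < v'" "0 < k"
    using x X_MP[OF w] lyapunov_exponent_2(2)[OF d w] by (auto simp: u_def v_def u'_def v'_def X_def k_def)
  have "exp (ln k - ln (u' / u) - ln (v' / v)) = k * (u / u') * (v / v')"
    unfolding exp_diff using pos by simp
  then have "exp (2 * (ln k - ln (u' / u) - ln (v' / v))) = (k * (u / u') * (v / v'))\<^sup>2"
    unfolding exp_double by simp
  then have "exp (2 * (ln k - ln (u' / u) - ln (v' / v))) * (G / (u\<^sup>2 * v\<^sup>2)) = k\<^sup>2 * G / (u'\<^sup>2 * v'\<^sup>2)"
    using pos by (simp add: power2_eq_square field_simps)
  moreover have "pd (?A *v x) (?A *v y) \<le> k\<^sup>2 * G / (u'\<^sup>2 * v'\<^sup>2)"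
    unfolding pd_def u'_def[symmetric] v'_def[symmetric]
    using gram2_P_le[OF d P_MP_P[OF w], of n x y] by (intro divide_right_mono) (simp_all add: G_def k_def)
  ultimately show ?thesis
    by (simp add: a_def pd_def G_def u_def v_def u'_def v'_def k_def)
qed

text \<open>The exponent in \<open>pd_MP\<close> has mean about L_1 + L_2 - 2 L_1 per step,
  uniformly in both directions by \<open>lower\<close>. This is negative, and
  \<open>expectation_exp_le\<close> converts it into contraction of a small power of the
  sine.\<close>

lemma contraction_after_steps:
  assumes d: "2 \<le> CARD('d)" and gap: "lyapunov_exponent 2 \<nu> < lyapunov_exponent 1 \<nu>"
    and lower: "\<And>\<beta>. \<beta> < lyapunov_exponent 1 \<nu> \<Longrightarrow> \<exists>n0. \<forall>n\<ge>n0. \<forall>x\<in>X. \<beta> * n \<le> (\<integral>\<omega>. a n x \<omega> \<partial>S)"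
  obtains N q \<alpha> where "1 \<le> N" "0 < q" "q < 1" "0 < \<alpha>" "\<alpha> \<le> 1"
    "\<And>x y. x \<in> X \<Longrightarrow> y \<in> X \<Longrightarrow> (\<integral>\<^sup>+\<omega>. ennreal (pd (MP N \<omega> *v x) (MP N \<omega> *v y) powr (\<alpha> / 2)) \<partial>S)
      \<le> ennreal (q ^ N) * ennreal (pd x y powr (\<alpha> / 2))"
proof -
  \<comment> \<open>An error \<open>h\<close> in each of the three rates leaves a mean of at most
    \<open>- h\<close> per step out of the full gap \<open>4 * h\<close>.\<close>
  define h where "h = (lyapunov_exponent 1 \<nu> - lyapunov_exponent 2 \<nu>) / 4"
  have h: "0 < h" using gap by (simp add: h_def)
  obtain n0 where n0: "\<And>n x. n0 \<le> n \<Longrightarrow> x \<in> X \<Longrightarrow> (lyapunov_exponent 1 \<nu> - h) * n \<le> (\<integral>\<omega>. a n x \<omega> \<partial>S)"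
    using lower[of "lyapunov_exponent 1 \<nu> - h"] h by auto
  have "eventually (\<lambda>n. (\<integral>\<omega>. ln (wedge_norm (MP n \<omega>)) \<partial>S) / n
      < lyapunov_exponent 1 \<nu> + lyapunov_exponent 2 \<nu> + h) sequentially"
    using h by (intro order_tendstoD(2)[OF lyapunov_exponent_2(1)[OF d]]) simp
  then have "eventually (\<lambda>n. (\<integral>\<omega>. ln (wedge_norm (MP n \<omega>)) \<partial>S) / n
      < lyapunov_exponent 1 \<nu> + lyapunov_exponent 2 \<nu> + h \<and> max 1 n0 \<le> n) sequentially"
    using eventually_ge_at_top[of "max 1 n0"] by eventually_elim simp
  then obtain N where N: "(\<integral>\<omega>. ln (wedge_norm (MP N \<omega>)) \<partial>S) / N
      < lyapunov_exponent 1 \<nu> + lyapunov_exponent 2 \<nu> + h" "1 \<le> N" "n0 \<le> N"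
    by (auto simp: eventually_sequentially)
  have EN: "(\<integral>\<omega>. ln (wedge_norm (MP N \<omega>)) \<partial>S) < (lyapunov_exponent 1 \<nu> + lyapunov_exponent 2 \<nu> + h) * N"
    using N by (simp add: divide_less_eq)
  have lnb: "0 \<le> ln b" using b1 by simp
  \<comment> \<open>A bound for the exponent: the exterior square contributes
    \<open>2 * ln b\<close> per step, each of the two directions \<open>ln b\<close>.\<close>
  define \<Lambda> where "\<Lambda> = 4 * ln b * N + 1"
  have \<Lambda>: "1 \<le> \<Lambda>" using lnb by (simp add: \<Lambda>_def)
  define \<kappa> where "\<kappa> = h * N"
  have \<kappa>: "0 < \<kappa>" using h N by (simp add: \<kappa>_def)
  \<comment> \<open>The smallness conditions of \<open>expectation_exp_le\<close>, where half of the
    decay \<kappa> is given up.\<close>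
  define \<alpha> where "\<alpha> = min (1 / \<Lambda>) (\<kappa> / 2 / \<Lambda>\<^sup>2)"
  have \<alpha>: "0 < \<alpha>" "\<alpha> \<le> 1" "\<alpha> * \<Lambda> \<le> 1" "\<alpha> * \<Lambda>\<^sup>2 \<le> - (\<kappa> / 2) - (- \<kappa>)"
  proof -
    show "0 < \<alpha>" using \<Lambda> \<kappa> by (simp add: \<alpha>_def)
    have 1: "\<alpha> \<le> 1 / \<Lambda>" "\<alpha> \<le> \<kappa> / 2 / \<Lambda>\<^sup>2" by (simp_all add: \<alpha>_def)
    have "1 / \<Lambda> \<le> 1" using \<Lambda> by simp
    then show "\<alpha> \<le> 1" using 1 by linarith
    show "\<alpha> * \<Lambda> \<le> 1" using 1(1) \<Lambda> by (simp add: le_divide_eq)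
    have "0 < \<Lambda>\<^sup>2" using \<Lambda> by simp
    then show "\<alpha> * \<Lambda>\<^sup>2 \<le> - (\<kappa> / 2) - (- \<kappa>)" using 1(2) by (simp add: pos_le_divide_eq)
  qed
  \<comment> \<open>The remaining half of the decay, distributed over the \<open>N\<close>
    steps.\<close>
  define q where "q = exp (- (\<alpha> * h / 2))"
  have q: "0 < q" "q < 1" "q ^ N = exp (\<alpha> * (- (\<kappa> / 2)))"
    using \<alpha> h by (simp_all add: q_def \<kappa>_def exp_of_nat_mult[symmetric] mult_ac)
  note [measurable] = borel_measurable_wedge_norm[OF d]
  have aint: "integrable S (a N x)" if "x \<in> X" for x
    by (rule P.integrable_const_bound[of _ "ln b * N"]) (use a_bound that in auto)
  have wint: "integrable S (\<lambda>\<omega>. ln (wedge_norm (MP N \<omega>)))"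
    by (rule P.integrable_const_bound[of _ "ln (b\<^sup>2) * N"]) (use lyapunov_exponent_2(3)[OF d] in auto)
  show ?thesis
  proof (rule that[OF N(2) q(1,2) \<alpha>(1,2)])
    fix x y assume x: "x \<in> X" "y \<in> X"
    define u where "u \<omega> = ln (wedge_norm (MP N \<omega>)) - a N x \<omega> - a N y \<omega>" for \<omega>
    have um[measurable]: "u \<in> borel_measurable S" unfolding u_def by measurable
    have ub: "\<bar>u \<omega>\<bar> \<le> \<Lambda>" if w: "\<omega> \<in> space S" for \<omega>
    proof -
      have "\<bar>u \<omega>\<bar> \<le> \<bar>ln (wedge_norm (MP N \<omega>))\<bar> + \<bar>a N x \<omega>\<bar> + \<bar>a N y \<omega>\<bar>"
        unfolding u_def by linarith
      also have "\<dots> \<le> ln (b\<^sup>2) * N + ln b * N + ln b * N"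
        using lyapunov_exponent_2(3)[OF d w, of N] a_bound[OF w x(1), of N] a_bound[OF w x(2), of N] by linarith
      also have "\<dots> \<le> \<Lambda>" using b1 by (simp add: \<Lambda>_def ln_realpow)
      finally show ?thesis .
    qed
    have "(\<integral>\<omega>. u \<omega> \<partial>S) = (\<integral>\<omega>. ln (wedge_norm (MP N \<omega>)) \<partial>S) - (\<integral>\<omega>. a N x \<omega> \<partial>S) - (\<integral>\<omega>. a N y \<omega> \<partial>S)"
      unfolding u_def using wint aint x by simp
    also have "\<dots> \<le> (lyapunov_exponent 1 \<nu> + lyapunov_exponent 2 \<nu> + h) * N
        - (lyapunov_exponent 1 \<nu> - h) * N - (lyapunov_exponent 1 \<nu> - h) * N"
      using EN n0[OF N(3) x(1)] n0[OF N(3) x(2)] by linarith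
    also have "\<dots> = - \<kappa>" by (simp add: \<kappa>_def h_def field_simps)
    finally have Eu: "(\<integral>\<omega>. u \<omega> \<partial>S) \<le> - \<kappa>" .
    have Ee: "(\<integral>\<omega>. exp (\<alpha> * u \<omega>) \<partial>S) \<le> q ^ N"
      unfolding q(3)
      by (rule P.expectation_exp_le[where L = \<Lambda> and m' = "- \<kappa>"]) (use ub Eu \<alpha> in auto)
    have ie: "integrable S (\<lambda>\<omega>. exp (\<alpha> * u \<omega>))"
    proof (rule P.integrable_const_bound[of _ "exp (\<alpha> * \<Lambda>)"])
      show "AE \<omega> in S. norm (exp (\<alpha> * u \<omega>)) \<le> exp (\<alpha> * \<Lambda>)"
        using ub \<alpha>(1) by (intro AE_I2) (simp add: abs_le_iff)
    qed measurable
    have "(\<integral>\<^sup>+\<omega>. ennreal (pd (MP N \<omega> *v x) (MP N \<omega> *v y) powr (\<alpha> / 2)) \<partial>S)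
        \<le> (\<integral>\<^sup>+\<omega>. ennreal (exp (\<alpha> * u \<omega>)) * ennreal (pd x y powr (\<alpha> / 2)) \<partial>S)"
    proof (rule nn_integral_mono)
      fix \<omega> assume w: "\<omega> \<in> space S"
      have "pd (MP N \<omega> *v x) (MP N \<omega> *v y) powr (\<alpha> / 2) \<le> (exp (2 * u \<omega>) * pd x y) powr (\<alpha> / 2)"
        using pd_MP[OF d w x, of N] pd_nonneg \<alpha> by (intro powr_mono2) (auto simp: u_def)
      also have "\<dots> = exp (\<alpha> * u \<omega>) * pd x y powr (\<alpha> / 2)"
        using pd_nonneg by (simp add: powr_mult) (simp add: powr_def)
      finally show "ennreal (pd (MP N \<omega> *v x) (MP N \<omega> *v y) powr (\<alpha> / 2))
          \<le> ennreal (exp (\<alpha> * u \<omega>)) * ennreal (pd x y powr (\<alpha> / 2))"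
        by (simp add: ennreal_mult[symmetric] ennreal_leI)
    qed
    also have "\<dots> = (\<integral>\<^sup>+\<omega>. ennreal (exp (\<alpha> * u \<omega>)) \<partial>S) * ennreal (pd x y powr (\<alpha> / 2))"
      by (rule nn_integral_multc) measurable
    also have "(\<integral>\<^sup>+\<omega>. ennreal (exp (\<alpha> * u \<omega>)) \<partial>S) = ennreal (\<integral>\<omega>. exp (\<alpha> * u \<omega>) \<partial>S)"
      by (rule nn_integral_eq_integral[OF ie]) simp
    also have "\<dots> * ennreal (pd x y powr (\<alpha> / 2)) \<le> ennreal (q ^ N) * ennreal (pd x y powr (\<alpha> / 2))"
      using Ee by (intro mult_right_mono ennreal_leI) auto
    finally show "(\<integral>\<^sup>+\<omega>. ennreal (pd (MP N \<omega> *v x) (MP N \<omega> *v y) powr (\<alpha> / 2)) \<partial>S)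
      \<le> ennreal (q ^ N) * ennreal (pd x y powr (\<alpha> / 2))" .
  qed
qed

definition \<sigma> :: "real ^ 'd ^ 'd \<Rightarrow> real ^ 'd \<Rightarrow> real" where
  "\<sigma> g x = ln (norm (P (g *v x)) / norm (P x))"

lemma abs_ln_diff_le:
  fixes u v l :: real
  assumes "l \<le> u" "l \<le> v" "0 < l"
  shows "\<bar>ln u - ln v\<bar> \<le> \<bar>u - v\<bar> / l"
proof -
  have le: "ln u - ln v \<le> \<bar>u - v\<bar> / l" if "l \<le> u" "l \<le> v" for u v :: real
  proof -
    have pos: "0 < u" "0 < v" using that assms by auto
    have "ln u - ln v = ln (u / v)" using pos by (simp add: ln_div)
    also have "\<dots> \<le> u / v - 1" using pos by (intro ln_le_minus_one) simp
    also have "\<dots> = (u - v) / v" using pos by (simp add: diff_divide_distrib)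
    also have "\<dots> \<le> \<bar>u - v\<bar> / v" using pos by (intro divide_right_mono) auto
    also have "\<dots> \<le> \<bar>u - v\<bar> / l" using that assms pos by (intro divide_left_mono) auto
    finally show ?thesis .
  qed
  show ?thesis using le[OF assms(1,2)] le[OF assms(2,1)] by (simp add: abs_le_iff abs_minus_commute)
qed

text \<open>The growth of a direction is evaluated at unit representatives. For representatives at
  an acute angle the chord is at most twice the sine, and the logarithm is Lipschitz on values at
  least \<open>1 / b\<close>.\<close>

lemma \<sigma>_diff:
  assumes g: "g \<in> \<Sigma>" and x: "x \<in> X" "y \<in> X"
  shows "\<bar>\<sigma> g x - \<sigma> g y\<bar> \<le> 2 * b\<^sup>2 * sqrt (pd x y)"
proof -
  define u where "u = (1 / norm (P x)) *\<^sub>R P x"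
  define v where "v = (1 / norm (P y)) *\<^sub>R P y"
  have nuv: "norm u = 1" "norm v = 1" "P u = u" "P v = v"
    using x P_linear by (auto simp: u_def v_def X_def linear_scale P_idem)
  have \<sigma>u: "\<sigma> g x = ln (norm (P (g *v u)))" "\<sigma> g y = ln (norm (P (g *v v)))"
    using P_linear P_act_P[OF g]
    by (simp_all add: \<sigma>_def u_def v_def matrix_vector_mult_scaleR linear_scale)
  have pd: "pd x y = 1 - (u \<bullet> v)\<^sup>2"
    using x by (simp add: pd_def gram2_def u_def v_def X_def diff_divide_distrib power_divide power_mult_distrib)
  \<comment> \<open>The sign is chosen to make the angle with \<open>u\<close> acute; opposite
    vectors represent the same direction but are far apart as vectors.\<close>
  define w where "w = (if 0 \<le> u \<bullet> v then v else - v)"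
  have w: "P w = w" "norm w = 1" "\<sigma> g y = ln (norm (P (g *v w)))" "0 \<le> u \<bullet> w" "(u \<bullet> w)\<^sup>2 = (u \<bullet> v)\<^sup>2"
    using nuv \<sigma>u P_linear
    by (auto simp: w_def linear_neg linear_neg[OF matrix_vector_mul_linear] inner_minus_right)
  have "(norm (u - w))\<^sup>2 = 2 * (1 - u \<bullet> w)"
    using nuv w by (simp add: power2_norm_eq_inner inner_diff_left inner_diff_right inner_commute norm_eq_1)
  also have "\<dots> \<le> 2 * ((1 - u \<bullet> w) * (1 + u \<bullet> w))"
  proof -
    have "u \<bullet> w \<le> 1" using norm_cauchy_schwarz[of u w] nuv w by simp
    then have "(1 - u \<bullet> w) * 1 \<le> (1 - u \<bullet> w) * (1 + u \<bullet> w)" using w(4) by (intro mult_left_mono) auto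
    then show ?thesis by simp
  qed
  also have "\<dots> = 2 * pd x y" unfolding pd w(5)[symmetric] by (simp add: power2_eq_square algebra_simps)
  also have "\<dots> \<le> (2 * sqrt (pd x y))\<^sup>2" using pd_nonneg[of x y] by (simp add: power_mult_distrib)
  finally have uw: "norm (u - w) \<le> 2 * sqrt (pd x y)"
    by (rule power2_le_imp_le) (simp add: pd_nonneg)
  have lower: "1 / b \<le> norm (P (g *v z))" if "norm (P z) = 1" for z
    using P_act_ge[OF g, of z] that b1 by (simp add: field_simps)
  have "\<bar>\<sigma> g x - \<sigma> g y\<bar> \<le> \<bar>norm (P (g *v u)) - norm (P (g *v w))\<bar> / (1 / b)"
    unfolding \<sigma>u(1) w(3) using lower[of u] lower[of w] nuv w b1 by (intro abs_ln_diff_le) auto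
  also have "\<dots> = b * \<bar>norm (P (g *v u)) - norm (P (g *v w))\<bar>" by simp
  also have "\<bar>norm (P (g *v u)) - norm (P (g *v w))\<bar> \<le> norm (P (g *v u) - P (g *v w))"
    by (rule norm_triangle_ineq3)
  also have "P (g *v u) - P (g *v w) = P (g *v (u - w))"
    using P_linear by (simp add: linear_diff matrix_vector_mult_diff_distrib)
  also have "norm \<dots> \<le> b * norm (P (u - w))" by (rule P_act_le[OF g])
  also have "b * norm (P (u - w)) \<le> b * (2 * sqrt (pd x y))"
    using P_le[of "u - w"] uw b1 by (intro mult_left_mono) auto
  finally show ?thesis using b1 by (simp add: power2_eq_square mult_ac mult_left_mono)
qed

lemma open_X: "open X"
proof -
  have "open (P -` (- {0}))" using P_cont[of UNIV] by (intro open_vimage) auto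
  then show ?thesis by (simp add: X_def vimage_def Compl_eq)
qed

lemma pd_measurable [measurable]:
  assumes [measurable]: "f \<in> borel_measurable N" "h \<in> borel_measurable N"
  shows "(\<lambda>z. pd (f z) (h z)) \<in> borel_measurable N"
proof -
  have [measurable]: "(\<lambda>z. P (f z)) \<in> borel_measurable N" "(\<lambda>z. P (h z)) \<in> borel_measurable N"
    using measurable_compose[OF assms(1) P_measurable] measurable_compose[OF assms(2) P_measurable] by auto
  show ?thesis unfolding pd_def gram2_def by measurable
qed

text \<open>The gauge is the adapted weight, on pairs of vectors, of the \<alpha>-th power of the
  sine. It contracts in one step and is comparable with that power, hence still dominates the
  differences of \<sigma>.\<close>

theorem contracting_cocycle_exists:
  assumes d: "2 \<le> CARD('d)" and gap: "lyapunov_exponent 2 \<nu> < lyapunov_exponent 1 \<nu>"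
    and lower: "\<And>\<beta>. \<beta> < lyapunov_exponent 1 \<nu> \<Longrightarrow> \<exists>n0. \<forall>n\<ge>n0. \<forall>x\<in>X. \<beta> * n \<le> (\<integral>\<omega>. a n x \<omega> \<partial>S)"
    and x0: "x0 \<in> X"
  obtains c \<theta> B D L where "contracting_cocycle \<nu> X x0 (*v) c \<sigma> \<theta> B D L"
proof -
  obtain N q \<alpha> where N: "1 \<le> N" and q: "0 < q" "q < 1" and \<alpha>: "0 < \<alpha>" "\<alpha> \<le> 1"
    and step: "\<And>x y. x \<in> X \<Longrightarrow> y \<in> X \<Longrightarrow> (\<integral>\<^sup>+\<omega>. ennreal (pd (MP N \<omega> *v x) (MP N \<omega> *v y) powr (\<alpha> / 2)) \<partial>S)
      \<le> ennreal (q ^ N) * ennreal (pd x y powr (\<alpha> / 2))"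
    by (rule contraction_after_steps[OF d gap]) (erule lower, rule that)
  define r where "r x y = pd x y powr (\<alpha> / 2)" for x y
  define \<rho> where "\<rho> z = ennreal (r (fst z) (snd z))" for z
  define act where "act g z = (g *v fst z, g *v snd z)" for g :: "real ^ 'd ^ 'd" and z :: "(real ^ 'd) \<times> (real ^ 'd)"
  let ?K = "kernel act"
  have c: "fst \<in> borel_measurable (borel :: ((real ^ 'd) \<times> (real ^ 'd)) measure)"
    "snd \<in> borel_measurable (borel :: ((real ^ 'd) \<times> (real ^ 'd)) measure)"
    by (intro borel_measurable_continuous_onI continuous_intros)+
  have act_m: "(\<lambda>p. act (fst p) (snd p)) \<in> borel_measurable (\<nu> \<Otimes>\<^sub>M borel)"
  proof -
    have [measurable]: "fst \<in> borel_measurable (\<nu> \<Otimes>\<^sub>M (borel :: ((real ^ 'd) \<times> (real ^ 'd)) measure))"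
      using measurable_compose[OF measurable_fst measurable_ident_\<nu>] .
    have [measurable]: "(\<lambda>p. fst (snd p)) \<in> borel_measurable (\<nu> \<Otimes>\<^sub>M (borel :: ((real ^ 'd) \<times> (real ^ 'd)) measure))"
      "(\<lambda>p. snd (snd p)) \<in> borel_measurable (\<nu> \<Otimes>\<^sub>M (borel :: ((real ^ 'd) \<times> (real ^ 'd)) measure))"
      using measurable_compose[OF measurable_snd c(1)] measurable_compose[OF measurable_snd c(2)] .
    show ?thesis unfolding act_def by (intro borel_measurable_Pair) measurable
  qed
  have \<rho>m[measurable]: "\<rho> \<in> borel_measurable borel"
    unfolding \<rho>_def r_def using c[measurable] by measurable
  have r0: "0 \<le> r x y" "r x y \<le> 1" for x y
    using pd_nonneg[of x y] pd_le_1[of x y] \<alpha> by (auto simp: r_def intro: powr_le1)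
  have r_act: "r (g *v x) (g *v y) \<le> b ^ 4 * r x y" if "g \<in> \<Sigma>" "x \<in> X" "y \<in> X" for g x y
  proof -
    have "r (g *v x) (g *v y) \<le> (b ^ 8 * pd x y) powr (\<alpha> / 2)"
      unfolding r_def using pd_act[OF d that] pd_nonneg \<alpha> by (intro powr_mono2) auto
    also have "\<dots> = (b ^ 8) powr (\<alpha> / 2) * r x y" using b1 pd_nonneg by (simp add: r_def powr_mult)
    also have "(b ^ 8) powr (\<alpha> / 2) \<le> (b ^ 8) powr (1 / 2)" using b1 \<alpha> by (intro powr_mono) auto
    also have "(b ^ 8) powr (1 / 2) = b ^ 4"
    proof -
      have "sqrt (b ^ 8) = b ^ 4"
        using b1 by (intro real_sqrt_unique) (simp_all flip: power_mult)
      then show ?thesis using b1 by (simp add: powr_half_sqrt)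
    qed
    finally show ?thesis using r0 by (simp add: mult_right_mono)
  qed
  have actX: "act g z \<in> X \<times> X" if "g \<in> space \<nu>" "z \<in> X \<times> X" for g z
    using that X_act space_\<nu> by (auto simp: act_def)
  have Kb: "(?K ^^ k) \<rho> z \<le> ennreal ((b ^ 4) ^ k) * \<rho> z" if "z \<in> X \<times> X" for k z
    using that
  proof (induction k arbitrary: z)
    case (Suc k)
    have "(?K ^^ Suc k) \<rho> z \<le> (\<integral>\<^sup>+g. ennreal ((b ^ 4) ^ Suc k) * \<rho> z \<partial>\<nu>)"
      unfolding funpow.simps(2) comp_def kernel_def[of act "(?K ^^ k) \<rho>"]
    proof (rule nn_integral_mono)
      fix g assume g: "g \<in> space \<nu>"
      have "(?K ^^ k) \<rho> (act g z) \<le> ennreal ((b ^ 4) ^ k) * \<rho> (act g z)"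
        using Suc actX[OF g] by blast
      also have "\<dots> \<le> ennreal ((b ^ 4) ^ k) * (ennreal (b ^ 4) * \<rho> z)"
        using r_act[of g "fst z" "snd z"] g space_\<nu> Suc.prems b1 r0
        by (intro mult_left_mono) (auto simp: \<rho>_def act_def ennreal_mult[symmetric] ennreal_leI)
      also have "\<dots> = ennreal ((b ^ 4) ^ Suc k) * \<rho> z"
      proof -
        have "ennreal ((b ^ 4) ^ Suc k) = ennreal (b ^ 4) * ennreal ((b ^ 4) ^ k)"
          unfolding power_Suc using b1 by (intro ennreal_mult) auto
        then show ?thesis by (simp only: mult_ac)
      qed
      finally show "(?K ^^ k) \<rho> (act g z) \<le> ennreal ((b ^ 4) ^ Suc k) * \<rho> z" .
    qed
    then show ?case by (simp add: M.emeasure_space_1)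
  qed simp
  have Kstep: "(?K ^^ N) \<rho> z \<le> ennreal (q ^ N) * \<rho> z" if z: "z \<in> X \<times> X" for z
  proof -
    have "(?K ^^ N) \<rho> z = (\<integral>\<^sup>+\<omega>. \<rho> (MP N \<omega> *v fst z, MP N \<omega> *v snd z) \<partial>S)"
    proof (rule kernel_pow_eq[where orb = "\<lambda>n \<omega> z. (MP n \<omega> *v fst z, MP n \<omega> *v snd z)"])
      show "(MP (Suc n) (case_nat g \<omega>) *v fst z, MP (Suc n) (case_nat g \<omega>) *v snd z)
          = (MP n \<omega> *v fst (act g z), MP n \<omega> *v snd (act g z))" for n g \<omega> z
        by (simp del: matrix_product.simps(2) add: matrix_product_case_nat matrix_vector_mul_assoc act_def)
      show "(\<lambda>\<omega>. \<rho> (MP n \<omega> *v fst z, MP n \<omega> *v snd z)) \<in> borel_measurable S" for n z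
        unfolding \<rho>_def r_def fst_conv snd_conv by measurable
    qed simp
    also have "\<dots> \<le> ennreal (q ^ N) * \<rho> z"
      using step[of "fst z" "snd z"] z by (auto simp: \<rho>_def r_def)
    finally show ?thesis .
  qed
  define we where "we = adapted_weight act q N \<rho>"
  define C where "C = (\<Sum>k<N. (1 / q) ^ k * (b ^ 4) ^ k)"
  have C0: "0 \<le> C" unfolding C_def using q b1 by (intro sum_nonneg) auto
  have we_m[measurable]: "we \<in> borel_measurable borel"
    unfolding we_def adapted_weight_def[abs_def]
    using measurable_kernel_pow[OF act_m \<rho>m, measurable] by measurable
  have we_ge: "\<rho> z \<le> we z" for z
  proof -
    have "\<rho> z = ennreal ((1 / q) ^ 0) * (?K ^^ 0) \<rho> z" by simp
    also have "\<dots> \<le> we z"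
      unfolding we_def adapted_weight_def using N by (intro member_le_sum) auto
    finally show ?thesis .
  qed
  have we_le: "we z \<le> ennreal (C * r (fst z) (snd z))" if "z \<in> X \<times> X" for z
  proof -
    have "we z \<le> (\<Sum>k<N. ennreal ((1 / q) ^ k) * (ennreal ((b ^ 4) ^ k) * \<rho> z))"
      unfolding we_def adapted_weight_def by (intro sum_mono mult_left_mono Kb that) auto
    also have "\<dots> = (\<Sum>k<N. ennreal ((1 / q) ^ k * (b ^ 4) ^ k * r (fst z) (snd z)))"
      using q b1 r0 by (simp add: \<rho>_def ennreal_mult[symmetric] mult.assoc)
    also have "\<dots> = ennreal (C * r (fst z) (snd z))"
      unfolding C_def sum_distrib_right using q b1 r0 by (intro sum_ennreal) auto
    finally show ?thesis .
  qed
  define c where "c x y = enn2real (we (x, y))" for x y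
  have we_c: "we (x, y) = ennreal (c x y)" if "x \<in> X" "y \<in> X" for x y
    using we_le[of "(x, y)"] that unfolding c_def by (simp add: top.not_eq_extremum le_less_trans)
  have c0: "0 \<le> c x y" for x y by (simp add: c_def)
  have c_ge: "r x y \<le> c x y" if "x \<in> X" "y \<in> X" for x y
    using we_ge[of "(x, y)"] we_c[OF that] c0 by (simp add: \<rho>_def)
  have c_le: "c x y \<le> C * r x y" if "x \<in> X" "y \<in> X" for x y
    using we_le[of "(x, y)"] we_c[OF that] that C0 r0 by (simp add: ennreal_le_iff)
  have c_m: "(\<lambda>g. c (g *v x) (g *v y)) \<in> borel_measurable \<nu>" for x y
  proof -
    have "(\<lambda>g. (g *v x, g *v y)) \<in> borel_measurable \<nu>"
      by (intro borel_measurable_Pair) measurable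
    from measurable_compose[OF this we_m] show ?thesis unfolding c_def by measurable
  qed
  define B where "B = C * b ^ 4"
  define L where "L = max (ln b) (2 * b\<^sup>2)"
  have "contracting_cocycle \<nu> X x0 (*v) c \<sigma> q B C L"
  proof unfold_locales
    show "x0 \<in> X" by (rule x0)
    show "g *v x \<in> X" if "g \<in> space \<nu>" "x \<in> X" for g x using X_act that space_\<nu> by simp
    show "0 \<le> c x y" for x y by (rule c0)
    show "c x y \<le> C" if "x \<in> X" "y \<in> X" for x y
      using c_le[OF that] mult_left_mono[OF r0(2) C0, of x y] by simp
    show "c (g *v x) (g *v y) \<le> B * c x y" if g: "g \<in> space \<nu>" and x: "x \<in> X" "y \<in> X" for g x y
    proof -
      have g': "g \<in> \<Sigma>" using g space_\<nu> by simp
      have "c (g *v x) (g *v y) \<le> C * r (g *v x) (g *v y)" by (rule c_le[OF X_act[OF g' x(1)] X_act[OF g' x(2)]])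
      also have "\<dots> \<le> C * (b ^ 4 * r x y)" by (rule mult_left_mono[OF r_act[OF g' x] C0])
      also have "\<dots> \<le> C * (b ^ 4 * c x y)" using c_ge[OF x] C0 b1 by (intro mult_left_mono) auto
      finally show ?thesis by (simp add: B_def mult.assoc)
    qed
    show "(\<lambda>g. c (g *v x) (g *v y)) \<in> borel_measurable \<nu>" for x y by (rule c_m)
    show "(\<integral>g. c (g *v x) (g *v y) \<partial>\<nu>) \<le> q * c x y" if x: "x \<in> X" "y \<in> X" for x y
    proof -
      have "(\<integral>\<^sup>+g. ennreal (c (g *v x) (g *v y)) \<partial>\<nu>) = ?K we (x, y)"
        unfolding kernel_def act_def fst_conv snd_conv
        by (rule nn_integral_cong) (use x X_act space_\<nu> in \<open>simp add: we_c\<close>)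
      also have "\<dots> \<le> ennreal q * we (x, y)"
        unfolding we_def using x by (intro kernel_adapted_weight[OF act_m \<rho>m q(1)] Kstep) simp
      also have "\<dots> = ennreal (q * c x y)" using we_c[OF x] c0 q by (simp add: ennreal_mult)
      finally have nn: "(\<integral>\<^sup>+g. ennreal (c (g *v x) (g *v y)) \<partial>\<nu>) \<le> ennreal (q * c x y)" .
      then show ?thesis
        using c_m[of x y] c0 q by (subst integral_eq_nn_integral) (auto intro: enn2real_leI)
    qed
    show "0 \<le> q" "q < 1" using q by auto
    show "0 \<le> B" "0 \<le> C" "0 \<le> L" using C0 b1 by (auto simp: B_def L_def le_max_iff_disj)
    show "(\<lambda>g. \<phi> (g *v x)) \<in> borel_measurable \<nu>"
      if lip: "\<And>x y. x \<in> X \<Longrightarrow> y \<in> X \<Longrightarrow> \<bar>\<phi> x - \<phi> y\<bar> \<le> K * c x y" and x: "x \<in> X" for \<phi> K x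
    proof -
      \<comment> \<open>The gauge \<open>c z y\<close> tends to 0 as z approaches \<open>y\<close>,
        so a function that is Lipschitz for it is continuous on the open set \<open>X\<close>, and
        therefore Borel there.\<close>
      have "isCont \<phi> y" if y: "y \<in> X" for y
      proof -
        have "((\<lambda>z. r z y) \<longlongrightarrow> r y y) (at y)"
        proof -
          have Pt: "(P \<longlongrightarrow> P y) (at y)" using P_cont[of UNIV] by (simp add: continuous_on_eq_continuous_at isCont_def)
          have "((\<lambda>z. pd z y) \<longlongrightarrow> pd y y) (at y)"
            unfolding pd_def gram2_def using y by (intro tendsto_intros Pt) (auto simp: X_def)
          then show ?thesis unfolding r_def using \<alpha> pd_nonneg
            by (intro tendsto_powr') auto
        qed
        moreover have "r y y = 0" by (simp add: r_def pd_def gram2_def dot_square_norm power2_eq_square)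
        ultimately have "((\<lambda>z. \<bar>K\<bar> * (C * r z y)) \<longlongrightarrow> \<bar>K\<bar> * (C * 0)) (at y)"
          by (intro tendsto_mult tendsto_const) simp
        then have lim: "((\<lambda>z. \<bar>K\<bar> * (C * r z y)) \<longlongrightarrow> 0) (at y)" by simp
        have "eventually (\<lambda>z. z \<in> X) (at y)"
          using open_X y by (intro eventually_at_in_open') auto
        then have "eventually (\<lambda>z. norm (\<phi> z - \<phi> y) \<le> \<bar>K\<bar> * (C * r z y)) (at y)"
        proof eventually_elim
          case (elim z)
          have "K * c z y \<le> \<bar>K\<bar> * (C * r z y)"
            using c_le[OF elim y] c0 by (intro mult_mono) auto
          then show ?case using lip[OF elim y] by simp
        qed
        then have "((\<lambda>z. \<phi> z - \<phi> y) \<longlongrightarrow> 0) (at y)" using lim by (rule Lim_null_comparison)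
        then show ?thesis unfolding isCont_def by (rule LIM_zero_cancel)
      qed
      then have "continuous_on X \<phi>" by (simp add: continuous_at_imp_continuous_on)
      then have "(\<lambda>z. if z \<in> X then \<phi> z else 0) \<in> borel_measurable borel"
        using open_X by (intro borel_measurable_continuous_on_if) auto
      then have "(\<lambda>g. if g *v x \<in> X then \<phi> (g *v x) else 0) \<in> borel_measurable \<nu>"
        by (rule measurable_compose[rotated]) measurable
      then show ?thesis
        by (rule measurable_cong[THEN iffD1, rotated]) (use X_act x space_\<nu> in auto)
    qed
    show "(\<lambda>g. \<sigma> g x) \<in> borel_measurable \<nu>" for x
    proof -
      have "(\<lambda>g. P (g *v x)) \<in> borel_measurable \<nu>"
        by (rule measurable_compose[OF _ P_measurable]) measurable
      then show ?thesis unfolding \<sigma>_def by measurable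
    qed
    show "\<bar>\<sigma> g x\<bar> \<le> L" if g: "g \<in> space \<nu>" and x: "x \<in> X" for g x
    proof -
      obtain \<omega> where w: "\<omega> \<in> space S" using P.not_empty by blast
      have "case_nat g \<omega> \<in> space S" using w g by (auto simp: space_S split: nat.split)
      from a_bound[OF this x, of 1] show ?thesis by (simp add: a_def \<sigma>_def L_def le_max_iff_disj)
    qed
    show "\<bar>\<sigma> g x - \<sigma> g y\<bar> \<le> L * c x y" if g: "g \<in> space \<nu>" and x: "x \<in> X" "y \<in> X" for g x y
    proof -
      \<comment> \<open>Lowering the exponent from 1/2 to \<alpha>/2 increases a number in the unit
        interval.\<close>
      have "sqrt (pd x y) \<le> r x y"
        unfolding r_def powr_half_sqrt[OF pd_nonneg, symmetric]
        using pd_nonneg[of x y] pd_le_1[of x y] \<alpha> by (intro powr_mono') auto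
      then have sq: "sqrt (pd x y) \<le> c x y" using c_ge[OF x] by simp
      have "\<bar>\<sigma> g x - \<sigma> g y\<bar> \<le> 2 * b\<^sup>2 * sqrt (pd x y)" using \<sigma>_diff[OF _ x] g space_\<nu> by simp
      also have "\<dots> \<le> 2 * b\<^sup>2 * c x y" using sq by (rule mult_left_mono) simp
      also have "\<dots> \<le> L * c x y" using c0 by (intro mult_right_mono) (auto simp: L_def)
      finally show ?thesis .
    qed
  qed
  then show ?thesis by (rule that)
qed

end


section \<open>Identification of the functional with the Lyapunov exponent\<close>

lemma density_in_matrix_law:
  assumes law: "matrix_law \<Sigma> \<mu> b" and f: "integrable \<mu> f" "AE g in \<mu>. 0 \<le> f g" "(\<integral>g. f g \<partial>\<mu>) = 1"
  shows "matrix_law \<Sigma> (density \<mu> (\<lambda>x. ennreal (f x))) b"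
proof -
  interpret matrix_law \<Sigma> \<mu> b by (rule law)
  have "emeasure (density \<mu> (\<lambda>x. ennreal (f x))) (space \<mu>) = (\<integral>\<^sup>+x. ennreal (f x) \<partial>\<mu>)"
    using f(1) by (subst emeasure_density) (auto intro!: nn_integral_cong simp: indicator_def)
  also have "\<dots> = ennreal (\<integral>g. f g \<partial>\<mu>)" using f by (intro nn_integral_eq_integral) auto
  finally have "prob_space (density \<mu> (\<lambda>x. ennreal (f x)))"
    using f(3) by (intro prob_spaceI) simp
  then show ?thesis
    by (rule matrix_law.intro) (simp add: sets_\<nu>, rule inv_\<Sigma>, assumption, rule b1,
        erule norm_le_b, erule norm_ge_b)
qed

text \<open>The expected growth in n steps is the sum of the iterates of the operator on the
  one-step mean \<open>\<psi> f\<close>. Each iterate differs from \<open>F f\<close> by a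
  geometrically small amount, so the total error stays bounded in n and in the direction.\<close>

lemma expectation_a_near_F:
  fixes \<Sigma> :: "(real ^ 'd ^ 'd) set"
  assumes Q: "quotient_law \<Sigma> \<mu> b V P"
    and C: "contracting_cocycle \<mu> (quotient_law.X P) x0 (*v) c (quotient_law.\<sigma> P) \<theta> B D L"
    and near: "contracting_cocycle.near \<mu> \<theta> B f" and f0: "AE g in \<mu>. 0 \<le> f g"
  obtains K where "0 \<le> K" "\<And>n x. x \<in> quotient_law.X P \<Longrightarrow>
    \<bar>(\<integral>\<omega>. quotient_law.a P n x \<omega> \<partial>(\<Pi>\<^sub>M i\<in>(UNIV :: nat set). density \<mu> (\<lambda>x. ennreal (f x))))
      - n * contracting_cocycle.F \<mu> x0 (*v) (quotient_law.\<sigma> P) f\<bar> \<le> K"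
proof -
  interpret Q: quotient_law \<Sigma> \<mu> b V P by (rule Q)
  interpret C: contracting_cocycle \<mu> Q.X x0 "(*v)" c Q.\<sigma> \<theta> B D L by (rule C)
  note fi = C.nearD[OF near]
  have fm[measurable]: "f \<in> borel_measurable \<mu>" using fi(1) by simp
  let ?\<nu> = "density \<mu> (\<lambda>x. ennreal (f x))"
  have law: "matrix_law \<Sigma> ?\<nu> b" by (rule density_in_matrix_law[OF Q.matrix_law_axioms fi(1) f0 fi(2)])
  interpret N: matrix_law \<Sigma> ?\<nu> b by (rule law)
  interpret N: quotient_law \<Sigma> ?\<nu> b V P
    by (rule quotient_law.intro[OF law quotient_law.axioms(2)[OF Q]])
  define v where "v n x = (\<integral>\<omega>. Q.a n x \<omega> \<partial>N.S)" for n x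
  define \<phi> where "\<phi> n x = (\<Sum>k<n. (C.T f ^^ k) (C.\<psi> f) x)" for n x
  have lk: "C.lip (C.q ^ k * (L * C.L1 f)) ((C.T f ^^ k) (C.\<psi> f))" for k
    by (rule C.T_pow_lip[OF near C.\<psi>_lip[OF fi(1)]])
  have l\<phi>: "C.lip (\<Sum>k<n. C.q ^ k * (L * C.L1 f)) (\<phi> n)" for n
    unfolding \<phi>_def[abs_def] by (rule C.lip_sum[OF lk]) simp
  have v\<phi>: "v n x = \<phi> n x" if "x \<in> Q.X" for n x
    using that
  proof (induction n arbitrary: x)
    case 0
    then show ?case by (simp add: v_def \<phi>_def Q.a_def Q.X_def)
  next
    case (Suc n)
    \<comment> \<open>Splitting off the first factor gives the recursion: one step of mean growth,
      then the operator applied to the growth in the remaining \<open>n\<close> steps.\<close>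
    have "v (Suc n) x = (\<integral>g. \<integral>\<omega>. Q.a (Suc n) x (case_nat g \<omega>) \<partial>N.S \<partial>?\<nu>)"
      unfolding v_def by (rule N.integral_case_nat[OF N.a_measurable]) (rule N.a_bound[OF _ Suc.prems])
    also have "\<dots> = (\<integral>g. Q.\<sigma> g x + \<phi> n (g *v x) \<partial>?\<nu>)"
    proof (rule Bochner_Integration.integral_cong[OF refl])
      fix g assume "g \<in> space ?\<nu>"
      then have g: "g \<in> \<Sigma>" "g \<in> space ?\<nu>" by (simp_all add: Q.space_\<nu>)
      have gx: "g *v x \<in> Q.X" by (rule Q.X_act[OF g(1) Suc.prems])
      have "(\<integral>\<omega>. Q.a (Suc n) x (case_nat g \<omega>) \<partial>N.S) = (\<integral>\<omega>. Q.\<sigma> g x + Q.a n (g *v x) \<omega> \<partial>N.S)"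
      proof (rule Bochner_Integration.integral_cong[OF refl])
        fix \<omega> assume w: "\<omega> \<in> space N.S"
        have "case_nat g \<omega> \<in> space N.S" using w g by (auto simp: N.space_S split: nat.split)
        from N.a_cocycle[OF this Suc.prems, of 1 n]
        show "Q.a (Suc n) x (case_nat g \<omega>) = Q.\<sigma> g x + Q.a n (g *v x) \<omega>"
          by (simp add: Q.a_def Q.\<sigma>_def seq_shift_def)
      qed
      also have "\<dots> = Q.\<sigma> g x + v n (g *v x)"
      proof -
        have "integrable N.S (Q.a n (g *v x))"
          by (rule N.P.integrable_const_bound[of _ "ln b * n"]) (use N.a_bound[OF _ gx] N.a_measurable in auto)
        then show ?thesis by (simp add: v_def N.P.prob_space)
      qed
      also have "v n (g *v x) = \<phi> n (g *v x)" by (rule Suc.IH[OF gx])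
      finally show "(\<integral>\<omega>. Q.a (Suc n) x (case_nat g \<omega>) \<partial>N.S) = Q.\<sigma> g x + \<phi> n (g *v x)" .
    qed
    also have "\<dots> = (\<integral>g. f g *\<^sub>R (Q.\<sigma> g x + \<phi> n (g *v x)) \<partial>\<mu>)"
      by (rule integral_density)
        (use C.\<sigma>_meas[OF Suc.prems] C.lip_measurable[OF l\<phi> Suc.prems] f0 in auto)
    also have "\<dots> = (\<integral>g. Q.\<sigma> g x * f g + \<phi> n (g *v x) * f g \<partial>\<mu>)"
      by (simp add: algebra_simps)
    also have "\<dots> = C.\<psi> f x + C.T f (\<phi> n) x"
      unfolding C.\<psi>_def C.T_def
      by (rule Bochner_Integration.integral_add[OF C.\<psi>_integrable[OF fi(1) Suc.prems] C.T_integrable[OF l\<phi> fi(1) Suc.prems]])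
    also have "C.T f (\<phi> n) x = (\<Sum>k<n. (C.T f ^^ Suc k) (C.\<psi> f) x)"
      unfolding \<phi>_def[abs_def] using C.T_sum[of "{..<n}", OF lk _ fi(1) Suc.prems] by simp
    also have "C.\<psi> f x + \<dots> = \<phi> (Suc n) x"
      unfolding \<phi>_def by (subst sum.lessThan_Suc_shift) simp
    finally show ?case .
  qed
  define K where "K = C.E * (L * C.L1 f) / (1 - C.q)"
  have A0: "0 \<le> C.E * (L * C.L1 f)" using C.E_nonneg C.L C.L1_nonneg by simp
  show ?thesis
  proof (rule that[of K])
    show "0 \<le> K" using A0 C.q by (simp add: K_def)
    fix n x assume x: "x \<in> Q.X"
    have "v n x - n * C.F f = (\<Sum>k<n. (C.T f ^^ k) (C.\<psi> f) x - C.F f)"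
      by (simp add: v\<phi>[OF x] \<phi>_def sum_subtractf)
    also have "\<bar>\<dots>\<bar> \<le> (\<Sum>k<n. C.E * (L * C.L1 f) * C.q ^ k)"
      unfolding C.F_def
      by (intro order_trans[OF sum_abs] sum_mono C.\<eta>_approx(2)[OF near C.\<psi>_lip[OF fi(1)] x])
    also have "\<dots> = C.E * (L * C.L1 f) * (\<Sum>k<n. C.q ^ k)" by (simp add: sum_distrib_left)
    also have "\<dots> \<le> C.E * (L * C.L1 f) * (1 / (1 - C.q))"
    proof (rule mult_left_mono[OF _ A0])
      have "(\<Sum>k<n. C.q ^ k) = (1 - C.q ^ n) / (1 - C.q)"
        using C.q by (simp add: sum_gp_strict)
      also have "\<dots> \<le> 1 / (1 - C.q)" using C.q by (intro divide_right_mono) auto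
      finally show "(\<Sum>k<n. C.q ^ k) \<le> 1 / (1 - C.q)" .
    qed
    finally show "\<bar>(\<integral>\<omega>. Q.a n x \<omega> \<partial>N.S) - n * C.F f\<bar> \<le> K" by (simp add: v_def K_def)
  qed
qed

context quotient_law
begin

lemma expectation_a_le_spectral:
  assumes x: "x \<in> X"
  shows "(\<integral>\<omega>. a n x \<omega> \<partial>S) \<le> (\<integral>\<omega>. ln (spectral_norm (MP n \<omega>)) \<partial>S)"
proof (rule integral_mono)
  show "integrable S (a n x)"
    by (rule P.integrable_const_bound[of _ "ln b * n"]) (use a_bound[OF _ x] in auto)
  show "integrable S (\<lambda>\<omega>. ln (spectral_norm (MP n \<omega>)))"
    by (rule P.integrable_const_bound[of _ "ln b * n"]) (use lyapunov_exponent_1(5) in auto)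
  fix \<omega> assume w: "\<omega> \<in> space S"
  have pos: "0 < norm (P x)" "0 < norm (P (MP n \<omega> *v x))"
    using x X_MP[OF w x] by (auto simp: X_def)
  have "norm (P (MP n \<omega> *v x)) \<le> spectral_norm (MP n \<omega>) * norm (P x)"
    using P_le[of "MP n \<omega> *v P x"] norm_le_spectral_norm[of "MP n \<omega>" "P x"] P_MP_P[OF w, of n x] by simp
  then have "norm (P (MP n \<omega> *v x)) / norm (P x) \<le> spectral_norm (MP n \<omega>)"
    using pos by (simp add: pos_divide_le_eq)
  then show "a n x \<omega> \<le> ln (spectral_norm (MP n \<omega>))"
    unfolding a_def using pos lyapunov_exponent_1(4)[OF w, of n] by (subst ln_le_cancel_iff) auto
qed

text \<open>Growth in the quotient never exceeds that of the operator norm, hence \<ge>. For \<le>,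
  small moments grow in the quotient at a rate just above \<open>F\<close> and on \<open>V\<close>
  at a rate below it; the extension lemma combines them on the whole space.\<close>

lemma lyapunov_exponent_1_eq:
  fixes F K :: real
  assumes x0: "x0 \<in> X"
    and K: "0 \<le> K" "\<And>n x. x \<in> X \<Longrightarrow> \<bar>(\<integral>\<omega>. a n x \<omega> \<partial>S) - n * F\<bar> \<le> K"
    and mg: "moment_growth \<nu> V norm s t" "0 < s" "s \<le> 1" "t < F"
  shows "lyapunov_exponent 1 \<nu> = F"
proof (rule antisym)
  show "F \<le> lyapunov_exponent 1 \<nu>"
  proof (rule LIMSEQ_le[OF _ lyapunov_exponent_1(2)])
    have "(\<lambda>n. F - K * (1 / n)) \<longlonglongrightarrow> F - K * 0"
      by (intro tendsto_intros lim_1_over_n)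
    then show "(\<lambda>n. F - K * (1 / n)) \<longlonglongrightarrow> F" by simp
    show "\<exists>N. \<forall>n\<ge>N. F - K * (1 / n) \<le> (\<integral>\<omega>. ln (spectral_norm (MP n \<omega>)) \<partial>S) / n"
    proof (intro exI[of _ 1] allI impI)
      fix n :: nat assume n: "1 \<le> n"
      have "n * F - K \<le> (\<integral>\<omega>. ln (spectral_norm (MP n \<omega>)) \<partial>S)"
        using K(2)[OF x0, of n] expectation_a_le_spectral[OF x0, of n] by linarith
      then have "(n * F - K) / n \<le> (\<integral>\<omega>. ln (spectral_norm (MP n \<omega>)) \<partial>S) / n"
        by (rule divide_right_mono) simp
      then show "F - K * (1 / n) \<le> (\<integral>\<omega>. ln (spectral_norm (MP n \<omega>)) \<partial>S) / n"
        using n by (simp add: diff_divide_distrib)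
    qed
  qed
  show "lyapunov_exponent 1 \<nu> \<le> F"
  proof (rule field_le_epsilon)
    fix e :: real assume e: "0 < e"
    define t1 where "t1 = F + e / 2"
    \<comment> \<open>So many steps make the bounded error \<open>K\<close> smaller than half of the
      margin \<open>e / 2\<close> between \<open>F\<close> and \<open>t1\<close>.\<close>
    obtain N :: nat where N: "K / (e / 4) < N" using reals_Archimedean2 by blast
    then have "K < N * (e / 4)" using e by (subst (asm) pos_divide_less_eq) auto
    then have KN: "N * F + K \<le> N * t1 - N * (e / 4)" using e by (simp add: t1_def field_simps)
    have "0 \<le> K / (e / 4)" using K e by simp
    then have N1: "1 \<le> N" using N by (cases N) auto
    define L where "L = ln b * N + 1"
    have L: "1 \<le> L" using b1 by (simp add: L_def)
    define s' where "s' = min s (min (1 / L) (N * (e / 4) / L\<^sup>2))"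
    have s': "0 < s'" "s' \<le> s" "s' \<le> 1" "s' * L \<le> 1" "s' * L\<^sup>2 \<le> N * t1 - (N * F + K)"
    proof -
      show "0 < s'" using mg L N1 e by (simp add: s'_def)
      have 1: "s' \<le> s" "s' \<le> 1 / L" "s' \<le> N * (e / 4) / L\<^sup>2" by (simp_all add: s'_def)
      show "s' \<le> s" by (rule 1)
      show "s' \<le> 1" using 1 mg by linarith
      show "s' * L \<le> 1" using 1(2) L by (simp add: le_divide_eq)
      have "0 < L\<^sup>2" using L by simp
      then have "s' * L\<^sup>2 \<le> N * (e / 4)" using 1(3) by (subst (asm) pos_le_divide_eq) auto
      then show "s' * L\<^sup>2 \<le> N * t1 - (N * F + K)" using KN by linarith
    qed
    have "moment_growth \<nu> UNIV (\<lambda>x. norm (P x)) s' t1"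
    proof (rule moment_growth_of_steps[OF subspace_UNIV _ _ _ _ _ s'(1,3) N1])
      show "norm (P (x + y)) \<le> norm (P x) + norm (P y)" for x y
        using P_linear by (simp add: linear_add norm_triangle_ineq)
      fix x
      show "(\<integral>\<^sup>+\<omega>. ennreal (norm (P (MP N \<omega> *v x)) powr s') \<partial>S) \<le> ennreal (exp (s' * N * t1) * norm (P x) powr s')"
      proof (cases "x \<in> X")
        case True
        then have pos: "0 < norm (P x)" by (simp add: X_def)
        have Ee: "(\<integral>\<omega>. exp (s' * a N x \<omega>) \<partial>S) \<le> exp (s' * (N * t1))"
        proof (rule P.expectation_exp_le[where L = L and m' = "N * F + K"])
          show "\<bar>a N x \<omega>\<bar> \<le> L" if "\<omega> \<in> space S" for \<omega>
            using a_bound[OF that True, of N] by (simp add: L_def)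
          show "(\<integral>\<omega>. a N x \<omega> \<partial>S) \<le> N * F + K" using K(2)[OF True, of N] by linarith
        qed (use s' in auto)
        have ie: "integrable S (\<lambda>\<omega>. exp (s' * a N x \<omega>))"
        proof (rule P.integrable_const_bound[of _ "exp (s' * (ln b * N))"])
          show "AE \<omega> in S. norm (exp (s' * a N x \<omega>)) \<le> exp (s' * (ln b * N))"
            using a_bound[OF _ True, of _ N] s' by (intro AE_I2) (simp add: abs_le_iff)
        qed measurable
        have "(\<integral>\<^sup>+\<omega>. ennreal (norm (P (MP N \<omega> *v x)) powr s') \<partial>S)
            = (\<integral>\<^sup>+\<omega>. ennreal (exp (s' * a N x \<omega>)) * ennreal (norm (P x) powr s') \<partial>S)"
        proof (rule nn_integral_cong)
          fix \<omega> assume w: "\<omega> \<in> space S"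
          have "0 < norm (P (MP N \<omega> *v x))" using X_MP[OF w True] by (simp add: X_def)
          then have "norm (P (MP N \<omega> *v x)) powr s' = exp (s' * a N x \<omega>) * norm (P x) powr s'"
            using pos by (simp add: a_def powr_def ln_div exp_add[symmetric] algebra_simps)
          then show "ennreal (norm (P (MP N \<omega> *v x)) powr s') = ennreal (exp (s' * a N x \<omega>)) * ennreal (norm (P x) powr s')"
            by (simp add: ennreal_mult)
        qed
        also have "\<dots> = (\<integral>\<^sup>+\<omega>. ennreal (exp (s' * a N x \<omega>)) \<partial>S) * ennreal (norm (P x) powr s')"
          by (rule nn_integral_multc) measurable
        also have "(\<integral>\<^sup>+\<omega>. ennreal (exp (s' * a N x \<omega>)) \<partial>S) = ennreal (\<integral>\<omega>. exp (s' * a N x \<omega>) \<partial>S)"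
          by (rule nn_integral_eq_integral[OF ie]) simp
        also have "\<dots> * ennreal (norm (P x) powr s') \<le> ennreal (exp (s' * (N * t1))) * ennreal (norm (P x) powr s')"
          using Ee by (intro mult_right_mono ennreal_leI) auto
        also have "\<dots> = ennreal (exp (s' * N * t1) * norm (P x) powr s')"
          by (simp add: ennreal_mult mult.assoc)
        finally show ?thesis .
      next
        case False
        \<comment> \<open>Vectors of \<open>V\<close> have class 0 and stay there, so both sides
          vanish.\<close>
        then have "P x = 0" by (simp add: X_def)
        then have "P (MP N \<omega> *v x) = 0" if "\<omega> \<in> space S" for \<omega>
          using P_MP_le[OF that, of N x] by simp
        then have "(\<integral>\<^sup>+\<omega>. ennreal (norm (P (MP N \<omega> *v x)) powr s') \<partial>S) = (\<integral>\<^sup>+\<omega>. 0 \<partial>S)"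
          by (intro nn_integral_cong) simp
        then show ?thesis by simp
      qed
    qed (auto intro: P_act_le)
    moreover have "moment_growth \<nu> V norm s' t1"
      by (rule moment_growth_mono[OF moment_growth_exponent_mono[OF V V_inv mg(1) s'(1,2)] s'(1)])
        (use mg e in \<open>auto simp: t1_def\<close>)
    ultimately have "moment_growth \<nu> UNIV norm s' (F + e)"
      using moment_growth_extension[OF subspace_UNIV V _ _ V_inv P_linear P_le P_diff P_V, of s' t1 "F + e"]
        s' e by (simp add: t1_def)
    then show "lyapunov_exponent 1 \<nu> \<le> F + e"
      by (rule lyapunov_exponent_le_moment_growth) (use s' in auto)
  qed
qed

end

section \<open>The L^p norms dominate the L^1 norm\<close>

context prob_space
begin

lemma Lp_power_integrable_powr:
  assumes "f \<in> Lp_space M p" "p \<noteq> \<infinity>"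
  shows "integrable M (\<lambda>x. \<bar>f x\<bar> powr enn2real p)"
  using assms by (simp add: Lp_space_def)

lemma one_le_enn2real: "1 \<le> p \<Longrightarrow> p \<noteq> \<infinity> \<Longrightarrow> 1 \<le> enn2real p"
  by (metis enn2real_1 enn2real_mono infinity_ennreal_def top.not_eq_extremum)

lemma Lp_space_AE_bound:
  assumes "f \<in> Lp_space M \<infinity>"
  shows "AE x in M. \<bar>f x\<bar> \<le> Lp_norm M \<infinity> f"
  using esssup_AE[of "\<lambda>x. ennreal \<bar>f x\<bar>" M]
proof eventually_elim
  case (elim x)
  have "esssup M (\<lambda>x. ennreal \<bar>f x\<bar>) < top" using assms by (simp add: Lp_space_def)
  then have "ennreal \<bar>f x\<bar> \<le> ennreal (Lp_norm M \<infinity> f)" using elim by (simp add: Lp_norm_def)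
  then show ?case by (simp add: Lp_norm_def)
qed

lemma Lp_space_infI:
  assumes [measurable]: "f \<in> borel_measurable M" and "AE x in M. \<bar>f x\<bar> \<le> r"
  shows "f \<in> Lp_space M \<infinity>"
proof -
  have "AE x in M. ennreal \<bar>f x\<bar> \<le> ennreal r"
    using assms(2) by eventually_elim (rule ennreal_leI)
  then have "esssup M (\<lambda>x. ennreal \<bar>f x\<bar>) \<le> ennreal r" by (intro esssup_I) auto
  then show ?thesis by (simp add: Lp_space_def le_less_trans)
qed

lemma Lp_space_measurable: "f \<in> Lp_space M p \<Longrightarrow> f \<in> borel_measurable M"
  by (simp add: Lp_space_def)

lemma Lp_space_integrable:
  assumes f: "f \<in> Lp_space M p" and p: "1 \<le> p"
  shows "integrable M f"
proof (cases "p = \<infinity>")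
  case True
  then show ?thesis
    using Lp_space_AE_bound[of f] f Lp_space_measurable[OF f]
    by (intro integrable_const_bound[of _ "Lp_norm M \<infinity> f"]) auto
next
  case False
  have le: "y \<le> 1 + y powr enn2real p" if "0 \<le> y" for y :: real
  proof (cases "y \<le> 1")
    case True
    then show ?thesis using powr_ge_zero[of y "enn2real p"] by linarith
  next
    case F: False
    then have "y powr 1 \<le> y powr enn2real p" using one_le_enn2real[OF p False] by (intro powr_mono) auto
    then show ?thesis using F by simp
  qed
  show ?thesis
  proof (rule Bochner_Integration.integrable_bound)
    show "integrable M (\<lambda>x. 1 + \<bar>f x\<bar> powr enn2real p)"
      using Lp_power_integrable_powr[OF f False] by simp
    show "AE x in M. norm (f x) \<le> norm (1 + \<bar>f x\<bar> powr enn2real p)"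
      using le by (intro AE_I2) simp
  qed (rule Lp_space_measurable[OF f])
qed

lemma Lp_space_diff:
  assumes f: "f \<in> Lp_space M p" and h: "h \<in> Lp_space M p" and p: "1 \<le> p"
  shows "(\<lambda>x. f x - h x) \<in> Lp_space M p"
proof (cases "p = \<infinity>")
  case True
  have "AE x in M. \<bar>f x - h x\<bar> \<le> Lp_norm M \<infinity> f + Lp_norm M \<infinity> h"
    using Lp_space_AE_bound[OF f[unfolded True]] Lp_space_AE_bound[OF h[unfolded True]]
    by eventually_elim linarith
  then show ?thesis
    unfolding True using Lp_space_measurable[OF f] Lp_space_measurable[OF h] by (intro Lp_space_infI) auto
next
  case False
  note [measurable] = Lp_space_measurable[OF f] Lp_space_measurable[OF h]
  let ?p = "enn2real p"
  have p1: "1 \<le> ?p" by (rule one_le_enn2real[OF p False])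
  have le: "\<bar>y - z\<bar> powr ?p \<le> 2 powr ?p * (\<bar>y\<bar> powr ?p + \<bar>z\<bar> powr ?p)" for y z :: real
  proof -
    have "\<bar>y - z\<bar> powr ?p \<le> (2 * max \<bar>y\<bar> \<bar>z\<bar>) powr ?p" using p1 by (intro powr_mono2) auto
    also have "\<dots> = 2 powr ?p * (max \<bar>y\<bar> \<bar>z\<bar>) powr ?p" by (simp add: powr_mult)
    also have "\<dots> \<le> 2 powr ?p * (\<bar>y\<bar> powr ?p + \<bar>z\<bar> powr ?p)"
      by (intro mult_left_mono) (auto simp: max_def)
    finally show ?thesis .
  qed
  have "integrable M (\<lambda>x. \<bar>f x - h x\<bar> powr ?p)"
  proof (rule Bochner_Integration.integrable_bound)
    show "integrable M (\<lambda>x. 2 powr ?p * (\<bar>f x\<bar> powr ?p + \<bar>h x\<bar> powr ?p))"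
      using Lp_power_integrable_powr[OF f False] Lp_power_integrable_powr[OF h False] by simp
    show "AE x in M. norm (\<bar>f x - h x\<bar> powr ?p) \<le> norm (2 powr ?p * (\<bar>f x\<bar> powr ?p + \<bar>h x\<bar> powr ?p))"
      using le by (intro AE_I2) simp
  qed measurable
  then show ?thesis using False by (simp add: Lp_space_def)
qed

lemma Lp_space_const: "(\<lambda>_. r) \<in> Lp_space M p"
proof (cases "p = \<infinity>")
  case True
  then show ?thesis using Lp_space_infI[of "\<lambda>_. r" "\<bar>r\<bar>"] by simp
qed (simp add: Lp_space_def)

lemma Lp_space_const_add:
  assumes "h \<in> Lp_space M p" "1 \<le> p"
  shows "(\<lambda>x. r + h x) \<in> Lp_space M p"
  using Lp_space_diff[OF assms(1) Lp_space_const[of "- r"] assms(2)] by (simp add: add.commute)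

text \<open>For finite p this is Jensen's inequality for the power 1/p, through the tangent at the
  mean \<open>m\<close> of the p-th power; it is what makes L^1 estimates sufficient for every
  p.\<close>

lemma integral_abs_le_Lp_norm:
  assumes f: "f \<in> Lp_space M p" and p: "1 \<le> p"
  shows "(\<integral>x. \<bar>f x\<bar> \<partial>M) \<le> Lp_norm M p f"
proof (cases "p = \<infinity>")
  case True
  have "(\<integral>x. \<bar>f x\<bar> \<partial>M) \<le> (\<integral>x. Lp_norm M \<infinity> f \<partial>M)"
    using Lp_space_AE_bound[of f] f True Lp_space_integrable[OF f p]
    by (intro integral_mono_AE) auto
  then show ?thesis by (simp add: True prob_space)
next
  case False
  let ?p = "enn2real p"
  have p1: "1 \<le> ?p" by (rule one_le_enn2real[OF p False])
  note ip = Lp_power_integrable_powr[OF f False]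
  note [measurable] = Lp_space_measurable[OF f]
  define m where "m = (\<integral>x. \<bar>f x\<bar> powr ?p \<partial>M)"
  have m0: "0 \<le> m" by (simp add: m_def)
  show ?thesis
  \<comment> \<open>The tangent needs a positive base point; for \<open>m = 0\<close> the function
    vanishes almost everywhere.\<close>
  proof (cases "m = 0")
    case True
    then have "AE x in M. \<bar>f x\<bar> powr ?p = 0"
      using ip by (simp add: m_def integral_nonneg_eq_0_iff_AE)
    then have "AE x in M. \<bar>f x\<bar> = 0" by eventually_elim simp
    then have "(\<integral>x. \<bar>f x\<bar> \<partial>M) = (\<integral>x. 0 \<partial>M)" by (intro integral_cong_AE) auto
    then show ?thesis using False by (simp add: Lp_norm_def)
  next
    case m: False
    define r where "r = 1 / ?p"
    have r: "0 < r" "r \<le> 1" "?p * r = 1" using p1 by (auto simp: r_def)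
    have "(\<integral>x. \<bar>f x\<bar> \<partial>M) \<le> (\<integral>x. m powr r * ((1 - r) + r * (\<bar>f x\<bar> powr ?p / m)) \<partial>M)"
    proof (rule integral_mono)
      show "integrable M (\<lambda>x. \<bar>f x\<bar>)" using Lp_space_integrable[OF f p] by simp
      show "integrable M (\<lambda>x. m powr r * ((1 - r) + r * (\<bar>f x\<bar> powr ?p / m)))" using ip by simp
      fix x
      have "\<bar>f x\<bar> = (\<bar>f x\<bar> powr ?p) powr r" using r p1 by (simp add: powr_powr)
      also have "\<dots> \<le> m powr r * ((1 - r) + r * (\<bar>f x\<bar> powr ?p / m))"
        using m m0 r by (intro powr_le_tangent) auto
      finally show "\<bar>f x\<bar> \<le> m powr r * ((1 - r) + r * (\<bar>f x\<bar> powr ?p / m))" .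
    qed
    also have "\<dots> = m powr r * ((1 - r) + r * (m / m))"
      using ip by (simp add: prob_space m_def)
    also have "\<dots> = m powr r" using m by simp
    finally show ?thesis using False by (simp add: Lp_norm_def m_def r_def)
  qed
qed

end

theorem corollary3p7:
  fixes \<Sigma> :: "(real ^ 'd ^ 'd) set"
    and \<mu>\<^sub>0 :: "(real ^ 'd ^ 'd) measure"
    and p :: ennreal
  assumes "2 \<le> CARD('d)"
    and "compact \<Sigma>"
    and "\<forall>A\<in>\<Sigma>. invertible A"
    and "\<mu>\<^sub>0 \<in> Prob \<Sigma>"
    and "supp_measure \<mu>\<^sub>0 = \<Sigma>"
    and "lyapunov_exponent 1 \<mu>\<^sub>0 > lyapunov_exponent 2 \<mu>\<^sub>0"
    and "1 \<le> p"
  shows "\<exists>U F. sn_open (Lp_mean1 \<mu>\<^sub>0 p) (Lp_norm \<mu>\<^sub>0 p) U \<and> (\<lambda>_. 1) \<in> U \<and>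
           real_analytic_on (Lp_mean0 \<mu>\<^sub>0 p) (Lp_norm \<mu>\<^sub>0 p)
             {h \<in> Lp_mean0 \<mu>\<^sub>0 p. (\<lambda>x. 1 + h x) \<in> U} (\<lambda>h. F (\<lambda>x. 1 + h x)) \<and>
           (\<forall>f\<in>U. (AE x in \<mu>\<^sub>0. 0 \<le> f x) \<longrightarrow>
             F f = lyapunov_exponent 1 (density \<mu>\<^sub>0 (\<lambda>x. ennreal (f x))))"
proof -
  obtain b where b: "1 \<le> b" "\<And>A x. A \<in> \<Sigma> \<Longrightarrow> norm (A *v x) \<le> b * norm x"
    "\<And>A x. A \<in> \<Sigma> \<Longrightarrow> norm x \<le> b * norm (A *v x)"
    by (rule compact_invertible_norm_bounds[OF assms(2,3)]) (rule that)
  interpret M: matrix_law \<Sigma> \<mu>\<^sub>0 b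
  proof (rule matrix_law.intro)
    show "prob_space \<mu>\<^sub>0" "sets \<mu>\<^sub>0 = sets (restrict_space borel \<Sigma>)"
      using assms(4) by (simp_all add: Prob_def)
  qed (use assms(3) in blast, rule b(1), erule b(2), erule b(3))
  obtain V s t where V: "subspace V" "\<And>g x. g \<in> \<Sigma> \<Longrightarrow> x \<in> V \<Longrightarrow> g *v x \<in> V"
    and low: "0 < s" "s \<le> 1" "t < lyapunov_exponent 1 \<mu>\<^sub>0" "moment_growth \<mu>\<^sub>0 V norm s t"
    and max: "\<forall>V' s' t'. subspace V' \<and> (\<forall>g\<in>\<Sigma>. \<forall>x\<in>V'. g *v x \<in> V') \<and> 0 < s' \<and> s' \<le> 1 \<and>
      t' < lyapunov_exponent 1 \<mu>\<^sub>0 \<and> moment_growth \<mu>\<^sub>0 V' norm s' t' \<longrightarrow> dim V' \<le> dim V"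
    by (rule M.maximal_low_growth_subspace) (rule that)
  obtain P where P: "linear P" "\<And>x. norm (P x) \<le> norm x" "\<And>x. x - P x \<in> V" "\<And>x. x \<in> V \<Longrightarrow> P x = 0"
    by (rule orthogonal_projection_exists[OF V(1)]) (rule that)
  interpret Q: quotient_law \<Sigma> \<mu>\<^sub>0 b V P
    by (rule quotient_law.intro[OF M.matrix_law_axioms quotient_law_axioms.intro])
      (rule V(1), erule (1) V(2), rule P(1), rule P(2), rule P(3), erule P(4))
  have lower: "\<exists>n0. \<forall>n\<ge>n0. \<forall>x\<in>Q.X. \<beta> * n \<le> (\<integral>\<omega>. Q.a n x \<omega> \<partial>M.S)" if "\<beta> < lyapunov_exponent 1 \<mu>\<^sub>0" for \<beta>
    by (rule Q.uniform_lower_bound[OF assms(5) low max that]) blast+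
  \<comment> \<open>Otherwise the moment bound on \<open>V\<close> would give an exponent of at most
    \<open>t\<close>, below L_1. So the quotient is nonzero and a base point exists.\<close>
  have "V \<noteq> UNIV"
    using M.lyapunov_exponent_le_moment_growth[of s t] low by auto
  then obtain x0 where "x0 \<notin> V" by blast
  then have x0: "x0 \<in> Q.X" using Q.P_eq_0 by (simp add: Q.X_def)
  obtain c \<theta> B D L where C: "contracting_cocycle \<mu>\<^sub>0 Q.X x0 (*v) c Q.\<sigma> \<theta> B D L"
    by (rule Q.contracting_cocycle_exists[OF assms(1,6) lower x0])
  interpret C: contracting_cocycle \<mu>\<^sub>0 Q.X x0 "(*v)" c Q.\<sigma> \<theta> B D L by (rule C)
  have near1: "C.near (\<lambda>_. 1)" using C.\<delta> by (simp add: C.near_def C.L1_def M.M.prob_space)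
  \<comment> \<open>Together with the Lipschitz bound at 1 this keeps the functional above the rate
    \<open>t1\<close> on \<open>V\<close> throughout \<open>U\<close>.\<close>
  have F1: "lyapunov_exponent 1 \<mu>\<^sub>0 \<le> C.F (\<lambda>_. 1)"
  proof (rule dense_le)
    fix \<beta> assume \<beta>: "\<beta> < lyapunov_exponent 1 \<mu>\<^sub>0"
    obtain n0 where n0: "\<And>n. n0 \<le> n \<Longrightarrow> \<beta> * n \<le> (\<integral>\<omega>. Q.a n x0 \<omega> \<partial>M.S)"
      using lower[OF \<beta>] x0 by blast
    obtain K where K: "0 \<le> K" "\<And>n x. x \<in> Q.X \<Longrightarrow>
      \<bar>(\<integral>\<omega>. Q.a n x \<omega> \<partial>(\<Pi>\<^sub>M i\<in>(UNIV :: nat set). density \<mu>\<^sub>0 (\<lambda>x. ennreal 1))) - n * C.F (\<lambda>_. 1)\<bar> \<le> K"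
      by (rule expectation_a_near_F[OF Q.quotient_law_axioms C near1]) auto
    have "density \<mu>\<^sub>0 (\<lambda>x. ennreal 1) = \<mu>\<^sub>0" by (simp add: density_1)
    with K have K2: "\<bar>(\<integral>\<omega>. Q.a n x0 \<omega> \<partial>M.S) - n * C.F (\<lambda>_. 1)\<bar> \<le> K" for n
      using x0 by metis
    show "\<beta> \<le> C.F (\<lambda>_. 1)"
    proof (rule ccontr)
      assume "\<not> \<beta> \<le> C.F (\<lambda>_. 1)"
      then have pos: "0 < \<beta> - C.F (\<lambda>_. 1)" by simp
      obtain n :: nat where n: "K / (\<beta> - C.F (\<lambda>_. 1)) < n" using reals_Archimedean2 by blast
      define m where "m = max n n0"
      have "K / (\<beta> - C.F (\<lambda>_. 1)) < m" using n by (simp add: m_def)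
      then have "K < m * (\<beta> - C.F (\<lambda>_. 1))" using pos by (subst (asm) pos_divide_less_eq) auto
      moreover have "\<beta> * m \<le> (\<integral>\<omega>. Q.a m x0 \<omega> \<partial>M.S)" by (rule n0) (simp add: m_def)
      ultimately show False using K2[of m] by (simp add: algebra_simps)
    qed
  qed
  \<comment> \<open>One half of the gap allows the rate on \<open>V\<close> to rise under
    perturbation, the other half allows the functional to fall.\<close>
  define t1 where "t1 = (t + lyapunov_exponent 1 \<mu>\<^sub>0) / 2"
  have t1: "t < t1" "t1 < lyapunov_exponent 1 \<mu>\<^sub>0" using low by (auto simp: t1_def)
  obtain \<delta>' where \<delta>': "0 < \<delta>'" and mg: "\<And>f. integrable \<mu>\<^sub>0 f \<Longrightarrow> (AE g in \<mu>\<^sub>0. 0 \<le> f g) \<Longrightarrow>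
    (\<integral>g. \<bar>f g - 1\<bar> \<partial>\<mu>\<^sub>0) < \<delta>' \<Longrightarrow> moment_growth (density \<mu>\<^sub>0 (\<lambda>x. ennreal (f x))) V norm s t1"
    by (rule moment_growth_density[OF M.matrix_law_axioms V(2) low(4) t1(1) low(1)]) (use b in auto)
  define A where "A = (1 + C.E) * (2 * L) * C.\<kappa>"
  have A: "0 \<le> A" using C.E_nonneg C.L C.\<kappa>(1) by (simp add: A_def)
  \<comment> \<open>In turn: the operator stays a contraction, moments on \<open>V\<close> grow at
    most at rate \<open>t1\<close>, and the functional stays above \<open>t1\<close>.\<close>
  define \<delta>0 where "\<delta>0 = min C.\<delta> (min \<delta>' ((lyapunov_exponent 1 \<mu>\<^sub>0 - t1) / (A + 1)))"
  have \<delta>0: "0 < \<delta>0" "\<delta>0 \<le> C.\<delta>" "\<delta>0 \<le> \<delta>'" "\<delta>0 * (A + 1) \<le> lyapunov_exponent 1 \<mu>\<^sub>0 - t1"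
  proof -
    show "0 < \<delta>0" using C.\<delta>(1) \<delta>' t1 A by (simp add: \<delta>0_def)
    have "\<delta>0 \<le> (lyapunov_exponent 1 \<mu>\<^sub>0 - t1) / (A + 1)" by (simp add: \<delta>0_def)
    then show "\<delta>0 * (A + 1) \<le> lyapunov_exponent 1 \<mu>\<^sub>0 - t1" using A by (simp add: pos_le_divide_eq)
  qed (simp_all add: \<delta>0_def)
  \<comment> \<open>An L^1 condition; it is open for the L^p norm because that norm is
    larger.\<close>
  define U where "U = {f \<in> Lp_mean1 \<mu>\<^sub>0 p. C.L1 (\<lambda>x. f x - 1) < \<delta>0}"
  note Lp = M.M.Lp_space_integrable[OF _ assms(7)] M.M.Lp_space_diff[OF _ _ assms(7)]
  have L1_Lp: "C.L1 (\<lambda>x. f x - h x) \<le> Lp_norm \<mu>\<^sub>0 p (\<lambda>x. f x - h x)"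
    if "f \<in> Lp_space \<mu>\<^sub>0 p" "h \<in> Lp_space \<mu>\<^sub>0 p" for f h
    unfolding C.L1_def by (rule M.M.integral_abs_le_Lp_norm[OF Lp(2)[OF that] assms(7)])
  have near: "C.near f" "integrable \<mu>\<^sub>0 f" if "f \<in> U" for f
    using that \<delta>0(2) Lp(1) by (auto simp: U_def Lp_mean1_def C.near_def)
  have open_U: "sn_open (Lp_mean1 \<mu>\<^sub>0 p) (Lp_norm \<mu>\<^sub>0 p) U"
    unfolding sn_open_def
  proof (intro conjI ballI)
    fix f assume f: "f \<in> U"
    show "\<exists>r>0. sn_ball (Lp_mean1 \<mu>\<^sub>0 p) (Lp_norm \<mu>\<^sub>0 p) f r \<subseteq> U"
    proof (intro exI[of _ "\<delta>0 - C.L1 (\<lambda>x. f x - 1)"] conjI subsetI)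
      show "0 < \<delta>0 - C.L1 (\<lambda>x. f x - 1)" using f by (simp add: U_def)
      fix h assume h: "h \<in> sn_ball (Lp_mean1 \<mu>\<^sub>0 p) (Lp_norm \<mu>\<^sub>0 p) f (\<delta>0 - C.L1 (\<lambda>x. f x - 1))"
      then have hL: "h \<in> Lp_space \<mu>\<^sub>0 p" "f \<in> Lp_space \<mu>\<^sub>0 p"
        using f by (auto simp: sn_ball_def U_def Lp_mean1_def)
      have "C.L1 (\<lambda>x. h x - 1) \<le> C.L1 (\<lambda>x. f x - 1) + C.L1 (\<lambda>x. h x - f x)"
        using C.L1_triangle[of "\<lambda>x. f x - 1" "\<lambda>x. h x - 1"] Lp(1)[OF hL(1)] Lp(1)[OF hL(2)] by simp
      then show "h \<in> U" using h L1_Lp[OF hL] by (simp add: sn_ball_def U_def)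
    qed
  qed (auto simp: U_def)
  have one_U: "(\<lambda>_. 1) \<in> U"
    using \<delta>0(1) M.M.Lp_space_const by (simp add: U_def Lp_mean1_def M.M.prob_space C.L1_def)
  let ?V = "Lp_mean0 \<mu>\<^sub>0 p" and ?N = "Lp_norm \<mu>\<^sub>0 p"
  have Vm: "?V \<subseteq> C.mean0" using Lp(1) by (auto simp: Lp_mean0_def C.mean0_def)
  let ?U0 = "{h \<in> ?V. (\<lambda>x. 1 + h x) \<in> U}"
  \<comment> \<open>After translation by 1 the neighbourhood is the part of an L^1 ball around 0
    that lies in the mean zero space.\<close>
  have in_U0: "h \<in> ?U0 \<longleftrightarrow> h \<in> ?V \<and> C.L1 h < \<delta>0" for h
    using M.M.Lp_space_const_add[OF _ assms(7), of h 1] Lp(1)[of h]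
    by (auto simp: U_def Lp_mean0_def Lp_mean1_def M.M.prob_space)
  have L1_V: "C.L1 (\<lambda>x. h x - a x) \<le> ?N (\<lambda>x. h x - a x)" if "a \<in> ?V" "h \<in> ?V" for a h
    using L1_Lp that by (simp add: Lp_mean0_def)
  have ball_U0: "sn_ball ?V ?N a (\<delta>0 - C.L1 a) \<subseteq> ?U0" if a: "a \<in> ?U0" for a
  proof
    fix h assume "h \<in> sn_ball ?V ?N a (\<delta>0 - C.L1 a)"
    then have h: "h \<in> ?V" "?N (\<lambda>x. h x - a x) < \<delta>0 - C.L1 a" by (auto simp: sn_ball_def)
    have "C.L1 h \<le> C.L1 a + C.L1 (\<lambda>x. h x - a x)"
      using a h Vm by (intro C.L1_triangle) (auto simp: C.mean0_def)
    then show "h \<in> ?U0" unfolding in_U0 using h L1_V[of a h] a by simp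
  qed
  have analytic: "real_analytic_on ?V ?N ?U0 (\<lambda>h. C.F (\<lambda>x. 1 + h x))"
    unfolding real_analytic_on_def
  proof (intro conjI ballI)
    show "sn_open ?V ?N ?U0"
      unfolding sn_open_def
    proof (intro conjI ballI)
      fix a assume a: "a \<in> ?U0"
      then have "0 < \<delta>0 - C.L1 a" unfolding in_U0 by simp
      then show "\<exists>r>0. sn_ball ?V ?N a r \<subseteq> ?U0" using ball_U0[OF a] by blast
    qed auto
    fix a assume a: "a \<in> ?U0"
    then have aL: "0 < \<delta>0 - C.L1 a" "a \<in> ?V" unfolding in_U0 by auto
    have na: "C.near (\<lambda>x. 1 + a x)" using near(1) a by blast
    \<comment> \<open>The first term keeps the ball inside the neighbourhood, the second makes the
      power series at \<open>a\<close> converge geometrically.\<close>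
    define r where "r = min (\<delta>0 - C.L1 a) (1 / C.\<kappa>)"
    have r: "0 < r" "sn_ball ?V ?N a r \<subseteq> sn_ball ?V ?N a (\<delta>0 - C.L1 a)"
      using aL C.\<kappa>(1) by (auto simp: r_def sn_ball_def)
    show "\<exists>r>0. \<exists>T :: nat \<Rightarrow> _ \<Rightarrow> real. sn_ball ?V ?N a r \<subseteq> ?U0 \<and>
        (\<forall>n. cont_sym_multilinear ?V ?N n (T n)) \<and>
        (\<forall>x\<in>sn_ball ?V ?N a r. (\<lambda>n. T n (replicate n (\<lambda>t. x t - a t))) sums C.F (\<lambda>t. 1 + x t))"
    proof (intro exI[of _ r] conjI allI ballI
        exI[of _ "\<lambda>n. symmetrize n (\<lambda>hs. C.\<eta> (\<lambda>x. 1 + a x) (C.Z (\<lambda>x. 1 + a x) hs))"])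
      show "0 < r" by (rule r)
      show sub: "sn_ball ?V ?N a r \<subseteq> ?U0" using r(2) ball_U0[OF a] by blast
      show "cont_sym_multilinear ?V ?N n (symmetrize n (\<lambda>hs. C.\<eta> (\<lambda>x. 1 + a x) (C.Z (\<lambda>x. 1 + a x) hs)))" for n
        by (rule C.cont_sym_multilinear_coefficients[OF na Vm L1_V])
      fix x assume x: "x \<in> sn_ball ?V ?N a r"
      then have xV: "x \<in> ?V" "?N (\<lambda>t. x t - a t) < r" by (auto simp: sn_ball_def)
      let ?h = "\<lambda>t. x t - a t"
      have h: "?h \<in> C.mean0" using C.mean0_comb[of x a 1 "- 1"] xV aL Vm by auto
      have eq: "(\<lambda>g. (1 + a g) + ?h g) = (\<lambda>g. 1 + x g)" by auto
      have nx: "C.near (\<lambda>g. (1 + a g) + ?h g)" unfolding eq using near(1) sub x by blast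
      have "C.L1 ?h < 1 / C.\<kappa>" using L1_V[OF aL(2) xV(1)] xV(2) by (simp add: r_def)
      then have "C.\<kappa> * C.L1 ?h < 1" using C.\<kappa>(1) by (simp add: pos_less_divide_eq mult.commute)
      from C.F_sums[OF na h nx this]
      show "(\<lambda>n. symmetrize n (\<lambda>hs. C.\<eta> (\<lambda>x. 1 + a x) (C.Z (\<lambda>x. 1 + a x) hs)) (replicate n ?h))
        sums C.F (\<lambda>t. 1 + x t)"
        unfolding eq .
    qed
  qed
  have F_value: "C.F f = lyapunov_exponent 1 (density \<mu>\<^sub>0 (\<lambda>x. ennreal (f x)))"
    if f: "f \<in> U" and f0: "AE x in \<mu>\<^sub>0. 0 \<le> f x" for f
  proof -
    let ?\<nu> = "density \<mu>\<^sub>0 (\<lambda>x. ennreal (f x))"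
    note nf = near[OF f]
    have law: "matrix_law \<Sigma> ?\<nu> b"
      by (rule density_in_matrix_law[OF M.matrix_law_axioms nf(2) f0 C.nearD(2)[OF nf(1)]])
    interpret N: matrix_law \<Sigma> ?\<nu> b by (rule law)
    interpret N: quotient_law \<Sigma> ?\<nu> b V P
      by (rule quotient_law.intro[OF law quotient_law.axioms(2)[OF Q.quotient_law_axioms]])
    obtain K where K: "0 \<le> K" "\<And>n x. x \<in> Q.X \<Longrightarrow> \<bar>(\<integral>\<omega>. Q.a n x \<omega> \<partial>N.S) - n * C.F f\<bar> \<le> K"
      by (rule expectation_a_near_F[OF Q.quotient_law_axioms C nf(1) f0]) (rule that)
    have fL: "C.L1 (\<lambda>x. f x - 1) < \<delta>0" using f by (simp add: U_def)
    have mgf: "moment_growth ?\<nu> V norm s t1"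
      using fL \<delta>0(3) by (intro mg nf f0) (simp add: C.L1_def)
    have h: "(\<lambda>x. f x - 1) \<in> C.mean0"
      using nf C.nearD(2)[OF nf(1)] by (simp add: C.mean0_def M.M.prob_space)
    have "\<bar>C.F f - C.F (\<lambda>_. 1)\<bar> \<le> A * C.L1 (\<lambda>x. f x - 1)"
      using C.F_lipschitz_at[OF near1 h] nf(1) by (simp add: A_def mult.assoc)
    also have "\<dots> \<le> A * \<delta>0" using fL A by (intro mult_left_mono) auto
    also have "\<dots> < \<delta>0 * (A + 1)" using \<delta>0(1) by (simp add: algebra_simps)
    \<comment> \<open>The quotient dominates \<open>V\<close> also for the perturbed law, so its
      rate is the exponent.\<close>
    finally have "t1 < C.F f" using F1 \<delta>0(4) by linarith
    then show ?thesis
      using N.lyapunov_exponent_1_eq[OF x0 K mgf low(1,2)] by simp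
  qed
  show ?thesis
    using open_U one_U analytic F_value by (intro exI[of _ U] exI[of _ C.F]) auto
qed

end
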